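(* The map $\iota:\mathfrak{g}_1^*\to\mathfrak{G}_\infty^*$, $\iota(\gamma):=(\gamma^{\otimes k})_{k=1}^\infty$, belongs to $\mathcal{C}^\infty(\mathfrak{g}_1^*,\mathfrak{G}_\infty^* )$ and is a morphism of the Lie-Poisson space $(\mathfrak{g}_1^*,\{\cdot,\cdot\}_{\mathfrak{g}_1^*})$ into the weak Lie-Poisson space $(\mathfrak{G}_\infty^*,\mathcal{A}_\infty,\{\cdot,\cdot\}_{\mathfrak{G}_\infty^*})$: $$\forall\mathcal{F},\mathcal{G}\in\mathcal{A}_\infty,\qquad\{\iota^*\mathcal{F},\iota^*\mathcal{G}\}_{\mathfrak{g}_1^*}=\iota^*\{\mathcal{F},\mathcal{G}\}_{\mathfrak{G}_\infty^*},$$ where $\iota^*\mathcal{F}=\mathcal{F}\circ\iota$.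
   Context: Fix $d\in\mathbb{N}$. Points of $\mathbb{R}^{2d}$ are $z=(x,v)$. For $k\in\mathbb{N}$, $\mathfrak{g}_k$ is the real vector space of smooth functions $f:(\mathbb{R}^{2d})^k\to\mathbb{R}$ invariant under permutations of $z_1,\dots,z_k\in\mathbb{R}^{2d}$, with the topology generated by the seminorms $\sup_{|\alpha|\le n}\|\partial^\alpha f\|_{L^\infty(K)}$ ($K$ compact, $n\in\mathbb{N}$); $\mathfrak{g}_k^*$ is its strong dual (permutation-invariant compactly supported distributions). $\mathfrak{g}_k$ is reflexive. On $\mathfrak{g}_1$: $[f,g]_{\mathfrak{g}_1}=\nabla_xf\cdot\nabla_vg-\nabla_vf\cdot\nabla_xg$, and $\{\mathcal{F},\mathcal{G}\}_{\mathfrak{g}_1^*}(\gamma):=\langle[\mathrm{d}\mathcal{F}[\gamma],\mathrm{d}\mathcal{G}[\gamma]]_{\mathfrak{g}_1},\gamma\rangle$ for $\mathcal{F},\mathcal{G}\in\mathcal{C}^\infty(\mathfrak{g}_1^* )$, with Gâteaux derivatives identified with elements of $\mathfrak{g}_1\cong\mathfrak{g}_1^{**}$. $\mathfrak{G}_\infty:=\bigoplus_{k=1}^\infty\mathfrak{g}_k$ with the locally convex direct sum topology (finitely many nonzero components), $\mathfrak{G}_\infty^*=\prod_{k=1}^\infty\mathfrak{g}_k^*$ its strong dual with the product topology; $\mathfrak{G}_\infty^{**}\cong\mathfrak{G}_\infty$, so Gâteaux derivatives at points of $\mathfrak{G}_\infty^*$ are identified with elements of $\mathfrak{G}_\infty$.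 Lie bracket: $[F,G]^{(k)}_{\mathfrak{G}_\infty}=\sum_{\ell,j\ge1,\ \ell+j-1=k}\mathrm{Sym}_k(f^{(\ell)}\wedge_1g^{(j)})$, where $$f^{(\ell)}\wedge_1g^{(j)}(z_1,\dots,z_k)=\ell j\big(\nabla_{x_1}f^{(\ell)}(z_1,\dots,z_\ell)\cdot\nabla_{v_1}g^{(j)}(z_1,z_{\ell+1},\dots,z_k)-\nabla_{x_1}g^{(j)}(z_1,\dots,z_j)\cdot\nabla_{v_1}f^{(\ell)}(z_1,z_{j+1},\dots,z_k)\big)$$ and $\mathrm{Sym}_k(h)(z_1,\dots,z_k)=\frac1{k!}\sum_{\pi\in\mathbb{S}_k}h(z_{\pi(1)},\dots,z_{\pi(k)})$. $\{\mathcal{F},\mathcal{G}\}_{\mathfrak{G}_\infty^*}(\Gamma)=\langle[\mathrm{d}\mathcal{F}[\Gamma],\mathrm{d}\mathcal{G}[\Gamma]]_{\mathfrak{G}_\infty},\Gamma\rangle_{\mathfrak{G}_\infty-\mathfrak{G}_\infty^*}$. $\mathcal{A}_\infty\subset\mathcal{C}^\infty(\mathfrak{G}_\infty^* )$ is the algebra generated under pointwise product by the functionals $\Gamma\mapsto\langle F,\Gamma\rangle$, $F\in\mathfrak{G}_\infty$, and the real constants. Smoothness is in the Gâteaux sense: all iterated directional derivatives $\mathrm{d}^nf:X\times X^n\to Y$ exist and are jointly continuous. *)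

theory Defs
  imports "HOL-Analysis.Analysis" "HOL-Library.Function_Algebras"
begin

section \<open>Locally convex spaces of functions\<close>

text \<open>
  All vector spaces below are linear subspaces of function types with the pointwise operations.
  Such a space is represented by a \<^typ>\<open>'a topology\<close> whose \<^const>\<open>topspace\<close> is the
  subspace.
\<close>

instantiation "fun" :: (type, real_vector) real_vector
begin

definition scaleR_fun :: "real \<Rightarrow> ('a \<Rightarrow> 'b) \<Rightarrow> 'a \<Rightarrow> 'b" where
  "scaleR_fun c f = (\<lambda>x. c *\<^sub>R f x)"

instance
  by standard (auto simp: scaleR_fun_def plus_fun_def scaleR_add_right scaleR_add_left)

end

definition seminorm_topology :: "'a::real_vector set \<Rightarrow> ('a \<Rightarrow> real) set \<Rightarrow> 'a topology" where
  "seminorm_topology V P =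
     topology_generated_by {{y \<in> V. p (y - x) < \<epsilon>} | p x \<epsilon>. p \<in> P \<and> x \<in> V \<and> \<epsilon> > 0}"

lemma topspace_seminorm_topology:
  assumes "P \<noteq> {}"
  shows "topspace (seminorm_topology V P) = V"
proof -
  obtain p where p: "p \<in> P" using assms by blast
  have "x \<in> \<Union> {{y \<in> V. p (y - x) < \<epsilon>} | p x \<epsilon>. p \<in> P \<and> x \<in> V \<and> \<epsilon> > 0}"
    if x: "x \<in> V" for x
  proof (rule UnionI)
    show "{y \<in> V. p (y - x) < \<bar>p 0\<bar> + 1}
        \<in> {{y \<in> V. p (y - x) < \<epsilon>} | p x \<epsilon>. p \<in> P \<and> x \<in> V \<and> \<epsilon> > 0}"
      using p x by (intro CollectI exI[of _ p] exI[of _ x] exI[of _ "\<bar>p 0\<bar> + 1"]) auto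
    have "p (x - x) = p 0" by simp
    then show "x \<in> {y \<in> V. p (y - x) < \<bar>p 0\<bar> + 1}"
      using x by simp
  qed
  then show ?thesis
    unfolding seminorm_topology_def topology_generated_by_topspace by blast
qed

text \<open>Von Neumann boundedness.\<close>

definition tvs_bounded :: "'a::real_vector topology \<Rightarrow> 'a set \<Rightarrow> bool" where
  "tvs_bounded X B \<longleftrightarrow> B \<subseteq> topspace X \<and>
     (\<forall>U. openin X U \<and> 0 \<in> U \<longrightarrow> (\<exists>s>0. \<forall>t>s. B \<subseteq> (\<lambda>x. t *\<^sub>R x) ` U))"

text \<open>Functionals are set to 0 off the space, so that equal functionals are equal as HOL functions.\<close>

definition tvs_dual :: "'a::real_vector topology \<Rightarrow> ('a \<Rightarrow> real) set" where
  "tvs_dual X = {\<phi>. continuous_map X euclideanreal \<phi> \<and>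
     (\<forall>x\<in>topspace X. \<forall>y\<in>topspace X. \<phi> (x + y) = \<phi> x + \<phi> y) \<and>
     (\<forall>c. \<forall>x\<in>topspace X. \<phi> (c *\<^sub>R x) = c * \<phi> x) \<and>
     (\<forall>x. x \<notin> topspace X \<longrightarrow> \<phi> x = 0)}"

definition strong_dual :: "'a::real_vector topology \<Rightarrow> ('a \<Rightarrow> real) topology" where
  "strong_dual X = seminorm_topology (tvs_dual X)
     {\<lambda>\<phi>. SUP x\<in>B. \<bar>\<phi> x\<bar> | B. tvs_bounded X B \<and> B \<noteq> {}}"

lemma tvs_bounded_zero:
  assumes "0 \<in> topspace X"
  shows "tvs_bounded X {0}"
proof -
  have "{0} \<subseteq> (\<lambda>x. t *\<^sub>R x) ` U" if "0 \<in> U" for t :: real and U :: "'a set"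
    using imageI[OF that, of "\<lambda>x. t *\<^sub>R x"] by simp
  moreover have "\<exists>s::real. s > 0" using zero_less_one by blast
  ultimately show ?thesis
    unfolding tvs_bounded_def using assms by (meson empty_subsetI insert_subset)
qed

lemma topspace_strong_dual:
  assumes "0 \<in> topspace X"
  shows "topspace (strong_dual X) = tvs_dual X"
  unfolding strong_dual_def
proof (rule topspace_seminorm_topology)
  have "\<exists>B. tvs_bounded X B \<and> B \<noteq> {}"
    using tvs_bounded_zero[OF assms] by (intro exI[of _ "{0}"] conjI) simp_all
  then show "{\<lambda>\<phi>. SUP x\<in>B. \<bar>\<phi> x\<bar> | B. tvs_bounded X B \<and> B \<noteq> {}} \<noteq> {}"
    by (simp only: Collect_empty_eq not_all not_not) fast
qed

section \<open>Gateaux calculus\<close>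

definition has_gateaux_derivative ::
  "'b::real_vector topology \<Rightarrow> ('a::real_vector \<Rightarrow> 'b) \<Rightarrow> 'a \<Rightarrow> 'a \<Rightarrow> 'b \<Rightarrow> bool" where
  "has_gateaux_derivative Y f x v l \<longleftrightarrow>
     limitin Y (\<lambda>t. (1 / t) *\<^sub>R (f (x + t *\<^sub>R v) - f x)) l (at (0::real))"

text \<open>
  \<open>D n x v\<close> is the iterated directional derivative of order \<open>n\<close> at \<open>x\<close> in the directions
  \<open>v 0, \<dots>, v (n - 1)\<close>; the limits determine \<open>D\<close> on the relevant arguments when \<open>Y\<close> is Hausdorff.
\<close>

definition gateaux_smooth ::
  "'a::real_vector topology \<Rightarrow> 'b::real_vector topology \<Rightarrow> ('a \<Rightarrow> 'b) \<Rightarrow> bool" where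
  "gateaux_smooth X Y f \<longleftrightarrow> (\<exists>D :: nat \<Rightarrow> 'a \<Rightarrow> (nat \<Rightarrow> 'a) \<Rightarrow> 'b.
     (\<forall>x\<in>topspace X. D 0 x (\<lambda>i. undefined) = f x) \<and>
     (\<forall>n. \<forall>x\<in>topspace X. \<forall>v \<in> {..<Suc n} \<rightarrow>\<^sub>E topspace X.
        has_gateaux_derivative Y (\<lambda>y. D n y (restrict v {..<n})) x (v n) (D (Suc n) x v)) \<and>
     (\<forall>n. continuous_map (prod_topology X (product_topology (\<lambda>i. X) {..<n})) Y
        (\<lambda>(x, v). D n x v)))"

text \<open>
  The derivative of a real functional on a dual space \<open>X\<close>, identified with the element of the
  predual \<open>V\<close> that represents it under the pairing \<open>pr\<close>.
\<close>

definition functional_gradient ::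
  "'f set \<Rightarrow> 'a::real_vector topology \<Rightarrow> ('f \<Rightarrow> 'a \<Rightarrow> real) \<Rightarrow> ('a \<Rightarrow> real) \<Rightarrow> 'a \<Rightarrow> 'f" where
  "functional_gradient V X pr \<F> x = (THE f. f \<in> V \<and>
     (\<forall>v\<in>topspace X. has_gateaux_derivative euclideanreal \<F> x v (pr f v)))"

section \<open>Symmetric smooth functions\<close>

text \<open>
  A point \<open>(z\<^sub>1, \<dots>, z\<^sub>k)\<close> with \<open>z\<^sub>i = (x\<^sub>i, v\<^sub>i)\<close> is given by a sequence \<open>Z\<close> of which only the entries
  \<open>Z 1, \<dots>, Z k\<close> matter: functions of \<open>k\<close> points are functions on sequences depending on
  these entries only. For such functions, continuity for the product topology on sequences, and
  suprema over compact sets of sequences, are those on the space of \<open>k\<close>-tuples.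
\<close>

type_synonym 'd phase = "(real ^ 'd) \<times> (real ^ 'd)"
type_synonym 'd config = "nat \<Rightarrow> 'd phase"
type_synonym 'd obs = "'d config \<Rightarrow> real"

definition depends_on_first :: "nat \<Rightarrow> 'd::finite obs \<Rightarrow> bool" where
  "depends_on_first k f \<longleftrightarrow> (\<forall>Z W. (\<forall>i\<in>{1..k}. Z i = W i) \<longrightarrow> f Z = f W)"

definition partial_deriv :: "nat \<times> 'd::finite phase \<Rightarrow> 'd obs \<Rightarrow> 'd obs" where
  "partial_deriv a f = (\<lambda>Z. deriv (\<lambda>t. f (Z(fst a := Z (fst a) + t *\<^sub>R snd a))) 0)"

text \<open>Multi-indices are written out as lists of coordinate directions.\<close>

definition multi_indices :: "nat \<Rightarrow> (nat \<times> 'd::finite phase) list set" where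
  "multi_indices k = lists ({1..k} \<times> Basis)"

definition iter_partial :: "(nat \<times> 'd::finite phase) list \<Rightarrow> 'd obs \<Rightarrow> 'd obs" where
  "iter_partial \<alpha> f = foldr partial_deriv \<alpha> f"

definition smooth_obs :: "nat \<Rightarrow> 'd::finite obs \<Rightarrow> bool" where
  "smooth_obs k f \<longleftrightarrow> (\<forall>\<alpha>\<in>multi_indices k.
     continuous_on UNIV (iter_partial \<alpha> f) \<and>
     (\<forall>i\<in>{1..k}. \<forall>e\<in>Basis. \<forall>Z.
        (\<lambda>t. iter_partial \<alpha> f (Z(i := Z i + t *\<^sub>R e))) differentiable at (0::real)))"

definition sym_smooth :: "nat \<Rightarrow> 'd::finite obs set" where
  "sym_smooth k = {f. depends_on_first k f \<and> smooth_obs k f \<and>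
     (\<forall>\<pi> Z. \<pi> permutes {1..k} \<longrightarrow> f (\<lambda>i. Z (\<pi> i)) = f Z)}"

definition sym_smooth_top :: "nat \<Rightarrow> 'd::finite obs topology" where
  "sym_smooth_top k = seminorm_topology (sym_smooth k)
     {\<lambda>f. Sup {\<bar>iter_partial \<alpha> f Z\<bar> | \<alpha> Z. \<alpha> \<in> multi_indices k \<and> length \<alpha> \<le> n \<and> Z \<in> K}
       | K n. compact K \<and> K \<noteq> {}}"

lemma topspace_sym_smooth_top: "topspace (sym_smooth_top k :: 'd::finite obs topology) = sym_smooth k"
  unfolding sym_smooth_top_def
proof (rule topspace_seminorm_topology)
  have "compact {(\<lambda>i. 0) :: 'd config} \<and> {(\<lambda>i. 0) :: 'd config} \<noteq> {}" by simp
  then show "{\<lambda>f :: 'd obs. Sup {\<bar>iter_partial \<alpha> f Z\<bar> | \<alpha> Z. \<alpha> \<in> multi_indices k \<and> length \<alpha> \<le> n \<and> Z \<in> K}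
      | K n. compact K \<and> K \<noteq> {}} \<noteq> {}"
    by (simp only: Collect_empty_eq not_all not_not) fast
qed

text \<open>\<open>grad_x_dot_grad_v i f Z g W\<close> is
  \<open>\<nabla>\<^bsub>x\<^sub>i\<^esub> f (Z) \<bullet> \<nabla>\<^bsub>v\<^sub>i\<^esub> g (W)\<close>.\<close>

definition grad_x_dot_grad_v ::
  "nat \<Rightarrow> 'd::finite obs \<Rightarrow> 'd config \<Rightarrow> 'd obs \<Rightarrow> 'd config \<Rightarrow> real" where
  "grad_x_dot_grad_v i f Z g W =
     (\<Sum>b\<in>Basis. partial_deriv (i, (b, 0)) f Z * partial_deriv (i, (0, b)) g W)"

section \<open>The Lie-Poisson bracket on the dual of the one-particle algebra\<close>

abbreviation g1_dual :: "('d::finite obs \<Rightarrow> real) topology" where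
  "g1_dual \<equiv> strong_dual (sym_smooth_top 1)"

definition bracket_g1 :: "'d::finite obs \<Rightarrow> 'd obs \<Rightarrow> 'd obs" where
  "bracket_g1 f g = (\<lambda>Z. grad_x_dot_grad_v 1 f Z g Z - grad_x_dot_grad_v 1 g Z f Z)"

definition poisson_g1 ::
  "(('d::finite obs \<Rightarrow> real) \<Rightarrow> real) \<Rightarrow> (('d obs \<Rightarrow> real) \<Rightarrow> real) \<Rightarrow> ('d obs \<Rightarrow> real) \<Rightarrow> real" where
  "poisson_g1 \<F> \<G> \<gamma> =
     (let d = (\<lambda>\<H>. functional_gradient (sym_smooth 1) g1_dual (\<lambda>f \<nu>. \<nu> f) \<H> \<gamma>)
      in \<gamma> (bracket_g1 (d \<F>) (d \<G>)))"

section \<open>The Lie-Poisson bracket on the dual of the infinite hierarchy algebra\<close>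

text \<open>Sequences \<open>(F k)\<close> over \<open>k \<ge> 1\<close> carry a dummy component \<open>F 0 = 0\<close>.\<close>

definition G_inf :: "(nat \<Rightarrow> 'd::finite obs) set" where
  "G_inf = {F. F 0 = 0 \<and> (\<forall>k\<ge>1. F k \<in> sym_smooth k) \<and> finite {k. F k \<noteq> 0}}"

definition G_inf_dual :: "(nat \<Rightarrow> 'd::finite obs \<Rightarrow> real) topology" where
  "G_inf_dual = subtopology
     (product_topology (\<lambda>k. strong_dual (sym_smooth_top k)) UNIV) {\<Gamma>. \<Gamma> 0 = 0}"

definition pairing :: "(nat \<Rightarrow> 'd::finite obs) \<Rightarrow> (nat \<Rightarrow> 'd obs \<Rightarrow> real) \<Rightarrow> real" where
  "pairing F \<Gamma> = (\<Sum>k | F k \<noteq> 0. \<Gamma> k (F k))"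

definition wedge1 :: "nat \<Rightarrow> nat \<Rightarrow> 'd::finite obs \<Rightarrow> 'd obs \<Rightarrow> 'd obs" where
  "wedge1 l j f g = (\<lambda>Z. real l * real j *
     (grad_x_dot_grad_v 1 f Z g (\<lambda>i. if i = 1 then Z 1 else Z (l + i - 1))
      - grad_x_dot_grad_v 1 g Z f (\<lambda>i. if i = 1 then Z 1 else Z (j + i - 1))))"

definition Sym :: "nat \<Rightarrow> 'd::finite obs \<Rightarrow> 'd obs" where
  "Sym k h = (\<lambda>Z. 1 / fact k * (\<Sum>\<pi> | \<pi> permutes {1..k}. h (\<lambda>i. Z (\<pi> i))))"

definition bracket_G_inf ::
  "(nat \<Rightarrow> 'd::finite obs) \<Rightarrow> (nat \<Rightarrow> 'd obs) \<Rightarrow> nat \<Rightarrow> 'd obs" where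
  "bracket_G_inf F G k =
     (\<Sum>(l, j) | l \<ge> 1 \<and> j \<ge> 1 \<and> l + j - 1 = k. Sym k (wedge1 l j (F l) (G j)))"

definition poisson_G_inf ::
  "((nat \<Rightarrow> 'd::finite obs \<Rightarrow> real) \<Rightarrow> real) \<Rightarrow> ((nat \<Rightarrow> 'd obs \<Rightarrow> real) \<Rightarrow> real) \<Rightarrow>
   (nat \<Rightarrow> 'd obs \<Rightarrow> real) \<Rightarrow> real" where
  "poisson_G_inf \<F> \<G> \<Gamma> =
     (let d = (\<lambda>\<H>. functional_gradient G_inf G_inf_dual pairing \<H> \<Gamma>)
      in pairing (bracket_G_inf (d \<F>) (d \<G>)) \<Gamma>)"

inductive_set A_inf :: "((nat \<Rightarrow> 'd::finite obs \<Rightarrow> real) \<Rightarrow> real) set" where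
  const: "(\<lambda>\<Gamma>. c) \<in> A_inf"
| linear: "F \<in> G_inf \<Longrightarrow> (\<lambda>\<Gamma>. pairing F \<Gamma>) \<in> A_inf"
| add: "\<F> \<in> A_inf \<Longrightarrow> \<G> \<in> A_inf \<Longrightarrow> (\<lambda>\<Gamma>. \<F> \<Gamma> + \<G> \<Gamma>) \<in> A_inf"
| mult: "\<F> \<in> A_inf \<Longrightarrow> \<G> \<in> A_inf \<Longrightarrow> (\<lambda>\<Gamma>. \<F> \<Gamma> * \<G> \<Gamma>) \<in> A_inf"

section \<open>Tensor powers\<close>

text \<open>
  \<open>apply_at \<gamma> i h\<close> lets \<open>\<gamma>\<close> act on \<open>h\<close> in the variable \<open>z\<^sub>i\<close>, the other variables being
  parameters. The tensor power of a distribution acts by successive application to the variables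
  \<open>z\<^sub>k, \<dots>, z\<^sub>1\<close>.
\<close>

definition apply_at :: "('d::finite obs \<Rightarrow> real) \<Rightarrow> nat \<Rightarrow> 'd obs \<Rightarrow> 'd obs" where
  "apply_at \<gamma> i h = (\<lambda>Z. \<gamma> (\<lambda>W. h (Z(i := W 1))))"

primrec apply_first :: "('d::finite obs \<Rightarrow> real) \<Rightarrow> nat \<Rightarrow> 'd obs \<Rightarrow> 'd obs" where
  "apply_first \<gamma> 0 h = h"
| "apply_first \<gamma> (Suc k) h = apply_first \<gamma> k (apply_at \<gamma> (Suc k) h)"

lemma apply_first_prod:
  assumes "\<gamma> \<in> tvs_dual (sym_smooth_top 1)" and "\<And>i. i \<in> {1..k} \<Longrightarrow> f i \<in> sym_smooth 1"
  shows "apply_first \<gamma> k (\<lambda>Z. c * (\<Prod>i=1..k. f i (\<lambda>j. Z i))) = (\<lambda>Z. c * (\<Prod>i=1..k. \<gamma> (f i)))"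
  using assms(2)
proof (induction k arbitrary: c)
  case 0
  then show ?case by simp
next
  case (Suc k)
  have f: "f (Suc k) \<in> sym_smooth 1" using Suc.prems by simp
  have eq: "(\<lambda>W. c * (\<Prod>i=1..Suc k. f i (\<lambda>j. (Z(Suc k := W 1)) i)))
      = (c * (\<Prod>i=1..k. f i (\<lambda>j. Z i))) *\<^sub>R f (Suc k)" for Z
  proof
    fix W
    have "f (Suc k) (\<lambda>j. W 1) = f (Suc k) W"
      using f[unfolded sym_smooth_def depends_on_first_def, simplified mem_Collect_eq, THEN conjunct1,
          rule_format, of "\<lambda>j. W 1" W] by simp
    moreover have "(\<Prod>i=1..k. f i (\<lambda>j. (Z(Suc k := W 1)) i)) = (\<Prod>i=1..k. f i (\<lambda>j. Z i))"
      by (rule prod.cong) auto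
    ultimately show "c * (\<Prod>i=1..Suc k. f i (\<lambda>j. (Z(Suc k := W 1)) i))
        = ((c * (\<Prod>i=1..k. f i (\<lambda>j. Z i))) *\<^sub>R f (Suc k)) W"
      by (simp add: scaleR_fun_def)
  qed
  have "apply_at \<gamma> (Suc k) (\<lambda>Z. c * (\<Prod>i=1..Suc k. f i (\<lambda>j. Z i)))
      = (\<lambda>Z. (c * \<gamma> (f (Suc k))) * (\<Prod>i=1..k. f i (\<lambda>j. Z i)))"
    unfolding apply_at_def eq using assms(1) f
    by (simp add: tvs_dual_def topspace_sym_smooth_top fun_eq_iff mult.commute mult.left_commute)
  then show ?case
    using Suc.IH[of "c * \<gamma> (f (Suc k))"] Suc.prems by (simp add: algebra_simps)
qed

text \<open>After all \<open>k\<close> variables are used up, the result is constant; it is read off at \<open>0\<close>.\<close>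

definition tensor_power :: "('d::finite obs \<Rightarrow> real) \<Rightarrow> nat \<Rightarrow> 'd obs \<Rightarrow> real" where
  "tensor_power \<gamma> k f = (if f \<in> sym_smooth k then apply_first \<gamma> k f (\<lambda>i. 0) else 0)"

definition iota :: "('d::finite obs \<Rightarrow> real) \<Rightarrow> nat \<Rightarrow> 'd obs \<Rightarrow> real" where
  "iota \<gamma> = (\<lambda>k. if k = 0 then 0 else tensor_power \<gamma> k)"

end

theory Submission
  imports Defs
begin

text \<open>Smooth symmetric functions on a bounded set have all their derivatives bounded by a
  product of one-variable weights, and a weight defines a bounded set of one-variable functions.
  Hence the pairing with \<open>\<gamma>\<^sub>1 \<otimes> \<cdots> \<otimes> \<gamma>\<^sub>k\<close>, uniformly over a bounded set, is
  controlled by products of strong dual seminorms of the \<open>\<gamma>\<^sub>i\<close>. This is joint continuity, and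
  since tensor products are multilinear, the iterated derivatives of \<open>\<iota>\<close> and of \<open>\<F> \<circ> \<iota>\<close> are
  polynomials in tensor products. Distributions in different slots commute (Fubini), because
  this is plain for polynomials, which are dense in the smooth topology. So if \<open>F\<close> is the gradient
  of \<open>\<F>\<close> at \<open>\<iota> \<gamma>\<close>, the gradient of \<open>\<F> \<circ> \<iota>\<close> at \<open>\<gamma>\<close> is \<open>u = \<Sum>\<^sub>k k u\<^sub>k\<close>, where \<open>u\<^sub>k\<close> is
  \<open>F\<^bsup>(k)\<^esup>\<close> with \<open>\<gamma>\<close> applied to all slots but the first. Applying \<open>\<gamma>\<close> to all slots of
  \<open>F\<^bsup>(l)\<^esup> \<and>\<^sub>1 G\<^bsup>(j)\<^esup>\<close>, with slot 1 last, integrates the two factors separately and leaves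
  \<open>l j \<gamma> ([u\<^sub>l, v\<^sub>j])\<close>.\<close>

text \<open>For products of one-variable functions the order is plainly irrelevant; the price for
  general functions is density of polynomials together with all derivatives up to a given order.
  Joint continuity is a separate matter: the strong dual topology asks for uniformity over bounded
  sets, and such a set comes with infinitely many bounds, one for each order and radius, although a
  single distribution uses only one of them. Weights on the orders let one strong dual seminorm per
  factor absorb them all. Gradients are definite descriptions: a candidate is exhibited, and Dirac
  functionals show that it is the only one. No general chain rule is invoked for
  \<open>\<F> \<circ> iota\<close>; both gradients are followed together through the generation of
  \<open>A_inf\<close>, by linearity and the Leibniz rule.\<close>

section \<open>Topologies generated by seminorms\<close>

definition seminorm_on :: "'a::real_vector set \<Rightarrow> ('a \<Rightarrow> real) \<Rightarrow> bool" where
  "seminorm_on V p \<longleftrightarrow> (\<forall>x\<in>V. 0 \<le> p x) \<and> (\<forall>x\<in>V. \<forall>y\<in>V. p (x + y) \<le> p x + p y) \<and>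
     (\<forall>c. \<forall>x\<in>V. p (c *\<^sub>R x) = \<bar>c\<bar> * p x)"

lemma seminorm_on_zero: "subspace V \<Longrightarrow> seminorm_on V p \<Longrightarrow> p 0 = 0"
  unfolding seminorm_on_def using subspace_0[of V] by (metis abs_zero mult_zero_left scaleR_zero_left)

text \<open>The function spaces and their strong duals both carry a \<open>seminorm_topology\<close>
  on a subspace of a function type. The locale derives neighbourhoods, boundedness, continuity and
  limits once for the two interpretations \<open>sym\<close> and \<open>dual\<close>.\<close>

locale seminormed_space =
  fixes V :: "'a::real_vector set" and P :: "('a \<Rightarrow> real) set"
  assumes subspace: "subspace V" and nonempty: "P \<noteq> {}"
    and seminorm: "p \<in> P \<Longrightarrow> seminorm_on V p"
begin

lemma nonneg: "p \<in> P \<Longrightarrow> x \<in> V \<Longrightarrow> 0 \<le> p x"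
  using seminorm by (auto simp: seminorm_on_def)

lemma triangle: "p \<in> P \<Longrightarrow> x \<in> V \<Longrightarrow> y \<in> V \<Longrightarrow> p (x + y) \<le> p x + p y"
  using seminorm by (auto simp: seminorm_on_def)

lemma scale: "p \<in> P \<Longrightarrow> x \<in> V \<Longrightarrow> p (c *\<^sub>R x) = \<bar>c\<bar> * p x"
  using seminorm by (auto simp: seminorm_on_def)

lemma zero: "p \<in> P \<Longrightarrow> p 0 = 0"
  using seminorm subspace seminorm_on_zero by blast

lemma topspace: "topspace (seminorm_topology V P) = V"
  by (rule topspace_seminorm_topology[OF nonempty])

lemma openin_ball:
  assumes "p \<in> P" "x \<in> V" "e > 0"
  shows "openin (seminorm_topology V P) {y \<in> V. p (y - x) < e}"
  unfolding seminorm_topology_def using assms by (intro topology_generated_by_Basis) auto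

text \<open>The defining subbase consists of balls with arbitrary centres. Only the subbase case of
  the induction has content: the triangle inequality recentres a ball at x, with the remaining slack
  \<open>e - p (x - z)\<close> as radius. Since P need not be directed, a finite subfamily
  appears.\<close>

lemma openin_nhd:
  assumes "openin (seminorm_topology V P) U" "x \<in> U"
  shows "\<exists>F e. finite F \<and> F \<subseteq> P \<and> e > 0 \<and> (\<forall>y\<in>V. (\<forall>p\<in>F. p (y - x) < e) \<longrightarrow> y \<in> U)"
proof -
  have "generate_topology_on {{y \<in> V. p (y - x) < \<epsilon>} | p x \<epsilon>. p \<in> P \<and> x \<in> V \<and> \<epsilon> > 0} U"
    using assms(1) unfolding seminorm_topology_def by (rule openin_topology_generated_by)
  then have "x \<in> U \<Longrightarrow> \<exists>F e. finite F \<and> F \<subseteq> P \<and> e > 0 \<and> (\<forall>y\<in>V. (\<forall>p\<in>F. p (y - x) < e) \<longrightarrow> y \<in> U)"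
  proof (induction)
    case Empty
    then show ?case by simp
  next
    case (Int a b)
    have "x \<in> a" "x \<in> b" using Int.prems by auto
    obtain F e where F: "finite F" "F \<subseteq> P" "e > 0" "\<forall>y\<in>V. (\<forall>p\<in>F. p (y - x) < e) \<longrightarrow> y \<in> a"
      using Int.IH(1)[OF \<open>x \<in> a\<close>] by (elim exE conjE)
    obtain G d where G: "finite G" "G \<subseteq> P" "d > 0" "\<forall>y\<in>V. (\<forall>p\<in>G. p (y - x) < d) \<longrightarrow> y \<in> b"
      using Int.IH(2)[OF \<open>x \<in> b\<close>] by (elim exE conjE)
    show ?case
      using F G by (intro exI[of _ "F \<union> G"] exI[of _ "min e d"]) auto
  next
    case (UN K)
    then obtain k where k: "k \<in> K" "x \<in> k" by (elim UnionE)
    obtain F e where F: "finite F" "F \<subseteq> P" "e > 0" "\<forall>y\<in>V. (\<forall>p\<in>F. p (y - x) < e) \<longrightarrow> y \<in> k"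
      using UN.IH[OF k] by (elim exE conjE)
    then show ?case
      using k(1) by (intro exI[of _ F] exI[of _ e]) auto
  next
    case (Basis s)
    then obtain p z e where s: "s = {y \<in> V. p (y - z) < e}" "p \<in> P" "z \<in> V" "e > 0" by blast
    have "y \<in> s" if "y \<in> V" "p (y - x) < e - p (x - z)" for y
    proof -
      have "y - x \<in> V" "x - z \<in> V" using that s Basis subspace by (auto intro: subspace_diff)
      then have "p ((y - x) + (x - z)) \<le> p (y - x) + p (x - z)" using triangle[OF s(2)] by blast
      then show ?thesis using that s by simp
    qed
    moreover have "e - p (x - z) > 0" using s Basis by auto
    ultimately show ?case using s(2)
      by (intro exI[of _ "{p}"] exI[of _ "e - p (x - z)"]) auto
  qed
  then show ?thesis using assms(2) by blast
qed

lemma bounded_iff: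
  "tvs_bounded (seminorm_topology V P) B \<longleftrightarrow> B \<subseteq> V \<and> (\<forall>p\<in>P. \<exists>M. \<forall>x\<in>B. p x \<le> M)"
proof (intro iffI conjI ballI)
  assume B: "tvs_bounded (seminorm_topology V P) B"
  then show BV: "B \<subseteq> V" by (simp add: tvs_bounded_def topspace)
  fix p assume p: "p \<in> P"
  have "openin (seminorm_topology V P) {y \<in> V. p (y - 0) < 1}"
    using p subspace_0[OF subspace] by (intro openin_ball) auto
  moreover have "0 \<in> {y \<in> V. p (y - 0) < 1}"
    using subspace_0[OF subspace] zero[OF p] by simp
  ultimately obtain s where s: "s > 0" "\<And>t. t > s \<Longrightarrow> B \<subseteq> (\<lambda>x. t *\<^sub>R x) ` {y \<in> V. p (y - 0) < 1}"
    using B unfolding tvs_bounded_def by blast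
  have "p x \<le> s + 1" if xB: "x \<in> B" for x
  proof -
    obtain y where "y \<in> V" "p y < 1" "x = (s + 1) *\<^sub>R y" using s(2)[of "s + 1"] xB by auto
    then show ?thesis using s(1) scale[OF p, of y "s + 1"] by simp
  qed
  then show "\<exists>M. \<forall>x\<in>B. p x \<le> M" by blast
next
  assume B: "B \<subseteq> V \<and> (\<forall>p\<in>P. \<exists>M. \<forall>x\<in>B. p x \<le> M)"
  then obtain M where M: "\<And>p x. p \<in> P \<Longrightarrow> x \<in> B \<Longrightarrow> p x \<le> M p" by metis
  have "\<exists>s>0. \<forall>t>s. B \<subseteq> (\<lambda>x. t *\<^sub>R x) ` U" if U: "openin (seminorm_topology V P) U" "0 \<in> U" for U
  proof -
    obtain F e where F: "finite F" "F \<subseteq> P" "e > 0" "\<forall>y\<in>V. (\<forall>p\<in>F. p (y - 0) < e) \<longrightarrow> y \<in> U"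
      using openin_nhd[OF U] by (elim exE conjE)
    \<comment> \<open>For t > s the sum of the finitely many bounds is below \<open>e * t\<close>,
      so every seminorm in F of \<open>x / t\<close> is below e. The summand 1 keeps s positive when
      all bounds vanish.\<close>
    define s where "s = (\<Sum>p\<in>F. \<bar>M p\<bar>) / e + 1"
    have s: "s > 0" unfolding s_def using F(3) by (smt (verit) abs_ge_zero divide_nonneg_pos sum_nonneg)
    have "x \<in> (\<lambda>x. t *\<^sub>R x) ` U" if t: "t > s" "x \<in> B" for t x
    proof (rule image_eqI)
      have t0: "t > 0" using t s by simp
      show "x = t *\<^sub>R ((1/t) *\<^sub>R x)" using t0 by simp
      have xV: "x \<in> V" using B t by blast
      show "(1/t) *\<^sub>R x \<in> U"
      proof (rule F(4)[rule_format])
        show "(1/t) *\<^sub>R x \<in> V" using xV subspace by (simp add: subspace_scale)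
        fix p assume p: "p \<in> F"
        then have "\<bar>M p\<bar> \<le> (\<Sum>p\<in>F. \<bar>M p\<bar>)" using F(1) by (intro member_le_sum) auto
        also have "\<dots> < e * t" using t F(3) unfolding s_def by (simp add: field_simps)
        finally have "p x < e * t" using M[of p x] p F(2) t by fastforce
        moreover have "p ((1/t) *\<^sub>R x) = \<bar>1/t\<bar> * p x" using scale p F(2) xV by blast
        ultimately have "p ((1/t) *\<^sub>R x) = p x / t" using t0 by simp
        then show "p ((1/t) *\<^sub>R x - 0) < e"
          using t0 \<open>p x < e * t\<close> by (simp add: pos_divide_less_eq)
      qed
    qed
    then show ?thesis using s by blast
  qed
  then show "tvs_bounded (seminorm_topology V P) B"
    using B by (simp add: tvs_bounded_def topspace)
qed

text \<open>Some basic neighbourhood of 0 is mapped into the interval from -1 to 1, and scaling by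
  \<open>e / (2 * M)\<close> brings x into it; the 2 provides the strict inequality. The conclusion
  speaks of a common upper bound M instead of a maximum over F, which also makes sense for empty
  F.\<close>

lemma dual_bound:
  assumes "\<phi> \<in> tvs_dual (seminorm_topology V P)"
  shows "\<exists>F C. finite F \<and> F \<subseteq> P \<and> C \<ge> 0 \<and>
    (\<forall>x\<in>V. \<forall>M\<ge>0. (\<forall>p\<in>F. p x \<le> M) \<longrightarrow> \<bar>\<phi> x\<bar> \<le> C * M)"
proof -
  have \<phi>: "continuous_map (seminorm_topology V P) euclideanreal \<phi>"
    "\<And>c x. x \<in> V \<Longrightarrow> \<phi> (c *\<^sub>R x) = c * \<phi> x"
    using assms by (auto simp: tvs_dual_def topspace)
  have \<phi>0: "\<phi> 0 = 0" using \<phi>(2)[of 0 0] subspace_0[OF subspace] by simp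
  have U1: "openin (seminorm_topology V P) {x \<in> topspace (seminorm_topology V P). \<phi> x \<in> {-1<..<1}}"
    by (rule openin_continuous_map_preimage[OF \<phi>(1)]) (simp add: open_openin[symmetric])
  have U2: "0 \<in> {x \<in> topspace (seminorm_topology V P). \<phi> x \<in> {-1<..<1}}"
    using subspace_0[OF subspace] \<phi>0 by (simp add: topspace)
  obtain F e where F: "finite F" "F \<subseteq> P" "e > 0"
    "\<forall>y\<in>V. (\<forall>p\<in>F. p (y - 0) < e) \<longrightarrow> y \<in> {x \<in> topspace (seminorm_topology V P). \<phi> x \<in> {-1<..<1}}"
    using openin_nhd[OF U1 U2] by (elim exE conjE)
  have *: "\<bar>\<phi> x\<bar> \<le> 2 / e * M" if x: "x \<in> V" and M: "M > 0" and p: "\<And>p. p \<in> F \<Longrightarrow> p x \<le> M" for x M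
  proof -
    have "(e / (2 * M)) *\<^sub>R x \<in> {x \<in> topspace (seminorm_topology V P). \<phi> x \<in> {-1<..<1}}"
    proof (rule F(4)[rule_format])
      show "(e / (2 * M)) *\<^sub>R x \<in> V" using x subspace by (simp add: subspace_scale)
      fix q assume q: "q \<in> F"
      have "q ((e / (2 * M)) *\<^sub>R x) = e / (2 * M) * q x"
        using scale[of q x "e / (2 * M)"] q F(2,3) x M by auto
      also have "\<dots> \<le> e / (2 * M) * M" using p[OF q] M F(3) by (intro mult_left_mono) auto
      also have "\<dots> < e" using M F(3) by simp
      finally show "q ((e / (2 * M)) *\<^sub>R x - 0) < e" by simp
    qed
    then have "\<bar>e / (2 * M) * \<phi> x\<bar> < 1" using \<phi>(2)[OF x] by (auto simp: abs_less_iff)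
    then have "e / (2 * M) * \<bar>\<phi> x\<bar> < 1" using F(3) M by (simp add: abs_mult)
    then show ?thesis using F(3) M by (simp add: field_simps)
  qed
  \<comment> \<open>The scaling argument divides by M. The case M = 0 is reached by enlarging M by
    \<open>d * e / 2\<close> and letting d tend to 0.\<close>
  have "\<bar>\<phi> x\<bar> \<le> 2 / e * M" if x: "x \<in> V" "M \<ge> 0" "\<And>p. p \<in> F \<Longrightarrow> p x \<le> M" for x M
  proof (rule field_le_epsilon)
    fix d :: real assume d: "d > 0"
    have "\<bar>\<phi> x\<bar> \<le> 2 / e * (M + d * e / 2)"
    proof (rule *)
      have "d * e / 2 > 0" using d F(3) by simp
      then show "M + d * e / 2 > 0" "\<And>p. p \<in> F \<Longrightarrow> p x \<le> M + d * e / 2" using x by fastforce+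
    qed (rule x(1))
    also have "\<dots> = 2 / e * M + d" using F(3) by (simp add: field_simps)
    finally show "\<bar>\<phi> x\<bar> \<le> 2 / e * M + d" .
  qed
  then show ?thesis using F by (intro exI[of _ F] exI[of _ "2 / e"]) simp
qed

lemma continuous_mapI:
  assumes f: "\<And>z. z \<in> topspace T \<Longrightarrow> f z \<in> V"
    and nhd: "\<And>p z e. p \<in> P \<Longrightarrow> z \<in> topspace T \<Longrightarrow> e > 0 \<Longrightarrow>
      \<exists>N. openin T N \<and> z \<in> N \<and> (\<forall>w\<in>N. p (f w - f z) < e)"
  shows "continuous_map T (seminorm_topology V P) f"
  unfolding seminorm_topology_def
proof (rule continuous_on_generated_topo)
  show "f ` topspace T \<subseteq> \<Union> {{y \<in> V. p (y - x) < \<epsilon>} | p x \<epsilon>. p \<in> P \<and> x \<in> V \<and> \<epsilon> > 0}"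
    using f topspace[unfolded seminorm_topology_def topology_generated_by_topspace] by auto
  fix U assume "U \<in> {{y \<in> V. p (y - x) < \<epsilon>} | p x \<epsilon>. p \<in> P \<and> x \<in> V \<and> \<epsilon> > 0}"
  then obtain p x e where U: "U = {y \<in> V. p (y - x) < e}" "p \<in> P" "x \<in> V" "e > 0" by blast
  show "openin T (f -` U \<inter> topspace T)"
  proof (subst openin_subopen, intro ballI)
    fix z assume z: "z \<in> f -` U \<inter> topspace T"
    obtain N where N: "openin T N" "z \<in> N" "\<And>w. w \<in> N \<Longrightarrow> p (f w - f z) < e - p (f z - x)"
      using nhd[OF U(2), of z "e - p (f z - x)"] z U by auto
    have "w \<in> f -` U \<inter> topspace T" if w: "w \<in> N" for w
    proof -
      have wT: "w \<in> topspace T" using openin_subset[OF N(1)] w by blast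
      have "p ((f w - f z) + (f z - x)) \<le> p (f w - f z) + p (f z - x)"
        using f wT z U subspace by (intro triangle) (auto intro: subspace_diff)
      then show ?thesis using N(3)[OF w] f[OF wT] wT U by simp
    qed
    then show "\<exists>S. openin T S \<and> z \<in> S \<and> S \<subseteq> f -` U \<inter> topspace T" using N by blast
  qed
qed

lemma limitinI:
  assumes l: "l \<in> V" and f: "\<forall>\<^sub>F z in F. f z \<in> V"
    and lim: "\<And>p e. p \<in> P \<Longrightarrow> e > 0 \<Longrightarrow> \<forall>\<^sub>F z in F. p (f z - l) < e"
  shows "limitin (seminorm_topology V P) f l F"
  unfolding limitin_def
proof (intro conjI allI impI)
  show "l \<in> topspace (seminorm_topology V P)" using l by (simp add: topspace)
  fix U assume U: "openin (seminorm_topology V P) U \<and> l \<in> U"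
  obtain G e where G: "finite G" "G \<subseteq> P" "e > 0"
    "\<forall>y\<in>V. (\<forall>p\<in>G. p (y - l) < e) \<longrightarrow> y \<in> U"
    using openin_nhd[OF conjunct1[OF U] conjunct2[OF U]] by (elim exE conjE)
  have "\<forall>\<^sub>F z in F. \<forall>p\<in>G. p (f z - l) < e"
    using G lim by (intro eventually_ball_finite) auto
  with f show "\<forall>\<^sub>F z in F. f z \<in> U"
    by eventually_elim (simp add: G(4))
qed

lemma limitinD:
  assumes "limitin (seminorm_topology V P) f l F" "p \<in> P" "e > 0"
  shows "\<forall>\<^sub>F z in F. f z \<in> V \<and> p (f z - l) < e"
proof -
  have l: "l \<in> V" using assms(1) by (simp add: limitin_def topspace)
  have "l \<in> {y \<in> V. p (y - l) < e}" using l assms zero[of p] by simp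
  then have "\<forall>\<^sub>F z in F. f z \<in> {y \<in> V. p (y - l) < e}"
    using assms(1) openin_ball[OF assms(2) l assms(3)] unfolding limitin_def by blast
  then show ?thesis by simp
qed

lemma dualI:
  assumes add: "\<And>x y. x \<in> V \<Longrightarrow> y \<in> V \<Longrightarrow> \<phi> (x + y) = \<phi> x + \<phi> y"
    and sc: "\<And>c x. x \<in> V \<Longrightarrow> \<phi> (c *\<^sub>R x) = c * \<phi> x"
    and off: "\<And>x. x \<notin> V \<Longrightarrow> \<phi> x = 0"
    and p: "p \<in> P" and C: "\<And>x. x \<in> V \<Longrightarrow> \<bar>\<phi> x\<bar> \<le> C * p x"
  shows "\<phi> \<in> tvs_dual (seminorm_topology V P)"
proof -
  have diff: "\<phi> (x - y) = \<phi> x - \<phi> y" if "x \<in> V" "y \<in> V" for x y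
  proof -
    have "- y \<in> V" using that(2) subspace by (simp add: subspace_neg)
    then have "\<phi> (x + - y) = \<phi> x + \<phi> (- y)" using that(1) add by blast
    moreover have "\<phi> ((- 1) *\<^sub>R y) = (- 1) * \<phi> y" by (rule sc[OF that(2)])
    ultimately show ?thesis by simp
  qed
  have "continuous_map (seminorm_topology V P) euclideanreal \<phi>"
    unfolding mtopology_is_euclidean[symmetric] Met_TC.continuous_map_to_metric
  proof (intro ballI allI impI)
    fix x and e :: real assume x: "x \<in> topspace (seminorm_topology V P)" and e: "e > 0"
    have xV: "x \<in> V" using x by (simp add: topspace)
    \<comment> \<open>C carries no sign assumption; \<open>\<bar>C\<bar> + 1\<close> is a positive
      Lipschitz constant with respect to p.\<close>
    have e': "e / (\<bar>C\<bar> + 1) > 0" using e by simp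
    let ?U = "{y \<in> V. p (y - x) < e / (\<bar>C\<bar> + 1)}"
    have "\<phi> y \<in> ball (\<phi> x) e" if y: "y \<in> ?U" for y
    proof -
      have yV: "y \<in> V" and py: "p (y - x) < e / (\<bar>C\<bar> + 1)" using y by auto
      have yx: "y - x \<in> V" using yV xV subspace by (simp add: subspace_diff)
      have "\<bar>\<phi> y - \<phi> x\<bar> \<le> C * p (y - x)" using C[OF yx] diff[OF yV xV] by simp
      also have "\<dots> \<le> (\<bar>C\<bar> + 1) * p (y - x)" using nonneg[OF p yx] by (intro mult_right_mono) auto
      also have "\<dots> < e" using py by (simp add: field_simps)
      finally show ?thesis by (simp add: dist_real_def abs_minus_commute)
    qed
    moreover have "x \<in> ?U" using xV zero[OF p] e' by simp
    ultimately show "\<exists>U. openin (seminorm_topology V P) U \<and> x \<in> U \<and> (\<forall>y\<in>U. \<phi> y \<in> Met_TC.mball (\<phi> x) e)"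
      unfolding mball_eq_ball using openin_ball[OF p xV e'] by blast
  qed
  then show ?thesis using add sc off by (simp add: tvs_dual_def topspace)
qed

end

section \<open>Smooth functions of configurations\<close>

text \<open>The index set is arbitrary, not an initial segment, because a distribution applied in
  slot i removes exactly i from it.\<close>

definition depends_on :: "nat set \<Rightarrow> 'd::finite obs \<Rightarrow> bool" where
  "depends_on I f \<longleftrightarrow> (\<forall>Z W. (\<forall>i\<in>I. Z i = W i) \<longrightarrow> f Z = f W)"

lemma depends_on_first_iff: "depends_on_first k f \<longleftrightarrow> depends_on {1..k} f"
  by (simp add: depends_on_first_def depends_on_def)

lemma depends_onD: "depends_on I f \<Longrightarrow> (\<And>i. i \<in> I \<Longrightarrow> Z i = W i) \<Longrightarrow> f Z = f W"
  unfolding depends_on_def by blast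

lemma depends_on_mono: "depends_on I f \<Longrightarrow> I \<subseteq> J \<Longrightarrow> depends_on J f"
  unfolding depends_on_def by blast

text \<open>Names the update inside \<open>partial_deriv\<close>. Translations along one coordinate
  direction form a one-parameter group and different ones commute; the mean value arguments below
  use only this.\<close>

definition shift :: "nat \<times> 'd::finite phase \<Rightarrow> real \<Rightarrow> 'd config \<Rightarrow> 'd config" where
  "shift a t Z = Z(fst a := Z (fst a) + t *\<^sub>R snd a)"

lemma shift_0 [simp]: "shift a 0 Z = Z"
  by (simp add: shift_def)

lemma shift_shift: "shift a s (shift a t Z) = shift a (s + t) Z"
  by (simp add: shift_def fun_eq_iff algebra_simps)

lemma shift_commute: "shift a s (shift b t Z) = shift b t (shift a s Z)"
  by (auto simp: shift_def fun_eq_iff)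

lemma partial_deriv_shift: "partial_deriv a f Z = deriv (\<lambda>t. f (shift a t Z)) 0"
  by (simp add: partial_deriv_def shift_def)

definition has_partial :: "'d::finite obs \<Rightarrow> nat \<times> 'd phase \<Rightarrow> 'd obs \<Rightarrow> bool" where
  "has_partial f a f' \<longleftrightarrow> (\<forall>Z. ((\<lambda>t. f (shift a t Z)) has_real_derivative f' Z) (at 0))"

lemma partial_deriv_eq: "has_partial f a f' \<Longrightarrow> partial_deriv a f = f'"
  by (auto simp: has_partial_def partial_deriv_shift fun_eq_iff intro: DERIV_imp_deriv)

lemma has_partial_at:
  assumes "has_partial f a f'"
  shows "((\<lambda>t. f (shift a t Z)) has_real_derivative f' (shift a s Z)) (at s)"
proof -
  have "((\<lambda>t. f (shift a t (shift a s Z))) has_real_derivative f' (shift a s Z)) (at 0)"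
    using assms by (simp add: has_partial_def)
  then have "((\<lambda>t. f (shift a (t + s) Z)) has_real_derivative f' (shift a s Z)) (at 0)"
    by (simp only: shift_shift)
  then show ?thesis using DERIV_shift[of "\<lambda>t. f (shift a t Z)" "f' (shift a s Z)" 0 s] by simp
qed

lemma has_partial_add:
  "has_partial f a f' \<Longrightarrow> has_partial g a g' \<Longrightarrow> has_partial (\<lambda>Z. f Z + g Z) a (\<lambda>Z. f' Z + g' Z)"
  unfolding has_partial_def by (auto intro!: derivative_eq_intros)

lemma has_partial_mult:
  "has_partial f a f' \<Longrightarrow> has_partial g a g' \<Longrightarrow>
    has_partial (\<lambda>Z. f Z * g Z) a (\<lambda>Z. f' Z * g Z + f Z * g' Z)"
  unfolding has_partial_def by (auto intro!: derivative_eq_intros)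

lemma has_partial_const: "has_partial (\<lambda>Z. c) a (\<lambda>Z. 0)"
  by (simp add: has_partial_def)

lemma has_partial_independent:
  assumes "depends_on I f" "fst a \<notin> I"
  shows "has_partial f a (\<lambda>Z. 0)"
proof -
  have "f (shift a t Z) = f Z" for t Z
    using assms by (intro depends_onD[OF assms(1)]) (auto simp: shift_def)
  then show ?thesis by (simp add: has_partial_def)
qed

lemma depends_on_partial_deriv:
  assumes "depends_on I f"
  shows "depends_on I (partial_deriv a f)"
  unfolding depends_on_def
proof (intro allI impI)
  fix Z W :: "'a config"
  assume "\<forall>i\<in>I. Z i = W i"
  then have "f (shift a t Z) = f (shift a t W)" for t
    by (intro depends_onD[OF assms]) (auto simp: shift_def)
  then show "partial_deriv a f Z = partial_deriv a f W" by (simp add: partial_deriv_shift)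
qed

lemma iter_partial_Nil [simp]: "iter_partial [] f = f"
  by (simp add: iter_partial_def)

lemma iter_partial_Cons [simp]: "iter_partial (a # \<alpha>) f = partial_deriv a (iter_partial \<alpha> f)"
  by (simp add: iter_partial_def)

lemma iter_partial_append: "iter_partial (\<alpha> @ \<beta>) f = iter_partial \<alpha> (iter_partial \<beta> f)"
  by (simp add: iter_partial_def)

lemma depends_on_iter_partial: "depends_on I f \<Longrightarrow> depends_on I (iter_partial \<alpha> f)"
  by (induction \<alpha>) (simp_all add: depends_on_partial_deriv)

text \<open>\<open>smooth_obs k\<close> inspects lists of derivatives in the slots 1 to k. The
  coinductive form admits derivatives in every slot and reproduces itself under each of them, so
  smoothness of a construction follows from exhibiting a class of continuous functions closed under
  differentiation.\<close>

coinductive smooth_config :: "'d::finite obs \<Rightarrow> bool" where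
  "continuous_on UNIV f \<Longrightarrow>
   (\<And>a. snd a \<in> Basis \<Longrightarrow> has_partial f a (partial_deriv a f)) \<Longrightarrow>
   (\<And>a. snd a \<in> Basis \<Longrightarrow> smooth_config (partial_deriv a f)) \<Longrightarrow> smooth_config f"

lemma smooth_config_continuous: "smooth_config f \<Longrightarrow> continuous_on UNIV f"
  by (auto elim: smooth_config.cases)

lemma smooth_config_has_partial:
  "smooth_config f \<Longrightarrow> snd a \<in> Basis \<Longrightarrow> has_partial f a (partial_deriv a f)"
  by (erule smooth_config.cases) blast

lemma smooth_config_partial_deriv:
  "smooth_config f \<Longrightarrow> snd a \<in> Basis \<Longrightarrow> smooth_config (partial_deriv a f)"
  by (erule smooth_config.cases) blast

lemma smooth_configI:
  assumes "S f"
    and cont: "\<And>f. S f \<Longrightarrow> continuous_on UNIV f"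
    and part: "\<And>f a. S f \<Longrightarrow> snd a \<in> Basis \<Longrightarrow> \<exists>f'. S f' \<and> has_partial f a f'"
  shows "smooth_config f"
  using assms(1)
proof (coinduction arbitrary: f)
  case (smooth_config f)
  have "has_partial f a (partial_deriv a f) \<and> S (partial_deriv a f)" if "snd a \<in> Basis" for a
    using part[OF smooth_config that] partial_deriv_eq by metis
  then show ?case using cont[OF smooth_config] by blast
qed

lemma smooth_config_iter_partial:
  "smooth_config f \<Longrightarrow> \<alpha> \<in> lists (UNIV \<times> Basis) \<Longrightarrow> smooth_config (iter_partial \<alpha> f)"
  by (induction \<alpha>) (auto intro!: smooth_config_partial_deriv)

lemma smooth_config_const: "smooth_config (\<lambda>Z. c)"
proof (rule smooth_configI[of "\<lambda>f. \<exists>c. f = (\<lambda>Z. c)"])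
  show "\<And>f a. \<exists>c. f = (\<lambda>Z. c) \<Longrightarrow> snd a \<in> Basis \<Longrightarrow> \<exists>f'. (\<exists>c. f' = (\<lambda>Z. c)) \<and> has_partial f a f'"
    using has_partial_const by blast
qed auto

text \<open>Differentiating a product gives a sum of products, so products alone are not a class
  suited to coinduction; the algebra generated by the smooth functions is.\<close>

inductive smooth_alg :: "'d::finite obs \<Rightarrow> bool" where
  base: "smooth_config f \<Longrightarrow> smooth_alg f"
| add: "smooth_alg f \<Longrightarrow> smooth_alg g \<Longrightarrow> smooth_alg (\<lambda>Z. f Z + g Z)"
| mult: "smooth_alg f \<Longrightarrow> smooth_alg g \<Longrightarrow> smooth_alg (\<lambda>Z. f Z * g Z)"

lemma smooth_alg_smooth: "smooth_alg f \<Longrightarrow> smooth_config f"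
proof (rule smooth_configI[of smooth_alg])
  fix f :: "'a obs" and a :: "nat \<times> 'a phase"
  show "smooth_alg f \<Longrightarrow> continuous_on UNIV f"
    by (induction rule: smooth_alg.induct) (auto intro: smooth_config_continuous continuous_intros)
  show "smooth_alg f \<Longrightarrow> snd a \<in> Basis \<Longrightarrow> \<exists>f'. smooth_alg f' \<and> has_partial f a f'"
  proof (induction rule: smooth_alg.induct)
    case (base f)
    then show ?case
      using smooth_config_has_partial smooth_config_partial_deriv smooth_alg.base by blast
  next
    case (add f g)
    then obtain f' g' where "smooth_alg f'" "has_partial f a f'" "smooth_alg g'" "has_partial g a g'"
      by blast
    then show ?case
      by (intro exI[of _ "\<lambda>Z. f' Z + g' Z"] conjI has_partial_add smooth_alg.add)
  next
    case (mult f g)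
    then obtain f' g' where "smooth_alg f'" "has_partial f a f'" "smooth_alg g'" "has_partial g a g'"
      by blast
    then show ?case
      using mult.hyps
      by (intro exI[of _ "\<lambda>Z. f' Z * g Z + f Z * g' Z"] conjI has_partial_mult smooth_alg.intros(2,3))
  qed
qed

lemma smooth_config_add: "smooth_config f \<Longrightarrow> smooth_config g \<Longrightarrow> smooth_config (\<lambda>Z. f Z + g Z)"
  by (rule smooth_alg_smooth[OF smooth_alg.add[OF smooth_alg.base smooth_alg.base]])

lemma smooth_config_mult: "smooth_config f \<Longrightarrow> smooth_config g \<Longrightarrow> smooth_config (\<lambda>Z. f Z * g Z)"
  by (rule smooth_alg_smooth[OF smooth_alg.mult[OF smooth_alg.base smooth_alg.base]])

lemma smooth_config_cmult: "smooth_config f \<Longrightarrow> smooth_config (\<lambda>Z. c * f Z)"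
  by (intro smooth_config_mult smooth_config_const)

lemma smooth_config_diff: "smooth_config f \<Longrightarrow> smooth_config g \<Longrightarrow> smooth_config (\<lambda>Z. f Z - g Z)"
  using smooth_config_add[of f "\<lambda>Z. (- 1) * g Z"] smooth_config_cmult[of g "- 1"] by simp

lemma smooth_config_sum:
  "(\<And>i. i \<in> A \<Longrightarrow> smooth_config (f i)) \<Longrightarrow> smooth_config (\<lambda>Z. \<Sum>i\<in>A. f i Z)"
proof (induction A rule: infinite_finite_induct)
  case (insert x A)
  then have "smooth_config (\<lambda>Z. f x Z + (\<Sum>i\<in>A. f i Z))" by (intro smooth_config_add) auto
  then show ?case using insert.hyps by simp
qed (simp_all add: smooth_config_const)

lemma smooth_config_prod:
  "(\<And>i. i \<in> A \<Longrightarrow> smooth_config (f i)) \<Longrightarrow> smooth_config (\<lambda>Z. \<Prod>i\<in>A. f i Z)"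
proof (induction A rule: infinite_finite_induct)
  case (insert x A)
  then have "smooth_config (\<lambda>Z. f x Z * (\<Prod>i\<in>A. f i Z))" by (intro smooth_config_mult) auto
  then show ?case using insert.hyps by simp
qed (simp_all add: smooth_config_const)

lemma smooth_config_power: "smooth_config f \<Longrightarrow> smooth_config (\<lambda>Z. f Z ^ n)"
  using smooth_config_prod[of "{..<n}" "\<lambda>i. f"] by simp

lemma partial_deriv_add:
  "smooth_config f \<Longrightarrow> smooth_config g \<Longrightarrow> snd a \<in> Basis \<Longrightarrow>
    partial_deriv a (\<lambda>Z. f Z + g Z) = (\<lambda>Z. partial_deriv a f Z + partial_deriv a g Z)"
  by (intro partial_deriv_eq has_partial_add smooth_config_has_partial)

lemma partial_deriv_mult:
  "smooth_config f \<Longrightarrow> smooth_config g \<Longrightarrow> snd a \<in> Basis \<Longrightarrow>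
    partial_deriv a (\<lambda>Z. f Z * g Z) = (\<lambda>Z. partial_deriv a f Z * g Z + f Z * partial_deriv a g Z)"
  by (intro partial_deriv_eq has_partial_mult smooth_config_has_partial)

lemma partial_deriv_const: "partial_deriv a (\<lambda>Z. c) = (\<lambda>Z. 0)"
  by (intro partial_deriv_eq has_partial_const)

lemma partial_deriv_cmult:
  "smooth_config f \<Longrightarrow> snd a \<in> Basis \<Longrightarrow> partial_deriv a (\<lambda>Z. c * f Z) = (\<lambda>Z. c * partial_deriv a f Z)"
  using partial_deriv_mult[OF smooth_config_const, of f a c] by (simp add: partial_deriv_const)

lemma iter_partial_lincomb:
  assumes "smooth_config f" "smooth_config g" "\<alpha> \<in> lists (UNIV \<times> Basis)"
  shows "iter_partial \<alpha> (\<lambda>Z. c * f Z + d * g Z) = (\<lambda>Z. c * iter_partial \<alpha> f Z + d * iter_partial \<alpha> g Z)"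
  using assms(3)
proof (induction \<alpha>)
  case (Cons a \<alpha>)
  then have a: "snd a \<in> Basis" and \<alpha>: "\<alpha> \<in> lists (UNIV \<times> Basis)" by auto
  note sm = smooth_config_iter_partial[OF assms(1) \<alpha>] smooth_config_iter_partial[OF assms(2) \<alpha>]
  show ?case
    using Cons a sm by (simp add: partial_deriv_add partial_deriv_cmult smooth_config_cmult)
qed simp

lemma iter_partial_diff:
  assumes "smooth_config f" "smooth_config g" "\<alpha> \<in> lists (UNIV \<times> Basis)"
  shows "iter_partial \<alpha> (\<lambda>Z. f Z - g Z) = (\<lambda>Z. iter_partial \<alpha> f Z - iter_partial \<alpha> g Z)"
  using iter_partial_lincomb[OF assms, of 1 "- 1"] by simp

lemma iter_partial_cmult:
  assumes "smooth_config f" "\<alpha> \<in> lists (UNIV \<times> Basis)"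
  shows "iter_partial \<alpha> (\<lambda>Z. c * f Z) = (\<lambda>Z. c * iter_partial \<alpha> f Z)"
  using iter_partial_lincomb[OF assms(1,1,2), of c 0] by simp

lemma continuous_config_compose:
  assumes "continuous_on UNIV f" "\<And>i. continuous_on S (\<lambda>x. c x i)"
  shows "continuous_on S (\<lambda>x. f (c x))"
  by (rule continuous_on_compose2[OF assms(1) continuous_on_coordinatewise_then_product[OF assms(2)]]) auto

lemma continuous_on_shift:
  assumes "continuous_on S t" "\<And>i. continuous_on S (\<lambda>x. c x i)"
  shows "continuous_on S (\<lambda>x. shift a (t x) (c x) i)"
  unfolding shift_def using assms by (cases "i = fst a") (auto intro!: continuous_intros)

text \<open>The left side is symmetric in a and b, while the mean value theorem, used in direction a
  and then in direction b, turns it into a mixed derivative in that order at a nearby point.\<close>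

lemma second_difference_mvt:
  assumes f: "smooth_config f" and a: "snd a \<in> Basis" and b: "snd b \<in> Basis" and t: "t > 0"
  shows "\<exists>\<xi> \<eta>. 0 < \<xi> \<and> \<xi> < t \<and> 0 < \<eta> \<and> \<eta> < t \<and>
    f (shift a t (shift b t Z)) - f (shift a t Z) - f (shift b t Z) + f Z
      = t * t * partial_deriv b (partial_deriv a f) (shift b \<eta> (shift a \<xi> Z))"
proof -
  note pa = has_partial_at[OF smooth_config_has_partial[OF f a]]
  note pba = has_partial_at[OF smooth_config_has_partial[OF smooth_config_partial_deriv[OF f a] b]]
  have "\<exists>\<xi>>0. \<xi> < t \<and>
    (f (shift a t (shift b t Z)) - f (shift a t Z)) - (f (shift a 0 (shift b t Z)) - f (shift a 0 Z))
      = (t - 0) * (partial_deriv a f (shift a \<xi> (shift b t Z)) - partial_deriv a f (shift a \<xi> Z))"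
    by (rule MVT2[OF t DERIV_diff[OF pa pa]])
  then obtain \<xi> where \<xi>: "0 < \<xi>" "\<xi> < t"
    "(f (shift a t (shift b t Z)) - f (shift a t Z)) - (f (shift a 0 (shift b t Z)) - f (shift a 0 Z))
      = (t - 0) * (partial_deriv a f (shift a \<xi> (shift b t Z)) - partial_deriv a f (shift a \<xi> Z))"
    by (elim exE conjE)
  have "\<exists>\<eta>>0. \<eta> < t \<and>
    partial_deriv a f (shift b t (shift a \<xi> Z)) - partial_deriv a f (shift b 0 (shift a \<xi> Z))
      = (t - 0) * partial_deriv b (partial_deriv a f) (shift b \<eta> (shift a \<xi> Z))"
    by (rule MVT2[OF t pba])
  then obtain \<eta> where \<eta>: "0 < \<eta>" "\<eta> < t"
    "partial_deriv a f (shift b t (shift a \<xi> Z)) - partial_deriv a f (shift b 0 (shift a \<xi> Z))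
      = (t - 0) * partial_deriv b (partial_deriv a f) (shift b \<eta> (shift a \<xi> Z))"
    by (elim exE conjE)
  show ?thesis
    using \<xi> \<eta> by (intro exI[of _ \<xi>] exI[of _ \<eta>]) (simp add: shift_commute[of b t a \<xi>])
qed

text \<open>Schwarz's theorem. Both mixed derivatives at points near Z equal the same second
  difference divided by \<open>t * t\<close>; if they differed at Z, continuity within half of the
  gap would give a contradiction.\<close>

lemma partial_deriv_commute:
  assumes f: "smooth_config f" and a: "snd a \<in> Basis" and b: "snd b \<in> Basis"
  shows "partial_deriv a (partial_deriv b f) = partial_deriv b (partial_deriv a f)"
proof
  fix Z
  \<comment> \<open>Only the points reached by shifts in the two directions matter, so continuity on
    the space of sequences is used through a function of two real variables.\<close>
  have near: "\<exists>d>0. \<forall>\<xi> \<eta>. 0 < \<xi> \<and> \<xi> < d \<and> 0 < \<eta> \<and> \<eta> < d \<longrightarrow>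
      \<bar>partial_deriv q (partial_deriv p f) (shift q \<eta> (shift p \<xi> Z)) - partial_deriv q (partial_deriv p f) Z\<bar> < e"
    if pq: "snd p \<in> Basis" "snd q \<in> Basis" and e: "e > 0" for p q e
  proof -
    let ?G = "\<lambda>x::real \<times> real. partial_deriv q (partial_deriv p f) (shift q (snd x) (shift p (fst x) Z))"
    have "continuous_on UNIV ?G"
    proof (rule continuous_config_compose[where f = "partial_deriv q (partial_deriv p f)"
          and c = "\<lambda>x. shift q (snd x) (shift p (fst x) Z)"])
      show "continuous_on UNIV (partial_deriv q (partial_deriv p f))"
        using pq f by (simp add: smooth_config_continuous smooth_config_partial_deriv)
      show "continuous_on UNIV (\<lambda>x::real \<times> real. shift q (snd x) (shift p (fst x) Z) i)" for i
        by (intro continuous_on_shift) (auto intro!: continuous_intros)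
    qed
    then have "\<exists>d>0. \<forall>x\<in>UNIV. dist x (0, 0) < d \<longrightarrow> dist (?G x) (?G (0, 0)) < e"
      using e spec[OF bspec[OF iffD1[OF continuous_on_iff], of UNIV ?G "(0, 0)"], of e] by simp
    then obtain d where d: "d > 0" "\<And>x. dist x (0, 0) < d \<Longrightarrow> dist (?G x) (?G (0, 0)) < e"
      by (elim exE conjE) simp
    have "dist (\<xi>, \<eta>) (0, 0) < d" if "0 < \<xi>" "\<xi> < d / 2" "0 < \<eta>" "\<eta> < d / 2" for \<xi> \<eta>
    proof -
      have "dist (\<xi>, \<eta>) (0, 0) \<le> norm \<xi> + norm \<eta>" using norm_Pair_le[of \<xi> \<eta>] by (simp add: dist_norm)
      then show ?thesis using that by simp
    qed
    then have "\<bar>?G (\<xi>, \<eta>) - ?G (0, 0)\<bar> < e" if "0 < \<xi>" "\<xi> < d / 2" "0 < \<eta>" "\<eta> < d / 2" for \<xi> \<eta>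
      using d(2)[of "(\<xi>, \<eta>)"] that by (simp add: dist_real_def)
    then show ?thesis using d(1) by (intro exI[of _ "d / 2"]) simp
  qed
  show "partial_deriv a (partial_deriv b f) Z = partial_deriv b (partial_deriv a f) Z"
  proof (rule ccontr)
    let ?u = "partial_deriv a (partial_deriv b f)" and ?w = "partial_deriv b (partial_deriv a f)"
    assume "?u Z \<noteq> ?w Z"
    then have e: "\<bar>?u Z - ?w Z\<bar> / 2 > 0" by simp
    obtain d1 where d1: "d1 > 0" "\<And>\<xi> \<eta>. 0 < \<xi> \<Longrightarrow> \<xi> < d1 \<Longrightarrow> 0 < \<eta> \<Longrightarrow> \<eta> < d1 \<Longrightarrow>
      \<bar>?u (shift a \<eta> (shift b \<xi> Z)) - ?u Z\<bar> < \<bar>?u Z - ?w Z\<bar> / 2" using near[OF b a e] by auto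
    obtain d2 where d2: "d2 > 0" "\<And>\<xi> \<eta>. 0 < \<xi> \<Longrightarrow> \<xi> < d2 \<Longrightarrow> 0 < \<eta> \<Longrightarrow> \<eta> < d2 \<Longrightarrow>
      \<bar>?w (shift b \<eta> (shift a \<xi> Z)) - ?w Z\<bar> < \<bar>?u Z - ?w Z\<bar> / 2" using near[OF a b e] by auto
    define t where "t = min d1 d2"
    have t: "t > 0" "t \<le> d1" "t \<le> d2" using d1 d2 by (auto simp: t_def)
    obtain \<xi> \<eta> where 1: "0 < \<xi>" "\<xi> < t" "0 < \<eta>" "\<eta> < t"
      "f (shift a t (shift b t Z)) - f (shift a t Z) - f (shift b t Z) + f Z = t * t * ?w (shift b \<eta> (shift a \<xi> Z))"
      using second_difference_mvt[OF f a b t(1)] by blast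
    obtain \<xi>' \<eta>' where 2: "0 < \<xi>'" "\<xi>' < t" "0 < \<eta>'" "\<eta>' < t"
      "f (shift b t (shift a t Z)) - f (shift b t Z) - f (shift a t Z) + f Z = t * t * ?u (shift a \<eta>' (shift b \<xi>' Z))"
      using second_difference_mvt[OF f b a t(1)] by blast
    have "t * t * ?w (shift b \<eta> (shift a \<xi> Z)) = t * t * ?u (shift a \<eta>' (shift b \<xi>' Z))"
      using 1(5) 2(5) unfolding shift_commute[of b t a t] by linarith
    then have "?w (shift b \<eta> (shift a \<xi> Z)) = ?u (shift a \<eta>' (shift b \<xi>' Z))" using t(1) by simp
    then have "\<bar>?u Z - ?w Z\<bar> \<le> \<bar>?w (shift b \<eta> (shift a \<xi> Z)) - ?w Z\<bar> + \<bar>?u (shift a \<eta>' (shift b \<xi>' Z)) - ?u Z\<bar>"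
      using abs_triangle_ineq4[of "?w (shift b \<eta> (shift a \<xi> Z)) - ?w Z" "?u (shift a \<eta>' (shift b \<xi>' Z)) - ?u Z"] by simp
    moreover have "\<bar>?w (shift b \<eta> (shift a \<xi> Z)) - ?w Z\<bar> < \<bar>?u Z - ?w Z\<bar> / 2"
      using 1 t by (intro d2(2)) auto
    moreover have "\<bar>?u (shift a \<eta>' (shift b \<xi>' Z)) - ?u Z\<bar> < \<bar>?u Z - ?w Z\<bar> / 2"
      using 2 t by (intro d1(2)) auto
    ultimately show False by argo
  qed
qed

lemma iter_partial_partial_deriv:
  assumes "smooth_config f" "\<alpha> \<in> lists (UNIV \<times> Basis)" "snd a \<in> Basis"
  shows "iter_partial \<alpha> (partial_deriv a f) = partial_deriv a (iter_partial \<alpha> f)"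
  using assms(2)
proof (induction \<alpha>)
  case (Cons b \<alpha>)
  then have "\<alpha> \<in> lists (UNIV \<times> Basis)" "snd b \<in> Basis" by auto
  then show ?case
    using partial_deriv_commute[OF smooth_config_iter_partial[OF assms(1)], of \<alpha> b a] assms(3) Cons.IH by simp
qed simp

text \<open>Since derivatives commute, any occurrence of a can be made the innermost one. The
  density induction needs this to pass from h to its derivative in a chosen direction.\<close>

lemma iter_partial_remove1:
  assumes "smooth_config f" "\<alpha> \<in> lists (UNIV \<times> Basis)" "a \<in> set \<alpha>"
  shows "iter_partial \<alpha> f = iter_partial (remove1 a \<alpha>) (partial_deriv a f)"
  using assms(2,3)
proof (induction \<alpha>)
  case (Cons b \<alpha>)
  show ?case
  proof (cases "a = b")
    case True
    then show ?thesis using iter_partial_partial_deriv[OF assms(1), of \<alpha> a] Cons by auto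
  qed (use Cons in auto)
qed simp

lemma smooth_config_imp_smooth_obs:
  assumes "smooth_config f"
  shows "smooth_obs k f"
  unfolding smooth_obs_def
proof (intro ballI conjI allI)
  fix \<alpha> assume \<alpha>: "\<alpha> \<in> (multi_indices k :: (nat \<times> 'a phase) list set)"
  then have sm: "smooth_config (iter_partial \<alpha> f)"
    by (intro smooth_config_iter_partial assms) (auto simp: multi_indices_def)
  then show "continuous_on UNIV (iter_partial \<alpha> f)" by (rule smooth_config_continuous)
  fix i :: nat and e :: "'a phase" and Z :: "'a config" assume e: "e \<in> Basis"
  then have "has_partial (iter_partial \<alpha> f) (i, e) (partial_deriv (i, e) (iter_partial \<alpha> f))"
    by (intro smooth_config_has_partial[OF sm]) simp
  then show "(\<lambda>t. iter_partial \<alpha> f (Z(i := Z i + t *\<^sub>R e))) differentiable at 0"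
    unfolding has_partial_def shift_def by (auto simp: real_differentiable_def)
qed

text \<open>The coinduction class consists of the iterated derivatives in the slots 1 to k together
  with the zero function, which is the derivative in any later slot.\<close>

lemma smooth_obs_imp_smooth_config:
  fixes f :: "'d::finite obs"
  assumes "depends_on {1..k} f" "smooth_obs k f"
  shows "smooth_config f"
proof (rule smooth_configI[of "\<lambda>g. g = (\<lambda>Z. 0) \<or> (\<exists>\<alpha>\<in>multi_indices k. g = iter_partial \<alpha> f)"])
  show "f = (\<lambda>Z. 0) \<or> (\<exists>\<alpha>\<in>multi_indices k. f = iter_partial \<alpha> f)"
    by (intro disjI2 bexI[of _ "[]"]) (auto simp: multi_indices_def)
  fix g :: "'d obs"
  assume g: "g = (\<lambda>Z. 0) \<or> (\<exists>\<alpha>\<in>multi_indices k. g = iter_partial \<alpha> f)"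
  then show "continuous_on UNIV g" using assms(2) by (auto simp: smooth_obs_def)
  fix a :: "nat \<times> 'd phase" assume a: "snd a \<in> Basis"
  show "\<exists>g'. (g' = (\<lambda>Z. 0) \<or> (\<exists>\<alpha>\<in>multi_indices k. g' = iter_partial \<alpha> f)) \<and> has_partial g a g'"
  proof (cases "g = (\<lambda>Z. 0)")
    case True
    then show ?thesis using has_partial_const by blast
  next
    case False
    then obtain \<alpha> where \<alpha>: "\<alpha> \<in> multi_indices k" "g = iter_partial \<alpha> f" using g by blast
    show ?thesis
    proof (cases "fst a \<in> {1..k}")
      case True
      have "(\<lambda>t. g (shift a t Z)) differentiable at 0" for Z
        using assms(2) \<alpha> True a unfolding smooth_obs_def shift_def by blast
      then have "has_partial g a (partial_deriv a g)"
        by (simp add: has_partial_def partial_deriv_shift DERIV_deriv_iff_real_differentiable)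
      moreover have "partial_deriv a g = iter_partial (a # \<alpha>) f" "a # \<alpha> \<in> multi_indices k"
        using \<alpha> True a by (auto simp: multi_indices_def mem_Times_iff)
      ultimately show ?thesis by metis
    next
      case False
      then show ?thesis
        using has_partial_independent[OF depends_on_iter_partial[OF assms(1)]] \<alpha> by blast
    qed
  qed
qed

lemma sym_smooth_iff:
  "f \<in> sym_smooth k \<longleftrightarrow> depends_on {1..k} f \<and> smooth_config f \<and>
     (\<forall>\<pi> Z. \<pi> permutes {1..k} \<longrightarrow> f (\<lambda>i. Z (\<pi> i)) = f Z)"
  unfolding sym_smooth_def depends_on_first_iff
  using smooth_config_imp_smooth_obs smooth_obs_imp_smooth_config by blast

lemma sym_smooth_1_iff: "f \<in> sym_smooth 1 \<longleftrightarrow> depends_on {1} f \<and> smooth_config f"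
  unfolding sym_smooth_iff by (simp add: permutes_sing)

lemma smooth_config_subst:
  fixes f :: "'d::finite obs"
  assumes f: "smooth_config f" and inj: "inj_on \<sigma> C"
  shows "smooth_config (\<lambda>Z. f (\<lambda>i. if i \<in> C then Z (\<sigma> i) else W i))"
proof (rule smooth_configI[of "\<lambda>g. \<exists>f. smooth_config f \<and> g = (\<lambda>Z. f (\<lambda>i. if i \<in> C then Z (\<sigma> i) else W i))"])
  show "\<exists>f'. smooth_config f' \<and>
      (\<lambda>Z. f (\<lambda>i. if i \<in> C then Z (\<sigma> i) else W i)) = (\<lambda>Z. f' (\<lambda>i. if i \<in> C then Z (\<sigma> i) else W i))"
    using f by (intro exI[of _ f]) simp
  fix g :: "'d obs"
  assume "\<exists>f. smooth_config f \<and> g = (\<lambda>Z. f (\<lambda>i. if i \<in> C then Z (\<sigma> i) else W i))"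
  then obtain f where f: "smooth_config f" and g: "g = (\<lambda>Z. f (\<lambda>i. if i \<in> C then Z (\<sigma> i) else W i))"
    by (elim exE conjE)
  show "continuous_on UNIV g"
    unfolding g
  proof (rule continuous_config_compose[OF smooth_config_continuous[OF f]])
    show "continuous_on UNIV (\<lambda>Z. if i \<in> C then Z (\<sigma> i) else W i)" for i
      by (cases "i \<in> C") (auto intro: continuous_on_product_coordinates)
  qed
  fix a :: "nat \<times> 'd phase" assume a: "snd a \<in> Basis"
  show "\<exists>g'. (\<exists>f. smooth_config f \<and> g' = (\<lambda>Z. f (\<lambda>i. if i \<in> C then Z (\<sigma> i) else W i))) \<and> has_partial g a g'"
  proof (cases "fst a \<in> \<sigma> ` C")
    case True
    then obtain i where i: "i \<in> C" "fst a = \<sigma> i" by blast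
    have eq: "(\<lambda>j. if j \<in> C then shift a t Z (\<sigma> j) else W j)
        = shift (i, snd a) t (\<lambda>j. if j \<in> C then Z (\<sigma> j) else W j)" for t Z
      using i inj by (auto simp: shift_def fun_eq_iff inj_on_def)
    have "has_partial g a (\<lambda>Z. partial_deriv (i, snd a) f (\<lambda>j. if j \<in> C then Z (\<sigma> j) else W j))"
      using smooth_config_has_partial[OF f, of "(i, snd a)"] a
      by (simp add: has_partial_def g eq)
    moreover have "smooth_config (partial_deriv (i, snd a) f)"
      using smooth_config_partial_deriv[OF f] a by simp
    ultimately show ?thesis
      by (intro exI[of _ "\<lambda>Z. partial_deriv (i, snd a) f (\<lambda>j. if j \<in> C then Z (\<sigma> j) else W j)"])
        (auto intro: exI[of _ "partial_deriv (i, snd a) f"])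
  next
    case False
    have "shift a t Z (\<sigma> j) = Z (\<sigma> j)" if "j \<in> C" for t Z j
    proof -
      have "\<sigma> j \<noteq> fst a" using False that by (metis imageI)
      then show ?thesis by (simp add: shift_def)
    qed
    then have "(\<lambda>j. if j \<in> C then shift a t Z (\<sigma> j) else W j) = (\<lambda>j. if j \<in> C then Z (\<sigma> j) else W j)" for t Z
      by (simp add: fun_eq_iff)
    then have "has_partial g a (\<lambda>Z. 0)" by (simp add: has_partial_def g)
    then show ?thesis
      by (intro exI[of _ "\<lambda>Z. 0"] conjI exI[of _ "\<lambda>Z. 0"]) (auto intro: smooth_config_const)
  qed
qed

section \<open>Slices and the topology of symmetric smooth functions\<close>

text \<open>The function on which \<open>apply_at\<close> lets its distribution act: variable i of
  h, with the others frozen at Z, is renamed to the variable 1 of a one-particle observable.\<close>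

definition slice :: "nat \<Rightarrow> 'd::finite obs \<Rightarrow> 'd config \<Rightarrow> 'd obs" where
  "slice i h Z = (\<lambda>W. h (Z(i := W 1)))"

lemma apply_at_slice: "apply_at \<gamma> i h Z = \<gamma> (slice i h Z)"
  by (simp add: apply_at_def slice_def)

lemma slice_in_sym_smooth: "smooth_config h \<Longrightarrow> slice i h Z \<in> sym_smooth 1"
proof -
  assume h: "smooth_config h"
  have "slice i h Z = (\<lambda>W. h (\<lambda>j. if j \<in> {i} then W 1 else Z j))"
    by (auto simp: slice_def fun_eq_iff fun_upd_def intro!: arg_cong[of _ _ h])
  then have "smooth_config (slice i h Z)"
    using smooth_config_subst[OF h, of "\<lambda>_. 1" "{i}" Z] by simp
  then show ?thesis by (simp only: sym_smooth_1_iff depends_on_def slice_def) simp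
qed

lemma partial_deriv_slice:
  "fst a = 1 \<Longrightarrow> partial_deriv a (slice i h Z) = slice i (partial_deriv (i, snd a) h) Z"
  by (auto simp: partial_deriv_def slice_def fun_eq_iff)

lemma iter_partial_slice:
  "\<alpha> \<in> multi_indices 1 \<Longrightarrow>
    iter_partial \<alpha> (slice i h Z) = slice i (iter_partial (map (\<lambda>a. (i, snd a)) \<alpha>) h) Z"
  unfolding multi_indices_def
  by (induction \<alpha>) (auto simp: partial_deriv_slice)

text \<open>One number N bounds both the order and the radius, which turns the seminorms into a
  single increasing sequence. Carrying a bound M instead of a supremum avoids any question whether a
  \<open>Sup\<close> is meaningful.\<close>

definition cn_bound :: "nat \<Rightarrow> nat \<Rightarrow> 'd::finite obs \<Rightarrow> real \<Rightarrow> bool" where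
  "cn_bound k N f M \<longleftrightarrow> (\<forall>\<alpha>\<in>multi_indices k. length \<alpha> \<le> N \<longrightarrow>
     (\<forall>Z. (\<forall>i\<in>{1..k}. norm (Z i) \<le> real N) \<longrightarrow> \<bar>iter_partial \<alpha> f Z\<bar> \<le> M))"

lemma cn_bound_mono: "cn_bound k N f M \<Longrightarrow> n \<le> N \<Longrightarrow> M \<le> M' \<Longrightarrow> cn_bound k n f M'"
  unfolding cn_bound_def by (meson le_trans of_nat_mono order_trans)

definition cn_norm :: "nat \<Rightarrow> nat \<Rightarrow> 'd::finite config set \<Rightarrow> 'd obs \<Rightarrow> real" where
  "cn_norm k n K f = Sup {\<bar>iter_partial \<alpha> f Z\<bar> | \<alpha> Z. \<alpha> \<in> multi_indices k \<and> length \<alpha> \<le> n \<and> Z \<in> K}"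

lemma sym_smooth_top_eq:
  "sym_smooth_top k = seminorm_topology (sym_smooth k) {cn_norm k n K | K n. compact K \<and> K \<noteq> {}}"
  unfolding sym_smooth_top_def cn_norm_def[abs_def] ..

lemma finite_multi_indices: "finite {\<alpha> \<in> (multi_indices k :: (nat \<times> 'd::finite phase) list set). length \<alpha> \<le> n}"
proof -
  have "{\<alpha> \<in> (multi_indices k :: (nat \<times> 'd phase) list set). length \<alpha> \<le> n}
      = {\<alpha>. set \<alpha> \<subseteq> {1..k} \<times> Basis \<and> length \<alpha> \<le> n}"
    by (auto simp: multi_indices_def)
  then show ?thesis using finite_lists_length_le[of "{1..k} \<times> (Basis :: 'd phase set)" n] by simp
qed

lemma multi_indices_subset: "\<alpha> \<in> multi_indices k \<Longrightarrow> \<alpha> \<in> lists (UNIV \<times> Basis)"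
  by (auto simp: multi_indices_def)

lemma Nil_multi_indices: "[] \<in> multi_indices k"
  by (simp add: multi_indices_def)

text \<open>A \<open>Sup\<close> of reals informs only about sets bounded above. Here boundedness
  comes from compactness for each derivative and from there being finitely many multi-indices of
  bounded length.\<close>

lemma cn_norm_upper:
  fixes f :: "'d::finite obs"
  assumes f: "smooth_config f" and K: "compact K"
    and \<alpha>: "\<alpha> \<in> multi_indices k" "length \<alpha> \<le> n" and Z: "Z \<in> K"
  shows "\<bar>iter_partial \<alpha> f Z\<bar> \<le> cn_norm k n K f"
  unfolding cn_norm_def
proof (rule cSup_upper)
  let ?I = "{\<alpha> \<in> (multi_indices k :: (nat \<times> 'd phase) list set). length \<alpha> \<le> n}"
  let ?S = "{\<bar>iter_partial \<alpha> f Z\<bar> | \<alpha> Z. \<alpha> \<in> multi_indices k \<and> length \<alpha> \<le> n \<and> Z \<in> K}"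
  show "\<bar>iter_partial \<alpha> f Z\<bar> \<in> ?S"
    using \<alpha> Z by (intro CollectI exI[of _ \<alpha>] exI[of _ Z] conjI refl)
  have "\<exists>M. \<forall>Z\<in>K. \<bar>iter_partial \<alpha> f Z\<bar> \<le> M" if "\<alpha> \<in> ?I" for \<alpha>
  proof -
    have "\<alpha> \<in> lists (UNIV \<times> Basis)" using that multi_indices_subset[of \<alpha> k] by simp
    then have "continuous_on UNIV (iter_partial \<alpha> f)"
      by (rule smooth_config_continuous[OF smooth_config_iter_partial[OF f]])
    then have "continuous_on K (iter_partial \<alpha> f)" by (rule continuous_on_subset) simp
    then have "bounded (iter_partial \<alpha> f ` K)"
      using K by (intro compact_imp_bounded compact_continuous_image)
    then show ?thesis by (simp add: bounded_iff)
  qed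
  then have "\<forall>\<alpha>\<in>?I. \<exists>M. \<forall>Z\<in>K. \<bar>iter_partial \<alpha> f Z\<bar> \<le> M" by (rule ballI)
  from bchoice[OF this] obtain M where M: "\<forall>\<alpha>\<in>?I. \<forall>Z\<in>K. \<bar>iter_partial \<alpha> f Z\<bar> \<le> M \<alpha>" by (elim exE)
  show "bdd_above ?S"
  proof (rule bdd_aboveI)
    fix x assume "x \<in> ?S"
    then obtain \<beta> W where x: "x = \<bar>iter_partial \<beta> f W\<bar>" "\<beta> \<in> ?I" "W \<in> K" by (elim CollectE exE conjE) simp
    then have "x \<le> M \<beta>" using M by simp
    also have "\<dots> \<le> \<bar>M \<beta>\<bar>" by simp
    also have "\<dots> \<le> (\<Sum>\<beta>\<in>?I. \<bar>M \<beta>\<bar>)" by (rule member_le_sum[OF x(2) _ finite_multi_indices]) simp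
    finally show "x \<le> (\<Sum>\<beta>\<in>?I. \<bar>M \<beta>\<bar>)" .
  qed
qed

lemma cn_norm_least:
  assumes "K \<noteq> {}"
    and "\<And>\<alpha> Z. \<alpha> \<in> multi_indices k \<Longrightarrow> length \<alpha> \<le> n \<Longrightarrow> Z \<in> K \<Longrightarrow> \<bar>iter_partial \<alpha> f Z\<bar> \<le> M"
  shows "cn_norm k n K f \<le> M"
  unfolding cn_norm_def
proof (rule cSup_least)
  let ?S = "{\<bar>iter_partial \<alpha> f Z\<bar> | \<alpha> Z. \<alpha> \<in> multi_indices k \<and> length \<alpha> \<le> n \<and> Z \<in> K}"
  obtain Z where "Z \<in> K" using assms(1) by blast
  then have "\<bar>iter_partial [] f Z\<bar> \<in> ?S"
    by (intro CollectI exI[of _ "[]"] exI[of _ Z] conjI refl Nil_multi_indices) simp_all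
  then show "?S \<noteq> {}" by (metis empty_iff)
  show "x \<le> M" if "x \<in> ?S" for x
    using that by (elim CollectE exE conjE) (simp add: assms(2))
qed

lemma sym_smooth_smooth: "f \<in> sym_smooth k \<Longrightarrow> smooth_config f"
  by (simp add: sym_smooth_iff)

lemma sym_smooth_depends: "f \<in> sym_smooth k \<Longrightarrow> depends_on {1..k} f"
  by (simp add: sym_smooth_iff)

lemma sym_smooth_lincomb:
  assumes "f \<in> sym_smooth k" "g \<in> sym_smooth k"
  shows "(\<lambda>Z. c * f Z + d * g Z) \<in> sym_smooth k"
  unfolding sym_smooth_iff depends_on_def
proof (intro conjI allI impI)
  show "smooth_config (\<lambda>Z. c * f Z + d * g Z)"
    using assms by (intro smooth_config_add smooth_config_cmult) (simp_all add: sym_smooth_iff)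
  show "c * f Z + d * g Z = c * f W + d * g W" if "\<forall>i\<in>{1..k}. Z i = W i" for Z W
    using assms that unfolding sym_smooth_iff depends_on_def by metis
qed (use assms in \<open>simp add: sym_smooth_iff\<close>)

lemma subspace_sym_smooth: "subspace (sym_smooth k :: 'd::finite obs set)"
proof (rule subspaceI)
  have "(\<lambda>Z. 0) \<in> (sym_smooth k :: 'd obs set)"
    unfolding sym_smooth_iff by (simp add: depends_on_def smooth_config_const)
  then show "0 \<in> (sym_smooth k :: 'd obs set)" by (simp only: zero_fun_def)
next
  fix f g :: "'d obs" assume f: "f \<in> sym_smooth k" and g: "g \<in> sym_smooth k"
  have "f + g = (\<lambda>Z. 1 * f Z + 1 * g Z)" by (simp add: fun_eq_iff)
  then show "f + g \<in> sym_smooth k" using sym_smooth_lincomb[OF f g, of 1 1] by (simp only:)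
next
  fix f :: "'d obs" and c :: real assume f: "f \<in> sym_smooth k"
  have "c *\<^sub>R f = (\<lambda>Z. c * f Z + 0 * f Z)" by (simp add: fun_eq_iff scaleR_fun_def)
  then show "c *\<^sub>R f \<in> sym_smooth k" using sym_smooth_lincomb[OF f f, of c 0] by (simp only:)
qed

lemma seminorm_on_cn_norm:
  fixes K :: "'d::finite config set"
  assumes K: "compact K" "K \<noteq> {}"
  shows "seminorm_on (sym_smooth k) (cn_norm k n K)"
  unfolding seminorm_on_def
proof (intro conjI allI ballI)
  obtain Z where "Z \<in> K" using K(2) by blast
  then have "\<bar>iter_partial [] f Z\<bar> \<le> cn_norm k n K f" if "f \<in> sym_smooth k" for f :: "'d obs"
    using that by (intro cn_norm_upper sym_smooth_smooth K Nil_multi_indices) auto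
  then show nn: "0 \<le> cn_norm k n K f" if "f \<in> sym_smooth k" for f :: "'d obs"
    using that abs_ge_zero order_trans by blast
  fix f :: "'d obs" assume f: "f \<in> sym_smooth k"
  note upf = cn_norm_upper[OF sym_smooth_smooth[OF f] K(1)]
  { fix g :: "'d obs" assume g: "g \<in> sym_smooth k"
    show "cn_norm k n K (f + g) \<le> cn_norm k n K f + cn_norm k n K g"
    proof (rule cn_norm_least[OF K(2)])
      fix \<alpha> :: "(nat \<times> 'd phase) list" and Z assume *: "\<alpha> \<in> multi_indices k" "length \<alpha> \<le> n" "Z \<in> K"
      have "iter_partial \<alpha> (f + g) Z = iter_partial \<alpha> f Z + iter_partial \<alpha> g Z"
        using iter_partial_lincomb[OF sym_smooth_smooth[OF f] sym_smooth_smooth[OF g] multi_indices_subset[OF *(1)], of 1 1]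
        by (simp add: plus_fun_def)
      then show "\<bar>iter_partial \<alpha> (f + g) Z\<bar> \<le> cn_norm k n K f + cn_norm k n K g"
        using upf[OF *] cn_norm_upper[OF sym_smooth_smooth[OF g] K(1) *] by linarith
    qed }
  fix c :: real
  have cf: "c *\<^sub>R f \<in> sym_smooth k" for c by (rule subspace_scale[OF subspace_sym_smooth f])
  have le: "cn_norm k n K (c *\<^sub>R f) \<le> \<bar>c\<bar> * cn_norm k n K f" if f: "f \<in> sym_smooth k"
    for c and f :: "'d obs"
  proof (rule cn_norm_least[OF K(2)])
    fix \<alpha> :: "(nat \<times> 'd phase) list" and Z assume *: "\<alpha> \<in> multi_indices k" "length \<alpha> \<le> n" "Z \<in> K"
    have "iter_partial \<alpha> (c *\<^sub>R f) Z = c * iter_partial \<alpha> f Z"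
      using iter_partial_cmult[OF sym_smooth_smooth[OF f] multi_indices_subset[OF *(1)], of c]
      by (simp add: scaleR_fun_def)
    then show "\<bar>iter_partial \<alpha> (c *\<^sub>R f) Z\<bar> \<le> \<bar>c\<bar> * cn_norm k n K f"
      using cn_norm_upper[OF sym_smooth_smooth[OF f] K(1) *] by (simp add: abs_mult mult_left_mono)
  qed
  show "cn_norm k n K (c *\<^sub>R f) = \<bar>c\<bar> * cn_norm k n K f"
  proof (cases "c = 0")
    case True
    then show ?thesis using le[OF f, of 0] nn[OF cf[of 0]] by simp
  next
    case False
    \<comment> \<open>The reverse inequality of homogeneity is the inequality \<open>le\<close> for
      the inverse scalar.\<close>
    have "cn_norm k n K ((1 / c) *\<^sub>R (c *\<^sub>R f)) \<le> \<bar>1 / c\<bar> * cn_norm k n K (c *\<^sub>R f)"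
      by (rule le[OF cf])
    then have "\<bar>c\<bar> * cn_norm k n K f \<le> cn_norm k n K (c *\<^sub>R f)"
      using False by (simp add: field_simps)
    then show ?thesis using le[OF f, of c] by linarith
  qed
qed

definition cn_norms :: "nat \<Rightarrow> ('d::finite obs \<Rightarrow> real) set" where
  "cn_norms k = {cn_norm k n K | K n. compact K \<and> K \<noteq> {}}"

interpretation sym: seminormed_space "sym_smooth k" "cn_norms k" for k
proof
  show "subspace (sym_smooth k)" by (rule subspace_sym_smooth)
  have "cn_norm k 0 {\<lambda>i. 0} \<in> cn_norms k"
    unfolding cn_norms_def by (intro CollectI exI[of _ "{\<lambda>i. 0}"] exI[of _ 0]) simp
  then show "cn_norms k \<noteq> {}" by (metis empty_iff)
  show "seminorm_on (sym_smooth k) p" if p: "p \<in> cn_norms k" for p :: "'a obs \<Rightarrow> real"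
  proof -
    obtain K n where "p = cn_norm k n K" "compact K" "K \<noteq> {}"
      using p unfolding cn_norms_def mem_Collect_eq by (elim exE conjE)
    then show ?thesis using seminorm_on_cn_norm by metis
  qed
qed

lemma sym_smooth_top_cn: "sym_smooth_top k = seminorm_topology (sym_smooth k) (cn_norms k)"
  by (simp add: sym_smooth_top_eq cn_norms_def)

text \<open>All entries are bounded, also those beyond k, since only then is the set compact in the
  product topology. Functions of k points do not notice: \<open>cn_bound_box\<close> replaces the
  later entries by 0.\<close>

definition config_box :: "nat \<Rightarrow> 'd::finite config set" where
  "config_box N = {Z. \<forall>i. norm (Z i) \<le> real N}"

lemma compact_box: "compact (config_box N :: 'd::finite config set)"
proof -
  have "compactin (product_topology (\<lambda>i. euclidean) UNIV) (Pi\<^sub>E UNIV (\<lambda>i::nat. cball (0 :: 'd phase) (real N)))"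
    by (simp add: compactin_PiE)
  then have "compact (Pi\<^sub>E UNIV (\<lambda>i::nat. cball (0 :: 'd phase) (real N)))"
    by (simp add: euclidean_product_topology)
  moreover have "config_box N = Pi\<^sub>E UNIV (\<lambda>i::nat. cball (0 :: 'd phase) (real N))"
    by (auto simp: config_box_def PiE_def)
  ultimately show ?thesis by simp
qed

lemma box_norm: "cn_norm k N (config_box N) \<in> cn_norms k"
proof -
  have "(\<lambda>i. 0) \<in> config_box N" by (simp add: config_box_def)
  then have "config_box N \<noteq> {}" by (metis empty_iff)
  then show ?thesis
    unfolding cn_norms_def by (intro CollectI exI[of _ "config_box N"] exI[of _ N] conjI compact_box refl)
qed

lemma cn_bound_box:
  assumes f: "f \<in> sym_smooth k"
  shows "cn_bound k N f M \<longleftrightarrow> cn_norm k N (config_box N) f \<le> M"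
proof
  assume b: "cn_bound k N f M"
  have "(\<lambda>i. 0) \<in> config_box N" by (simp add: config_box_def)
  then have "config_box N \<noteq> {}" by (metis empty_iff)
  then show "cn_norm k N (config_box N) f \<le> M"
    by (rule cn_norm_least) (use b in \<open>simp add: cn_bound_def config_box_def\<close>)
next
  assume le: "cn_norm k N (config_box N) f \<le> M"
  show "cn_bound k N f M"
    unfolding cn_bound_def
  proof (intro ballI allI impI)
    fix \<alpha> :: "(nat \<times> 'a phase) list" and Z :: "'a config"
    assume *: "\<alpha> \<in> multi_indices k" "length \<alpha> \<le> N" "\<forall>i\<in>{1..k}. norm (Z i) \<le> real N"
    define W where "W i = (if i \<in> {1..k} then Z i else 0)" for i
    have "iter_partial \<alpha> f Z = iter_partial \<alpha> f W"
      by (rule depends_onD[OF depends_on_iter_partial[OF sym_smooth_depends[OF f]]]) (simp add: W_def)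
    moreover have "W \<in> config_box N" using *(3) by (simp add: config_box_def W_def)
    then have "\<bar>iter_partial \<alpha> f W\<bar> \<le> cn_norm k N (config_box N) f"
      by (rule cn_norm_upper[OF sym_smooth_smooth[OF f] compact_box *(1,2)])
    ultimately show "\<bar>iter_partial \<alpha> f Z\<bar> \<le> M" using le by simp
  qed
qed

text \<open>Each coordinate projection of a compact K is bounded, and only the k relevant
  coordinates count. The N chosen dominates their radii as well as the order n.\<close>

lemma cn_norms_le_cn_bound:
  fixes p :: "'d::finite obs \<Rightarrow> real"
  assumes "p \<in> cn_norms k"
  shows "\<exists>N. \<forall>f M. cn_bound k N f M \<longrightarrow> p f \<le> M"
proof -
  obtain K n where p: "p = cn_norm k n K" "compact K" "K \<noteq> {}" using assms by (auto simp: cn_norms_def)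
  have "\<exists>r. \<forall>Z\<in>K. norm (Z i) \<le> r" for i
  proof -
    have "continuous_on K (\<lambda>Z. Z i)"
      by (rule continuous_on_subset[OF continuous_on_product_coordinates]) simp
    then have "bounded ((\<lambda>Z. Z i) ` K)" using p(2) by (intro compact_imp_bounded compact_continuous_image)
    then show ?thesis by (auto simp: bounded_iff)
  qed
  then have "\<forall>i. \<exists>r. \<forall>Z\<in>K. norm (Z i) \<le> r" by simp
  from choice[OF this] obtain r where "\<forall>i. \<forall>Z\<in>K. norm (Z i) \<le> r i" by (elim exE)
  then have r: "\<And>i Z. Z \<in> K \<Longrightarrow> norm (Z i) \<le> r i" by simp
  define N where "N = max n (nat \<lceil>\<Sum>i\<in>{1..k}. \<bar>r i\<bar>\<rceil>)"
  have rN: "norm (Z i) \<le> real N" if "Z \<in> K" "i \<in> {1..k}" for Z i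
  proof -
    have "norm (Z i) \<le> \<bar>r i\<bar>" using r[OF that(1), of i] by linarith
    also have "\<dots> \<le> (\<Sum>i\<in>{1..k}. \<bar>r i\<bar>)" using that(2) by (intro member_le_sum) auto
    also have "\<dots> \<le> real N" unfolding N_def by linarith
    finally show ?thesis .
  qed
  have "p f \<le> M" if "cn_bound k N f M" for f M
    unfolding p(1) using that rN by (intro cn_norm_least[OF p(3)]) (auto simp: cn_bound_def N_def)
  then show ?thesis by blast
qed

lemma dual_lincomb:
  assumes "\<gamma> \<in> tvs_dual (sym_smooth_top k)" "f \<in> sym_smooth k" "g \<in> sym_smooth k"
  shows "\<gamma> (\<lambda>Z. c * f Z + d * g Z) = c * \<gamma> f + d * \<gamma> g"
proof -
  have "c *\<^sub>R f \<in> sym_smooth k" "d *\<^sub>R g \<in> sym_smooth k"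
    using assms(2,3) by (auto intro: subspace_scale[OF subspace_sym_smooth])
  then have "\<gamma> (c *\<^sub>R f + d *\<^sub>R g) = c * \<gamma> f + d * \<gamma> g"
    using assms by (simp add: tvs_dual_def topspace_sym_smooth_top)
  moreover have "c *\<^sub>R f + d *\<^sub>R g = (\<lambda>Z. c * f Z + d * g Z)" by (simp add: fun_eq_iff scaleR_fun_def)
  ultimately show ?thesis by simp
qed

lemma dual_zero: "\<gamma> \<in> tvs_dual (sym_smooth_top k) \<Longrightarrow> \<gamma> (\<lambda>Z. 0) = 0"
  using dual_lincomb[of \<gamma> k "\<lambda>Z. 0" "\<lambda>Z. 0" 0 0] subspace_0[OF subspace_sym_smooth[of k]]
  by (simp add: zero_fun_def)

text \<open>The bounds \<open>cn_bound\<close> are directed: the finitely many seminorms that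
  control \<gamma> are all dominated at one N, the sum of the individual ones.\<close>

lemma dual_cn_bound:
  assumes "\<gamma> \<in> tvs_dual (sym_smooth_top k)"
  shows "\<exists>N C. C \<ge> 0 \<and> (\<forall>f\<in>sym_smooth k. \<forall>M\<ge>0. cn_bound k N f M \<longrightarrow> \<bar>\<gamma> f\<bar> \<le> C * M)"
proof -
  obtain F C where F: "finite F" "F \<subseteq> cn_norms k" and C: "C \<ge> 0"
    "\<forall>x\<in>sym_smooth k. \<forall>M\<ge>0. (\<forall>p\<in>F. p x \<le> M) \<longrightarrow> \<bar>\<gamma> x\<bar> \<le> C * M"
    using sym.dual_bound[OF assms[unfolded sym_smooth_top_cn]] by (elim exE conjE)
  have "\<forall>p\<in>F. \<exists>N. \<forall>f M. cn_bound k N f M \<longrightarrow> p f \<le> M"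
    using F(2) cn_norms_le_cn_bound by blast
  from bchoice[OF this] obtain n where n: "\<forall>p\<in>F. \<forall>f M. cn_bound k (n p) f M \<longrightarrow> p f \<le> M"
    by (elim exE)
  have nle: "n p \<le> (\<Sum>p\<in>F. n p)" if "p \<in> F" for p using F(1) that by (intro member_le_sum) auto
  have "\<bar>\<gamma> f\<bar> \<le> C * M" if f: "f \<in> sym_smooth k" "M \<ge> 0" "cn_bound k (\<Sum>p\<in>F. n p) f M" for f M
  proof (rule C(2)[rule_format, OF f(1,2)])
    fix p assume p: "p \<in> F"
    have "cn_bound k (n p) f M" by (rule cn_bound_mono[OF f(3) nle[OF p] order_refl])
    then show "p f \<le> M" using n p by simp
  qed
  then show ?thesis using C(1) by (intro exI[of _ "\<Sum>p\<in>F. n p"] exI[of _ C]) simp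
qed

lemma dual_cn_boundI:
  fixes \<phi> :: "'d::finite obs \<Rightarrow> real"
  assumes add: "\<And>f g. f \<in> sym_smooth k \<Longrightarrow> g \<in> sym_smooth k \<Longrightarrow> \<phi> (f + g) = \<phi> f + \<phi> g"
    and sc: "\<And>c f. f \<in> sym_smooth k \<Longrightarrow> \<phi> (c *\<^sub>R f) = c * \<phi> f"
    and off: "\<And>f. f \<notin> sym_smooth k \<Longrightarrow> \<phi> f = 0"
    and C: "\<And>f M. f \<in> sym_smooth k \<Longrightarrow> M \<ge> 0 \<Longrightarrow> cn_bound k N f M \<Longrightarrow> \<bar>\<phi> f\<bar> \<le> C * M"
  shows "\<phi> \<in> tvs_dual (sym_smooth_top k)"
  unfolding sym_smooth_top_cn
proof (rule sym.dualI[OF add sc off box_norm])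
  fix f :: "'d obs" assume f: "f \<in> sym_smooth k"
  show "\<bar>\<phi> f\<bar> \<le> C * cn_norm k N (config_box N) f"
    by (rule C[OF f sym.nonneg[OF box_norm f]]) (simp add: cn_bound_box[OF f])
qed auto

lemma tvs_bounded_sym_smooth_iff:
  fixes B :: "'d::finite obs set"
  shows "tvs_bounded (sym_smooth_top k) B \<longleftrightarrow> B \<subseteq> sym_smooth k \<and> (\<forall>N. \<exists>M. \<forall>f\<in>B. cn_bound k N f M)"
  unfolding sym_smooth_top_cn sym.bounded_iff
proof (intro conj_cong refl iffI allI ballI)
  fix N assume B: "B \<subseteq> sym_smooth k" "\<forall>p\<in>cn_norms k. \<exists>M. \<forall>x\<in>B. p x \<le> M"
  obtain M where "\<forall>x\<in>B. cn_norm k N (config_box N) x \<le> M" using bspec[OF B(2) box_norm[of k N]] by blast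
  then show "\<exists>M. \<forall>f\<in>B. cn_bound k N f M" using B(1) cn_bound_box by blast
next
  fix p :: "'d obs \<Rightarrow> real" assume B: "\<forall>N. \<exists>M. \<forall>f\<in>B. cn_bound k N f M" and p: "p \<in> cn_norms k"
  obtain N where N: "\<forall>f M. cn_bound k N f M \<longrightarrow> p f \<le> M" using cn_norms_le_cn_bound[OF p] by blast
  obtain M where "\<forall>f\<in>B. cn_bound k N f M" using B by blast
  then show "\<exists>M. \<forall>x\<in>B. p x \<le> M" using N by blast
qed

declare split_paired_All [simp del] split_paired_Ex [simp del] One_nat_def [simp del]

text \<open>Handles both signs of t at once. With D the derivative at 0 it gives convergence of
  difference quotients at a rate fixed by the oscillation of the derivative; with D = 0 it is the
  estimate along a segment in the density proof.\<close>

lemma mvt_bound: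
  fixes \<phi> :: "real \<Rightarrow> real"
  assumes der: "\<And>s. \<bar>s\<bar> \<le> \<bar>t\<bar> \<Longrightarrow> (\<phi> has_real_derivative \<phi>' s) (at s)"
    and bd: "\<And>s. \<bar>s\<bar> \<le> \<bar>t\<bar> \<Longrightarrow> \<bar>\<phi>' s - D\<bar> \<le> e"
  shows "\<bar>\<phi> t - \<phi> 0 - t * D\<bar> \<le> e * \<bar>t\<bar>"
proof -
  have "\<exists>s. \<bar>s\<bar> \<le> \<bar>t\<bar> \<and> \<phi> t - \<phi> 0 = t * \<phi>' s"
  proof (cases "t = 0")
    case True
    then show ?thesis by (intro exI[of _ 0]) simp
  next
    case nz: False
    show ?thesis
    proof (cases "t > 0")
      case True
      have "\<exists>z>0. z < t \<and> \<phi> t - \<phi> 0 = (t - 0) * \<phi>' z"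
        by (rule MVT2[OF True]) (use der True in auto)
      then obtain z where "z > 0" "z < t" "\<phi> t - \<phi> 0 = (t - 0) * \<phi>' z" by (elim exE conjE)
      then show ?thesis using True by (intro exI[of _ z]) auto
    next
      case False
      then have t: "t < 0" using nz by simp
      have "\<exists>z>t. z < 0 \<and> \<phi> 0 - \<phi> t = (0 - t) * \<phi>' z"
        by (rule MVT2[OF t]) (use der t in auto)
      then obtain z where "z > t" "z < 0" "\<phi> 0 - \<phi> t = (0 - t) * \<phi>' z" by (elim exE conjE)
      then show ?thesis using t by (intro exI[of _ z]) auto
    qed
  qed
  then obtain s where s: "\<bar>s\<bar> \<le> \<bar>t\<bar>" "\<phi> t - \<phi> 0 = t * \<phi>' s" by (elim exE conjE)
  have "\<phi> t - \<phi> 0 - t * D = (\<phi>' s - D) * t" using s(2) by (simp add: algebra_simps)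
  then have "\<bar>\<phi> t - \<phi> 0 - t * D\<bar> = \<bar>\<phi>' s - D\<bar> * \<bar>t\<bar>" by (simp only: abs_mult)
  also have "\<dots> \<le> e * \<bar>t\<bar>" by (intro mult_right_mono bd[OF s(1)]) simp
  finally show ?thesis .
qed

section \<open>Distributions acting in one variable\<close>

abbreviation dual1 :: "('d::finite obs \<Rightarrow> real) set" where
  "dual1 \<equiv> tvs_dual (sym_smooth_top 1)"

abbreviation to_slot :: "nat \<Rightarrow> (nat \<times> 'd::finite phase) list \<Rightarrow> (nat \<times> 'd phase) list" where
  "to_slot i \<alpha> \<equiv> map (\<lambda>a. (i, snd a)) \<alpha>"

lemma to_slot_lists: "\<alpha> \<in> multi_indices k \<Longrightarrow> to_slot i \<alpha> \<in> lists ({i} \<times> Basis)"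
  unfolding multi_indices_def by (induction \<alpha>) auto

lemma lists_subset: "\<alpha> \<in> lists (I \<times> Basis) \<Longrightarrow> \<alpha> \<in> lists (UNIV \<times> Basis)"
  by auto

lemma dual1_bound:
  assumes "\<gamma> \<in> dual1"
  shows "\<exists>N C. C \<ge> 0 \<and> (\<forall>u\<in>sym_smooth 1. \<forall>M\<ge>0.
    (\<forall>\<alpha>\<in>multi_indices 1. length \<alpha> \<le> N \<longrightarrow> (\<forall>W. norm (W 1) \<le> real N \<longrightarrow> \<bar>iter_partial \<alpha> u W\<bar> \<le> M)) \<longrightarrow>
    \<bar>\<gamma> u\<bar> \<le> C * M)"
  using dual_cn_bound[OF assms] by (simp add: cn_bound_def)

text \<open>A tube lemma: continuity in the parameter x is uniform over the compact ball in which
  the entry of slot i moves. The parameter space is general so that it can be the configuration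
  itself or the real parameter of a shift.\<close>

lemma uniform_in_slot:
  fixes p :: "'x::topological_space \<Rightarrow> 'd::finite config" and g :: "'d obs"
  assumes g: "continuous_on UNIV g" and p: "\<And>j. continuous_on UNIV (\<lambda>x. p x j)" and e: "e > 0"
  shows "\<forall>\<^sub>F x in nhds x0. \<forall>w. norm w \<le> r \<longrightarrow> \<bar>g ((p x)(i := w)) - g ((p x0)(i := w))\<bar> \<le> e"
proof -
  have "continuous_on (UNIV \<times> cball 0 r) (\<lambda>xw. g ((p (fst xw))(i := snd xw)))"
  proof (rule continuous_config_compose[OF g])
    show "continuous_on (UNIV \<times> cball 0 r) (\<lambda>xw. ((p (fst xw))(i := snd xw)) j)" for j
    proof (cases "j = i")
      case False
      have "continuous_on (UNIV \<times> cball 0 r) (\<lambda>xw::'x \<times> 'd phase. p (fst xw) j)"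
        by (rule continuous_on_compose2[OF p]) (auto intro!: continuous_intros)
      then show ?thesis using False by simp
    qed (auto intro!: continuous_intros)
  qed
  from continuous_on_prod_compactE[OF this compact_cball UNIV_I e, of x0]
  obtain X0 where X0: "x0 \<in> X0" "open X0"
    "\<forall>x\<in>X0 \<inter> UNIV. \<forall>t\<in>cball 0 r. dist (g ((p (fst (x, t)))(i := snd (x, t)))) (g ((p (fst (x0, t)))(i := snd (x0, t)))) \<le> e"
    by metis
  have "\<forall>x\<in>X0. \<forall>w. norm w \<le> r \<longrightarrow> \<bar>g ((p x)(i := w)) - g ((p x0)(i := w))\<bar> \<le> e"
    using X0(3) by (simp add: dist_real_def)
  then show ?thesis unfolding eventually_nhds using X0(1,2) by (intro exI[of _ X0]) simp
qed

lemma uniform_in_slot_derivs: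
  fixes p :: "'x::topological_space \<Rightarrow> 'd::finite config"
  assumes g: "smooth_config g" and p: "\<And>j. continuous_on UNIV (\<lambda>x. p x j)" and e: "e > 0"
  shows "\<forall>\<^sub>F x in nhds x0. \<forall>\<alpha>\<in>{\<alpha> \<in> multi_indices 1. length \<alpha> \<le> N}. \<forall>w. norm w \<le> r \<longrightarrow>
    \<bar>iter_partial (to_slot i \<alpha>) g ((p x)(i := w)) - iter_partial (to_slot i \<alpha>) g ((p x0)(i := w))\<bar> \<le> e"
proof (rule eventually_ball_finite[OF finite_multi_indices], intro ballI)
  fix \<alpha> :: "(nat \<times> 'd phase) list" assume "\<alpha> \<in> {\<alpha> \<in> multi_indices 1. length \<alpha> \<le> N}"
  then have "to_slot i \<alpha> \<in> lists ({i} \<times> Basis)" by (intro to_slot_lists[of _ 1]) simp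
  then have "continuous_on UNIV (iter_partial (to_slot i \<alpha>) g)"
    by (intro smooth_config_continuous smooth_config_iter_partial[OF g] lists_subset)
  then show "\<forall>\<^sub>F x in nhds x0. \<forall>w. norm w \<le> r \<longrightarrow>
    \<bar>iter_partial (to_slot i \<alpha>) g ((p x)(i := w)) - iter_partial (to_slot i \<alpha>) g ((p x0)(i := w))\<bar> \<le> e"
    by (rule uniform_in_slot[OF _ p e])
qed

lemma iter_partial_slice_at:
  assumes "\<alpha> \<in> multi_indices 1"
  shows "iter_partial \<alpha> (slice i h Z) W = iter_partial (to_slot i \<alpha>) h (Z(i := W 1))"
  by (subst iter_partial_slice[OF assms]) (simp add: slice_def)

text \<open>A distribution is controlled by finitely many derivatives on a ball of the slot on which
  it acts, and these vary uniformly there as the other variables move. So the slices converge in the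
  seminorm that bounds \<gamma>.\<close>

lemma apply_at_continuous:
  fixes h :: "'d::finite obs"
  assumes \<gamma>: "\<gamma> \<in> dual1" and h: "smooth_config h"
  shows "continuous_on UNIV (apply_at \<gamma> i h)"
proof (rule continuous_at_imp_continuous_on, intro ballI)
  fix Z0 :: "'d config"
  obtain N C where C: "C \<ge> 0" "\<forall>u\<in>sym_smooth 1. \<forall>M\<ge>0.
    (\<forall>\<alpha>\<in>multi_indices 1. length \<alpha> \<le> N \<longrightarrow> (\<forall>W. norm (W 1) \<le> real N \<longrightarrow> \<bar>iter_partial \<alpha> u W\<bar> \<le> M)) \<longrightarrow>
    \<bar>\<gamma> u\<bar> \<le> C * M"
    using dual1_bound[OF \<gamma>] by (elim exE conjE)
  note C2 = C(2)[THEN bspec, THEN spec, THEN mp, THEN mp]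
  show "isCont (apply_at \<gamma> i h) Z0"
    unfolding isCont_def
  proof (rule tendstoI)
    fix e :: real assume e: "e > 0"
    define e' where "e' = e / (C + 1)"
    have e': "e' > 0" using e C(1) by (simp add: e'_def)
    have "\<forall>\<^sub>F Z in nhds Z0. \<forall>\<alpha>\<in>{\<alpha> \<in> multi_indices 1. length \<alpha> \<le> N}. \<forall>w. norm w \<le> real N \<longrightarrow>
      \<bar>iter_partial (to_slot i \<alpha>) h (Z(i := w)) - iter_partial (to_slot i \<alpha>) h (Z0(i := w))\<bar> \<le> e'"
      by (rule uniform_in_slot_derivs[OF h _ e']) (rule continuous_on_product_coordinates)
    then have "\<forall>\<^sub>F Z in nhds Z0. dist (apply_at \<gamma> i h Z) (apply_at \<gamma> i h Z0) < e"
    proof eventually_elim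
      case (elim Z)
      let ?u = "\<lambda>W. 1 * slice i h Z W + (- 1) * slice i h Z0 W"
      note sl = slice_in_sym_smooth[OF h]
      have "\<bar>\<gamma> ?u\<bar> \<le> C * e'"
      proof (rule C2[OF sym_smooth_lincomb[OF sl sl]])
        show "\<forall>\<alpha>\<in>multi_indices 1. length \<alpha> \<le> N \<longrightarrow> (\<forall>W. norm (W 1) \<le> real N \<longrightarrow> \<bar>iter_partial \<alpha> ?u W\<bar> \<le> e')"
        proof (intro ballI allI impI)
          fix \<alpha> :: "(nat \<times> 'd phase) list" and W :: "'d config"
          assume *: "\<alpha> \<in> multi_indices 1" "length \<alpha> \<le> N" "norm (W 1) \<le> real N"
          have "iter_partial \<alpha> ?u W = iter_partial \<alpha> (slice i h Z) W - iter_partial \<alpha> (slice i h Z0) W"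
            by (subst iter_partial_lincomb[OF sym_smooth_smooth[OF sl] sym_smooth_smooth[OF sl] multi_indices_subset[OF *(1)]]) simp
          then show "\<bar>iter_partial \<alpha> ?u W\<bar> \<le> e'"
            using elim * by (simp add: iter_partial_slice_at)
        qed
      qed (use e' in simp)
      moreover have "\<gamma> ?u = apply_at \<gamma> i h Z - apply_at \<gamma> i h Z0"
        by (subst dual_lincomb[OF \<gamma> sl sl]) (simp add: apply_at_slice)
      moreover have "C * e' < e" using e C(1) by (simp add: e'_def field_simps)
      ultimately show ?case by (simp add: dist_real_def)
    qed
    then show "\<forall>\<^sub>F Z in at Z0. dist (apply_at \<gamma> i h Z) (apply_at \<gamma> i h Z0) < e"
      by (rule filter_leD[OF at_within_le_nhds])
  qed
qed

lemma shift_fun_upd: "fst a \<noteq> i \<Longrightarrow> (shift a s Z)(i := w) = shift a s (Z(i := w))"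
  by (simp add: shift_def fun_upd_twist)

text \<open>Differentiation under the distribution: difference quotients of slices converge to the
  slice of the derivative in the seminorm bounding \<gamma>, because \<open>mvt_bound\<close>
  applies to every derivative in slot i with the same error.\<close>

lemma apply_at_has_partial:
  fixes h :: "'d::finite obs"
  assumes \<gamma>: "\<gamma> \<in> dual1" and h: "smooth_config h" and a: "snd a \<in> Basis" "fst a \<noteq> i"
  shows "has_partial (apply_at \<gamma> i h) a (apply_at \<gamma> i (partial_deriv a h))"
  unfolding has_partial_def DERIV_def
proof (rule allI, rule tendstoI)
  fix Z :: "'d config" and e :: real assume e: "e > 0"
  obtain N C where C: "C \<ge> 0" "\<forall>u\<in>sym_smooth 1. \<forall>M\<ge>0.
    (\<forall>\<alpha>\<in>multi_indices 1. length \<alpha> \<le> N \<longrightarrow> (\<forall>W. norm (W 1) \<le> real N \<longrightarrow> \<bar>iter_partial \<alpha> u W\<bar> \<le> M)) \<longrightarrow>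
    \<bar>\<gamma> u\<bar> \<le> C * M"
    using dual1_bound[OF \<gamma>] by (elim exE conjE)
  note C2 = C(2)[THEN bspec, THEN spec, THEN mp, THEN mp]
  define e' where "e' = e / (C + 1)"
  have e': "e' > 0" using e C(1) by (simp add: e'_def)
  have ph: "smooth_config (partial_deriv a h)" by (rule smooth_config_partial_deriv[OF h a(1)])
  have "\<forall>\<^sub>F s in nhds 0. \<forall>\<alpha>\<in>{\<alpha> \<in> multi_indices 1. length \<alpha> \<le> N}. \<forall>w. norm w \<le> real N \<longrightarrow>
    \<bar>iter_partial (to_slot i \<alpha>) (partial_deriv a h) ((shift a s Z)(i := w))
      - iter_partial (to_slot i \<alpha>) (partial_deriv a h) ((shift a 0 Z)(i := w))\<bar> \<le> e'"
    by (rule uniform_in_slot_derivs[OF ph _ e']) (intro continuous_on_shift continuous_intros)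
  then obtain d where d: "d > 0" and near: "\<And>s \<alpha> w. \<bar>s\<bar> < d \<Longrightarrow> \<alpha> \<in> multi_indices 1 \<Longrightarrow> length \<alpha> \<le> N \<Longrightarrow>
    norm w \<le> real N \<Longrightarrow> \<bar>iter_partial (to_slot i \<alpha>) (partial_deriv a h) ((shift a s Z)(i := w))
      - iter_partial (to_slot i \<alpha>) (partial_deriv a h) (Z(i := w))\<bar> \<le> e'"
    unfolding eventually_nhds_metric by (elim exE conjE) (simp add: dist_real_def)
  have "dist ((apply_at \<gamma> i h (shift a (0 + t) Z) - apply_at \<gamma> i h (shift a 0 Z)) / t)
      (apply_at \<gamma> i (partial_deriv a h) Z) < e" if t: "t \<noteq> 0" "\<bar>t\<bar> < d" for t
  proof -
    note sl = slice_in_sym_smooth[OF h] and slp = slice_in_sym_smooth[OF ph]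
    \<comment> \<open>\<open>?q\<close> is the difference quotient and \<open>?u\<close> its
      distance to the expected derivative. The form as linear combinations is the one to which
      \<open>dual_lincomb\<close> and \<open>iter_partial_lincomb\<close> apply.\<close>
    let ?q = "\<lambda>W. (1 / t) * slice i h (shift a t Z) W + (- (1 / t)) * slice i h Z W"
    let ?u = "\<lambda>W. 1 * ?q W + (- 1) * slice i (partial_deriv a h) Z W"
    have q: "?q \<in> sym_smooth 1" by (rule sym_smooth_lincomb[OF sl sl])
    have "\<bar>\<gamma> ?u\<bar> \<le> C * e'"
    proof (rule C2[OF sym_smooth_lincomb[OF q slp]])
      show "\<forall>\<alpha>\<in>multi_indices 1. length \<alpha> \<le> N \<longrightarrow> (\<forall>W. norm (W 1) \<le> real N \<longrightarrow> \<bar>iter_partial \<alpha> ?u W\<bar> \<le> e')"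
      proof (intro ballI allI impI)
        fix \<alpha> :: "(nat \<times> 'd phase) list" and W :: "'d config"
        assume *: "\<alpha> \<in> multi_indices 1" "length \<alpha> \<le> N" "norm (W 1) \<le> real N"
        note \<alpha> = multi_indices_subset[OF *(1)]
        have \<alpha>': "to_slot i \<alpha> \<in> lists (UNIV \<times> Basis)" by (rule lists_subset[OF to_slot_lists[OF *(1)]])
        let ?g = "iter_partial (to_slot i \<alpha>) h" and ?Z = "Z(i := W 1)"
        have g: "smooth_config ?g" by (rule smooth_config_iter_partial[OF h \<alpha>'])
        have pg: "iter_partial (to_slot i \<alpha>) (partial_deriv a h) = partial_deriv a ?g"
          by (rule iter_partial_partial_deriv[OF h \<alpha>' a(1)])
        have "iter_partial \<alpha> ?u W = (?g (shift a t ?Z) - ?g ?Z) / t - partial_deriv a ?g ?Z"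
          apply (subst iter_partial_lincomb[OF sym_smooth_smooth[OF q] sym_smooth_smooth[OF slp] \<alpha>])
          apply (subst iter_partial_lincomb[OF sym_smooth_smooth[OF sl] sym_smooth_smooth[OF sl] \<alpha>])
          apply (simp add: iter_partial_slice_at[OF *(1)] shift_fun_upd[OF a(2)] pg diff_divide_distrib)
          done
        moreover have "\<bar>?g (shift a t ?Z) - ?g (shift a 0 ?Z) - t * partial_deriv a ?g ?Z\<bar> \<le> e' * \<bar>t\<bar>"
        proof (rule mvt_bound)
          fix s assume s: "\<bar>s\<bar> \<le> \<bar>t\<bar>"
          show "((\<lambda>s. ?g (shift a s ?Z)) has_real_derivative partial_deriv a ?g (shift a s ?Z)) (at s)"
            by (rule has_partial_at[OF smooth_config_has_partial[OF g a(1)]])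
          show "\<bar>partial_deriv a ?g (shift a s ?Z) - partial_deriv a ?g ?Z\<bar> \<le> e'"
            using near[of s \<alpha> "W 1"] s t(2) * by (simp add: pg shift_fun_upd[OF a(2)])
        qed
        moreover have "(?g (shift a t ?Z) - ?g ?Z) / t - partial_deriv a ?g ?Z
            = (?g (shift a t ?Z) - ?g ?Z - t * partial_deriv a ?g ?Z) / t"
          using t(1) by (simp add: diff_divide_distrib)
        ultimately show "\<bar>iter_partial \<alpha> ?u W\<bar> \<le> e'"
          using t(1) by (simp add: pos_divide_le_eq)
      qed
    qed (use e' in simp)
    moreover have "\<gamma> ?u = (apply_at \<gamma> i h (shift a t Z) - apply_at \<gamma> i h Z) / t - apply_at \<gamma> i (partial_deriv a h) Z"
      apply (subst dual_lincomb[OF \<gamma> q slp])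
      apply (subst dual_lincomb[OF \<gamma> sl sl])
      apply (simp add: apply_at_slice diff_divide_distrib)
      done
    moreover have "C * e' < e" using e C(1) by (simp add: e'_def field_simps)
    ultimately show ?thesis by (simp add: dist_real_def)
  qed
  then show "\<forall>\<^sub>F t in at 0. dist ((apply_at \<gamma> i h (shift a (0 + t) Z) - apply_at \<gamma> i h (shift a 0 Z)) / t)
      (apply_at \<gamma> i (partial_deriv a h) Z) < e"
    unfolding eventually_at using d by (intro exI[of _ d]) (simp add: dist_real_def)
qed

lemma depends_on_apply_at:
  assumes "depends_on I h"
  shows "depends_on (I - {i}) (apply_at \<gamma> i h)"
  unfolding depends_on_def
proof (intro allI impI)
  fix Z W :: "'a config"
  assume "\<forall>j\<in>I - {i}. Z j = W j"
  then have "h (Z(i := w)) = h (W(i := w))" for w by (intro depends_onD[OF assms]) auto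
  then show "apply_at \<gamma> i h Z = apply_at \<gamma> i h W" by (simp add: apply_at_def)
qed

lemma depends_on_UNIV: "depends_on UNIV h"
  by (simp add: depends_on_def fun_eq_iff[symmetric])

lemma apply_at_zero: "\<gamma> \<in> dual1 \<Longrightarrow> apply_at \<gamma> i (\<lambda>Z. 0) = (\<lambda>Z. 0)"
  by (simp add: apply_at_def dual_zero)

text \<open>The functions \<open>apply_at \<gamma> i h\<close> with h smooth are closed under
  differentiation: in slot i the derivative is 0, which is \<open>apply_at\<close> of the zero
  function, and in the other slots it passes under \<gamma>.\<close>

lemma smooth_config_apply_at:
  fixes h :: "'d::finite obs"
  assumes \<gamma>: "\<gamma> \<in> dual1" and h: "smooth_config h"
  shows "smooth_config (apply_at \<gamma> i h)"
proof (rule smooth_configI[of "\<lambda>g. \<exists>h. smooth_config h \<and> g = apply_at \<gamma> i h"])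
  show "\<exists>h'. smooth_config h' \<and> apply_at \<gamma> i h = apply_at \<gamma> i h'" using h by (intro exI[of _ h]) simp
  fix g :: "'d obs" assume "\<exists>h. smooth_config h \<and> g = apply_at \<gamma> i h"
  then obtain h where h: "smooth_config h" and g: "g = apply_at \<gamma> i h" by (elim exE conjE)
  show "continuous_on UNIV g" unfolding g by (rule apply_at_continuous[OF \<gamma> h])
  fix a :: "nat \<times> 'd phase" assume a: "snd a \<in> Basis"
  show "\<exists>g'. (\<exists>h. smooth_config h \<and> g' = apply_at \<gamma> i h) \<and> has_partial g a g'"
  proof (cases "fst a = i")
    case True
    have "has_partial g a (\<lambda>Z. 0)"
      unfolding g by (rule has_partial_independent[OF depends_on_apply_at[OF depends_on_UNIV]]) (simp add: True)
    then show ?thesis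
      by (intro exI[of _ "\<lambda>Z. 0"] conjI) (simp_all add: apply_at_zero[OF \<gamma>] smooth_config_const exI[of _ "\<lambda>Z. 0"])
  next
    case False
    have "smooth_config (partial_deriv a h)" by (rule smooth_config_partial_deriv[OF h a])
    moreover have "has_partial g a (apply_at \<gamma> i (partial_deriv a h))"
      unfolding g by (rule apply_at_has_partial[OF \<gamma> h a False])
    ultimately show ?thesis
      by (intro exI[of _ "apply_at \<gamma> i (partial_deriv a h)"] conjI exI[of _ "partial_deriv a h"]) simp_all
  qed
qed

lemma partial_deriv_apply_at:
  "\<gamma> \<in> dual1 \<Longrightarrow> smooth_config h \<Longrightarrow> snd a \<in> Basis \<Longrightarrow> fst a \<noteq> i \<Longrightarrow>
    partial_deriv a (apply_at \<gamma> i h) = apply_at \<gamma> i (partial_deriv a h)"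
  by (rule partial_deriv_eq[OF apply_at_has_partial])

lemma iter_partial_apply_at:
  assumes \<gamma>: "\<gamma> \<in> dual1" and h: "smooth_config h" and \<alpha>: "\<alpha> \<in> lists (I \<times> Basis)" "i \<notin> I"
  shows "iter_partial \<alpha> (apply_at \<gamma> i h) = apply_at \<gamma> i (iter_partial \<alpha> h)"
  using \<alpha>(1)
proof (induction \<alpha>)
  case (Cons a \<alpha>)
  then have a: "fst a \<in> I" "snd a \<in> Basis" "\<alpha> \<in> lists (I \<times> Basis)" by auto
  have "partial_deriv a (apply_at \<gamma> i (iter_partial \<alpha> h)) = apply_at \<gamma> i (partial_deriv a (iter_partial \<alpha> h))"
    using a \<alpha>(2) by (intro partial_deriv_apply_at[OF \<gamma> smooth_config_iter_partial[OF h lists_subset]]) auto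
  then show ?case using Cons.IH a by simp
qed simp

lemma apply_at_lincomb:
  assumes \<gamma>: "\<gamma> \<in> dual1" and f: "smooth_config f" and g: "smooth_config g"
  shows "apply_at \<gamma> i (\<lambda>Z. c * f Z + d * g Z) = (\<lambda>Z. c * apply_at \<gamma> i f Z + d * apply_at \<gamma> i g Z)"
proof
  fix Z
  have "slice i (\<lambda>Z. c * f Z + d * g Z) Z = (\<lambda>W. c * slice i f Z W + d * slice i g Z W)"
    by (simp add: slice_def)
  then show "apply_at \<gamma> i (\<lambda>Z. c * f Z + d * g Z) Z = c * apply_at \<gamma> i f Z + d * apply_at \<gamma> i g Z"
    using dual_lincomb[OF \<gamma> slice_in_sym_smooth[OF f] slice_in_sym_smooth[OF g]] by (simp add: apply_at_slice)
qed

lemma apply_at_mult: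
  assumes \<gamma>: "\<gamma> \<in> dual1" and f: "depends_on I f" "i \<notin> I" and g: "smooth_config g"
  shows "apply_at \<gamma> i (\<lambda>Z. f Z * g Z) = (\<lambda>Z. f Z * apply_at \<gamma> i g Z)"
proof
  fix Z
  have "f (Z(i := w)) = f Z" for w using f(2) by (intro depends_onD[OF f(1)]) auto
  then have "slice i (\<lambda>Z. f Z * g Z) Z = (\<lambda>W. f Z * slice i g Z W + 0 * slice i g Z W)"
    by (simp add: slice_def)
  then show "apply_at \<gamma> i (\<lambda>Z. f Z * g Z) Z = f Z * apply_at \<gamma> i g Z"
    using dual_lincomb[OF \<gamma> slice_in_sym_smooth[OF g] slice_in_sym_smooth[OF g], of "f Z" i Z 0 i Z]
    by (simp add: apply_at_slice)
qed

lemma apply_at_bound: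
  fixes h :: "'d::finite obs"
  assumes \<gamma>: "\<gamma> \<in> dual1"
  shows "\<exists>N C. C \<ge> 0 \<and> (\<forall>h. \<forall>i. \<forall>Z. \<forall>M\<ge>0. smooth_config (h :: 'd obs) \<longrightarrow>
    (\<forall>\<alpha>\<in>lists ({i} \<times> Basis). length \<alpha> \<le> N \<longrightarrow> (\<forall>w. norm w \<le> real N \<longrightarrow> \<bar>iter_partial \<alpha> h (Z(i := w))\<bar> \<le> M)) \<longrightarrow>
    \<bar>apply_at \<gamma> i h Z\<bar> \<le> C * M)"
proof -
  obtain N C where C: "C \<ge> 0" "\<forall>u\<in>sym_smooth 1. \<forall>M\<ge>0.
    (\<forall>\<alpha>\<in>multi_indices 1. length \<alpha> \<le> N \<longrightarrow> (\<forall>W. norm (W 1) \<le> real N \<longrightarrow> \<bar>iter_partial \<alpha> u W\<bar> \<le> M)) \<longrightarrow>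
    \<bar>\<gamma> u\<bar> \<le> C * M"
    using dual1_bound[OF \<gamma>] by (elim exE conjE)
  note C2 = C(2)[THEN bspec, THEN spec, THEN mp, THEN mp]
  show ?thesis
  proof (rule exI[of _ N], rule exI[of _ C], intro conjI allI impI C(1))
    fix h :: "'d obs" and i Z and M :: real
    assume M: "0 \<le> M" and h: "smooth_config h"
      and bd: "\<forall>\<alpha>\<in>lists ({i} \<times> Basis). length \<alpha> \<le> N \<longrightarrow> (\<forall>w. norm w \<le> real N \<longrightarrow> \<bar>iter_partial \<alpha> h (Z(i := w))\<bar> \<le> M)"
    show "\<bar>apply_at \<gamma> i h Z\<bar> \<le> C * M"
      unfolding apply_at_slice
    proof (rule C2[OF slice_in_sym_smooth[OF h] M], intro ballI allI impI)
      fix \<alpha> :: "(nat \<times> 'd phase) list" and W :: "'d config"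
      assume *: "\<alpha> \<in> multi_indices 1" "length \<alpha> \<le> N" "norm (W 1) \<le> real N"
      show "\<bar>iter_partial \<alpha> (slice i h Z) W\<bar> \<le> M"
        unfolding iter_partial_slice_at[OF *(1)]
        using bd[rule_format, OF to_slot_lists[OF *(1)]] * by simp
    qed
  qed
qed

section \<open>Polynomials in the coordinates and their density\<close>

definition crd :: "nat \<times> 'd::finite phase \<Rightarrow> 'd obs" where
  "crd c Z = Z (fst c) \<bullet> snd c"

text \<open>For a basis direction this is the projection onto the hyperplane where coordinate c
  vanishes. Written as a shift, it obeys the rules for shifts.\<close>

definition proj :: "nat \<times> 'd::finite phase \<Rightarrow> 'd config \<Rightarrow> 'd config" where
  "proj c Z = shift c (- crd c Z) Z"

lemma crd_shift:
  assumes "snd a \<in> Basis" "snd c \<in> Basis"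
  shows "crd c (shift a t Z) = crd c Z + (if c = a then t else 0)"
proof (cases "fst a = fst c")
  case True
  then have "c = a \<longleftrightarrow> snd a = snd c" by (metis prod_eqI)
  then show ?thesis
    using True by (simp add: crd_def shift_def inner_add_left inner_Basis[OF assms])
next
  case False
  then show ?thesis by (auto simp: crd_def shift_def)
qed

lemma crd_proj:
  "snd a \<in> Basis \<Longrightarrow> snd c \<in> Basis \<Longrightarrow> crd c (proj a Z) = (if c = a then 0 else crd c Z)"
  by (simp add: proj_def crd_shift)

lemma proj_shift_same: "snd c \<in> Basis \<Longrightarrow> proj c (shift c t Z) = proj c Z"
  by (simp add: proj_def crd_shift shift_shift)

lemma proj_shift_other:
  "snd c \<in> Basis \<Longrightarrow> snd a \<in> Basis \<Longrightarrow> a \<noteq> c \<Longrightarrow> proj c (shift a t Z) = shift a t (proj c Z)"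
  by (simp add: proj_def crd_shift shift_commute[of c _ a])

lemma proj_proj: "snd c \<in> Basis \<Longrightarrow> proj c (proj c Z) = proj c Z"
  using proj_shift_same[of c "- crd c Z" Z] by (simp add: proj_def)

lemma shift_proj: "shift c (crd c Z) (proj c Z) = Z"
  by (simp add: proj_def shift_shift)

lemma continuous_on_crd: "continuous_on UNIV (crd c)"
  unfolding crd_def[abs_def] by (intro continuous_intros continuous_on_product_coordinates)

lemma has_partial_crd:
  assumes "snd a \<in> Basis" "snd c \<in> Basis"
  shows "has_partial (crd c) a (\<lambda>Z. if c = a then 1 else 0)"
  unfolding has_partial_def crd_shift[OF assms] by (auto intro!: derivative_eq_intros)

lemma smooth_config_crd:
  fixes c :: "nat \<times> 'd::finite phase"
  assumes c: "snd c \<in> Basis"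
  shows "smooth_config (crd c)"
proof (rule smooth_configI[of "\<lambda>g. g = crd c \<or> smooth_config g"])
  fix g :: "'d obs" assume g: "g = crd c \<or> smooth_config g"
  then show "continuous_on UNIV g" using continuous_on_crd smooth_config_continuous by metis
  fix a :: "nat \<times> 'd phase" assume a: "snd a \<in> Basis"
  show "\<exists>g'. (g' = crd c \<or> smooth_config g') \<and> has_partial g a g'"
  proof (cases "g = crd c")
    case True
    then show ?thesis
      using has_partial_crd[OF a c] by (intro exI[of _ "\<lambda>Z. if c = a then 1 else 0"]) (simp add: smooth_config_const)
  next
    case False
    then have "smooth_config g" using g by simp
    then show ?thesis
      using a by (intro exI[of _ "partial_deriv a g"]) (simp add: smooth_config_has_partial smooth_config_partial_deriv)
  qed
qed simp

lemma has_partial_proj: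
  assumes c: "snd c \<in> Basis" and a: "snd a \<in> Basis" and f: "has_partial f a f'"
  shows "has_partial (\<lambda>Z. f (proj c Z)) a (\<lambda>Z. if a = c then 0 else f' (proj c Z))"
proof (cases "a = c")
  case True
  then show ?thesis using c by (simp add: has_partial_def proj_shift_same)
next
  case False
  then show ?thesis using f by (simp add: has_partial_def proj_shift_other[OF c a False])
qed

lemma smooth_config_proj:
  fixes f :: "'d::finite obs"
  assumes f: "smooth_config f" and c: "snd c \<in> Basis"
  shows "smooth_config (\<lambda>Z. f (proj c Z))"
proof (rule smooth_configI[of "\<lambda>g. \<exists>f. smooth_config f \<and> g = (\<lambda>Z. f (proj c Z))"])
  show "\<exists>f'. smooth_config f' \<and> (\<lambda>Z. f (proj c Z)) = (\<lambda>Z. f' (proj c Z))"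
    using f by (intro exI[of _ f]) simp
  fix g :: "'d obs" assume "\<exists>f. smooth_config f \<and> g = (\<lambda>Z. f (proj c Z))"
  then obtain f where f: "smooth_config f" and g: "g = (\<lambda>Z. f (proj c Z))" by (elim exE conjE)
  have "continuous_on UNIV (\<lambda>Z. proj c Z i)" for i
    unfolding proj_def
    by (intro continuous_on_shift continuous_intros continuous_on_crd continuous_on_product_coordinates)
  then show "continuous_on UNIV g"
    unfolding g by (rule continuous_config_compose[OF smooth_config_continuous[OF f]])
  fix a :: "nat \<times> 'd phase" assume a: "snd a \<in> Basis"
  let ?f' = "if a = c then (\<lambda>Z. 0) else partial_deriv a f"
  have "has_partial g a (\<lambda>Z. ?f' (proj c Z))"
    using has_partial_proj[OF c a smooth_config_has_partial[OF f a]] unfolding g by (simp add: if_distribR)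
  moreover have "smooth_config ?f'"
    using smooth_config_partial_deriv[OF f a] by (simp add: smooth_config_const)
  ultimately show "\<exists>g'. (\<exists>f. smooth_config f \<and> g' = (\<lambda>Z. f (proj c Z))) \<and> has_partial g a g'"
    by (intro exI[of _ "\<lambda>Z. ?f' (proj c Z)"] conjI exI[of _ ?f']) simp_all
qed

lemma partial_deriv_proj_same:
  "snd c \<in> Basis \<Longrightarrow> partial_deriv c (\<lambda>Z. f (proj c Z)) = (\<lambda>Z. 0)"
  by (rule partial_deriv_eq) (simp add: has_partial_def proj_shift_same)

lemma iter_partial_proj:
  assumes c: "snd c \<in> Basis" and \<alpha>: "\<alpha> \<in> lists (UNIV \<times> Basis)" "c \<notin> set \<alpha>"
  shows "iter_partial \<alpha> (\<lambda>Z. f (proj c Z)) = (\<lambda>Z. iter_partial \<alpha> f (proj c Z))"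
  using \<alpha>
proof (induction \<alpha>)
  case (Cons a \<alpha>)
  then have a: "snd a \<in> Basis" "a \<noteq> c" by auto
  show ?case
    using Cons by (simp add: partial_deriv_shift fun_eq_iff proj_shift_other[OF c a])
qed simp

lemma iter_partial_zero: "iter_partial \<alpha> (\<lambda>Z. 0) = (\<lambda>Z. 0)"
  by (induction \<alpha>) (simp_all add: partial_deriv_const)

text \<open>Sums of monomials in the coordinates of the slots in J. Keeping monomials visible gives
  an explicit antiderivative and the splitting into factors for separate slots; closure under
  products is derived.\<close>

inductive cpoly :: "nat set \<Rightarrow> 'd::finite obs \<Rightarrow> bool" for J where
  mono: "cpoly J (\<lambda>Z. r * (\<Prod>c\<in>J \<times> Basis. crd c Z ^ m c))"
| add: "cpoly J f \<Longrightarrow> cpoly J g \<Longrightarrow> cpoly J (\<lambda>Z. f Z + g Z)"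

lemma cpoly_const: "cpoly J (\<lambda>Z. r)"
  using cpoly.mono[of J r "\<lambda>_. 0"] by simp

lemma cpoly_crd:
  assumes "finite J" "c \<in> J \<times> Basis"
  shows "cpoly J (crd c)"
proof -
  have "(\<Prod>b\<in>J \<times> Basis. crd b Z ^ (if b = c then 1 else 0)) = crd c Z" for Z
  proof -
    have "(\<Prod>b\<in>J \<times> Basis. crd b Z ^ (if b = c then 1 else 0)) = (\<Prod>b\<in>J \<times> Basis. if b = c then crd b Z else 1)"
      by (rule prod.cong) auto
    also have "\<dots> = crd c Z" using assms by (subst prod.delta) auto
    finally show ?thesis .
  qed
  then show ?thesis using cpoly.mono[of J 1 "\<lambda>b. if b = c then 1 else 0"] by simp
qed

lemma cpoly_mult: "cpoly J f \<Longrightarrow> cpoly J g \<Longrightarrow> cpoly J (\<lambda>Z. f Z * g Z)"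
proof (induction rule: cpoly.induct)
  case f: (mono r m)
  show ?case
    using f
  proof (induction rule: cpoly.induct)
    case (mono s n)
    have "cpoly J (\<lambda>Z. (r * s) * (\<Prod>c\<in>J \<times> Basis. crd c Z ^ (m c + n c)))" by (rule cpoly.mono)
    then show ?case by (simp add: power_add prod.distrib mult_ac)
  next
    case (add g h)
    then show ?case using cpoly.add[OF add.IH] by (simp add: algebra_simps)
  qed
next
  case (add f h)
  then show ?case using cpoly.add[OF add.IH] by (simp add: algebra_simps)
qed

lemma cpoly_smooth: "cpoly J f \<Longrightarrow> smooth_config f"
proof (induction rule: cpoly.induct)
  case (mono r m)
  show ?case
    by (intro smooth_config_cmult smooth_config_prod smooth_config_power smooth_config_crd) auto
next
  case (add f g)
  then show ?case by (intro smooth_config_add)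
qed

text \<open>On the hyperplane a monomial containing c vanishes and any other monomial is
  unchanged.\<close>

lemma cpoly_proj:
  assumes J: "finite J" and c: "c \<in> J \<times> Basis"
  shows "cpoly J f \<Longrightarrow> cpoly J (\<lambda>Z. f (proj c Z))"
proof (induction rule: cpoly.induct)
  case (mono r m)
  have cB: "snd c \<in> Basis" using c by auto
  have "(\<Prod>b\<in>J \<times> Basis. crd b (proj c Z) ^ m b) = (if m c = 0 then 1 else 0) * (\<Prod>b\<in>J \<times> Basis. crd b Z ^ m b)" for Z
  proof (cases "m c = 0")
    case True
    have "(\<Prod>b\<in>J \<times> Basis. crd b (proj c Z) ^ m b) = (\<Prod>b\<in>J \<times> Basis. crd b Z ^ m b)"
    proof (rule prod.cong[OF refl])
      fix b :: "nat \<times> 'a phase" assume "b \<in> J \<times> Basis"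
      then have "snd b \<in> Basis" by auto
      then show "crd b (proj c Z) ^ m b = crd b Z ^ m b" using crd_proj[OF cB] True by auto
    qed
    then show ?thesis using True by simp
  next
    case False
    then have "crd c (proj c Z) ^ m c = 0" using crd_proj[OF cB cB] by simp
    then have "(\<Prod>b\<in>J \<times> Basis. crd b (proj c Z) ^ m b) = 0"
      using J c by (intro prod_zero) auto
    then show ?thesis using False by simp
  qed
  then show ?case
    using cpoly.mono[of J "r * (if m c = 0 then 1 else 0)" m] by (simp only: mult.assoc)
next
  case (add f g)
  then show ?case by (intro cpoly.add)
qed

text \<open>The exponent of c is raised by one and the coefficient divided by the new exponent.
  Vanishing on the hyperplane fixes the constant of integration.\<close>

lemma cpoly_antiderivative:
  assumes J: "finite J" and c: "c \<in> J \<times> Basis"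
  shows "cpoly J f \<Longrightarrow> \<exists>g. cpoly J g \<and> partial_deriv c g = f \<and> (\<forall>Z. g (proj c Z) = 0)"
proof (induction rule: cpoly.induct)
  case (mono r m)
  have cB: "snd c \<in> Basis" using c by auto
  let ?m = "m(c := Suc (m c))"
  let ?g = "\<lambda>Z. (r / Suc (m c)) * (\<Prod>b\<in>J \<times> Basis. crd b Z ^ ?m b)"
  have split: "(\<Prod>b\<in>J \<times> Basis. crd b Z ^ n b) = crd c Z ^ n c * (\<Prod>b\<in>J \<times> Basis - {c}. crd b Z ^ n b)" for n Z
    using J c by (intro prod.remove) auto
  have rest: "(\<Prod>b\<in>J \<times> Basis - {c}. crd b Z ^ ?m b) = (\<Prod>b\<in>J \<times> Basis - {c}. crd b Z ^ m b)" for Z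
    by (rule prod.cong) auto
  have rest_shift: "(\<Prod>b\<in>J \<times> Basis - {c}. crd b (shift c t Z) ^ m b) = (\<Prod>b\<in>J \<times> Basis - {c}. crd b Z ^ m b)" for t Z
  proof (rule prod.cong[OF refl])
    fix b :: "nat \<times> 'a phase" assume "b \<in> J \<times> Basis - {c}"
    then have "snd b \<in> Basis" "b \<noteq> c" by auto
    then show "crd b (shift c t Z) ^ m b = crd b Z ^ m b" using crd_shift[OF cB] by simp
  qed
  have pow: "((\<lambda>t. (r / Suc k) * ((x + t) ^ Suc k * p)) has_real_derivative r * (x ^ k * p)) (at 0)"
    for x p :: real and k
  proof -
    have "((\<lambda>t. x + t) has_real_derivative 1) (at 0)" by (auto intro!: derivative_eq_intros)
    from DERIV_cmult[OF DERIV_power_Suc[OF this, of k], of "r / Suc k * p"]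
    have "((\<lambda>t. r / Suc k * p * (x + t) ^ Suc k) has_real_derivative
        r / Suc k * p * ((1 + real k) * (1 * (x + 0) ^ k))) (at 0)" .
    moreover have "r / Suc k * p * ((1 + real k) * (1 * (x + 0) ^ k)) = r * (x ^ k * p)"
      by (simp add: field_simps)
    ultimately show ?thesis by (simp only: mult.assoc mult.commute[of p])
  qed
  have "has_partial ?g c (\<lambda>Z. r * (\<Prod>b\<in>J \<times> Basis. crd b Z ^ m b))"
    unfolding has_partial_def split rest rest_shift crd_shift[OF cB cB] fun_upd_same
    using pow by simp
  then have "partial_deriv c ?g = (\<lambda>Z. r * (\<Prod>b\<in>J \<times> Basis. crd b Z ^ m b))" by (rule partial_deriv_eq)
  moreover have "?g (proj c Z) = 0" for Z
    unfolding split crd_proj[OF cB cB] by simp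
  ultimately show ?case
    by (intro exI[of _ ?g] conjI allI cpoly.mono)
next
  case (add f1 f2)
  have cB: "snd c \<in> Basis" using c by auto
  obtain g1 where g1: "cpoly J g1" "partial_deriv c g1 = f1" "\<forall>Z. g1 (proj c Z) = 0"
    using add.IH(1) by (elim exE conjE)
  obtain g2 where g2: "cpoly J g2" "partial_deriv c g2 = f2" "\<forall>Z. g2 (proj c Z) = 0"
    using add.IH(2) by (elim exE conjE)
  show ?case
    using g1 g2 partial_deriv_add[OF cpoly_smooth[OF g1(1)] cpoly_smooth[OF g2(1)] cB]
    by (intro exI[of _ "\<lambda>Z. g1 Z + g2 Z"] conjI cpoly.add) simp_all
qed

lemma depends_on_crd_eq:
  assumes "\<And>b. b \<in> Basis \<Longrightarrow> crd (k, b) Z = crd (k, b) W"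
  shows "Z k = W k"
proof (rule euclidean_eqI)
  show "Z k \<bullet> b = W k \<bullet> b" if "b \<in> Basis" for b
    using assms[OF that] by (simp only: crd_def fst_conv snd_conv)
qed

text \<open>Stone-Weierstrass needs a compact set on which the polynomials separate points. Entries
  outside J are therefore pinned to 0 in S; since h and t depend only on J, the estimate carries
  over to arbitrary Z.\<close>

lemma cpoly_dense_uniform:
  fixes h :: "'d::finite obs"
  assumes J: "finite J" and h: "continuous_on UNIV h" "depends_on J h" and e: "e > 0"
  shows "\<exists>t. cpoly J t \<and> (\<forall>Z. (\<forall>c\<in>J \<times> Basis. \<bar>crd c Z\<bar> \<le> R) \<longrightarrow> \<bar>h Z - t Z\<bar> \<le> e)"
proof -
  \<comment> \<open>A vector whose coordinates are bounded by R has norm at most R times their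
    number, by comparison with the sum norm.\<close>
  define r where "r = (\<Sum>b\<in>(Basis :: 'd phase set). R)"
  define S where "S = Pi\<^sub>E UNIV (\<lambda>k::nat. if k \<in> J then cball (0 :: 'd phase) r else {0})"
  have "compactin (product_topology (\<lambda>k. euclidean) UNIV) S"
    unfolding S_def by (simp add: compactin_PiE)
  then have S: "compact S" by (simp add: euclidean_product_topology)
  have "\<exists>t. cpoly J t \<and> (\<forall>x\<in>S. \<bar>h x - t x\<bar> < e)"
  proof (rule Stone_Weierstrass_HOL[OF S, of "cpoly J"])
    show "cpoly J (\<lambda>x. c)" for c by (rule cpoly_const)
    show "continuous_on S f" if "cpoly J f" for f
      by (rule continuous_on_subset[OF smooth_config_continuous[OF cpoly_smooth[OF that]]]) simp
    show "cpoly J (\<lambda>x. f x + g x)" if "cpoly J f \<and> cpoly J g" for f g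
      using that by (intro cpoly.add) simp_all
    show "cpoly J (\<lambda>x. f x * g x)" if "cpoly J f \<and> cpoly J g" for f g
      using that by (intro cpoly_mult) simp_all
    show "continuous_on S h" by (rule continuous_on_subset[OF h(1)]) simp
    show "\<exists>f. cpoly J f \<and> f x \<noteq> f y" if xy: "x \<in> S \<and> y \<in> S \<and> x \<noteq> y" for x y
    proof -
      obtain k where k: "x k \<noteq> y k" using xy by (auto simp: fun_eq_iff)
      have kJ: "k \<in> J"
      proof (rule ccontr)
        assume "k \<notin> J"
        moreover have "x \<in> S" "y \<in> S" using xy by simp_all
        note PiE_mem[OF this(1)[unfolded S_def] UNIV_I[of k]] PiE_mem[OF this(2)[unfolded S_def] UNIV_I[of k]]
        ultimately have "x k = 0" "y k = 0" by simp_all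
        then show False using k by simp
      qed
      have "\<exists>b\<in>Basis. crd (k, b) x \<noteq> crd (k, b) y"
      proof (rule ccontr)
        assume "\<not> (\<exists>b\<in>Basis. crd (k, b) x \<noteq> crd (k, b) y)"
        then have *: "\<forall>b\<in>Basis. crd (k, b) x = crd (k, b) y" by simp
        have "x k = y k" by (rule depends_on_crd_eq) (rule bspec[OF *])
        then show False using k by simp
      qed
      then obtain b where b: "b \<in> Basis" "crd (k, b) x \<noteq> crd (k, b) y" by (elim bexE)
      then show ?thesis using cpoly_crd[OF J, of "(k, b)"] kJ by (intro exI[of _ "crd (k, b)"]) simp
    qed
  qed (rule e)
  then obtain t where t: "cpoly J t" "\<forall>x\<in>S. \<bar>h x - t x\<bar> < e" by (elim exE conjE)
  have tJ: "depends_on J t"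
    using t(1)
  proof (induction rule: cpoly.induct)
    case (mono r m)
    show ?case
      unfolding depends_on_def
    proof (intro allI impI)
      fix Z W :: "'d config" assume *: "\<forall>i\<in>J. Z i = W i"
      have "(\<Prod>c\<in>J \<times> Basis. crd c Z ^ m c) = (\<Prod>c\<in>J \<times> Basis. crd c W ^ m c)"
        using * by (intro prod.cong) (auto simp: crd_def)
      then show "r * (\<Prod>c\<in>J \<times> Basis. crd c Z ^ m c) = r * (\<Prod>c\<in>J \<times> Basis. crd c W ^ m c)" by simp
    qed
  next
    case (add f g)
    show ?case
      unfolding depends_on_def
    proof (intro allI impI)
      fix Z W :: "'d config" assume *: "\<forall>i\<in>J. Z i = W i"
      have "f Z = f W" by (rule depends_onD[OF add.IH(1)]) (simp add: *)
      moreover have "g Z = g W" by (rule depends_onD[OF add.IH(2)]) (simp add: *)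
      ultimately show "f Z + g Z = f W + g W" by simp
    qed
  qed
  have "\<bar>h Z - t Z\<bar> \<le> e" if Z: "\<forall>c\<in>J \<times> Basis. \<bar>crd c Z\<bar> \<le> R" for Z
  proof -
    define W where "W k = (if k \<in> J then Z k else 0)" for k
    have nr: "norm (Z k) \<le> r" if "k \<in> J" for k
    proof -
      have "norm (Z k) \<le> (\<Sum>b\<in>Basis. \<bar>Z k \<bullet> b\<bar>)" by (rule norm_le_l1)
      also have "\<dots> \<le> r" unfolding r_def
      proof (rule sum_mono)
        fix b :: "'d phase" assume "b \<in> Basis"
        then show "\<bar>Z k \<bullet> b\<bar> \<le> R" using bspec[OF Z, of "(k, b)"] that by (simp add: crd_def)
      qed
      finally show ?thesis .
    qed
    have "W \<in> S" unfolding S_def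
    proof (rule PiE_I)
      show "W k \<in> (if k \<in> J then cball 0 r else {0})" for k using nr by (simp add: W_def)
    qed simp
    moreover have "h Z = h W" by (rule depends_onD[OF h(2)]) (simp add: W_def)
    moreover have "t Z = t W" by (rule depends_onD[OF tJ]) (simp add: W_def)
    ultimately show ?thesis using bspec[OF t(2), of W] by simp
  qed
  then show ?thesis using t(1) by (intro exI[of _ t]) simp
qed

text \<open>The induction adds one derivative at a time: if \<open>t\<^sub>1\<close> approximates \<open>h\<close> and \<open>t\<^sub>2\<close>
  approximates \<open>\<partial>\<^sub>c h\<close>, then \<open>t\<^sub>1\<close> restricted to the hyperplane \<open>c = 0\<close> plus the antiderivative
  of \<open>t\<^sub>2\<close> vanishing there approximates \<open>h\<close> together with its derivative in direction \<open>c\<close>.\<close>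

lemma cpoly_dense:
  fixes h :: "'d::finite obs"
  assumes J: "finite J" and R: "R \<ge> 0"
  shows "\<nu> \<in> lists (J \<times> Basis) \<Longrightarrow> smooth_config h \<Longrightarrow> depends_on J h \<Longrightarrow> e > 0 \<Longrightarrow>
    \<exists>t. cpoly J t \<and> (\<forall>\<alpha>\<in>lists (UNIV \<times> Basis). mset \<alpha> \<subseteq># mset \<nu> \<longrightarrow>
      (\<forall>Z. (\<forall>c\<in>J \<times> Basis. \<bar>crd c Z\<bar> \<le> R) \<longrightarrow> \<bar>iter_partial \<alpha> h Z - iter_partial \<alpha> t Z\<bar> \<le> e))"
proof (induction \<nu> arbitrary: h e)
  case Nil
  obtain t where t: "cpoly J t" "\<forall>Z. (\<forall>c\<in>J \<times> Basis. \<bar>crd c Z\<bar> \<le> R) \<longrightarrow> \<bar>h Z - t Z\<bar> \<le> e"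
    using cpoly_dense_uniform[OF J smooth_config_continuous[OF Nil(2)] Nil(3,4), of R] by (elim exE conjE)
  then show ?case by (intro exI[of _ t]) simp
next
  case (Cons c \<nu>)
  \<comment> \<open>An error \<open>e'\<close> of the derivative, integrated over a segment of
    length at most R, adds to an error \<open>e'\<close> on the hyperplane:
    \<open>e' + e' * R = e\<close>.\<close>
  define e' where "e' = e / (1 + R)"
  have e': "e' > 0" using Cons(5) R by (simp add: e'_def)
  have "e' * (1 + R) = e" using R by (simp add: e'_def)
  then have ee': "e' + e' * R = e" by (simp add: algebra_simps)
  have c: "c \<in> J \<times> Basis" and cB: "snd c \<in> Basis" and \<nu>: "\<nu> \<in> lists (J \<times> Basis)" using Cons(2) by auto
  note h = Cons(3) and hJ = Cons(4)
  have ph: "smooth_config (partial_deriv c h)" by (rule smooth_config_partial_deriv[OF h cB])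
  define Bx where "Bx = {Z :: 'd config. \<forall>c\<in>J \<times> Basis. \<bar>crd c Z\<bar> \<le> R}"
  obtain t1 where t1: "cpoly J t1" "\<forall>\<alpha>\<in>lists (UNIV \<times> Basis). mset \<alpha> \<subseteq># mset \<nu> \<longrightarrow>
      (\<forall>Z. (\<forall>c\<in>J \<times> Basis. \<bar>crd c Z\<bar> \<le> R) \<longrightarrow> \<bar>iter_partial \<alpha> h Z - iter_partial \<alpha> t1 Z\<bar> \<le> e')"
    using Cons.IH[OF \<nu> h hJ e'] by (elim exE conjE)
  obtain t2 where t2: "cpoly J t2" "\<forall>\<alpha>\<in>lists (UNIV \<times> Basis). mset \<alpha> \<subseteq># mset \<nu> \<longrightarrow>
      (\<forall>Z. (\<forall>c\<in>J \<times> Basis. \<bar>crd c Z\<bar> \<le> R) \<longrightarrow> \<bar>iter_partial \<alpha> (partial_deriv c h) Z - iter_partial \<alpha> t2 Z\<bar> \<le> e')"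
    using Cons.IH[OF \<nu> ph depends_on_partial_deriv[OF hJ] e'] by (elim exE conjE)
  obtain g2 where g2: "cpoly J g2" "partial_deriv c g2 = t2" "\<forall>Z. g2 (proj c Z) = 0"
    using cpoly_antiderivative[OF J c t2(1)] by (elim exE conjE)
  define t where "t = (\<lambda>Z. t1 (proj c Z) + g2 Z)"
  have tc: "cpoly J t" unfolding t_def by (intro cpoly.add cpoly_proj[OF J c] t1(1) g2(1))
  note ts = cpoly_smooth[OF tc]
  have s1: "smooth_config (\<lambda>Z. t1 (proj c Z))" by (rule smooth_config_proj[OF cpoly_smooth[OF t1(1)] cB])
  note s2 = cpoly_smooth[OF g2(1)]
  have pt: "partial_deriv c t = t2"
    unfolding t_def using partial_deriv_add[OF s1 s2 cB] by (simp add: partial_deriv_proj_same[OF cB, of t1] g2(2))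
  have close1: "\<bar>iter_partial \<alpha> h Z - iter_partial \<alpha> t1 Z\<bar> \<le> e'"
    if "\<alpha> \<in> lists (UNIV \<times> Basis)" "mset \<alpha> \<subseteq># mset \<nu>" "Z \<in> Bx" for \<alpha> Z
    by (rule t1(2)[THEN bspec, THEN mp, THEN spec, THEN mp, OF that(1,2) that(3)[unfolded Bx_def mem_Collect_eq]])
  have close2: "\<bar>iter_partial \<alpha> (partial_deriv c h) Z - iter_partial \<alpha> t2 Z\<bar> \<le> e'"
    if "\<alpha> \<in> lists (UNIV \<times> Basis)" "mset \<alpha> \<subseteq># mset \<nu>" "Z \<in> Bx" for \<alpha> Z
    by (rule t2(2)[THEN bspec, THEN mp, THEN spec, THEN mp, OF that(1,2) that(3)[unfolded Bx_def mem_Collect_eq]])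
  have main: "\<bar>iter_partial \<alpha> h Z - iter_partial \<alpha> t Z\<bar> \<le> e"
    if \<alpha>: "\<alpha> \<in> lists (UNIV \<times> Basis)" "mset \<alpha> \<subseteq># mset (c # \<nu>)" and Z: "Z \<in> Bx" for \<alpha> Z
  \<comment> \<open>If c occurs, one copy is moved innermost and turns h and t into
    \<open>partial_deriv c h\<close> and t2, which are close. If not, \<alpha> is already among the
    multi-indices for \<nu> and commutes with the restriction to the hyperplane.\<close>
  proof (cases "c \<in> set \<alpha>")
    case True
    have 1: "remove1 c \<alpha> \<in> lists (UNIV \<times> Basis)" using \<alpha>(1) set_remove1_subset[of c \<alpha>] unfolding lists_eq_set by blast
    have 2: "mset (remove1 c \<alpha>) \<subseteq># mset \<nu>"
      using \<alpha>(2) by (simp add: subset_eq_diff_conv)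
    have "\<bar>iter_partial \<alpha> h Z - iter_partial \<alpha> t Z\<bar> \<le> e'"
      using close2[OF 1 2 Z] iter_partial_remove1[OF h \<alpha>(1) True] iter_partial_remove1[OF ts \<alpha>(1) True]
      by (simp add: pt)
    also have "e' \<le> e" using ee' mult_nonneg_nonneg[of e' R] e' R by linarith
    finally show ?thesis .
  next
    case False
    have \<alpha>\<nu>: "mset \<alpha> \<subseteq># mset \<nu>"
    proof (rule mset_subset_eqI)
      have c0: "count (mset \<alpha>) c = 0" using False by (simp add: count_eq_zero_iff)
      show "count (mset \<alpha>) b \<le> count (mset \<nu>) b" for b
        using mset_subset_eq_count[OF \<alpha>(2), of b] by (cases "b = c") (simp_all add: c0)
    qed
    let ?g = "\<lambda>Z. h Z - t Z"
    have gs: "smooth_config ?g" by (rule smooth_config_diff[OF h ts])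
    let ?G = "iter_partial \<alpha> ?g"
    have G: "?G = (\<lambda>Z. iter_partial \<alpha> h Z - iter_partial \<alpha> t Z)" by (rule iter_partial_diff[OF h ts \<alpha>(1)])
    \<comment> \<open>The segment from the projection of Z to Z stays in the coordinate box, so the
      approximations may be used along it.\<close>
    have proj_Bx: "shift c s (proj c Z) \<in> Bx" if "\<bar>s\<bar> \<le> \<bar>crd c Z\<bar>" for s
      unfolding Bx_def
    proof (intro CollectI ballI)
      fix b assume b: "b \<in> J \<times> (Basis :: 'd phase set)"
      then have bB: "snd b \<in> Basis" by auto
      have "\<bar>crd b Z\<bar> \<le> R" "\<bar>crd c Z\<bar> \<le> R" using Z b c by (auto simp: Bx_def)
      then show "\<bar>crd b (shift c s (proj c Z))\<bar> \<le> R"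
        using that by (simp add: crd_shift[OF cB bB] crd_proj[OF cB bB])
    qed
    have "iter_partial \<alpha> t (proj c Z) = iter_partial \<alpha> t1 (proj c Z)"
    proof -
      have "iter_partial \<alpha> t = (\<lambda>Z. iter_partial \<alpha> (\<lambda>Z. t1 (proj c Z)) Z + iter_partial \<alpha> g2 Z)"
        unfolding t_def using iter_partial_lincomb[OF s1 s2 \<alpha>(1), of 1 1] by simp
      moreover have "iter_partial \<alpha> g2 (proj c Z) = 0"
      proof -
        have "(\<lambda>Z. g2 (proj c Z)) = (\<lambda>Z. 0)" using g2(3) by (intro ext) simp
        then have "iter_partial \<alpha> (\<lambda>Z. g2 (proj c Z)) = (\<lambda>Z. 0)" by (simp only: iter_partial_zero)
        then show ?thesis unfolding iter_partial_proj[OF cB \<alpha>(1) False, of g2] by (rule fun_cong)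
      qed
      ultimately show ?thesis
        by (simp add: iter_partial_proj[OF cB \<alpha>(1) False, of t1] proj_proj[OF cB])
    qed
    moreover have "proj c Z \<in> Bx" using proj_Bx[of 0] by simp
    ultimately have G0: "\<bar>?G (proj c Z)\<bar> \<le> e'" using close1[OF \<alpha>(1) \<alpha>\<nu>] by (simp add: G)
    have Gs: "smooth_config ?G" by (rule smooth_config_iter_partial[OF gs \<alpha>(1)])
    have pg: "partial_deriv c ?g = (\<lambda>Z. partial_deriv c h Z - t2 Z)"
    proof -
      have "[c] \<in> lists (UNIV \<times> Basis)" using cB by (cases c) auto
      then have "iter_partial [c] ?g = (\<lambda>Z. iter_partial [c] h Z - iter_partial [c] t Z)"
        by (rule iter_partial_diff[OF h ts])
      then show ?thesis by (simp only: iter_partial_Cons iter_partial_Nil pt)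
    qed
    have pG: "partial_deriv c ?G Y = iter_partial \<alpha> (partial_deriv c h) Y - iter_partial \<alpha> t2 Y" for Y
    proof -
      have "partial_deriv c ?G = iter_partial \<alpha> (partial_deriv c ?g)"
        by (rule iter_partial_partial_deriv[OF gs \<alpha>(1) cB, symmetric])
      then show ?thesis unfolding pg by (simp only: iter_partial_diff[OF ph cpoly_smooth[OF t2(1)] \<alpha>(1)])
    qed
    have "\<bar>?G (shift c (crd c Z) (proj c Z)) - ?G (shift c 0 (proj c Z)) - crd c Z * 0\<bar> \<le> e' * \<bar>crd c Z\<bar>"
    proof (rule mvt_bound)
      fix s assume s: "\<bar>s\<bar> \<le> \<bar>crd c Z\<bar>"
      show "((\<lambda>s. ?G (shift c s (proj c Z))) has_real_derivative partial_deriv c ?G (shift c s (proj c Z))) (at s)"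
        by (rule has_partial_at[OF smooth_config_has_partial[OF Gs cB]])
      show "\<bar>partial_deriv c ?G (shift c s (proj c Z)) - 0\<bar> \<le> e'"
        using close2[OF \<alpha>(1) \<alpha>\<nu> proj_Bx[OF s]] by (simp add: pG)
    qed
    then have "\<bar>?G Z - ?G (proj c Z)\<bar> \<le> e' * \<bar>crd c Z\<bar>" by (simp add: shift_proj)
    also have "\<dots> \<le> e' * R" using Z c e' by (intro mult_left_mono) (auto simp: Bx_def)
    finally have "\<bar>?G Z\<bar> \<le> e" using G0 ee' by linarith
    then show ?thesis by (simp add: G)
  qed
  show ?case
    using tc main by (intro exI[of _ t]) (simp add: Bx_def)
qed

section \<open>Fubini for two distributions\<close>

text \<open>Derivatives in slot i pass under \<delta>, which acts in slot j, so the two one-slot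
  bounds compose. Their sum \<open>N1 + N2\<close> suffices both for the total order and for the
  radii.\<close>

lemma apply_at_twice_bound:
  fixes \<gamma> \<delta> :: "'d::finite obs \<Rightarrow> real"
  assumes \<gamma>: "\<gamma> \<in> dual1" and \<delta>: "\<delta> \<in> dual1" and ij: "i \<noteq> j"
  shows "\<exists>n C. C \<ge> 0 \<and> (\<forall>g Z. \<forall>M\<ge>0. smooth_config (g :: 'd obs) \<longrightarrow>
    (\<forall>\<alpha>\<in>lists ({i, j} \<times> Basis). length \<alpha> \<le> n \<longrightarrow>
      (\<forall>Y. norm (Y i) \<le> real n \<longrightarrow> norm (Y j) \<le> real n \<longrightarrow> \<bar>iter_partial \<alpha> g Y\<bar> \<le> M)) \<longrightarrow>
    \<bar>apply_at \<gamma> i (apply_at \<delta> j g) Z\<bar> \<le> C * M)"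
proof -
  obtain N1 C1 where 1: "C1 \<ge> 0" "\<forall>h. \<forall>i. \<forall>Z. \<forall>M\<ge>0. smooth_config (h :: 'd obs) \<longrightarrow>
    (\<forall>\<alpha>\<in>lists ({i} \<times> Basis). length \<alpha> \<le> N1 \<longrightarrow> (\<forall>w. norm w \<le> real N1 \<longrightarrow> \<bar>iter_partial \<alpha> h (Z(i := w))\<bar> \<le> M)) \<longrightarrow>
    \<bar>apply_at \<gamma> i h Z\<bar> \<le> C1 * M"
    using apply_at_bound[OF \<gamma>] by (elim exE conjE)
  obtain N2 C2 where 2: "C2 \<ge> 0" "\<forall>h. \<forall>i. \<forall>Z. \<forall>M\<ge>0. smooth_config (h :: 'd obs) \<longrightarrow>
    (\<forall>\<alpha>\<in>lists ({i} \<times> Basis). length \<alpha> \<le> N2 \<longrightarrow> (\<forall>w. norm w \<le> real N2 \<longrightarrow> \<bar>iter_partial \<alpha> h (Z(i := w))\<bar> \<le> M)) \<longrightarrow>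
    \<bar>apply_at \<delta> i h Z\<bar> \<le> C2 * M"
    using apply_at_bound[OF \<delta>] by (elim exE conjE)
  note b1 = 1(2)[THEN spec, THEN spec, THEN spec, THEN spec, THEN mp, THEN mp, THEN mp]
  note b2 = 2(2)[THEN spec, THEN spec, THEN spec, THEN spec, THEN mp, THEN mp, THEN mp]
  show ?thesis
  proof (rule exI[of _ "N1 + N2"], rule exI[of _ "C1 * C2"], intro conjI allI impI)
    show "0 \<le> C1 * C2" using 1(1) 2(1) by simp
    fix g :: "'d obs" and Z :: "'d config" and M :: real
    assume M: "0 \<le> M" and g: "smooth_config g" and
      bd: "\<forall>\<alpha>\<in>lists ({i, j} \<times> Basis). length \<alpha> \<le> N1 + N2 \<longrightarrow>
        (\<forall>Y. norm (Y i) \<le> real (N1 + N2) \<longrightarrow> norm (Y j) \<le> real (N1 + N2) \<longrightarrow> \<bar>iter_partial \<alpha> g Y\<bar> \<le> M)"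
    have "\<bar>apply_at \<gamma> i (apply_at \<delta> j g) Z\<bar> \<le> C1 * (C2 * M)"
    proof (rule b1[OF _ smooth_config_apply_at[OF \<delta> g]], goal_cases)
      case 1
      then show ?case using 2(1) M by simp
    next
      case 2
      show ?case
      proof (intro ballI allI impI)
        fix \<alpha> :: "(nat \<times> 'd phase) list" and w :: "'d phase"
        assume \<alpha>: "\<alpha> \<in> lists ({i} \<times> Basis)" "length \<alpha> \<le> N1" and w: "norm w \<le> real N1"
        have "\<bar>apply_at \<delta> j (iter_partial \<alpha> g) (Z(i := w))\<bar> \<le> C2 * M"
        proof (rule b2[OF M smooth_config_iter_partial[OF g lists_subset[OF \<alpha>(1)]]], intro ballI allI impI)
          fix \<beta> :: "(nat \<times> 'd phase) list" and v :: "'d phase"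
          assume \<beta>: "\<beta> \<in> lists ({j} \<times> Basis)" "length \<beta> \<le> N2" and v: "norm v \<le> real N2"
          have 3: "\<beta> @ \<alpha> \<in> lists ({i, j} \<times> Basis)" using \<alpha>(1) \<beta>(1) by auto
          have 4: "length (\<beta> @ \<alpha>) \<le> N1 + N2" using \<alpha>(2) \<beta>(2) by simp
          have "\<bar>iter_partial (\<beta> @ \<alpha>) g (Z(i := w, j := v))\<bar> \<le> M"
            by (rule bd[THEN bspec, THEN mp, THEN spec, THEN mp, THEN mp, OF 3 4]) (use ij w v in simp_all)
          then show "\<bar>iter_partial \<beta> (iter_partial \<alpha> g) (Z(i := w, j := v))\<bar> \<le> M"
            by (simp only: iter_partial_append)
        qed
        moreover have "iter_partial \<alpha> (apply_at \<delta> j g) = apply_at \<delta> j (iter_partial \<alpha> g)"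
          by (rule iter_partial_apply_at[OF \<delta> g \<alpha>(1)]) (use ij in simp)
        ultimately show "\<bar>iter_partial \<alpha> (apply_at \<delta> j g) (Z(i := w))\<bar> \<le> C2 * M" by simp
      qed
    qed
    then show "\<bar>apply_at \<gamma> i (apply_at \<delta> j g) Z\<bar> \<le> C1 * C2 * M" by (simp only: mult.assoc)
  qed
qed

lemma depends_on_crd_prod: "depends_on I (\<lambda>Z. r * (\<Prod>c\<in>I \<times> Basis. crd c Z ^ m c))"
  unfolding depends_on_def
proof (intro allI impI)
  fix Z W :: "'a config" assume *: "\<forall>i\<in>I. Z i = W i"
  have "(\<Prod>c\<in>I \<times> Basis. crd c Z ^ m c) = (\<Prod>c\<in>I \<times> Basis. crd c W ^ m c)"
    using * by (intro prod.cong) (auto simp: crd_def)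
  then show "r * (\<Prod>c\<in>I \<times> Basis. crd c Z ^ m c) = r * (\<Prod>c\<in>I \<times> Basis. crd c W ^ m c)" by simp
qed

text \<open>A monomial is a factor in slot i times a factor in slot j. Either order pulls out the
  factor that is not acted on, and the result is the product of the same two functions.\<close>

lemma apply_at_commute_cpoly:
  assumes \<gamma>: "\<gamma> \<in> dual1" and \<delta>: "\<delta> \<in> dual1" and ij: "i \<noteq> j"
  shows "cpoly {i, j} h \<Longrightarrow> apply_at \<gamma> i (apply_at \<delta> j h) = apply_at \<delta> j (apply_at \<gamma> i h)"
proof (induction rule: cpoly.induct)
  case (mono r m)
  let ?U = "\<lambda>Z. r * (\<Prod>c\<in>{i} \<times> Basis. crd c Z ^ m c)" and ?V = "\<lambda>Z. 1 * (\<Prod>c\<in>{j} \<times> Basis. crd c Z ^ m c)"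
  have UV: "(\<lambda>Z. r * (\<Prod>c\<in>{i, j} \<times> Basis. crd c Z ^ m c)) = (\<lambda>Z. ?U Z * ?V Z)"
  proof
    fix Z :: "'a config"
    have "{i, j} \<times> (Basis :: 'a phase set) = {i} \<times> Basis \<union> {j} \<times> Basis" by auto
    then have "(\<Prod>c\<in>{i, j} \<times> Basis. crd c Z ^ m c) = (\<Prod>c\<in>{i} \<times> Basis. crd c Z ^ m c) * (\<Prod>c\<in>{j} \<times> Basis. crd c Z ^ m c)"
      using ij by (simp only:) (rule prod.union_disjoint, auto)
    then show "r * (\<Prod>c\<in>{i, j} \<times> Basis. crd c Z ^ m c) = ?U Z * ?V Z" by simp
  qed
  have VU: "(\<lambda>Z. ?U Z * ?V Z) = (\<lambda>Z. ?V Z * ?U Z)" by (simp add: mult.commute)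
  have U: "smooth_config ?U" "depends_on {i} ?U" by (intro cpoly_smooth[OF cpoly.mono] depends_on_crd_prod)+
  have V: "smooth_config ?V" "depends_on {j} ?V" by (intro cpoly_smooth[OF cpoly.mono] depends_on_crd_prod)+
  let ?dV = "apply_at \<delta> j ?V" and ?gU = "apply_at \<gamma> i ?U"
  have dV: "depends_on {} ?dV" using depends_on_apply_at[OF V(2), of j \<delta>] by simp
  have gU: "depends_on {} ?gU" using depends_on_apply_at[OF U(2), of i \<gamma>] by simp
  have "apply_at \<delta> j (\<lambda>Z. ?U Z * ?V Z) = (\<lambda>Z. ?U Z * ?dV Z)"
    by (rule apply_at_mult[OF \<delta> U(2) _ V(1)]) (use ij in simp)
  moreover have "(\<lambda>Z. ?U Z * ?dV Z) = (\<lambda>Z. ?dV Z * ?U Z)" by (simp only: mult.commute)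
  moreover have "apply_at \<gamma> i (\<lambda>Z. ?dV Z * ?U Z) = (\<lambda>Z. ?dV Z * ?gU Z)"
    by (rule apply_at_mult[OF \<gamma> dV _ U(1)]) simp
  ultimately have 1: "apply_at \<gamma> i (apply_at \<delta> j (\<lambda>Z. ?U Z * ?V Z)) = (\<lambda>Z. ?dV Z * ?gU Z)" by (simp only:)
  have "apply_at \<gamma> i (\<lambda>Z. ?V Z * ?U Z) = (\<lambda>Z. ?V Z * ?gU Z)"
    by (rule apply_at_mult[OF \<gamma> V(2) _ U(1)]) (use ij in simp)
  moreover have "(\<lambda>Z. ?V Z * ?gU Z) = (\<lambda>Z. ?gU Z * ?V Z)" by (simp only: mult.commute)
  moreover have "apply_at \<delta> j (\<lambda>Z. ?gU Z * ?V Z) = (\<lambda>Z. ?gU Z * ?dV Z)"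
    by (rule apply_at_mult[OF \<delta> gU _ V(1)]) simp
  ultimately have 2: "apply_at \<delta> j (apply_at \<gamma> i (\<lambda>Z. ?V Z * ?U Z)) = (\<lambda>Z. ?gU Z * ?dV Z)" by (simp only:)
  show ?case unfolding UV using 1 2 unfolding VU by (simp add: mult.commute)
next
  case (add f g)
  note f = cpoly_smooth[OF add.hyps(1)] and g = cpoly_smooth[OF add.hyps(2)]
  note l1 = apply_at_lincomb[OF _ f g, of _ _ 1 1, simplified]
  have "apply_at \<gamma> i (apply_at \<delta> j (\<lambda>Z. f Z + g Z)) = (\<lambda>Z. apply_at \<gamma> i (apply_at \<delta> j f) Z + apply_at \<gamma> i (apply_at \<delta> j g) Z)"
    using apply_at_lincomb[OF \<gamma> smooth_config_apply_at[OF \<delta> f] smooth_config_apply_at[OF \<delta> g], of i 1 j 1 j]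
    by (simp add: l1[OF \<delta>])
  moreover have "apply_at \<delta> j (apply_at \<gamma> i (\<lambda>Z. f Z + g Z)) = (\<lambda>Z. apply_at \<delta> j (apply_at \<gamma> i f) Z + apply_at \<delta> j (apply_at \<gamma> i g) Z)"
    using apply_at_lincomb[OF \<delta> smooth_config_apply_at[OF \<gamma> f] smooth_config_apply_at[OF \<gamma> g], of j 1 i 1 i]
    by (simp add: l1[OF \<gamma>])
  ultimately show ?case by (simp only: add.IH)
qed

text \<open>With n copies of the list of all directions, approximation of the derivatives along
  sub-multisets becomes approximation of all derivatives of order at most n.\<close>

lemma mset_subset_concat_replicate:
  assumes "set \<alpha> \<subseteq> set cs" "length \<alpha> \<le> n"
  shows "mset \<alpha> \<subseteq># mset (concat (replicate n cs))"
proof (rule mset_subset_eqI)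
  fix a
  show "count (mset \<alpha>) a \<le> count (mset (concat (replicate n cs))) a"
  proof (cases "a \<in> set \<alpha>")
    case True
    then have "a \<in># mset cs" using assms(1) by auto
    then have "count (mset cs) a > 0" by (simp only: count_greater_zero_iff)
    then have "n * 1 \<le> n * count (mset cs) a" by (intro mult_le_mono2) linarith
    moreover have "count (mset (concat (replicate n cs))) a = n * count (mset cs) a"
      by (induction n) simp_all
    moreover have "count (mset \<alpha>) a \<le> length \<alpha>" by (metis count_le_size size_mset)
    ultimately show ?thesis using assms(2) by linarith
  next
    case False
    then have "count (mset \<alpha>) a = 0" by (simp add: count_eq_zero_iff)
    then show ?thesis by linarith
  qed
qed

theorem apply_at_commute:
  fixes h :: "'d::finite obs"
  assumes \<gamma>: "\<gamma> \<in> dual1" and \<delta>: "\<delta> \<in> dual1" and ij: "i \<noteq> j" and h: "smooth_config h"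
  shows "apply_at \<gamma> i (apply_at \<delta> j h) = apply_at \<delta> j (apply_at \<gamma> i h)"
proof
  fix Z
  \<comment> \<open>All variables except i and j are frozen at Z. Polynomials approximate functions
    of finitely many slots, and the two iterated applications at Z see no other values of h.\<close>
  define h' where "h' = (\<lambda>Y. h (\<lambda>k. if k \<in> {i, j} then Y k else Z k))"
  have h': "smooth_config h'" unfolding h'_def by (rule smooth_config_subst[OF h]) simp
  have h'J: "depends_on {i, j} h'"
    unfolding depends_on_def h'_def by (intro allI impI arg_cong[of _ _ h] ext) simp
  have eq: "h' (Z(i := x, j := y)) = h (Z(i := x, j := y))" "h' (Z(j := y, i := x)) = h (Z(j := y, i := x))" for x y
    unfolding h'_def by (rule arg_cong[of _ _ h], rule ext, simp)+
  obtain n1 C1 where 1: "C1 \<ge> 0" "\<forall>g Z. \<forall>M\<ge>0. smooth_config (g :: 'd obs) \<longrightarrow>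
    (\<forall>\<alpha>\<in>lists ({i, j} \<times> Basis). length \<alpha> \<le> n1 \<longrightarrow>
      (\<forall>Y. norm (Y i) \<le> real n1 \<longrightarrow> norm (Y j) \<le> real n1 \<longrightarrow> \<bar>iter_partial \<alpha> g Y\<bar> \<le> M)) \<longrightarrow>
    \<bar>apply_at \<gamma> i (apply_at \<delta> j g) Z\<bar> \<le> C1 * M"
    using apply_at_twice_bound[OF \<gamma> \<delta> ij] by (elim exE conjE)
  obtain n2 C2 where 2: "C2 \<ge> 0" "\<forall>g Z. \<forall>M\<ge>0. smooth_config (g :: 'd obs) \<longrightarrow>
    (\<forall>\<alpha>\<in>lists ({j, i} \<times> Basis). length \<alpha> \<le> n2 \<longrightarrow>
      (\<forall>Y. norm (Y j) \<le> real n2 \<longrightarrow> norm (Y i) \<le> real n2 \<longrightarrow> \<bar>iter_partial \<alpha> g Y\<bar> \<le> M)) \<longrightarrow>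
    \<bar>apply_at \<delta> j (apply_at \<gamma> i g) Z\<bar> \<le> C2 * M"
    using apply_at_twice_bound[OF \<delta> \<gamma> ij[symmetric]] by (elim exE conjE)
  note b1 = 1(2)[THEN spec, THEN spec, THEN spec, THEN mp, THEN mp, THEN mp]
  note b2 = 2(2)[THEN spec, THEN spec, THEN spec, THEN mp, THEN mp, THEN mp]
  define n where "n = n1 + n2"
  have fin: "finite ({i, j} \<times> (Basis :: 'd phase set))" by simp
  obtain cs where cs: "set cs = {i, j} \<times> (Basis :: 'd phase set)" using finite_list[OF fin] by (elim exE)
  define \<nu> where "\<nu> = concat (replicate n cs)"
  have "set \<nu> \<subseteq> set cs" unfolding \<nu>_def by (induction n) auto
  then have \<nu>: "\<nu> \<in> lists ({i, j} \<times> Basis)" unfolding cs lists_eq_set mem_Collect_eq .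
  have sub: "mset \<alpha> \<subseteq># mset \<nu>" if "\<alpha> \<in> lists ({i, j} \<times> Basis)" "length \<alpha> \<le> n" for \<alpha>
    unfolding \<nu>_def
    by (rule mset_subset_concat_replicate) (use that cs in \<open>simp_all only: lists_eq_set mem_Collect_eq\<close>)
  \<comment> \<open>Both orders agree on the polynomial t, and each changes by at most a constant
    times e when t is replaced by \<open>h'\<close>.\<close>
  have small: "\<bar>apply_at \<gamma> i (apply_at \<delta> j h') Z - apply_at \<delta> j (apply_at \<gamma> i h') Z\<bar> \<le> (C1 + C2) * e"
    if e: "e > 0" for e
  proof -
    obtain t where t: "cpoly {i, j} t" "\<forall>\<alpha>\<in>lists (UNIV \<times> Basis). mset \<alpha> \<subseteq># mset \<nu> \<longrightarrow>
      (\<forall>Z. (\<forall>c\<in>{i, j} \<times> Basis. \<bar>crd c Z\<bar> \<le> real n) \<longrightarrow> \<bar>iter_partial \<alpha> h' Z - iter_partial \<alpha> t Z\<bar> \<le> e)"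
      using cpoly_dense[OF finite.insertI[OF finite.insertI[OF finite.emptyI]] of_nat_0_le_iff \<nu> h' h'J e, of n]
      by (elim exE conjE)
    note ts = cpoly_smooth[OF t(1)]
    let ?u = "\<lambda>Z. 1 * h' Z + (- 1) * t Z"
    have us: "smooth_config ?u" by (intro smooth_config_add smooth_config_cmult h' ts)
    have bd: "\<bar>iter_partial \<alpha> ?u Y\<bar> \<le> e"
      if \<alpha>: "\<alpha> \<in> lists ({i, j} \<times> Basis)" "length \<alpha> \<le> n" and Y: "norm (Y i) \<le> real n" "norm (Y j) \<le> real n" for \<alpha> Y
    proof -
      have "\<bar>crd c Y\<bar> \<le> real n" if c: "c \<in> {i, j} \<times> Basis" for c
      proof -
        have "\<bar>Y (fst c) \<bullet> snd c\<bar> \<le> norm (Y (fst c))" using c by (intro Basis_le_norm) auto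
        also have "\<dots> \<le> real n" using Y c by auto
        finally show ?thesis by (simp only: crd_def)
      qed
      then have "\<forall>c\<in>{i, j} \<times> Basis. \<bar>crd c Y\<bar> \<le> real n" by (rule ballI)
      from t(2)[THEN bspec, THEN mp, THEN spec, THEN mp, OF lists_subset[OF \<alpha>(1)] sub[OF \<alpha>] this]
      show ?thesis using iter_partial_lincomb[OF h' ts lists_subset[OF \<alpha>(1)], of 1 "- 1"] by simp
    qed
    have A: "\<bar>apply_at \<gamma> i (apply_at \<delta> j ?u) Z\<bar> \<le> C1 * e"
    proof (rule b1[OF _ us], goal_cases)
      case 2
      show ?case by (intro ballI allI impI bd) (auto simp: n_def)
    next
      case 1
      show ?case using e by simp
    qed
    have B: "\<bar>apply_at \<delta> j (apply_at \<gamma> i ?u) Z\<bar> \<le> C2 * e"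
    proof (rule b2[OF _ us], goal_cases)
      case 2
      show ?case by (intro ballI allI impI bd) (auto simp: n_def insert_commute)
    next
      case 1
      show ?case using e by simp
    qed
    have "apply_at \<gamma> i (apply_at \<delta> j ?u) Z = apply_at \<gamma> i (apply_at \<delta> j h') Z - apply_at \<gamma> i (apply_at \<delta> j t) Z"
      unfolding apply_at_lincomb[OF \<delta> h' ts]
        apply_at_lincomb[OF \<gamma> smooth_config_apply_at[OF \<delta> h'] smooth_config_apply_at[OF \<delta> ts]] by simp
    moreover have "apply_at \<delta> j (apply_at \<gamma> i ?u) Z = apply_at \<delta> j (apply_at \<gamma> i h') Z - apply_at \<delta> j (apply_at \<gamma> i t) Z"
      unfolding apply_at_lincomb[OF \<gamma> h' ts]
        apply_at_lincomb[OF \<delta> smooth_config_apply_at[OF \<gamma> h'] smooth_config_apply_at[OF \<gamma> ts]] by simp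
    moreover have "apply_at \<gamma> i (apply_at \<delta> j t) Z = apply_at \<delta> j (apply_at \<gamma> i t) Z"
      by (simp only: apply_at_commute_cpoly[OF \<gamma> \<delta> ij t(1)])
    ultimately have "\<bar>apply_at \<gamma> i (apply_at \<delta> j h') Z - apply_at \<delta> j (apply_at \<gamma> i h') Z\<bar> \<le> C1 * e + C2 * e"
      using A B by linarith
    then show ?thesis by (simp only: distrib_right)
  qed
  have small_imp_zero: "D = 0" if D: "\<And>e. e > 0 \<Longrightarrow> \<bar>D\<bar> \<le> (C1 + C2) * e" for D :: real
  proof (rule ccontr)
    assume "D \<noteq> 0"
    then have d: "\<bar>D\<bar> > 0" by simp
    have pos: "C1 + C2 + 1 > 0" using 1(1) 2(1) by linarith
    have "\<bar>D\<bar> \<le> (C1 + C2) * (\<bar>D\<bar> / (C1 + C2 + 1))" by (rule D[OF divide_pos_pos[OF d pos]])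
    also have "\<dots> < \<bar>D\<bar>"
    proof -
      have "(C1 + C2) * \<bar>D\<bar> < \<bar>D\<bar> * (C1 + C2 + 1)" using d by (simp add: algebra_simps)
      then show ?thesis by (simp only: times_divide_eq_right pos_divide_less_eq[OF pos])
    qed
    finally show False by simp
  qed
  have "apply_at \<gamma> i (apply_at \<delta> j h') Z - apply_at \<delta> j (apply_at \<gamma> i h') Z = 0"
    by (rule small_imp_zero[OF small])
  then have "apply_at \<gamma> i (apply_at \<delta> j h') Z = apply_at \<delta> j (apply_at \<gamma> i h') Z" by linarith
  moreover have "apply_at \<gamma> i (apply_at \<delta> j h') Z = apply_at \<gamma> i (apply_at \<delta> j h) Z"
    unfolding apply_at_def by (simp only: eq)
  moreover have "apply_at \<delta> j (apply_at \<gamma> i h') Z = apply_at \<delta> j (apply_at \<gamma> i h) Z"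
    unfolding apply_at_def by (simp only: eq)
  ultimately show "apply_at \<gamma> i (apply_at \<delta> j h) Z = apply_at \<delta> j (apply_at \<gamma> i h) Z" by (simp only:)
qed

section \<open>The seminorms of the strong dual\<close>

lemma plus_functional: "(\<gamma> + \<delta>) f = \<gamma> f + (\<delta> f :: real)"
  by simp

lemma scaleR_functional: "(t *\<^sub>R \<gamma>) f = t * (\<gamma> f :: real)"
  by (simp add: scaleR_fun_def)

lemma subspace_dual: "subspace (tvs_dual (sym_smooth_top k) :: ('d::finite obs \<Rightarrow> real) set)"
proof -
  have cn: "\<gamma> \<in> tvs_dual (sym_smooth_top k) \<longleftrightarrow> continuous_map (sym_smooth_top k) euclideanreal \<gamma> \<and>
     (\<forall>x\<in>sym_smooth k. \<forall>y\<in>sym_smooth k. \<gamma> (x + y) = \<gamma> x + \<gamma> y) \<and>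
     (\<forall>c. \<forall>x\<in>sym_smooth k. \<gamma> (c *\<^sub>R x) = c * \<gamma> x) \<and> (\<forall>x. x \<notin> sym_smooth k \<longrightarrow> \<gamma> x = 0)" for \<gamma> :: "'d obs \<Rightarrow> real"
    by (simp add: tvs_dual_def topspace_sym_smooth_top)
  show ?thesis
  proof (rule subspaceI)
    show "0 \<in> (tvs_dual (sym_smooth_top k) :: ('d obs \<Rightarrow> real) set)"
      unfolding cn by (simp add: zero_fun_def)
  next
    fix \<gamma> \<delta> :: "'d obs \<Rightarrow> real" assume "\<gamma> \<in> tvs_dual (sym_smooth_top k)" "\<delta> \<in> tvs_dual (sym_smooth_top k)"
    then show "\<gamma> + \<delta> \<in> tvs_dual (sym_smooth_top k)"
      unfolding cn by (simp add: plus_fun_def continuous_map_add distrib_left)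
  next
    fix \<gamma> :: "'d obs \<Rightarrow> real" and c :: real assume "\<gamma> \<in> tvs_dual (sym_smooth_top k)"
    then show "c *\<^sub>R \<gamma> \<in> tvs_dual (sym_smooth_top k)"
      unfolding cn by (simp add: scaleR_fun_def continuous_map_real_mult algebra_simps)
  qed
qed

definition sup_norm :: "'d::finite obs set \<Rightarrow> ('d obs \<Rightarrow> real) \<Rightarrow> real" where
  "sup_norm B \<phi> = (SUP f\<in>B. \<bar>\<phi> f\<bar>)"

definition sup_norms :: "nat \<Rightarrow> (('d::finite obs \<Rightarrow> real) \<Rightarrow> real) set" where
  "sup_norms k = {sup_norm B | B. tvs_bounded (sym_smooth_top k) B \<and> B \<noteq> {}}"

lemma strong_dual_sup_norms:
  "strong_dual (sym_smooth_top k) = seminorm_topology (tvs_dual (sym_smooth_top k)) (sup_norms k)"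
  unfolding strong_dual_def sup_norms_def sup_norm_def[abs_def] ..

text \<open>Boundedness above is what gives the \<open>SUP\<close> in the strong dual seminorms its
  meaning; it combines the bound of \<phi> at one order with the uniform bound of B at that
  order.\<close>

lemma dual_bounded_image:
  fixes \<phi> :: "'d::finite obs \<Rightarrow> real"
  assumes \<phi>: "\<phi> \<in> tvs_dual (sym_smooth_top k)" and B: "tvs_bounded (sym_smooth_top k) B"
  shows "bdd_above ((\<lambda>f. \<bar>\<phi> f\<bar>) ` B)"
proof -
  obtain N C where C: "C \<ge> 0" "\<forall>f\<in>sym_smooth k. \<forall>M\<ge>0. cn_bound k N f M \<longrightarrow> \<bar>\<phi> f\<bar> \<le> C * M"
    using dual_cn_bound[OF \<phi>] by (elim exE conjE)
  have B': "B \<subseteq> sym_smooth k" "\<forall>N. \<exists>M. \<forall>f\<in>B. cn_bound k N f M"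
    using B by (simp_all add: tvs_bounded_sym_smooth_iff)
  obtain M where M: "\<forall>f\<in>B. cn_bound k N f M" using B'(2) by blast
  have "\<bar>\<phi> f\<bar> \<le> C * \<bar>M\<bar>" if "f \<in> B" for f
  proof -
    have f: "f \<in> sym_smooth k" using that B'(1) by blast
    have "cn_bound k N f \<bar>M\<bar>" by (rule cn_bound_mono[OF bspec[OF M that] order_refl]) simp
    then show ?thesis using C(2)[THEN bspec, THEN spec, THEN mp, THEN mp, OF f abs_ge_zero] by simp
  qed
  then show ?thesis by (intro bdd_aboveI2)
qed

lemma sup_norm_upper:
  assumes "\<phi> \<in> tvs_dual (sym_smooth_top k)" "tvs_bounded (sym_smooth_top k) B" "f \<in> B"
  shows "\<bar>\<phi> f\<bar> \<le> sup_norm B \<phi>"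
  unfolding sup_norm_def by (rule cSUP_upper[OF assms(3) dual_bounded_image[OF assms(1,2)]])

lemma sup_norm_least: "B \<noteq> {} \<Longrightarrow> (\<And>f. f \<in> B \<Longrightarrow> \<bar>\<phi> f\<bar> \<le> M) \<Longrightarrow> sup_norm B \<phi> \<le> M"
  unfolding sup_norm_def by (rule cSUP_least)

lemma seminorm_on_sup_norm:
  fixes B :: "'d::finite obs set"
  assumes B: "tvs_bounded (sym_smooth_top k) B" "B \<noteq> {}"
  shows "seminorm_on (tvs_dual (sym_smooth_top k)) (sup_norm B)"
  unfolding seminorm_on_def
proof (intro conjI allI ballI)
  obtain f where f: "f \<in> B" using B(2) by blast
  show nn: "0 \<le> sup_norm B \<phi>" if "\<phi> \<in> tvs_dual (sym_smooth_top k)" for \<phi>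
    using sup_norm_upper[OF that B(1) f] by linarith
  fix \<phi> :: "'d obs \<Rightarrow> real" assume \<phi>: "\<phi> \<in> tvs_dual (sym_smooth_top k)"
  { fix \<psi> :: "'d obs \<Rightarrow> real" assume \<psi>: "\<psi> \<in> tvs_dual (sym_smooth_top k)"
    show "sup_norm B (\<phi> + \<psi>) \<le> sup_norm B \<phi> + sup_norm B \<psi>"
    proof (rule sup_norm_least[OF B(2)])
      fix f assume f: "f \<in> B"
      show "\<bar>(\<phi> + \<psi>) f\<bar> \<le> sup_norm B \<phi> + sup_norm B \<psi>"
        unfolding plus_functional using sup_norm_upper[OF \<phi> B(1) f] sup_norm_upper[OF \<psi> B(1) f] by linarith
    qed }
  fix c :: real
  have le: "sup_norm B (c *\<^sub>R \<phi>) \<le> \<bar>c\<bar> * sup_norm B \<phi>" if \<phi>: "\<phi> \<in> tvs_dual (sym_smooth_top k)" for c \<phi>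
  proof (rule sup_norm_least[OF B(2)])
    fix f assume f: "f \<in> B"
    show "\<bar>(c *\<^sub>R \<phi>) f\<bar> \<le> \<bar>c\<bar> * sup_norm B \<phi>"
      unfolding scaleR_functional abs_mult by (rule mult_left_mono[OF sup_norm_upper[OF \<phi> B(1) f]]) simp
  qed
  have c\<phi>: "c *\<^sub>R \<phi> \<in> tvs_dual (sym_smooth_top k)" by (rule subspace_scale[OF subspace_dual \<phi>])
  show "sup_norm B (c *\<^sub>R \<phi>) = \<bar>c\<bar> * sup_norm B \<phi>"
  proof (cases "c = 0")
    case True
    then show ?thesis using le[OF \<phi>, of c] nn[OF c\<phi>] by simp
  next
    case False
    have "sup_norm B ((1 / c) *\<^sub>R (c *\<^sub>R \<phi>)) \<le> \<bar>1 / c\<bar> * sup_norm B (c *\<^sub>R \<phi>)" by (rule le[OF c\<phi>])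
    then have "\<bar>c\<bar> * sup_norm B \<phi> \<le> sup_norm B (c *\<^sub>R \<phi>)" using False by (simp add: field_simps)
    then show ?thesis using le[OF \<phi>, of c] by linarith
  qed
qed

interpretation dual: seminormed_space "tvs_dual (sym_smooth_top k)" "sup_norms k" for k
proof
  show "subspace (tvs_dual (sym_smooth_top k))" by (rule subspace_dual)
  have "tvs_bounded (sym_smooth_top k) {0 :: 'a obs}"
    using subspace_0[OF subspace_sym_smooth] by (intro tvs_bounded_zero) (simp only: topspace_sym_smooth_top)
  then have "sup_norm {0 :: 'a obs} \<in> sup_norms k"
    unfolding sup_norms_def by (intro CollectI exI[of _ "{0}"]) simp
  then show "sup_norms k \<noteq> ({} :: (('a obs \<Rightarrow> real) \<Rightarrow> real) set)" by (metis empty_iff)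
  show "seminorm_on (tvs_dual (sym_smooth_top k)) p" if p: "p \<in> sup_norms k" for p :: "('a obs \<Rightarrow> real) \<Rightarrow> real"
  proof -
    obtain B where "p = sup_norm B" "tvs_bounded (sym_smooth_top k) B" "B \<noteq> {}"
      using p unfolding sup_norms_def mem_Collect_eq by (elim exE conjE)
    then show ?thesis using seminorm_on_sup_norm by metis
  qed
qed

lemma topspace_dual: "topspace (strong_dual (sym_smooth_top k)) = tvs_dual (sym_smooth_top k)"
  unfolding strong_dual_sup_norms by (rule dual.topspace)

section \<open>Tensor products of distributions\<close>

text \<open>Each slot may hold its own distribution, because derivatives of a tensor power put
  directions into single slots. With \<open>foldr\<close> the last slot of the list acts first, as
  in \<open>apply_first\<close>; reordering lists is the form in which Fubini is used.\<close>

definition apply_slots :: "(nat \<Rightarrow> 'd::finite obs \<Rightarrow> real) \<Rightarrow> nat list \<Rightarrow> 'd obs \<Rightarrow> 'd obs" where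
  "apply_slots w xs h = foldr (\<lambda>i g. apply_at (w i) i g) xs h"

lemma apply_slots_Nil [simp]: "apply_slots w [] h = h"
  by (simp add: apply_slots_def)

lemma apply_slots_Cons [simp]: "apply_slots w (i # xs) h = apply_at (w i) i (apply_slots w xs h)"
  by (simp add: apply_slots_def)

lemma apply_slots_append: "apply_slots w (xs @ ys) h = apply_slots w xs (apply_slots w ys h)"
  by (simp add: apply_slots_def)

lemma apply_slots_Suc:
  "apply_slots w [1..<Suc (Suc k)] h = apply_slots w [1..<Suc k] (apply_at (w (Suc k)) (Suc k) h)"
  by (simp add: apply_slots_append)

lemma apply_slots_cong: "(\<And>i. i \<in> set xs \<Longrightarrow> w i = w' i) \<Longrightarrow> apply_slots w xs h = apply_slots w' xs h"
  by (induction xs) simp_all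

lemma apply_first_eq: "apply_first \<gamma> k h = apply_slots (\<lambda>_. \<gamma>) [1..<Suc k] h"
proof (induction k arbitrary: h)
  case (Suc k)
  then show ?case by (simp only: apply_first.simps apply_slots_Suc)
qed simp

lemma smooth_config_apply_slots:
  "(\<And>i. i \<in> set xs \<Longrightarrow> w i \<in> dual1) \<Longrightarrow> smooth_config h \<Longrightarrow> smooth_config (apply_slots w xs h)"
  by (induction xs) (simp_all add: smooth_config_apply_at)

lemma apply_slots_lincomb:
  assumes "\<And>i. i \<in> set xs \<Longrightarrow> w i \<in> dual1" "smooth_config f" "smooth_config g"
  shows "apply_slots w xs (\<lambda>Z. c * f Z + d * g Z) = (\<lambda>Z. c * apply_slots w xs f Z + d * apply_slots w xs g Z)"
  using assms(1)
proof (induction xs)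
  case (Cons i xs)
  have w: "\<And>i. i \<in> set xs \<Longrightarrow> w i \<in> dual1" and wi: "w i \<in> dual1" using Cons.prems by simp_all
  have "apply_at (w i) i (\<lambda>Z. c * apply_slots w xs f Z + d * apply_slots w xs g Z)
      = (\<lambda>Z. c * apply_at (w i) i (apply_slots w xs f) Z + d * apply_at (w i) i (apply_slots w xs g) Z)"
    by (rule apply_at_lincomb[OF wi smooth_config_apply_slots[OF w assms(2)] smooth_config_apply_slots[OF w assms(3)]])
  moreover have "apply_slots w xs (\<lambda>Z. c * f Z + d * g Z) = (\<lambda>Z. c * apply_slots w xs f Z + d * apply_slots w xs g Z)"
    by (rule Cons.IH[OF w])
  ultimately show ?case by (simp only: apply_slots_Cons)
qed simp

lemma depends_on_apply_slots: "depends_on I h \<Longrightarrow> depends_on (I - set xs) (apply_slots w xs h)"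
proof (induction xs)
  case (Cons i xs)
  have "depends_on (I - set xs - {i}) (apply_slots w (i # xs) h)"
    unfolding apply_slots_Cons by (rule depends_on_apply_at[OF Cons.IH[OF Cons.prems]])
  moreover have "I - set xs - {i} = I - set (i # xs)" by auto
  ultimately show ?case by (simp only:)
qed simp

text \<open>\<open>controlled S M k C h\<close> bounds the derivatives of \<open>h\<close> by a product of one-variable weights
  \<open>M\<close>. The key point of the joint continuity of tensor products is that on a bounded set of
  functions the weights can be chosen this way, because \<open>M (max m\<^sub>1 \<dots> m\<^sub>k) \<le> M m\<^sub>1 \<cdots> M m\<^sub>k\<close>
  as soon as \<open>M \<ge> 1\<close>.\<close>

definition controlled :: "nat set \<Rightarrow> (nat \<Rightarrow> real) \<Rightarrow> nat \<Rightarrow> real \<Rightarrow> 'd::finite obs \<Rightarrow> bool" where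
  "controlled S M k C h \<longleftrightarrow> (\<forall>m \<alpha> Z. (\<forall>i\<in>{1..k}. m i \<in> S) \<longrightarrow> \<alpha> \<in> lists ({1..k} \<times> Basis) \<longrightarrow>
     (\<forall>i\<in>{1..k}. length (filter (\<lambda>a. fst a = i) \<alpha>) \<le> m i) \<longrightarrow> (\<forall>i\<in>{1..k}. norm (Z i) \<le> real (m i)) \<longrightarrow>
     \<bar>iter_partial \<alpha> h Z\<bar> \<le> C * (\<Prod>i\<in>{1..k}. M (m i)))"

text \<open>The bound on a factor dual to \<open>controlled\<close>. The set S serves two purposes:
  for \<open>S = {N}\<close> with constant weight this is continuity at a single order, for
  \<open>S = UNIV\<close> it is a strong dual bound over all functions below the weight M.\<close>

definition dominated :: "nat set \<Rightarrow> (nat \<Rightarrow> real) \<Rightarrow> real \<Rightarrow> ('d::finite obs \<Rightarrow> real) \<Rightarrow> bool" where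
  "dominated S M R \<gamma> \<longleftrightarrow> \<gamma> \<in> dual1 \<and> (\<forall>u\<in>sym_smooth 1. \<forall>C\<ge>0.
     (\<forall>m\<in>S. cn_bound 1 m u (C * M m)) \<longrightarrow> \<bar>\<gamma> u\<bar> \<le> R * C)"

lemma dominatedD:
  "dominated S M R \<gamma> \<Longrightarrow> u \<in> sym_smooth 1 \<Longrightarrow> C \<ge> 0 \<Longrightarrow> (\<And>m. m \<in> S \<Longrightarrow> cn_bound 1 m u (C * M m)) \<Longrightarrow> \<bar>\<gamma> u\<bar> \<le> R * C"
  unfolding dominated_def by (elim conjE) (drule (1) bspec, simp)

lemma dominated_dual1: "dominated S M R \<gamma> \<Longrightarrow> \<gamma> \<in> dual1"
  by (simp add: dominated_def)

lemma dominated_mono: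
  assumes "dominated S M R \<gamma>" "R \<le> R'"
  shows "dominated S M R' \<gamma>"
  unfolding dominated_def
proof (intro conjI ballI allI impI)
  fix u :: "'a obs" and C :: real
  assume u: "u \<in> sym_smooth 1" "0 \<le> C" "\<forall>m\<in>S. cn_bound 1 m u (C * M m)"
  have "\<bar>\<gamma> u\<bar> \<le> R * C" using u by (intro dominatedD[OF assms(1)]) simp_all
  also have "\<dots> \<le> R' * C" by (rule mult_right_mono[OF assms(2) u(2)])
  finally show "\<bar>\<gamma> u\<bar> \<le> R' * C" .
qed (rule dominated_dual1[OF assms(1)])

lemma dominated_add_scaleR:
  assumes \<gamma>: "dominated S M R \<gamma>" and \<delta>: "dominated S M R' \<delta>"
  shows "dominated S M (R + \<bar>t\<bar> * R') (\<gamma> + t *\<^sub>R \<delta>)"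
  unfolding dominated_def
proof (intro conjI ballI allI impI)
  show "\<gamma> + t *\<^sub>R \<delta> \<in> dual1"
    by (intro subspace_add[OF subspace_dual] subspace_scale[OF subspace_dual] dominated_dual1[OF \<gamma>] dominated_dual1[OF \<delta>])
  fix u :: "'a obs" and C :: real
  assume u: "u \<in> sym_smooth 1" "0 \<le> C" "\<forall>m\<in>S. cn_bound 1 m u (C * M m)"
  have "\<bar>(\<gamma> + t *\<^sub>R \<delta>) u\<bar> \<le> \<bar>\<gamma> u\<bar> + \<bar>t\<bar> * \<bar>\<delta> u\<bar>"
    unfolding plus_functional scaleR_functional abs_mult[symmetric] by (rule abs_triangle_ineq)
  also have "\<dots> \<le> R * C + \<bar>t\<bar> * (R' * C)"
    using u by (intro add_mono mult_left_mono dominatedD[OF \<gamma>] dominatedD[OF \<delta>]) simp_all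
  finally show "\<bar>(\<gamma> + t *\<^sub>R \<delta>) u\<bar> \<le> (R + \<bar>t\<bar> * R') * C" by (simp add: algebra_simps)
qed

text \<open>With derivatives and positions in the first k slots fixed, the slice in slot
  \<open>Suc k\<close> obeys the weights with constant C times the product over those slots.
  Domination of \<gamma> replaces the missing weight by R.\<close>

lemma controlled_apply_at:
  fixes h :: "'d::finite obs"
  assumes h: "controlled S M (Suc k) C h" "smooth_config h" and \<gamma>: "dominated S M R \<gamma>"
    and pos: "C \<ge> 0" "\<And>m. M m \<ge> 0"
  shows "controlled S M k (R * C) (apply_at \<gamma> (Suc k) h)"
  unfolding controlled_def
proof (intro allI impI)
  fix m and \<alpha> :: "(nat \<times> 'd phase) list" and Z :: "'d config"
  assume m: "\<forall>i\<in>{1..k}. m i \<in> S" and \<alpha>: "\<alpha> \<in> lists ({1..k} \<times> Basis)"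
    and cnt: "\<forall>i\<in>{1..k}. length (filter (\<lambda>a. fst a = i) \<alpha>) \<le> m i" and Z: "\<forall>i\<in>{1..k}. norm (Z i) \<le> real (m i)"
  let ?g = "iter_partial \<alpha> h"
  have g: "smooth_config ?g" by (rule smooth_config_iter_partial[OF h(2) lists_subset[OF \<alpha>]])
  let ?P = "\<Prod>i\<in>{1..k}. M (m i)"
  have P: "?P \<ge> 0" by (intro prod_nonneg) (simp add: pos)
  have "\<bar>\<gamma> (slice (Suc k) ?g Z)\<bar> \<le> R * (C * ?P)"
  proof (rule dominatedD[OF \<gamma> slice_in_sym_smooth[OF g]])
    show "0 \<le> C * ?P" using P pos by simp
    fix p assume p: "p \<in> S"
    show "cn_bound 1 p (slice (Suc k) ?g Z) (C * ?P * M p)"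
      unfolding cn_bound_def
    proof (intro ballI allI impI)
      fix \<beta> :: "(nat \<times> 'd phase) list" and W :: "'d config"
      assume \<beta>: "\<beta> \<in> multi_indices 1" "length \<beta> \<le> p" and W: "\<forall>i\<in>{1..1}. norm (W i) \<le> real p"
      \<comment> \<open>The orders granted to the first k slots are extended by the order p that is
        being tested in the last slot.\<close>
      define m' where "m' = m(Suc k := p)"
      let ?\<beta> = "to_slot (Suc k) \<beta>"
      have \<beta>\<alpha>: "?\<beta> @ \<alpha> \<in> lists ({1..Suc k} \<times> Basis)"
        using to_slot_lists[OF \<beta>(1), of "Suc k"] \<alpha> by fastforce
      have f1: "filter (\<lambda>a. fst a = i) ?\<beta> = (if i = Suc k then ?\<beta> else [])" for i
        by (induction \<beta>) auto
      have f2: "filter (\<lambda>a. fst a = Suc k) \<alpha> = []"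
        using \<alpha> by (auto simp: filter_empty_conv)
      have "\<bar>iter_partial (?\<beta> @ \<alpha>) h (Z(Suc k := W 1))\<bar> \<le> C * (\<Prod>i\<in>{1..Suc k}. M (m' i))"
      proof (rule h(1)[unfolded controlled_def, THEN spec, THEN spec, THEN spec, THEN mp, THEN mp, THEN mp, THEN mp])
        show "\<forall>i\<in>{1..Suc k}. m' i \<in> S" using m p by (auto simp: m'_def)
        show "?\<beta> @ \<alpha> \<in> lists ({1..Suc k} \<times> Basis)" by (rule \<beta>\<alpha>)
        show "\<forall>i\<in>{1..Suc k}. length (filter (\<lambda>a. fst a = i) (?\<beta> @ \<alpha>)) \<le> m' i"
        proof
          fix i assume i: "i \<in> {1..Suc k}"
          show "length (filter (\<lambda>a. fst a = i) (?\<beta> @ \<alpha>)) \<le> m' i"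
          proof (cases "i = Suc k")
            case True
            then show ?thesis using \<beta>(2) by (simp add: f1 f2 m'_def)
          next
            case False
            then have "i \<in> {1..k}" using i by auto
            then show ?thesis using cnt False by (simp add: f1 m'_def)
          qed
        qed
        show "\<forall>i\<in>{1..Suc k}. norm ((Z(Suc k := W 1)) i) \<le> real (m' i)"
        proof
          fix i assume i: "i \<in> {1..Suc k}"
          show "norm ((Z(Suc k := W 1)) i) \<le> real (m' i)"
          proof (cases "i = Suc k")
            case True
            then show ?thesis using W by (simp add: m'_def)
          next
            case False
            then have "i \<in> {1..k}" using i by auto
            then show ?thesis using Z False by (simp add: m'_def)
          qed
        qed
      qed
      moreover have "(\<Prod>i\<in>{1..Suc k}. M (m' i)) = ?P * M p"
      proof -
        have "(\<Prod>i\<in>{1..k}. M (m' i)) = ?P" by (rule prod.cong) (auto simp: m'_def)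
        then show ?thesis by (simp add: m'_def)
      qed
      moreover have "iter_partial \<beta> (slice (Suc k) ?g Z) W = iter_partial (?\<beta> @ \<alpha>) h (Z(Suc k := W 1))"
        unfolding iter_partial_append by (rule iter_partial_slice_at[OF \<beta>(1)])
      ultimately show "\<bar>iter_partial \<beta> (slice (Suc k) ?g Z) W\<bar> \<le> C * ?P * M p" by (simp only: mult.assoc)
    qed
  qed
  moreover have "iter_partial \<alpha> (apply_at \<gamma> (Suc k) h) = apply_at \<gamma> (Suc k) ?g"
    by (rule iter_partial_apply_at[OF dominated_dual1[OF \<gamma>] h(2) \<alpha>]) simp
  ultimately show "\<bar>iter_partial \<alpha> (apply_at \<gamma> (Suc k) h) Z\<bar> \<le> R * C * ?P"
    by (simp only: apply_at_slice mult.assoc)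
qed

lemma controlled_0D:
  assumes "controlled S M 0 C h" shows "\<bar>h Z\<bar> \<le> C"
  using assms[unfolded controlled_def, THEN spec, THEN spec, THEN spec, THEN mp, THEN mp, THEN mp, THEN mp, of "\<lambda>_. 0" "[]" Z]
  by simp

lemma mem_upt: "i \<in> set [1..<Suc k] \<Longrightarrow> i \<in> {1..k}"
  by (simp only: set_upt atLeastLessThanSuc_atLeastAtMost)

lemma tensor_bound:
  fixes h :: "'d::finite obs"
  assumes R: "R \<ge> 0" and M: "\<And>m. M m \<ge> 0"
  shows "controlled S M k C h \<Longrightarrow> smooth_config h \<Longrightarrow> C \<ge> 0 \<Longrightarrow> (\<And>i. i \<in> {1..k} \<Longrightarrow> dominated S M R (w i)) \<Longrightarrow>
    \<bar>apply_slots w [1..<Suc k] h Z\<bar> \<le> R ^ k * C"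
proof (induction k arbitrary: h C)
  case 0
  then show ?case using controlled_0D[OF 0(1), of Z] by simp
next
  case (Suc k)
  have wk: "dominated S M R (w (Suc k))" by (rule Suc.prems(4)) simp
  have "\<bar>apply_slots w [1..<Suc k] (apply_at (w (Suc k)) (Suc k) h) Z\<bar> \<le> R ^ k * (R * C)"
  proof (rule Suc.IH)
    show "controlled S M k (R * C) (apply_at (w (Suc k)) (Suc k) h)"
      by (rule controlled_apply_at[OF Suc.prems(1,2) wk Suc.prems(3) M])
    show "smooth_config (apply_at (w (Suc k)) (Suc k) h)"
      by (rule smooth_config_apply_at[OF dominated_dual1[OF wk] Suc.prems(2)])
    show "0 \<le> R * C" using R Suc.prems(3) by simp
    show "dominated S M R (w i)" if "i \<in> {1..k}" for i using that by (intro Suc.prems(4)) simp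
  qed
  then show ?case unfolding apply_slots_Suc by (simp add: mult.assoc mult.left_commute)
qed

text \<open>The slots are exchanged one at a time, each exchange costing \<eta> instead of R. Since
  R is at least 1, all terms fit under the same power of R.\<close>

lemma tensor_diff_bound:
  fixes h :: "'d::finite obs"
  assumes R: "R \<ge> 1" and M: "\<And>m. M m \<ge> 0" and \<eta>: "\<eta> \<ge> 0"
  shows "controlled S M k C h \<Longrightarrow> smooth_config h \<Longrightarrow> C \<ge> 0 \<Longrightarrow>
    (\<And>i. i \<in> {1..k} \<Longrightarrow> dominated S M R (w i)) \<Longrightarrow> (\<And>i. i \<in> {1..k} \<Longrightarrow> dominated S M R (w' i)) \<Longrightarrow>
    (\<And>i. i \<in> {1..k} \<Longrightarrow> dominated S M \<eta> (w i - w' i)) \<Longrightarrow>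
    \<bar>apply_slots w [1..<Suc k] h Z - apply_slots w' [1..<Suc k] h Z\<bar> \<le> real k * \<eta> * R ^ k * C"
proof (induction k arbitrary: h C)
  case 0
  then show ?case by simp
next
  case (Suc k)
  note h = Suc.prems(2)
  have R0: "R \<ge> 0" using R by simp
  have k1: "Suc k \<in> {1..Suc k}" by simp
  note wk = Suc.prems(4)[OF k1] Suc.prems(5)[OF k1] Suc.prems(6)[OF k1]
  have sub: "i \<in> {1..Suc k}" if "i \<in> {1..k}" for i using that by simp
  note wi = Suc.prems(4)[OF sub] Suc.prems(5)[OF sub] Suc.prems(6)[OF sub]
  have RC: "R * C \<ge> 0" and \<eta>C: "\<eta> * C \<ge> 0" using R0 \<eta> Suc.prems(3) by simp_all
  note d1 = wk[THEN dominated_dual1]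
  let ?f = "apply_at (w' (Suc k)) (Suc k) h" and ?g = "apply_at (w (Suc k) - w' (Suc k)) (Suc k) h"
  have f: "smooth_config ?f" "controlled S M k (R * C) ?f"
    by (rule smooth_config_apply_at[OF d1(2) h]) (rule controlled_apply_at[OF Suc.prems(1,2) wk(2) Suc.prems(3) M])
  have g: "smooth_config ?g" "controlled S M k (\<eta> * C) ?g"
    by (rule smooth_config_apply_at[OF d1(3) h]) (rule controlled_apply_at[OF Suc.prems(1,2) wk(3) Suc.prems(3) M])
  \<comment> \<open>In the last slot w is split as \<open>w' + (w - w')\<close>: the first part
    leaves a difference in fewer slots, the second is small by itself.\<close>
  have fg: "apply_at (w (Suc k)) (Suc k) h = (\<lambda>Z. 1 * ?f Z + 1 * ?g Z)"
    by (simp add: apply_at_def fun_eq_iff)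
  have "apply_slots w [1..<Suc k] (\<lambda>Z. 1 * ?f Z + 1 * ?g Z) =
      (\<lambda>Z. 1 * apply_slots w [1..<Suc k] ?f Z + 1 * apply_slots w [1..<Suc k] ?g Z)"
    by (rule apply_slots_lincomb[OF dominated_dual1[OF wi(1)[OF mem_upt]] f(1) g(1)])
  then have "apply_slots w [1..<Suc (Suc k)] h Z - apply_slots w' [1..<Suc (Suc k)] h Z
    = (apply_slots w [1..<Suc k] ?f Z - apply_slots w' [1..<Suc k] ?f Z) + apply_slots w [1..<Suc k] ?g Z"
    unfolding apply_slots_Suc fg by simp
  moreover have "\<bar>apply_slots w [1..<Suc k] ?f Z - apply_slots w' [1..<Suc k] ?f Z\<bar> \<le> real k * \<eta> * R ^ k * (R * C)"
    by (rule Suc.IH[OF f(2,1) RC wi(1) wi(2) wi(3)])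
  moreover have "\<bar>apply_slots w [1..<Suc k] ?g Z\<bar> \<le> R ^ k * (\<eta> * C)"
    by (rule tensor_bound[OF R0 M g(2,1) \<eta>C wi(1)])
  moreover have "R ^ k * (\<eta> * C) \<le> R ^ Suc k * (\<eta> * C)"
    using R \<eta> Suc.prems(3) by (intro mult_right_mono power_increasing) simp_all
  moreover have "real k * \<eta> * R ^ k * (R * C) + R ^ Suc k * (\<eta> * C) = real (Suc k) * \<eta> * R ^ Suc k * C"
    by (simp add: algebra_simps)
  ultimately show ?case by linarith
qed

text \<open>The product rule with a quadratic remainder. The constant E is chosen before h, so the
  estimate is uniform over every set of functions controlled by the same weights.\<close>

lemma tensor_derivative_bound:
  fixes w d :: "nat \<Rightarrow> 'd::finite obs \<Rightarrow> real"
  assumes R: "R \<ge> 1" and M: "\<And>m. M m \<ge> 0"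
  shows "\<forall>i\<in>{1..k}. dominated S M R (w i) \<Longrightarrow> \<forall>i\<in>{1..k}. dominated S M R (d i) \<Longrightarrow>
    \<exists>E\<ge>0. \<forall>h C t Z. controlled S M k C h \<longrightarrow> smooth_config h \<longrightarrow> C \<ge> 0 \<longrightarrow> \<bar>t\<bar> \<le> 1 \<longrightarrow>
      \<bar>apply_slots (\<lambda>i. w i + t *\<^sub>R d i) [1..<Suc k] h Z - apply_slots w [1..<Suc k] h Z
        - t * (\<Sum>j\<in>{1..k}. apply_slots (w(j := d j)) [1..<Suc k] h Z)\<bar> \<le> E * t\<^sup>2 * C"
proof (induction k)
  case 0
  show ?case by (intro exI[of _ 0]) simp
next
  case (Suc k)
  have wi: "dominated S M R (w i)" "dominated S M R (d i)" if "i \<in> {1..k}" for i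
    using Suc.prems that by simp_all
  have wb1: "\<forall>i\<in>{1..k}. dominated S M R (w i)" by (rule ballI) (rule wi(1))
  have wb2: "\<forall>i\<in>{1..k}. dominated S M R (d i)" by (rule ballI) (rule wi(2))
  have wk: "dominated S M R (w (Suc k))" "dominated S M R (d (Suc k))" using Suc.prems by simp_all
  note d1 = wk[THEN dominated_dual1]
  obtain E where E: "E \<ge> 0" "\<forall>h C t Z. controlled S M k C h \<longrightarrow> smooth_config h \<longrightarrow> C \<ge> 0 \<longrightarrow> \<bar>t\<bar> \<le> 1 \<longrightarrow>
      \<bar>apply_slots (\<lambda>i. w i + t *\<^sub>R d i) [1..<Suc k] h Z - apply_slots w [1..<Suc k] h Z
        - t * (\<Sum>j\<in>{1..k}. apply_slots (w(j := d j)) [1..<Suc k] h Z)\<bar> \<le> E * t\<^sup>2 * C"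
    using Suc.IH[OF wb1 wb2] by (elim exE conjE)
  note E2 = E(2)[THEN spec, THEN spec, THEN spec, THEN spec, THEN mp, THEN mp, THEN mp, THEN mp]
  \<comment> \<open>The first term is the remainder in the first k slots with w in the last. The
    second pairs t times d in the last slot with the change of the other slots, again of size
    \<open>\<bar>t\<bar> * R\<close>; for \<open>\<bar>t\<bar> \<le> 1\<close> the perturbed factors
    are dominated with \<open>2 * R\<close>.\<close>
  define F where "F = E * R + real k * R * (2 * R) ^ k * R"
  have R0: "R \<ge> 0" and R2: "2 * R \<ge> 1" using R by simp_all
  have F: "F \<ge> 0" using E(1) R0 by (simp add: F_def)
  have main: "\<bar>apply_slots (\<lambda>i. w i + t *\<^sub>R d i) [1..<Suc (Suc k)] h Z - apply_slots w [1..<Suc (Suc k)] h Z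
        - t * (\<Sum>j\<in>{1..Suc k}. apply_slots (w(j := d j)) [1..<Suc (Suc k)] h Z)\<bar> \<le> F * t\<^sup>2 * C"
    if hc: "controlled S M (Suc k) C h" and h: "smooth_config h" and C: "C \<ge> 0" and t: "\<bar>t\<bar> \<le> 1" for h C t Z
  proof -
    let ?f = "apply_at (w (Suc k)) (Suc k) h" and ?g = "apply_at (d (Suc k)) (Suc k) h"
    let ?wt = "\<lambda>i. w i + t *\<^sub>R d i" and ?xs = "[1..<Suc k]"
    have f: "smooth_config ?f" "controlled S M k (R * C) ?f"
      by (rule smooth_config_apply_at[OF d1(1) h]) (rule controlled_apply_at[OF hc h wk(1) C M])
    have g: "smooth_config ?g" "controlled S M k (R * C) ?g"
      by (rule smooth_config_apply_at[OF d1(2) h]) (rule controlled_apply_at[OF hc h wk(2) C M])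
    have RC: "R * C \<ge> 0" using R0 C by simp
    have tR: "\<bar>t\<bar> * R \<ge> 0" using R0 by simp
    have R2t: "R + \<bar>t\<bar> * R \<le> 2 * R" using mult_right_mono[OF t R0] by simp
    have wt: "dominated S M (2 * R) (?wt i)" if "i \<in> {1..k}" for i
      by (rule dominated_mono[OF dominated_add_scaleR[OF wi[OF that]] R2t])
    have w2: "dominated S M (2 * R) (w i)" if "i \<in> {1..k}" for i
      by (rule dominated_mono[OF wi(1)[OF that]]) (use R0 in simp)
    have wd: "dominated S M (\<bar>t\<bar> * R) (?wt i - w i)" if "i \<in> {1..k}" for i
    proof -
      have "dominated S M 0 0"
        unfolding dominated_def using subspace_0[OF subspace_dual[of 1]] by simp
      from dominated_add_scaleR[OF this wi(2)[OF that], of t] show ?thesis by simp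
    qed
    have fg: "apply_at (?wt (Suc k)) (Suc k) h = (\<lambda>Z. 1 * ?f Z + t * ?g Z)"
      by (simp add: apply_at_def fun_eq_iff scaleR_functional)
    have "apply_slots ?wt ?xs (\<lambda>Z. 1 * ?f Z + t * ?g Z) = (\<lambda>Z. 1 * apply_slots ?wt ?xs ?f Z + t * apply_slots ?wt ?xs ?g Z)"
      by (rule apply_slots_lincomb[OF dominated_dual1[OF wt[OF mem_upt]] f(1) g(1)])
    then have 1: "apply_slots ?wt [1..<Suc (Suc k)] h Z = apply_slots ?wt ?xs ?f Z + t * apply_slots ?wt ?xs ?g Z"
      unfolding apply_slots_Suc fg by simp
    have "apply_slots (w(j := d j)) [1..<Suc (Suc k)] h Z = apply_slots (w(j := d j)) ?xs ?f Z" if "j \<in> {1..k}" for j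
      using that unfolding apply_slots_Suc by simp
    then have "(\<Sum>j\<in>{1..k}. apply_slots (w(j := d j)) [1..<Suc (Suc k)] h Z) = (\<Sum>j\<in>{1..k}. apply_slots (w(j := d j)) ?xs ?f Z)"
      by (intro sum.cong) simp_all
    moreover have "apply_slots (w(Suc k := d (Suc k))) [1..<Suc (Suc k)] h Z = apply_slots w ?xs ?g Z"
    proof -
      have "apply_slots (w(Suc k := d (Suc k))) ?xs ?g = apply_slots w ?xs ?g" by (rule apply_slots_cong) auto
      then show ?thesis unfolding apply_slots_Suc by simp
    qed
    ultimately have 2: "(\<Sum>j\<in>{1..Suc k}. apply_slots (w(j := d j)) [1..<Suc (Suc k)] h Z)
      = (\<Sum>j\<in>{1..k}. apply_slots (w(j := d j)) ?xs ?f Z) + apply_slots w ?xs ?g Z" by simp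
    have A: "\<bar>apply_slots ?wt ?xs ?f Z - apply_slots w ?xs ?f Z - t * (\<Sum>j\<in>{1..k}. apply_slots (w(j := d j)) ?xs ?f Z)\<bar>
      \<le> E * t\<^sup>2 * (R * C)" by (rule E2[OF f(2,1) RC t])
    have "\<bar>apply_slots ?wt ?xs ?g Z - apply_slots w ?xs ?g Z\<bar> \<le> real k * (\<bar>t\<bar> * R) * (2 * R) ^ k * (R * C)"
      by (rule tensor_diff_bound[OF R2 M tR g(2,1) RC wt w2 wd])
    then have "\<bar>t\<bar> * \<bar>apply_slots ?wt ?xs ?g Z - apply_slots w ?xs ?g Z\<bar> \<le> \<bar>t\<bar> * (real k * (\<bar>t\<bar> * R) * (2 * R) ^ k * (R * C))"
      by (rule mult_left_mono) simp
    also have "\<dots> = real k * R * (2 * R) ^ k * R * (\<bar>t\<bar> * \<bar>t\<bar>) * C" by (simp only: mult_ac)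
    also have "\<bar>t\<bar> * \<bar>t\<bar> = t\<^sup>2" by (simp add: power2_eq_square)
    finally have B: "\<bar>t * (apply_slots ?wt ?xs ?g Z - apply_slots w ?xs ?g Z)\<bar> \<le> real k * R * (2 * R) ^ k * R * t\<^sup>2 * C"
      by (simp only: abs_mult)
    have 3: "apply_slots ?wt [1..<Suc (Suc k)] h Z - apply_slots w [1..<Suc (Suc k)] h Z
        - t * (\<Sum>j\<in>{1..Suc k}. apply_slots (w(j := d j)) [1..<Suc (Suc k)] h Z)
      = (apply_slots ?wt ?xs ?f Z - apply_slots w ?xs ?f Z - t * (\<Sum>j\<in>{1..k}. apply_slots (w(j := d j)) ?xs ?f Z))
        + t * (apply_slots ?wt ?xs ?g Z - apply_slots w ?xs ?g Z)"
      unfolding 1 2 unfolding apply_slots_Suc by (simp add: algebra_simps)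
    have "F * t\<^sup>2 * C = E * t\<^sup>2 * (R * C) + real k * R * (2 * R) ^ k * R * t\<^sup>2 * C"
      unfolding F_def by (simp add: algebra_simps)
    then show ?thesis unfolding 3 using A B by linarith
  qed
  show ?case by (intro exI[of _ F] conjI allI impI F main)
qed

context seminormed_space
begin

lemma continuous_mapD:
  assumes "continuous_map T (seminorm_topology V P) f" "p \<in> P" "z \<in> topspace T" "e > 0"
  shows "\<exists>N. openin T N \<and> z \<in> N \<and> (\<forall>w\<in>N. f w \<in> V \<and> p (f w - f z) < e)"
proof -
  have fz: "f z \<in> V" using continuous_map_image_subset_topspace[OF assms(1)] assms(3) by (auto simp: topspace)
  have "openin T {w \<in> topspace T. f w \<in> {y \<in> V. p (y - f z) < e}}"
    by (rule openin_continuous_map_preimage[OF assms(1) openin_ball[OF assms(2) fz assms(4)]])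
  moreover have "z \<in> {w \<in> topspace T. f w \<in> {y \<in> V. p (y - f z) < e}}"
    using fz assms zero[OF assms(2)] by simp
  ultimately show ?thesis
    by (intro exI[of _ "{w \<in> topspace T. f w \<in> {y \<in> V. p (y - f z) < e}}"]) simp
qed

lemma continuous_map_sum2:
  assumes f: "continuous_map T (seminorm_topology V P) f" and g: "continuous_map T (seminorm_topology V P) g"
  shows "continuous_map T (seminorm_topology V P) (\<lambda>z. f z + g z)"
proof (rule continuous_mapI)
  have fV: "f z \<in> V" and gV: "g z \<in> V" if "z \<in> topspace T" for z
    using continuous_map_image_subset_topspace[OF f] continuous_map_image_subset_topspace[OF g] that
    by (auto simp: topspace)
  show "f z + g z \<in> V" if "z \<in> topspace T" for z
    using fV[OF that] gV[OF that] subspace by (rule subspace_add[rotated])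
  fix p z and e :: real assume p: "p \<in> P" and z: "z \<in> topspace T" and e: "e > 0"
  have e2: "e / 2 > 0" using e by simp
  obtain A where A: "openin T A" "z \<in> A" "\<forall>w\<in>A. f w \<in> V \<and> p (f w - f z) < e / 2"
    using continuous_mapD[OF f p z e2] by (elim exE conjE)
  obtain B where B: "openin T B" "z \<in> B" "\<forall>w\<in>B. g w \<in> V \<and> p (g w - g z) < e / 2"
    using continuous_mapD[OF g p z e2] by (elim exE conjE)
  have "p (f w + g w - (f z + g z)) < e" if "w \<in> A \<inter> B" for w
  proof -
    have w: "w \<in> A" "w \<in> B" using that by simp_all
    have "f w - f z \<in> V" "g w - g z \<in> V"
      using A(3) B(3) w fV[OF z] gV[OF z] by (simp_all add: subspace_diff[OF subspace])
    then have "p ((f w - f z) + (g w - g z)) \<le> p (f w - f z) + p (g w - g z)" by (rule triangle[OF p])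
    also have "\<dots> < e / 2 + e / 2" using bspec[OF A(3) w(1)] bspec[OF B(3) w(2)] by (intro add_strict_mono) simp_all
    also have "(f w - f z) + (g w - g z) = f w + g w - (f z + g z)" by (rule add_diff_add[symmetric])
    finally show ?thesis by simp
  qed
  then show "\<exists>N. openin T N \<and> z \<in> N \<and> (\<forall>w\<in>N. p (f w + g w - (f z + g z)) < e)"
    using A B by (intro exI[of _ "A \<inter> B"]) (simp add: openin_Int)
qed

lemma limitin_sum2:
  assumes f: "limitin (seminorm_topology V P) f a F" and g: "limitin (seminorm_topology V P) g b F"
  shows "limitin (seminorm_topology V P) (\<lambda>z. f z + g z) (a + b) F"
proof -
  obtain p0 where p0: "p0 \<in> P" using nonempty by blast
  have ab: "a \<in> V" "b \<in> V" using f g by (simp_all add: limitin_def topspace)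
  show ?thesis
  proof (rule limitinI)
    show "a + b \<in> V" by (rule subspace_add[OF subspace ab])
    show "\<forall>\<^sub>F z in F. f z + g z \<in> V"
      using limitinD[OF f p0 zero_less_one] limitinD[OF g p0 zero_less_one]
      by eventually_elim (simp add: subspace_add[OF subspace])
    fix p and e :: real assume p: "p \<in> P" and e: "e > 0"
    have e2: "e / 2 > 0" using e by simp
    show "\<forall>\<^sub>F z in F. p (f z + g z - (a + b)) < e"
      using limitinD[OF f p e2] limitinD[OF g p e2]
    proof eventually_elim
      case (elim z)
      have "f z - a \<in> V" "g z - b \<in> V" using elim ab by (simp_all add: subspace_diff[OF subspace])
      then have "p ((f z - a) + (g z - b)) \<le> p (f z - a) + p (g z - b)" by (rule triangle[OF p])
      also have "\<dots> < e / 2 + e / 2" using elim by (intro add_strict_mono) simp_all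
      also have "(f z - a) + (g z - b) = f z + g z - (a + b)" by (rule add_diff_add[symmetric])
      finally show ?case by simp
    qed
  qed
qed

end

section \<open>Continuity and derivatives of tensor products in the strong dual\<close>

text \<open>The multilinear map whose diagonal is \<open>tensor_power\<close>, with the value 0 off
  \<open>sym_smooth k\<close> that \<open>tvs_dual\<close> requires.\<close>

definition tens :: "(nat \<Rightarrow> 'd::finite obs \<Rightarrow> real) \<Rightarrow> nat \<Rightarrow> 'd obs \<Rightarrow> real" where
  "tens w k f = (if f \<in> sym_smooth k then apply_slots w [1..<Suc k] f (\<lambda>i. 0) else 0)"

lemma tensor_power_tens: "tensor_power \<gamma> k = tens (\<lambda>_. \<gamma>) k"
  by (intro ext) (simp only: tensor_power_def tens_def apply_first_eq)

lemma length_by_slot: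
  fixes \<alpha> :: "(nat \<times> 'd::finite phase) list"
  shows "\<alpha> \<in> lists ({1..k} \<times> Basis) \<Longrightarrow> length \<alpha> = (\<Sum>i\<in>{1..k}. length (filter (\<lambda>a. fst a = i) \<alpha>))"
proof (induction \<alpha>)
  case (Cons a \<alpha>)
  then have a: "fst a \<in> {1..k}" and IH: "length \<alpha> = (\<Sum>i\<in>{1..k}. length (filter (\<lambda>a. fst a = i) \<alpha>))" by auto
  have "(\<Sum>i\<in>{1..k}. length (filter (\<lambda>a. fst a = i) (a # \<alpha>)))
      = (\<Sum>i\<in>{1..k}. (if fst a = i then 1 else 0) + length (filter (\<lambda>a. fst a = i) \<alpha>))"
    by (rule sum.cong) simp_all
  also have "\<dots> = (\<Sum>i\<in>{1..k}. if fst a = i then 1 else 0) + length \<alpha>"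
    by (simp only: sum.distrib IH)
  also have "(\<Sum>i\<in>{1..k}. if fst a = i then 1 else 0) = (1::nat)"
    using a sum.delta'[of "{1..k}" "fst a" "\<lambda>_. 1 :: nat"] by simp
  finally show ?case by simp
qed simp

text \<open>At most N derivatives in each of k slots make a total order of at most
  \<open>k * N\<close>; the further N leaves room for the radius.\<close>

lemma cn_bound_imp_iter_bound:
  fixes f :: "'d::finite obs"
  assumes f: "cn_bound k (k * N + N) f C" and \<alpha>: "\<alpha> \<in> lists ({1..k} \<times> Basis)"
    and m: "\<And>i. i \<in> {1..k} \<Longrightarrow> m i \<le> N"
    and cnt: "\<forall>i\<in>{1..k}. length (filter (\<lambda>a. fst a = i) \<alpha>) \<le> m i" and Z: "\<forall>i\<in>{1..k}. norm (Z i) \<le> real (m i)"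
  shows "\<bar>iter_partial \<alpha> f Z\<bar> \<le> C"
proof (rule f[unfolded cn_bound_def, THEN bspec, THEN mp, THEN spec, THEN mp])
  show "\<alpha> \<in> multi_indices k" using \<alpha> by (simp add: multi_indices_def)
  have "length \<alpha> = (\<Sum>i\<in>{1..k}. length (filter (\<lambda>a. fst a = i) \<alpha>))" by (rule length_by_slot[OF \<alpha>])
  also have "\<dots> \<le> (\<Sum>i\<in>{1..k}. N)"
  proof (rule sum_mono)
    fix i assume i: "i \<in> {1..k}"
    show "length (filter (\<lambda>a. fst a = i) \<alpha>) \<le> N" using bspec[OF cnt i] m[OF i] by linarith
  qed
  finally show "length \<alpha> \<le> k * N + N" by simp
  show "\<forall>i\<in>{1..k}. norm (Z i) \<le> real (k * N + N)"
  proof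
    fix i assume i: "i \<in> {1..k}"
    have "real (m i) \<le> real (k * N + N)" unfolding of_nat_le_iff using m[OF i] by (rule trans_le_add2)
    then show "norm (Z i) \<le> real (k * N + N)" using bspec[OF Z i] by linarith
  qed
qed

lemma controlled_singleton:
  assumes "cn_bound k (k * N + N) f C"
  shows "controlled {N} (\<lambda>_. 1) k C f"
  unfolding controlled_def
proof (intro allI impI)
  fix m :: "nat \<Rightarrow> nat" and \<alpha> :: "(nat \<times> 'a phase) list" and Z :: "'a config"
  assume m: "\<forall>i\<in>{1..k}. m i \<in> {N}" and \<alpha>: "\<alpha> \<in> lists ({1..k} \<times> Basis)"
    "\<forall>i\<in>{1..k}. length (filter (\<lambda>a. fst a = i) \<alpha>) \<le> m i" "\<forall>i\<in>{1..k}. norm (Z i) \<le> real (m i)"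
  have "\<bar>iter_partial \<alpha> f Z\<bar> \<le> C"
    by (rule cn_bound_imp_iter_bound[OF assms \<alpha>(1) _ \<alpha>(2,3)]) (use m in simp)
  then show "\<bar>iter_partial \<alpha> f Z\<bar> \<le> C * (\<Prod>i\<in>{1..k}. 1)" by simp
qed

lemma controlled_UNIV:
  assumes k: "k \<ge> 1" and f: "\<And>m. cn_bound k (k * m + m) f (M m)" and M: "\<And>m. M m \<ge> 1"
  shows "controlled UNIV M k 1 f"
  unfolding controlled_def
proof (intro allI impI)
  fix m :: "nat \<Rightarrow> nat" and \<alpha> :: "(nat \<times> 'a phase) list" and Z :: "'a config"
  assume \<alpha>: "\<alpha> \<in> lists ({1..k} \<times> Basis)"
    "\<forall>i\<in>{1..k}. length (filter (\<lambda>a. fst a = i) \<alpha>) \<le> m i" "\<forall>i\<in>{1..k}. norm (Z i) \<le> real (m i)"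
  have ne: "m ` {1..k} \<noteq> {}" using k by simp
  have fin: "finite (m ` {1..k})" by simp
  obtain j where j: "j \<in> {1..k}" "Max (m ` {1..k}) = m j" using Max_in[OF fin ne] by (elim imageE)
  have "\<bar>iter_partial \<alpha> f Z\<bar> \<le> M (m j)"
  proof (rule cn_bound_imp_iter_bound[OF f \<alpha>(1) _ \<alpha>(2,3)])
    fix i assume "i \<in> {1..k}"
    then show "m i \<le> m j" unfolding j(2)[symmetric] by (intro Max_ge[OF fin] imageI)
  qed
  also have "M (m j) * 1 \<le> M (m j) * (\<Prod>i\<in>{1..k} - {j}. M (m i))"
    using M[of "m j"] by (intro mult_left_mono prod_ge_1 M) linarith
  then have "M (m j) \<le> M (m j) * (\<Prod>i\<in>{1..k} - {j}. M (m i))" by simp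
  also have "\<dots> = (\<Prod>i\<in>{1..k}. M (m i))" by (rule prod.remove[symmetric, OF _ j(1)]) simp
  finally show "\<bar>iter_partial \<alpha> f Z\<bar> \<le> 1 * (\<Prod>i\<in>{1..k}. M (m i))" by simp
qed

text \<open>All orders from N on are admissible, which lets finitely many distributions be dominated
  at one common order.\<close>

lemma dual1_dominated:
  assumes \<gamma>: "\<gamma> \<in> dual1"
  shows "\<exists>N R. R \<ge> 0 \<and> (\<forall>n\<ge>N. dominated {n} (\<lambda>_. 1) R \<gamma>)"
proof -
  obtain N C where C: "C \<ge> 0" "\<forall>f\<in>sym_smooth 1. \<forall>M\<ge>0. cn_bound 1 N f M \<longrightarrow> \<bar>\<gamma> f\<bar> \<le> C * M"
    using dual_cn_bound[OF \<gamma>] by (elim exE conjE)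
  have "dominated {n} (\<lambda>_. 1) C \<gamma>" if n: "n \<ge> N" for n
    unfolding dominated_def
  proof (intro conjI ballI allI impI \<gamma>)
    fix u :: "'a obs" and D :: real
    assume u: "u \<in> sym_smooth 1" "0 \<le> D" "\<forall>m\<in>{n}. cn_bound 1 m u (D * 1)"
    then have "cn_bound 1 n u D" by simp
    then have "cn_bound 1 N u D" using n by (rule cn_bound_mono) simp
    then show "\<bar>\<gamma> u\<bar> \<le> C * D" by (rule C(2)[THEN bspec, THEN spec, THEN mp, THEN mp, OF u(1,2)])
  qed
  then show ?thesis using C(1) by (intro exI[of _ N] exI[of _ C]) simp
qed

text \<open>Continuity of one fixed tensor product needs a single order only: all factors are
  dominated at the same N with constant weight, the common N and R being sums of the individual
  ones.\<close>

lemma tens_dual: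
  fixes w :: "nat \<Rightarrow> 'd::finite obs \<Rightarrow> real"
  assumes w: "\<And>i. i \<in> {1..k} \<Longrightarrow> w i \<in> dual1"
  shows "tens w k \<in> tvs_dual (sym_smooth_top k)"
proof -
  have "\<forall>i\<in>{1..k}. \<exists>NR. snd NR \<ge> 0 \<and> (\<forall>n\<ge>fst NR. dominated {n} (\<lambda>_. 1) (snd NR) (w i))"
  proof
    fix i assume i: "i \<in> {1..k}"
    obtain N R where "R \<ge> 0 \<and> (\<forall>n\<ge>N. dominated {n} (\<lambda>_. 1) R (w i))"
      using dual1_dominated[OF w[OF i]] by (elim exE)
    then show "\<exists>NR. snd NR \<ge> 0 \<and> (\<forall>n\<ge>fst NR. dominated {n} (\<lambda>_. 1) (snd NR) (w i))"
      by (intro exI[of _ "(N, R)"]) simp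
  qed
  from bchoice[OF this] obtain NR where NR: "\<forall>i\<in>{1..k}. snd (NR i) \<ge> 0 \<and> (\<forall>n\<ge>fst (NR i). dominated {n} (\<lambda>_. 1) (snd (NR i)) (w i))"
    by (elim exE)
  define N where "N = (\<Sum>i\<in>{1..k}. fst (NR i))"
  define R where "R = (\<Sum>i\<in>{1..k}. snd (NR i))"
  have R: "R \<ge> 0" unfolding R_def by (rule sum_nonneg) (use NR in simp)
  have dom: "dominated {N} (\<lambda>_. 1) R (w i)" if i: "i \<in> {1..k}" for i
  proof (rule dominated_mono)
    have "fst (NR i) \<le> N" unfolding N_def using i by (intro member_le_sum) simp_all
    then show "dominated {N} (\<lambda>_. 1) (snd (NR i)) (w i)" using bspec[OF NR i] by simp
    show "snd (NR i) \<le> R" unfolding R_def using i NR by (intro member_le_sum) simp_all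
  qed
  have lin: "tens w k (\<lambda>Z. c * f Z + d * g Z) = c * tens w k f + d * tens w k g"
    if "f \<in> sym_smooth k" "g \<in> sym_smooth k" for f g c d
    unfolding tens_def
    by (simp only: that sym_smooth_lincomb[OF that] if_True
        apply_slots_lincomb[OF w[OF mem_upt] sym_smooth_smooth[OF that(1)] sym_smooth_smooth[OF that(2)]])
  show ?thesis
  proof (rule dual_cn_boundI)
    fix f g :: "'d obs" assume fg: "f \<in> sym_smooth k" "g \<in> sym_smooth k"
    have "f + g = (\<lambda>Z. 1 * f Z + 1 * g Z)" by (simp add: fun_eq_iff)
    then show "tens w k (f + g) = tens w k f + tens w k g" using lin[OF fg, of 1 1] by (simp only: mult_1)
  next
    fix f :: "'d obs" and c :: real assume f: "f \<in> sym_smooth k"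
    have "c *\<^sub>R f = (\<lambda>Z. c * f Z + 0 * f Z)" by (simp add: fun_eq_iff scaleR_fun_def)
    then show "tens w k (c *\<^sub>R f) = c * tens w k f" using lin[OF f f, of c 0] by simp
  next
    fix f :: "'d obs" assume "f \<notin> sym_smooth k"
    then show "tens w k f = 0" by (simp add: tens_def)
  next
    fix f :: "'d obs" and C :: real assume f: "f \<in> sym_smooth k" "C \<ge> 0" "cn_bound k (k * N + N) f C"
    have "\<bar>apply_slots w [1..<Suc k] f (\<lambda>i. 0)\<bar> \<le> R ^ k * C"
      by (rule tensor_bound[OF R _ controlled_singleton[OF f(3)] sym_smooth_smooth[OF f(1)] f(2) dom]) simp
    then show "\<bar>tens w k f\<bar> \<le> R ^ k * C" by (simp only: tens_def f(1) if_True)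
  qed
qed

text \<open>The unit ball of the weight M. It is bounded, so its supremum is a strong dual seminorm,
  and this is the seminorm by which each factor of a tensor product is measured.\<close>

definition weight_ball :: "(nat \<Rightarrow> real) \<Rightarrow> 'd::finite obs set" where
  "weight_ball M = {u \<in> sym_smooth 1. \<forall>m. cn_bound 1 m u (M m)}"

lemma cn_bound_scaleR:
  assumes u: "smooth_config u" "cn_bound k N u M"
  shows "cn_bound k N (c *\<^sub>R u) (\<bar>c\<bar> * M)"
  unfolding cn_bound_def
proof (intro ballI allI impI)
  fix \<alpha> :: "(nat \<times> 'a phase) list" and Z :: "'a config"
  assume *: "\<alpha> \<in> multi_indices k" "length \<alpha> \<le> N" "\<forall>i\<in>{1..k}. norm (Z i) \<le> real N"
  have "\<bar>iter_partial \<alpha> u Z\<bar> \<le> M" by (rule u(2)[unfolded cn_bound_def, THEN bspec, THEN mp, THEN spec, THEN mp, OF *])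
  then have "\<bar>c\<bar> * \<bar>iter_partial \<alpha> u Z\<bar> \<le> \<bar>c\<bar> * M" by (rule mult_left_mono) simp
  moreover have "iter_partial \<alpha> (c *\<^sub>R u) Z = c * iter_partial \<alpha> u Z"
  proof -
    have "c *\<^sub>R u = (\<lambda>Z. c * u Z)" by (simp add: fun_eq_iff scaleR_fun_def)
    then show ?thesis by (simp only: iter_partial_cmult[OF u(1) multi_indices_subset[OF *(1)]])
  qed
  ultimately show "\<bar>iter_partial \<alpha> (c *\<^sub>R u) Z\<bar> \<le> \<bar>c\<bar> * M" by (simp only: abs_mult)
qed

lemma weight_ball_bounded: "tvs_bounded (sym_smooth_top 1) (weight_ball M)"
  unfolding tvs_bounded_sym_smooth_iff
proof (intro conjI allI)
  show "weight_ball M \<subseteq> sym_smooth 1" unfolding weight_ball_def by blast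
  show "\<exists>C. \<forall>f\<in>weight_ball M. cn_bound 1 N f C" for N
    by (rule exI[of _ "M N"]) (simp add: weight_ball_def)
qed

lemma weight_ball_nonempty:
  assumes M: "\<And>m. M m \<ge> 0"
  shows "weight_ball M \<noteq> ({} :: 'd::finite obs set)"
proof -
  have "(\<lambda>Z. 0) \<in> (sym_smooth 1 :: 'd obs set)"
    using subspace_0[OF subspace_sym_smooth[of 1]] by (simp only: zero_fun_def)
  moreover have "cn_bound 1 m (\<lambda>Z. 0) (M m)" for m
    unfolding cn_bound_def iter_partial_zero using M by simp
  ultimately have "(\<lambda>Z. 0) \<in> (weight_ball M :: 'd obs set)"
    unfolding weight_ball_def by (intro CollectI conjI allI)
  then show ?thesis by (metis empty_iff)
qed

text \<open>Dividing u by C moves it into the weight ball. The case C = 0 follows by replacing C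
  with \<open>C + d\<close> for small d.\<close>

lemma dominated_sup_norm:
  fixes \<gamma> :: "'d::finite obs \<Rightarrow> real"
  assumes \<gamma>: "\<gamma> \<in> dual1" and M: "\<And>m. M m \<ge> 0"
  shows "dominated UNIV M (sup_norm (weight_ball M) \<gamma>) \<gamma>"
  unfolding dominated_def
proof (intro conjI ballI allI impI \<gamma>)
  let ?s = "sup_norm (weight_ball M) \<gamma>"
  have pos: "\<bar>\<gamma> u\<bar> \<le> ?s * C" if u: "u \<in> sym_smooth 1" "C > 0" "\<And>m. cn_bound 1 m u (C * M m)" for u C
  proof -
    have "(1 / C) *\<^sub>R u \<in> weight_ball M"
      unfolding weight_ball_def
    proof (intro CollectI conjI allI)
      show "(1 / C) *\<^sub>R u \<in> sym_smooth 1" by (rule subspace_scale[OF subspace_sym_smooth u(1)])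
      show "cn_bound 1 m ((1 / C) *\<^sub>R u) (M m)" for m
        using cn_bound_scaleR[OF sym_smooth_smooth[OF u(1)] u(3), where c = "1 / C"] u(2) by simp
    qed
    then have "\<bar>\<gamma> ((1 / C) *\<^sub>R u)\<bar> \<le> ?s" by (rule sup_norm_upper[OF \<gamma> weight_ball_bounded])
    moreover have "\<gamma> ((1 / C) *\<^sub>R u) = \<gamma> u / C"
      using \<gamma> u(1) by (simp add: tvs_dual_def topspace_sym_smooth_top)
    ultimately show ?thesis using u(2) by (simp add: pos_divide_le_eq)
  qed
  fix u :: "'d obs" and C :: real
  assume u: "u \<in> sym_smooth 1" "0 \<le> C" "\<forall>m\<in>UNIV. cn_bound 1 m u (C * M m)"
  have s: "?s \<ge> 0"
    by (rule dual.nonneg[OF _ \<gamma>]) (use weight_ball_bounded weight_ball_nonempty[of M] M in \<open>auto simp: sup_norms_def\<close>)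
  show "\<bar>\<gamma> u\<bar> \<le> ?s * C"
  proof (rule field_le_epsilon)
    fix e :: real assume e: "e > 0"
    define d where "d = e / (?s + 1)"
    have d: "d > 0" using e s by (simp add: d_def)
    have "\<bar>\<gamma> u\<bar> \<le> ?s * (C + d)"
    proof (rule pos[OF u(1)])
      show "C + d > 0" using d u(2) by simp
      show "cn_bound 1 m u ((C + d) * M m)" for m
      proof (rule cn_bound_mono[OF _ order_refl])
        show "cn_bound 1 m u (C * M m)" using u(3) by simp
        show "C * M m \<le> (C + d) * M m" using M[of m] d by (intro mult_right_mono) simp_all
      qed
    qed
    also have "\<dots> = ?s * C + ?s * d" by (rule distrib_left)
    also have "?s * d \<le> (?s + 1) * d" using d by (intro mult_right_mono) simp_all
    also have "(?s + 1) * d = e" unfolding d_def using s by simp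
    finally show "\<bar>\<gamma> u\<bar> \<le> ?s * C + e" by simp
  qed
qed

text \<open>The bounds of B at order and radius \<open>k * m + m\<close>, raised to at least 1, form
  the weight; being at least 1 is what allows one weight to be estimated by a product of
  weights.\<close>

lemma bounded_set_weights:
  fixes B :: "'d::finite obs set"
  assumes k: "k \<ge> 1" and B: "tvs_bounded (sym_smooth_top k) B"
  shows "\<exists>M. (\<forall>m. M m \<ge> 1) \<and> (\<forall>h\<in>B. controlled UNIV M k 1 h)"
proof -
  have "\<forall>m. \<exists>C. \<forall>f\<in>B. cn_bound k (k * m + m) f C"
    using B by (simp add: tvs_bounded_sym_smooth_iff)
  from choice[OF this] obtain C where C: "\<forall>m. \<forall>f\<in>B. cn_bound k (k * m + m) f (C m)" by (elim exE)
  let ?M = "\<lambda>m. max 1 (C m)"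
  have "controlled UNIV ?M k 1 h" if h: "h \<in> B" for h
  proof (rule controlled_UNIV[OF k])
    show "cn_bound k (k * m + m) h (?M m)" for m
      by (rule cn_bound_mono[OF bspec[OF spec[OF C, of m] h] order_refl]) simp
  qed simp
  then show ?thesis by (intro exI[of _ ?M]) simp
qed

lemma sup_norm_weight_ball:
  assumes "\<And>m. M m \<ge> 0"
  shows "sup_norm (weight_ball M) \<in> sup_norms 1"
  unfolding sup_norms_def using weight_ball_bounded weight_ball_nonempty[OF assms]
  by (intro CollectI exI[of _ "weight_ball M"] conjI refl)

lemma minus_functional: "(\<gamma> - \<delta>) f = \<gamma> f - (\<delta> f :: real)"
  by simp

text \<open>The parameter space T is arbitrary because in the iterated derivatives the slots are
  filled by different components of one point and its directions.\<close>

lemma continuous_map_tens: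
  fixes w :: "'z \<Rightarrow> nat \<Rightarrow> 'd::finite obs \<Rightarrow> real"
  assumes k: "k \<ge> 1" and w: "\<And>i. i \<in> {1..k} \<Longrightarrow> continuous_map T g1_dual (\<lambda>z. w z i)"
  shows "continuous_map T (strong_dual (sym_smooth_top k)) (\<lambda>z. tens (w z) k)"
  unfolding strong_dual_sup_norms
proof (rule dual.continuous_mapI)
  note w' = w[unfolded strong_dual_sup_norms]
  have wd: "w z i \<in> dual1" if "z \<in> topspace T" "i \<in> {1..k}" for z i
    using continuous_map_image_subset_topspace[OF w'[OF that(2)]] that(1) unfolding dual.topspace by auto
  show "tens (w z) k \<in> tvs_dual (sym_smooth_top k)" if "z \<in> topspace T" for z
    by (rule tens_dual[OF wd[OF that]])
  fix p z and e :: real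
  assume p: "p \<in> (sup_norms k :: (('d obs \<Rightarrow> real) \<Rightarrow> real) set)" and z: "z \<in> topspace T" and e: "e > 0"
  obtain B where B: "p = sup_norm B" "tvs_bounded (sym_smooth_top k) B" "B \<noteq> {}"
    using p unfolding sup_norms_def mem_Collect_eq by (elim exE conjE)
  obtain M where M: "\<forall>m. M m \<ge> 1" "\<forall>h\<in>B. controlled UNIV M k 1 h"
    using bounded_set_weights[OF k B(2)] by (elim exE conjE)
  have M0: "M m \<ge> 0" for m using spec[OF M(1), of m] by linarith
  let ?q = "sup_norm (weight_ball M) :: ('d obs \<Rightarrow> real) \<Rightarrow> real"
  have q: "?q \<in> sup_norms 1" by (rule sup_norm_weight_ball[OF M0])
  \<comment> \<open>The summand 1 leaves room for the perturbation: factors within \<eta> of those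
    at z, with \<eta> at most 1, are still dominated with R.\<close>
  define R where "R = 1 + (\<Sum>i\<in>{1..k}. ?q (w z i))"
  have qi: "?q (w z i) \<le> R - 1" if "i \<in> {1..k}" for i
  proof -
    have "?q (w z i) \<le> (\<Sum>i\<in>{1..k}. ?q (w z i))"
      using that by (intro member_le_sum dual.nonneg[OF q] wd[OF z]) simp_all
    then show ?thesis by (simp add: R_def)
  qed
  have "(\<Sum>i\<in>{1..k}. ?q (w z i)) \<ge> 0" by (intro sum_nonneg dual.nonneg[OF q] wd[OF z])
  then have R: "R \<ge> 1" by (simp add: R_def)
  \<comment> \<open>Chosen so that the bound \<open>real k * \<eta> * R ^ k\<close> of
    \<open>tensor_diff_bound\<close> stays below \<open>e / 2\<close>; the 1 in the denominator
    keeps the quotient defined when the rest vanishes.\<close>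
  define \<eta> where "\<eta> = min 1 (e / (2 * (real k * R ^ k + 1)))"
  have den: "real k * R ^ k + 1 > 0" using R by (intro add_nonneg_pos mult_nonneg_nonneg zero_le_power) simp_all
  have \<eta>: "\<eta> > 0" "\<eta> \<le> 1" using e den by (simp_all add: \<eta>_def)
  have \<eta>e: "real k * \<eta> * R ^ k * 1 \<le> e / 2"
  proof -
    have "\<eta> \<le> e / (2 * (real k * R ^ k + 1))" by (simp add: \<eta>_def)
    then have "\<eta> * (real k * R ^ k + 1) \<le> e / 2" using den by (simp add: field_simps)
    moreover have "real k * \<eta> * R ^ k * 1 + \<eta> = \<eta> * (real k * R ^ k + 1)" by (simp add: algebra_simps)
    ultimately show ?thesis using \<eta>(1) by linarith
  qed
  have "\<forall>i\<in>{1..k}. \<exists>N. openin T N \<and> z \<in> N \<and> (\<forall>y\<in>N. w y i \<in> dual1 \<and> ?q (w y i - w z i) < \<eta>)"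
    using dual.continuous_mapD[OF w' q z \<eta>(1)] by (rule ballI)
  from bchoice[OF this] obtain U where U: "\<forall>i\<in>{1..k}. openin T (U i) \<and> z \<in> U i \<and> (\<forall>y\<in>U i. w y i \<in> dual1 \<and> ?q (w y i - w z i) < \<eta>)"
    by (elim exE)
  let ?N = "(\<Inter>i\<in>{1..k}. U i) \<inter> topspace T"
  have "openin T ?N" by (rule openin_INT) (use U in simp_all)
  moreover have "z \<in> ?N" using U z by simp
  moreover have "\<forall>y\<in>?N. p (tens (w y) k - tens (w z) k) < e"
  proof
    fix y assume y: "y \<in> ?N"
    have near: "?q (w y i - w z i) < \<eta>" if "i \<in> {1..k}" for i using U y that by simp
    have yi: "w y i \<in> dual1" if "i \<in> {1..k}" for i using y that by (intro wd) simp_all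
    have diff: "w y i - w z i \<in> dual1" if "i \<in> {1..k}" for i
      by (rule subspace_diff[OF subspace_dual yi[OF that] wd[OF z that]])
    have dz: "dominated UNIV M R (w z i)" if "i \<in> {1..k}" for i
      by (rule dominated_mono[OF dominated_sup_norm[OF wd[OF z that] M0]]) (use qi[OF that] in simp)
    have dd: "dominated UNIV M \<eta> (w y i - w z i)" if "i \<in> {1..k}" for i
      by (rule dominated_mono[OF dominated_sup_norm[OF diff[OF that] M0]]) (use near[OF that] in simp)
    have dy: "dominated UNIV M R (w y i)" if i: "i \<in> {1..k}" for i
    proof (rule dominated_mono[OF dominated_sup_norm[OF yi[OF i] M0]])
      have "?q ((w y i - w z i) + w z i) \<le> ?q (w y i - w z i) + ?q (w z i)"
        by (rule dual.triangle[OF q diff[OF i] wd[OF z i]])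
      then have "?q (w y i) \<le> ?q (w y i - w z i) + ?q (w z i)" by (simp only: diff_add_cancel)
      then show "?q (w y i) \<le> R" using near[OF i] qi[OF i] \<eta>(2) by linarith
    qed
    have "p (tens (w y) k - tens (w z) k) \<le> e / 2"
      unfolding B(1)
    proof (rule sup_norm_least[OF B(3)])
      fix h assume h: "h \<in> B"
      have hs: "h \<in> sym_smooth k" using B(2) h unfolding tvs_bounded_sym_smooth_iff by (elim conjE) (rule subsetD)
      have "\<bar>apply_slots (w y) [1..<Suc k] h (\<lambda>i. 0) - apply_slots (w z) [1..<Suc k] h (\<lambda>i. 0)\<bar> \<le> real k * \<eta> * R ^ k * 1"
        by (rule tensor_diff_bound[OF R M0 less_imp_le[OF \<eta>(1)] bspec[OF M(2) h] sym_smooth_smooth[OF hs] zero_le_one dy dz dd])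
      then show "\<bar>(tens (w y) k - tens (w z) k) h\<bar> \<le> e / 2"
        unfolding minus_functional using \<eta>e by (simp only: tens_def hs if_True)
    qed
    then show "p (tens (w y) k - tens (w z) k) < e" using e by linarith
  qed
  ultimately show "\<exists>N. openin T N \<and> z \<in> N \<and> (\<forall>y\<in>N. p (tens (w y) k - tens (w z) k) < e)"
    by (intro exI[of _ ?N] conjI)
qed

lemma sum_functional: "(\<Sum>j\<in>A. \<phi> j) f = (\<Sum>j\<in>A. (\<phi> j f :: real))"
  by (induction A rule: infinite_finite_induct) simp_all

text \<open>The quadratic remainder, uniform over a bounded set, becomes an error of at most
  \<open>E * \<bar>t\<bar>\<close> in every strong dual seminorm after division by t.\<close>

lemma tens_derivative:
  fixes w d :: "nat \<Rightarrow> 'd::finite obs \<Rightarrow> real"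
  assumes k: "k \<ge> 1" and w: "\<And>i. i \<in> {1..k} \<Longrightarrow> w i \<in> dual1" and d: "\<And>i. i \<in> {1..k} \<Longrightarrow> d i \<in> dual1"
  shows "limitin (strong_dual (sym_smooth_top k)) (\<lambda>t. (1 / t) *\<^sub>R (tens (\<lambda>i. w i + t *\<^sub>R d i) k - tens w k))
    (\<Sum>j\<in>{1..k}. tens (w(j := d j)) k) (at 0)"
  unfolding strong_dual_sup_norms
proof (rule dual.limitinI)
  have wt: "w i + t *\<^sub>R d i \<in> dual1" if "i \<in> {1..k}" for i t
    by (intro subspace_add[OF subspace_dual] subspace_scale[OF subspace_dual] w[OF that] d[OF that])
  have wj: "(w(j := d j)) i \<in> dual1" if "j \<in> {1..k}" "i \<in> {1..k}" for i j
    using w[OF that(2)] d[OF that(1)] by simp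
  show "(\<Sum>j\<in>{1..k}. tens (w(j := d j)) k) \<in> tvs_dual (sym_smooth_top k)"
    by (rule subspace_sum[OF subspace_dual]) (rule tens_dual[OF wj])
  show "\<forall>\<^sub>F t in at 0. (1 / t) *\<^sub>R (tens (\<lambda>i. w i + t *\<^sub>R d i) k - tens w k) \<in> tvs_dual (sym_smooth_top k)"
    by (intro always_eventually allI subspace_scale[OF subspace_dual] subspace_diff[OF subspace_dual] tens_dual[OF wt] tens_dual[OF w])
  fix p and e :: real
  assume p: "p \<in> (sup_norms k :: (('d obs \<Rightarrow> real) \<Rightarrow> real) set)" and e: "e > 0"
  obtain B where B: "p = sup_norm B" "tvs_bounded (sym_smooth_top k) B" "B \<noteq> {}"
    using p unfolding sup_norms_def mem_Collect_eq by (elim exE conjE)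
  obtain M where M: "\<forall>m. M m \<ge> 1" "\<forall>h\<in>B. controlled UNIV M k 1 h"
    using bounded_set_weights[OF k B(2)] by (elim exE conjE)
  have M0: "M m \<ge> 0" for m using spec[OF M(1), of m] by linarith
  let ?q = "sup_norm (weight_ball M) :: ('d obs \<Rightarrow> real) \<Rightarrow> real"
  have q: "?q \<in> sup_norms 1" by (rule sup_norm_weight_ball[OF M0])
  define R where "R = 1 + (\<Sum>i\<in>{1..k}. ?q (w i)) + (\<Sum>i\<in>{1..k}. ?q (d i))"
  have sw: "(\<Sum>i\<in>{1..k}. ?q (w i)) \<ge> 0" by (intro sum_nonneg dual.nonneg[OF q] w)
  have sd: "(\<Sum>i\<in>{1..k}. ?q (d i)) \<ge> 0" by (intro sum_nonneg dual.nonneg[OF q] d)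
  have R: "R \<ge> 1" using sw sd by (simp add: R_def)
  have dw: "\<forall>i\<in>{1..k}. dominated UNIV M R (w i)"
  proof
    fix i assume i: "i \<in> {1..k}"
    have "?q (w i) \<le> (\<Sum>i\<in>{1..k}. ?q (w i))"
      using i by (intro member_le_sum dual.nonneg[OF q] w) simp_all
    then show "dominated UNIV M R (w i)"
      using sd by (intro dominated_mono[OF dominated_sup_norm[OF w[OF i] M0]]) (simp add: R_def)
  qed
  have dd: "\<forall>i\<in>{1..k}. dominated UNIV M R (d i)"
  proof
    fix i assume i: "i \<in> {1..k}"
    have "?q (d i) \<le> (\<Sum>i\<in>{1..k}. ?q (d i))"
      using i by (intro member_le_sum dual.nonneg[OF q] d) simp_all
    then show "dominated UNIV M R (d i)"
      using sw by (intro dominated_mono[OF dominated_sup_norm[OF d[OF i] M0]]) (simp add: R_def)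
  qed
  obtain E where E: "E \<ge> 0" "\<forall>h C t Z. controlled UNIV M k C h \<longrightarrow> smooth_config h \<longrightarrow> C \<ge> 0 \<longrightarrow> \<bar>t\<bar> \<le> 1 \<longrightarrow>
      \<bar>apply_slots (\<lambda>i. w i + t *\<^sub>R d i) [1..<Suc k] h Z - apply_slots w [1..<Suc k] h Z
        - t * (\<Sum>j\<in>{1..k}. apply_slots (w(j := d j)) [1..<Suc k] h Z)\<bar> \<le> E * t\<^sup>2 * C"
    using tensor_derivative_bound[OF R M0 dw dd] by (elim exE conjE)
  note E2 = E(2)[THEN spec, THEN spec, THEN spec, THEN spec, THEN mp, THEN mp, THEN mp, THEN mp]
  define \<eta> where "\<eta> = min 1 (e / (2 * (E + 1)))"
  have \<eta>: "\<eta> > 0" "\<eta> \<le> 1" using e E(1) by (simp_all add: \<eta>_def)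
  have "\<eta> * (2 * (E + 1)) \<le> e" using E(1) by (simp add: \<eta>_def min_def pos_le_divide_eq)
  moreover have "\<eta> * (2 * (E + 1)) = 2 * \<eta> + 2 * (E * \<eta>)" by (simp add: algebra_simps)
  ultimately have \<eta>e: "E * \<eta> < e" using \<eta>(1) mult_nonneg_nonneg[OF E(1) less_imp_le[OF \<eta>(1)]] by linarith
  have "p ((1 / t) *\<^sub>R (tens (\<lambda>i. w i + t *\<^sub>R d i) k - tens w k) - (\<Sum>j\<in>{1..k}. tens (w(j := d j)) k)) < e"
    if t: "t \<noteq> 0" "\<bar>t\<bar> < \<eta>" for t
  proof -
    have "p ((1 / t) *\<^sub>R (tens (\<lambda>i. w i + t *\<^sub>R d i) k - tens w k) - (\<Sum>j\<in>{1..k}. tens (w(j := d j)) k)) \<le> E * \<bar>t\<bar>"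
      unfolding B(1)
    proof (rule sup_norm_least[OF B(3)])
      fix h assume h: "h \<in> B"
      have hs: "h \<in> sym_smooth k" using B(2) h unfolding tvs_bounded_sym_smooth_iff by (elim conjE) (rule subsetD)
      let ?a = "tens (\<lambda>i. w i + t *\<^sub>R d i) k h" and ?b = "tens w k h" and ?c = "\<Sum>j\<in>{1..k}. tens (w(j := d j)) k h"
      have t1: "\<bar>t\<bar> \<le> 1" using t(2) \<eta>(2) by linarith
      have "\<bar>?a - ?b - t * ?c\<bar> \<le> E * t\<^sup>2 * 1"
        unfolding tens_def using E2[OF bspec[OF M(2) h] sym_smooth_smooth[OF hs] zero_le_one t1] by (simp only: hs if_True)
      then have "\<bar>?a - ?b - t * ?c\<bar> \<le> E * \<bar>t\<bar> * \<bar>t\<bar>" by (simp add: power2_eq_square mult.assoc)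
      moreover have "((1 / t) *\<^sub>R (tens (\<lambda>i. w i + t *\<^sub>R d i) k - tens w k) - (\<Sum>j\<in>{1..k}. tens (w(j := d j)) k)) h
          = (?a - ?b - t * ?c) / t"
        unfolding minus_functional scaleR_functional sum_functional using t(1) by (simp add: diff_divide_distrib)
      ultimately show "\<bar>((1 / t) *\<^sub>R (tens (\<lambda>i. w i + t *\<^sub>R d i) k - tens w k) - (\<Sum>j\<in>{1..k}. tens (w(j := d j)) k)) h\<bar> \<le> E * \<bar>t\<bar>"
        using t(1) by (simp only: abs_divide) (simp add: pos_divide_le_eq)
    qed
    also have "\<dots> \<le> E * \<eta>" using t(2) E(1) by (intro mult_left_mono) simp_all
    also note \<eta>e
    finally show ?thesis .
  qed
  then show "\<forall>\<^sub>F t in at 0. p ((1 / t) *\<^sub>R (tens (\<lambda>i. w i + t *\<^sub>R d i) k - tens w k) - (\<Sum>j\<in>{1..k}. tens (w(j := d j)) k)) < e"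
    unfolding eventually_at using \<eta>(1) by (intro exI[of _ \<eta>]) (simp add: dist_real_def)
qed

section \<open>Gateaux smoothness\<close>

text \<open>The family of iterated derivatives is chosen recursively out of a class of maps that is
  closed under differentiation.\<close>

lemma gateaux_smoothI:
  fixes S :: "nat \<Rightarrow> ('a::real_vector \<Rightarrow> (nat \<Rightarrow> 'a) \<Rightarrow> 'b::real_vector) \<Rightarrow> bool"
  assumes S0: "S 0 \<phi>" and f: "\<And>x. x \<in> topspace X \<Longrightarrow> \<phi> x (\<lambda>i. undefined) = f x"
    and cont: "\<And>n \<phi>. S n \<phi> \<Longrightarrow> continuous_map (prod_topology X (product_topology (\<lambda>i. X) {..<n})) Y (\<lambda>(x, v). \<phi> x v)"
    and der: "\<And>n \<phi>. S n \<phi> \<Longrightarrow> \<exists>\<phi>'. S (Suc n) \<phi>' \<and> (\<forall>x\<in>topspace X. \<forall>v \<in> {..<Suc n} \<rightarrow>\<^sub>E topspace X.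
        has_gateaux_derivative Y (\<lambda>y. \<phi> y (restrict v {..<n})) x (v n) (\<phi>' x v))"
  shows "gateaux_smooth X Y f"
proof -
  define nxt where "nxt n \<phi> = (SOME \<phi>'. S (Suc n) \<phi>' \<and> (\<forall>x\<in>topspace X. \<forall>v \<in> {..<Suc n} \<rightarrow>\<^sub>E topspace X.
        has_gateaux_derivative Y (\<lambda>y. \<phi> y (restrict v {..<n})) x (v n) (\<phi>' x v)))" for n \<phi>
  define D where "D = rec_nat \<phi> nxt"
  have DS: "S (Suc n) (nxt n \<psi>) \<and> (\<forall>x\<in>topspace X. \<forall>v \<in> {..<Suc n} \<rightarrow>\<^sub>E topspace X.
        has_gateaux_derivative Y (\<lambda>y. \<psi> y (restrict v {..<n})) x (v n) (nxt n \<psi> x v))" if "S n \<psi>" for n \<psi>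
    unfolding nxt_def by (rule someI_ex[OF der[OF that]])
  have D0: "D 0 = \<phi>" and DSuc: "D (Suc n) = nxt n (D n)" for n by (simp_all add: D_def)
  have SD: "S n (D n)" for n
  proof (induction n)
    case (Suc n)
    then show ?case unfolding DSuc by (rule conjunct1[OF DS])
  qed (simp only: D0 S0)
  show ?thesis
    unfolding gateaux_smooth_def
  proof (intro exI[of _ D] conjI allI)
    show "\<forall>x\<in>topspace X. D 0 x (\<lambda>i. undefined) = f x" using f by (simp add: D0)
    show "\<forall>x\<in>topspace X. \<forall>v\<in>{..<Suc n} \<rightarrow>\<^sub>E topspace X.
        has_gateaux_derivative Y (\<lambda>y. D n y (restrict v {..<n})) x (v n) (D (Suc n) x v)" for n
      unfolding DSuc by (rule conjunct2[OF DS[OF SD]])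
    show "continuous_map (prod_topology X (product_topology (\<lambda>i. X) {..<n})) Y (\<lambda>(x, v). D n x v)" for n
      by (rule cont[OF SD])
  qed
qed

text \<open>The map a records what each slot holds: 0 stands for the base point x, and
  \<open>Suc i\<close> for the direction \<open>v i\<close>.\<close>

definition slots :: "(nat \<Rightarrow> nat) \<Rightarrow> 'a \<Rightarrow> (nat \<Rightarrow> 'a) \<Rightarrow> nat \<Rightarrow> 'a" where
  "slots a x v = (\<lambda>j. case a j of 0 \<Rightarrow> x | Suc i \<Rightarrow> v i)"

text \<open>The form of the n-th derivatives of a tensor power. The condition
  \<open>a j \<le> n\<close> says that only the directions 0 to n - 1 occur; differentiating once
  more replaces one occurrence of the base point by the code \<open>Suc n\<close> of the direction
  \<open>v n\<close>.\<close>

inductive tens_poly :: "nat \<Rightarrow> nat \<Rightarrow> (('d::finite obs \<Rightarrow> real) \<Rightarrow> (nat \<Rightarrow> 'd obs \<Rightarrow> real) \<Rightarrow> 'd obs \<Rightarrow> real) \<Rightarrow> bool"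
  for k n where
  base: "(\<And>j. a j \<le> n) \<Longrightarrow> tens_poly k n (\<lambda>x v. tens (slots a x v) k)"
| zero: "tens_poly k n (\<lambda>x v. 0)"
| add: "tens_poly k n \<phi> \<Longrightarrow> tens_poly k n \<psi> \<Longrightarrow> tens_poly k n (\<lambda>x v. \<phi> x v + \<psi> x v)"

lemma tens_poly_sum:
  "(\<And>j. j \<in> A \<Longrightarrow> tens_poly k n (\<phi> j)) \<Longrightarrow> tens_poly k n (\<lambda>x v. \<Sum>j\<in>A. \<phi> j x v)"
proof (induction A rule: infinite_finite_induct)
  case (insert j A)
  have "tens_poly k n (\<lambda>x v. \<phi> j x v + (\<Sum>j\<in>A. \<phi> j x v))"
    by (rule tens_poly.add) (use insert in simp_all)
  then show ?case by (simp only: sum.insert[OF insert.hyps])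
qed (simp_all add: tens_poly.zero)

lemma tens_zero_slot:
  assumes w: "\<And>i. i \<in> {1..k} \<Longrightarrow> w i \<in> dual1" and j: "j \<in> {1..k}" "w j = 0"
  shows "tens w k = 0"
proof
  fix f :: "'a obs"
  have "apply_slots w xs f = (\<lambda>Z. 0)" if "set xs \<subseteq> {1..k}" "j \<in> set xs" for xs
    using that
  proof (induction xs)
    case (Cons i xs)
    show ?case
    proof (cases "i = j")
      case True
      then show ?thesis using j(2) by (simp add: apply_at_def)
    next
      case False
      then have "apply_slots w xs f = (\<lambda>Z. 0)" using Cons by simp
      moreover have "w i \<in> dual1" using Cons.prems by (intro w) simp
      ultimately show ?thesis by (simp add: apply_at_zero)
    qed
  qed simp
  moreover have "set [1..<Suc k] \<subseteq> {1..k}" "j \<in> set [1..<Suc k]"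
    using j(1) by (simp_all only: set_upt atLeastLessThanSuc_atLeastAtMost)
  ultimately have "apply_slots w [1..<Suc k] f = (\<lambda>Z. 0)" by blast
  then show "tens w k f = 0 f" by (simp only: tens_def zero_fun_apply if_cancel)
qed

lemma continuous_map_slot:
  fixes X :: "'a topology"
  assumes "a j \<le> n"
  shows "continuous_map (prod_topology X (product_topology (\<lambda>i. X) {..<n})) X (\<lambda>z. slots a (fst z) (snd z) j)"
proof (cases "a j")
  case 0
  then show ?thesis by (simp add: slots_def continuous_map_fst)
next
  case (Suc i)
  then have "i \<in> {..<n}" using assms by simp
  then have "continuous_map (product_topology (\<lambda>i. X) {..<n}) X (\<lambda>v. v i)"
    by (rule continuous_map_product_projection)
  from continuous_map_compose[OF continuous_map_snd this] show ?thesis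
    by (simp add: slots_def Suc o_def)
qed

lemma has_gateaux_derivative_tens:
  fixes x :: "'d::finite obs \<Rightarrow> real"
  assumes k: "k \<ge> 1" and a: "\<And>j. a j \<le> n" and x: "x \<in> dual1" and v: "\<And>i. i < Suc n \<Longrightarrow> v i \<in> dual1"
  shows "has_gateaux_derivative (strong_dual (sym_smooth_top k)) (\<lambda>y. tens (slots a y (restrict v {..<n})) k) x (v n)
    (\<Sum>j\<in>{1..k}. if a j = 0 then tens (slots (a(j := Suc n)) x v) k else 0)"
proof -
  \<comment> \<open>Only slots holding the base point move. A slot that already holds a direction
    has increment 0, and its term in the product rule drops out by
    \<open>tens_zero_slot\<close>.\<close>
  let ?w = "slots a x v" and ?d = "\<lambda>j. if a j = 0 then v n else 0"
  have w: "?w j \<in> dual1" for j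
  proof (cases "a j")
    case 0
    then show ?thesis using x by (simp add: slots_def)
  next
    case (Suc i)
    then have "i < Suc n" using a[of j] by simp
    then show ?thesis using v by (simp add: slots_def Suc)
  qed
  have d: "?d j \<in> dual1" for j
  proof -
    have "v n \<in> dual1" "0 \<in> (dual1 :: ('d obs \<Rightarrow> real) set)"
      using v[of n] subspace_0[OF subspace_dual] by simp_all
    then show ?thesis by (cases "a j = 0") (simp_all only: if_True if_False simp_thms)
  qed
  have eq: "slots a (x + t *\<^sub>R v n) (restrict v {..<n}) = (\<lambda>j. ?w j + t *\<^sub>R ?d j)" for t
  proof
    fix j
    show "slots a (x + t *\<^sub>R v n) (restrict v {..<n}) j = ?w j + t *\<^sub>R ?d j"
    proof (cases "a j")
      case (Suc i)
      then have "i < n" using a[of j] by simp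
      then show ?thesis by (simp add: slots_def Suc)
    qed (simp add: slots_def)
  qed
  have eq0: "slots a x (restrict v {..<n}) = ?w" using eq[of 0] by simp
  have "(\<Sum>j\<in>{1..k}. tens (?w(j := ?d j)) k) = (\<Sum>j\<in>{1..k}. if a j = 0 then tens (slots (a(j := Suc n)) x v) k else 0)"
  proof (rule sum.cong[OF refl])
    fix j assume j: "j \<in> {1..k}"
    show "tens (?w(j := ?d j)) k = (if a j = 0 then tens (slots (a(j := Suc n)) x v) k else 0)"
    proof (cases "a j = 0")
      case True
      then have "?w(j := ?d j) = slots (a(j := Suc n)) x v" by (auto simp: slots_def fun_eq_iff)
      then show ?thesis by (simp only: True if_True simp_thms)
    next
      case False
      have "tens (?w(j := ?d j)) k = 0"
      proof (rule tens_zero_slot[OF _ j])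
        show "(?w(j := ?d j)) i \<in> dual1" for i using w[of i] d[of j] by (simp only: fun_upd_def) (simp split: if_split)
      qed (simp add: False)
      then show ?thesis by (simp only: False if_False)
    qed
  qed
  moreover have "limitin (strong_dual (sym_smooth_top k)) (\<lambda>t. (1 / t) *\<^sub>R (tens (\<lambda>i. ?w i + t *\<^sub>R ?d i) k - tens ?w k))
    (\<Sum>j\<in>{1..k}. tens (?w(j := ?d j)) k) (at 0)"
    by (rule tens_derivative[OF k w d])
  ultimately show ?thesis unfolding has_gateaux_derivative_def eq eq0 by (simp only:)
qed

lemma gateaux_smooth_tensor_power:
  assumes k: "k \<ge> 1"
  shows "gateaux_smooth (g1_dual :: ('d::finite obs \<Rightarrow> real) topology) (strong_dual (sym_smooth_top k)) (\<lambda>\<gamma>. tensor_power \<gamma> k)"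
proof (rule gateaux_smoothI[of "tens_poly k"])
  show "tens_poly k 0 (\<lambda>x v. tens (slots (\<lambda>_. 0) x v) k)" by (rule tens_poly.base) simp
  show "tens (slots (\<lambda>_. 0) x (\<lambda>i. undefined)) k = tensor_power x k" for x :: "'d obs \<Rightarrow> real"
    by (simp add: slots_def tensor_power_tens)
  fix n and \<phi> :: "('d obs \<Rightarrow> real) \<Rightarrow> (nat \<Rightarrow> 'd obs \<Rightarrow> real) \<Rightarrow> 'd obs \<Rightarrow> real"
  show "tens_poly k n \<phi> \<Longrightarrow> continuous_map (prod_topology g1_dual (product_topology (\<lambda>i. g1_dual) {..<n}))
      (strong_dual (sym_smooth_top k)) (\<lambda>(x, v). \<phi> x v)"
  proof (induction rule: tens_poly.induct)
    case (base a)
    have "continuous_map (prod_topology g1_dual (product_topology (\<lambda>i. g1_dual) {..<n}))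
      (strong_dual (sym_smooth_top k)) (\<lambda>z. tens (slots a (fst z) (snd z)) k)"
      by (rule continuous_map_tens[OF k], rule continuous_map_slot, rule base)
    then show ?case by (simp only: case_prod_unfold)
  next
    case zero
    have "0 \<in> topspace (strong_dual (sym_smooth_top k :: 'd obs topology))"
      unfolding topspace_dual by (rule subspace_0[OF subspace_dual])
    then show ?case unfolding case_prod_unfold by (rule continuous_map_const[THEN iffD2, OF disjI2])
  next
    case (add \<phi> \<psi>)
    show ?case
      using add.IH unfolding strong_dual_sup_norms case_prod_unfold by (rule dual.continuous_map_sum2)
  qed
  show "tens_poly k n \<phi> \<Longrightarrow> \<exists>\<phi>'. tens_poly k (Suc n) \<phi>' \<and>
      (\<forall>x\<in>topspace g1_dual. \<forall>v\<in>{..<Suc n} \<rightarrow>\<^sub>E topspace g1_dual.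
        has_gateaux_derivative (strong_dual (sym_smooth_top k)) (\<lambda>y. \<phi> y (restrict v {..<n})) x (v n) (\<phi>' x v))"
  proof (induction rule: tens_poly.induct)
    case (base a)
    let ?\<phi>' = "\<lambda>x v. \<Sum>j\<in>{1..k}. if a j = 0 then tens (slots (a(j := Suc n)) x v) k else 0"
    have "tens_poly k (Suc n) (\<lambda>x v. if a j = 0 then tens (slots (a(j := Suc n)) x v) k else 0)" for j
    proof (cases "a j = 0")
      case True
      have "tens_poly k (Suc n) (\<lambda>x v. tens (slots (a(j := Suc n)) x v) k)"
        by (rule tens_poly.base) (simp add: base le_SucI)
      then show ?thesis by (simp only: True if_True simp_thms)
    next
      case False
      then show ?thesis by (simp only: False if_False tens_poly.zero)
    qed
    then have "tens_poly k (Suc n) ?\<phi>'" by (rule tens_poly_sum)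
    moreover have "has_gateaux_derivative (strong_dual (sym_smooth_top k)) (\<lambda>y. tens (slots a y (restrict v {..<n})) k) x (v n) (?\<phi>' x v)"
      if "x \<in> topspace g1_dual" "v \<in> {..<Suc n} \<rightarrow>\<^sub>E topspace g1_dual" for x v
      by (rule has_gateaux_derivative_tens[OF k base])
        (use that in \<open>auto simp only: topspace_dual PiE_iff lessThan_iff\<close>)
    ultimately show ?case by (intro exI[of _ ?\<phi>'] conjI ballI)
  next
    case zero
    have "0 \<in> topspace (strong_dual (sym_smooth_top k :: 'd obs topology))"
      unfolding topspace_dual by (rule subspace_0[OF subspace_dual])
    then have z: "has_gateaux_derivative (strong_dual (sym_smooth_top k :: 'd obs topology)) (\<lambda>y. 0) x v 0" for x v :: "'d obs \<Rightarrow> real"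
      unfolding has_gateaux_derivative_def by simp
    show ?case by (intro exI[of _ "\<lambda>x v. 0"] conjI ballI tens_poly.zero z)
  next
    case (add \<phi> \<psi>)
    obtain \<phi>' where \<phi>': "tens_poly k (Suc n) \<phi>'" "\<forall>x\<in>topspace g1_dual. \<forall>v\<in>{..<Suc n} \<rightarrow>\<^sub>E topspace g1_dual.
        has_gateaux_derivative (strong_dual (sym_smooth_top k)) (\<lambda>y. \<phi> y (restrict v {..<n})) x (v n) (\<phi>' x v)"
      using add.IH(1) by (elim exE conjE)
    obtain \<psi>' where \<psi>': "tens_poly k (Suc n) \<psi>'" "\<forall>x\<in>topspace g1_dual. \<forall>v\<in>{..<Suc n} \<rightarrow>\<^sub>E topspace g1_dual.
        has_gateaux_derivative (strong_dual (sym_smooth_top k)) (\<lambda>y. \<psi> y (restrict v {..<n})) x (v n) (\<psi>' x v)"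
      using add.IH(2) by (elim exE conjE)
    have "has_gateaux_derivative (strong_dual (sym_smooth_top k)) (\<lambda>y. \<phi> y (restrict v {..<n}) + \<psi> y (restrict v {..<n})) x (v n) (\<phi>' x v + \<psi>' x v)"
      if x: "x \<in> topspace g1_dual" and v: "v \<in> {..<Suc n} \<rightarrow>\<^sub>E topspace g1_dual" for x v
    proof -
      note l = bspec[OF bspec[OF \<phi>'(2) x] v, unfolded has_gateaux_derivative_def strong_dual_sup_norms]
        bspec[OF bspec[OF \<psi>'(2) x] v, unfolded has_gateaux_derivative_def strong_dual_sup_norms]
      from dual.limitin_sum2[OF l] show ?thesis
        unfolding has_gateaux_derivative_def strong_dual_sup_norms
        by (simp only: scaleR_add_right[symmetric] add_diff_add)
    qed
    then show ?case by (intro exI[of _ "\<lambda>x v. \<phi>' x v + \<psi>' x v"] conjI tens_poly.add \<phi>'(1) \<psi>'(1) ballI)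
  qed
qed

lemma tens_functional_derivative:
  fixes \<gamma> :: "'d::finite obs \<Rightarrow> real"
  assumes "k \<ge> 1" "\<gamma> \<in> dual1" "\<delta> \<in> dual1"
  shows "has_gateaux_derivative (strong_dual (sym_smooth_top k)) (\<lambda>\<gamma>. tensor_power \<gamma> k) \<gamma> \<delta>
    (\<Sum>j\<in>{1..k}. tens ((\<lambda>_. \<gamma>)(j := \<delta>)) k)"
  unfolding has_gateaux_derivative_def tensor_power_tens
  by (rule tens_derivative[OF assms(1), of "\<lambda>_. \<gamma>" "\<lambda>_. \<delta>"]) (rule assms)+

lemma iota_0: "iota \<gamma> 0 = 0"
  by (simp add: iota_def)

lemma iota_pos: "k \<ge> 1 \<Longrightarrow> iota \<gamma> k = tensor_power \<gamma> k"
  by (simp add: iota_def)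

lemma topspace_G_inf_dual:
  "topspace G_inf_dual = {\<Gamma>. \<Gamma> 0 = 0 \<and> (\<forall>k. \<Gamma> k \<in> tvs_dual (sym_smooth_top k))}"
  unfolding G_inf_dual_def topspace_subtopology topspace_product_topology topspace_dual
  by (auto simp: PiE_iff)

text \<open>The target has the product topology, so limits and continuity are componentwise: the
  derivatives are chosen separately for each degree k and then assembled into sequences.\<close>

lemma gateaux_smooth_iota:
  "gateaux_smooth (g1_dual :: ('d::finite obs \<Rightarrow> real) topology) G_inf_dual iota"
proof -
  let ?Y = "\<lambda>k. strong_dual (sym_smooth_top k) :: ('d obs \<Rightarrow> real) topology"
  \<comment> \<open>Derivatives are fixed only where the limits determine them. In degree 0 the zero
    family is demanded outright, so that the assembled sequences stay in the subspace where the
    dummy component vanishes.\<close>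
  let ?P = "\<lambda>k D. (\<forall>x\<in>topspace g1_dual. D 0 x (\<lambda>i. undefined) = iota x k) \<and>
     (\<forall>n. \<forall>x\<in>topspace g1_dual. \<forall>v \<in> {..<Suc n} \<rightarrow>\<^sub>E topspace g1_dual.
        has_gateaux_derivative (?Y k) (\<lambda>y. D n y (restrict v {..<n})) x (v n) (D (Suc n) x v)) \<and>
     (\<forall>n. continuous_map (prod_topology g1_dual (product_topology (\<lambda>i. g1_dual) {..<n})) (?Y k)
        (\<lambda>(x, v). D n x v)) \<and> (k = 0 \<longrightarrow> D = (\<lambda>n x v. 0))"
  have "\<forall>k. \<exists>D. ?P k D"
  proof
    fix k
    show "\<exists>D. ?P k D"
    proof (cases "k \<ge> 1")
      case True
      have "iota x k = tensor_power x k" for x :: "'d obs \<Rightarrow> real" by (rule iota_pos[OF True])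
      then have "gateaux_smooth g1_dual (?Y k) (\<lambda>\<gamma>. iota \<gamma> k)"
        using gateaux_smooth_tensor_power[OF True] by (simp only:)
      moreover have "k \<noteq> 0" using True by simp
      ultimately show ?thesis unfolding gateaux_smooth_def by (simp only: simp_thms)
    next
      case False
      then have k: "k = 0" by simp
      have 0: "0 \<in> topspace (?Y k)" unfolding topspace_dual by (rule subspace_0[OF subspace_dual])
      have 1: "has_gateaux_derivative (?Y k) (\<lambda>y. 0) x v 0" for x v :: "'d obs \<Rightarrow> real"
        unfolding has_gateaux_derivative_def using 0 by simp
      have 2: "continuous_map (prod_topology g1_dual (product_topology (\<lambda>i. g1_dual) {..<n})) (?Y k) (\<lambda>(x, v). 0)" for n
        unfolding case_prod_unfold using 0 by simp
      show ?thesis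
        by (intro exI[of _ "\<lambda>n x v. 0"] conjI allI ballI impI refl 1 2) (simp add: k iota_0)
    qed
  qed
  from choice[OF this] obtain D where D: "\<forall>k. ?P k (D k)" by (elim exE)
  have D1: "D k 0 x (\<lambda>i. undefined) = iota x k" if "x \<in> topspace g1_dual" for k x
    by (rule bspec[OF conjunct1[OF spec[OF D, of k]] that])
  have D2: "has_gateaux_derivative (?Y k) (\<lambda>y. D k n y (restrict v {..<n})) x (v n) (D k (Suc n) x v)"
    if "x \<in> topspace g1_dual" "v \<in> {..<Suc n} \<rightarrow>\<^sub>E topspace g1_dual" for k n x v
    by (rule bspec[OF bspec[OF spec[OF conjunct1[OF conjunct2[OF spec[OF D, of k]]], of n] that(1)] that(2)])
  have D3: "continuous_map (prod_topology g1_dual (product_topology (\<lambda>i. g1_dual) {..<n})) (?Y k) (\<lambda>(x, v). D k n x v)" for k n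
    by (rule spec[OF conjunct1[OF conjunct2[OF conjunct2[OF spec[OF D, of k]]]], of n])
  have D4: "D 0 n x v = 0" for n x v
    using conjunct2[OF conjunct2[OF conjunct2[OF spec[OF D, of 0]]]] by simp
  show ?thesis
    unfolding gateaux_smooth_def
  proof (intro exI[of _ "\<lambda>n x v k. D k n x v"] conjI allI ballI)
    show "(\<lambda>k. D k 0 x (\<lambda>i. undefined)) = iota x" if "x \<in> topspace g1_dual" for x
      by (intro ext) (simp only: D1[OF that])
    fix n
    show "has_gateaux_derivative G_inf_dual (\<lambda>y k. D k n y (restrict v {..<n})) x (v n) (\<lambda>k. D k (Suc n) x v)"
      if x: "x \<in> topspace g1_dual" and v: "v \<in> {..<Suc n} \<rightarrow>\<^sub>E topspace g1_dual" for x v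
      unfolding has_gateaux_derivative_def G_inf_dual_def limitin_subtopology limitin_componentwise
    proof (intro conjI ballI)
      let ?q = "\<lambda>t. (1 / t) *\<^sub>R ((\<lambda>k. D k n (x + t *\<^sub>R v n) (restrict v {..<n})) - (\<lambda>k. D k n x (restrict v {..<n})))"
      have q: "?q t k = (1 / t) *\<^sub>R (D k n (x + t *\<^sub>R v n) (restrict v {..<n}) - D k n x (restrict v {..<n}))" for t k
        by (simp only: scaleR_fun_def minus_apply)
      have vn: "v n \<in> topspace g1_dual" by (rule PiE_mem[OF v]) simp
      have rv: "restrict v {..<n} \<in> {..<n} \<rightarrow>\<^sub>E topspace g1_dual"
        by (rule restrict_PiE_iff[THEN iffD2]) (use PiE_mem[OF v] in simp)
      have xt: "x + t *\<^sub>R v n \<in> topspace g1_dual" for t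
        using x vn unfolding topspace_dual
        by (intro subspace_add[OF subspace_dual] subspace_scale[OF subspace_dual])
      have DV: "D k n y (restrict v {..<n}) \<in> topspace (?Y k)" if "y \<in> topspace g1_dual" for y k
      proof -
        have "(y, restrict v {..<n}) \<in> topspace (prod_topology g1_dual (product_topology (\<lambda>i. g1_dual) {..<n}))"
          using that rv by (simp only: topspace_prod_topology topspace_product_topology mem_Sigma_iff)
        from funcset_mem[OF continuous_map_funspace[OF D3[of n k]] this] show ?thesis by (simp only: prod.case)
      qed
      show "(\<lambda>k. D k (Suc n) x v) \<in> {\<Gamma>. \<Gamma> 0 = 0}" by (simp only: D4 mem_Collect_eq)
      show "(\<lambda>k. D k (Suc n) x v) \<in> extensional UNIV" by simp
      have "?q t 0 = 0" for t by (simp only: q D4 diff_self scaleR_zero_right)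
      then show "\<forall>\<^sub>F t in at 0. ?q t \<in> {\<Gamma>. \<Gamma> 0 = 0}"
        by (intro always_eventually allI CollectI)
      have "?q t k \<in> topspace (?Y k)" for t k
        using DV[OF xt[of t], of k] DV[OF x, of k] unfolding q topspace_dual
        by (intro subspace_scale[OF subspace_dual] subspace_diff[OF subspace_dual])
      then show "\<forall>\<^sub>F t in at 0. ?q t \<in> topspace (product_topology ?Y UNIV)"
        unfolding topspace_product_topology by (intro always_eventually allI PiE_I) simp_all
      fix k
      show "limitin (?Y k) (\<lambda>t. ?q t k) (D k (Suc n) x v) (at 0)"
        unfolding q using D2[OF x v, of k] unfolding has_gateaux_derivative_def .
    qed
    show "continuous_map (prod_topology g1_dual (product_topology (\<lambda>i. g1_dual) {..<n})) G_inf_dual (\<lambda>(x, v). (\<lambda>k. D k n x v))"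
      unfolding G_inf_dual_def continuous_map_in_subtopology
    proof (rule conjI)
      show "continuous_map (prod_topology g1_dual (product_topology (\<lambda>i. g1_dual) {..<n}))
          (product_topology ?Y UNIV) (\<lambda>(x, v). (\<lambda>k. D k n x v))"
        unfolding continuous_map_componentwise_UNIV
      proof (rule allI)
        fix k
        show "continuous_map (prod_topology g1_dual (product_topology (\<lambda>i. g1_dual) {..<n})) (?Y k) (\<lambda>z. (case z of (x, v) \<Rightarrow> (\<lambda>k. D k n x v)) k)"
          using D3[of n k] by (simp only: case_prod_unfold)
      qed
      show "(\<lambda>(x, v). (\<lambda>k. D k n x v)) \<in> topspace (prod_topology g1_dual (product_topology (\<lambda>i. g1_dual) {..<n})) \<rightarrow> {\<Gamma>. \<Gamma> 0 = 0}"
        by (rule Pi_I) (simp only: case_prod_unfold D4 mem_Collect_eq)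
    qed
  qed
qed

section \<open>The algebra of smooth real functionals\<close>

lemma has_gateaux_real_iff:
  "has_gateaux_derivative euclideanreal f x v l \<longleftrightarrow> ((\<lambda>t. f (x + t *\<^sub>R v)) has_real_derivative l) (at 0)"
  unfolding has_gateaux_derivative_def limitin_canonical_iff DERIV_def by (simp add: divide_inverse mult.commute)

definition deriv_family :: "'a::real_vector topology \<Rightarrow> (nat \<Rightarrow> 'a \<Rightarrow> (nat \<Rightarrow> 'a) \<Rightarrow> real) \<Rightarrow> bool" where
  "deriv_family X D \<longleftrightarrow>
     (\<forall>n. \<forall>x\<in>topspace X. \<forall>v \<in> {..<Suc n} \<rightarrow>\<^sub>E topspace X.
        has_gateaux_derivative euclideanreal (\<lambda>y. D n y (restrict v {..<n})) x (v n) (D (Suc n) x v)) \<and>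
     (\<forall>n. continuous_map (prod_topology X (product_topology (\<lambda>i. X) {..<n})) euclideanreal (\<lambda>(x, v). D n x v))"

text \<open>By the Leibniz rule the n directions of a derivative of a product are distributed among
  the factors; e tells which of them are handed to the m-th derivative of a factor. The class is
  closed under one further derivative.\<close>

inductive deriv_alg :: "'a::real_vector topology \<Rightarrow> nat \<Rightarrow> ('a \<Rightarrow> (nat \<Rightarrow> 'a) \<Rightarrow> real) \<Rightarrow> bool"
  for X n where
  base: "deriv_family X D \<Longrightarrow> (\<And>i. i < m \<Longrightarrow> e i < n) \<Longrightarrow>
    deriv_alg X n (\<lambda>x v. D m x (restrict (\<lambda>i. v (e i)) {..<m}))"
| add: "deriv_alg X n \<phi> \<Longrightarrow> deriv_alg X n \<psi> \<Longrightarrow> deriv_alg X n (\<lambda>x v. \<phi> x v + \<psi> x v)"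
| mult: "deriv_alg X n \<phi> \<Longrightarrow> deriv_alg X n \<psi> \<Longrightarrow> deriv_alg X n (\<lambda>x v. \<phi> x v * \<psi> x v)"

text \<open>In a derivative of a product one factor is left alone; it must be read as an expression
  in one more direction, which it ignores.\<close>

lemma deriv_alg_restrict: "deriv_alg X n \<phi> \<Longrightarrow> deriv_alg X (Suc n) (\<lambda>x v. \<phi> x (restrict v {..<n}))"
proof (induction rule: deriv_alg.induct)
  case (base D m e)
  have "restrict (\<lambda>i. restrict v {..<n} (e i)) {..<m} = restrict (\<lambda>i. v (e i)) {..<m}" for v :: "nat \<Rightarrow> 'a"
    using base(2) by (intro ext) (simp add: restrict_def)
  moreover have "deriv_alg X (Suc n) (\<lambda>x v. D m x (restrict (\<lambda>i. v (e i)) {..<m}))"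
    by (rule deriv_alg.base[OF base(1)]) (use base(2) less_SucI in blast)
  ultimately show ?case by (simp only:)
next
  case (add \<phi> \<psi>)
  show ?case by (rule deriv_alg.add[OF add.IH])
next
  case (mult \<phi> \<psi>)
  show ?case by (rule deriv_alg.mult[OF mult.IH])
qed

lemma deriv_alg_continuous:
  "deriv_alg X n \<phi> \<Longrightarrow> continuous_map (prod_topology X (product_topology (\<lambda>i. X) {..<n})) euclideanreal (\<lambda>(x, v). \<phi> x v)"
proof (induction rule: deriv_alg.induct)
  case (base D m e)
  let ?T = "prod_topology X (product_topology (\<lambda>i. X) {..<n})"
  have "continuous_map ?T X (\<lambda>z. snd z (e i))" if "i < m" for i
  proof -
    have "continuous_map (product_topology (\<lambda>i. X) {..<n}) X (\<lambda>v. v (e i))"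
      using base(2)[OF that] by (intro continuous_map_product_projection) simp
    from continuous_map_compose[OF continuous_map_snd this] show ?thesis by (simp only: o_def)
  qed
  then have "continuous_map ?T (product_topology (\<lambda>i. X) {..<m}) (\<lambda>z. restrict (\<lambda>i. snd z (e i)) {..<m})"
    unfolding continuous_map_componentwise by (simp add: image_subset_iff restrict_extensional)
  then have "continuous_map ?T (prod_topology X (product_topology (\<lambda>i. X) {..<m})) (\<lambda>z. (fst z, restrict (\<lambda>i. snd z (e i)) {..<m}))"
    by (intro continuous_map_pairedI continuous_map_fst)
  moreover have "continuous_map (prod_topology X (product_topology (\<lambda>i. X) {..<m})) euclideanreal (\<lambda>(x, v). D m x v)"
    using base(1) by (simp add: deriv_family_def)
  ultimately have "continuous_map ?T euclideanreal ((\<lambda>(x, v). D m x v) \<circ> (\<lambda>z. (fst z, restrict (\<lambda>i. snd z (e i)) {..<m})))"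
    by (rule continuous_map_compose)
  then show ?case by (simp only: o_def case_prod_unfold fst_conv snd_conv)
next
  case (add \<phi> \<psi>)
  show ?case using add.IH unfolding case_prod_unfold by (rule continuous_map_add)
next
  case (mult \<phi> \<psi>)
  show ?case using mult.IH unfolding case_prod_unfold by (rule continuous_map_real_mult)
qed

lemma deriv_alg_derivative:
  "deriv_alg X n \<phi> \<Longrightarrow> \<exists>\<phi>'. deriv_alg X (Suc n) \<phi>' \<and> (\<forall>x\<in>topspace X. \<forall>v \<in> {..<Suc n} \<rightarrow>\<^sub>E topspace X.
     has_gateaux_derivative euclideanreal (\<lambda>y. \<phi> y (restrict v {..<n})) x (v n) (\<phi>' x v))"
proof (induction rule: deriv_alg.induct)
  case (base D m e)
  \<comment> \<open>The new direction, with number n, becomes the last argument of the derivative of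
    order \<open>Suc m\<close>.\<close>
  let ?e = "e(m := n)"
  have "deriv_alg X (Suc n) (\<lambda>x v. D (Suc m) x (restrict (\<lambda>i. v (?e i)) {..<Suc m}))"
  proof (rule deriv_alg.base[OF base(1)])
    fix i assume "i < Suc m"
    then show "?e i < Suc n" using base(2)[of i] by (cases "i = m") simp_all
  qed
  moreover have "has_gateaux_derivative euclideanreal (\<lambda>y. D m y (restrict (\<lambda>i. (restrict v {..<n}) (e i)) {..<m})) x (v n)
      (D (Suc m) x (restrict (\<lambda>i. v (?e i)) {..<Suc m}))"
    if x: "x \<in> topspace X" and v: "v \<in> {..<Suc n} \<rightarrow>\<^sub>E topspace X" for x v
  proof -
    let ?v = "restrict (\<lambda>i. v (?e i)) {..<Suc m}"
    have "v (?e i) \<in> topspace X" if "i < Suc m" for i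
    proof (rule PiE_mem[OF v])
      show "?e i \<in> {..<Suc n}" using base(2)[of i] that by (cases "i = m") simp_all
    qed
    then have vm: "?v \<in> {..<Suc m} \<rightarrow>\<^sub>E topspace X" by (intro restrict_PiE_iff[THEN iffD2]) simp
    have "has_gateaux_derivative euclideanreal (\<lambda>y. D m y (restrict ?v {..<m})) x (?v m) (D (Suc m) x ?v)"
      by (rule base(1)[unfolded deriv_family_def, THEN conjunct1, THEN spec, THEN bspec, THEN bspec, OF x vm])
    moreover have "restrict ?v {..<m} = restrict (\<lambda>i. (restrict v {..<n}) (e i)) {..<m}"
      using base(2) by (intro ext) (simp add: restrict_def)
    moreover have "?v m = v n" by simp
    ultimately show ?thesis by (simp only:)
  qed
  ultimately show ?case
    by (intro exI[of _ "\<lambda>x v. D (Suc m) x (restrict (\<lambda>i. v (?e i)) {..<Suc m})"] conjI ballI)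
next
  case (add \<phi> \<psi>)
  obtain \<phi>' where \<phi>': "deriv_alg X (Suc n) \<phi>'" "\<forall>x\<in>topspace X. \<forall>v \<in> {..<Suc n} \<rightarrow>\<^sub>E topspace X.
     has_gateaux_derivative euclideanreal (\<lambda>y. \<phi> y (restrict v {..<n})) x (v n) (\<phi>' x v)"
    using add.IH(1) by (elim exE conjE)
  obtain \<psi>' where \<psi>': "deriv_alg X (Suc n) \<psi>'" "\<forall>x\<in>topspace X. \<forall>v \<in> {..<Suc n} \<rightarrow>\<^sub>E topspace X.
     has_gateaux_derivative euclideanreal (\<lambda>y. \<psi> y (restrict v {..<n})) x (v n) (\<psi>' x v)"
    using add.IH(2) by (elim exE conjE)
  have "has_gateaux_derivative euclideanreal (\<lambda>y. \<phi> y (restrict v {..<n}) + \<psi> y (restrict v {..<n})) x (v n) (\<phi>' x v + \<psi>' x v)"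
    if x: "x \<in> topspace X" and v: "v \<in> {..<Suc n} \<rightarrow>\<^sub>E topspace X" for x v
    using bspec[OF bspec[OF \<phi>'(2) x] v] bspec[OF bspec[OF \<psi>'(2) x] v]
    unfolding has_gateaux_real_iff by (rule DERIV_add)
  then show ?case
    by (intro exI[of _ "\<lambda>x v. \<phi>' x v + \<psi>' x v"] conjI deriv_alg.add \<phi>'(1) \<psi>'(1) ballI)
next
  case (mult \<phi> \<psi>)
  obtain \<phi>' where \<phi>': "deriv_alg X (Suc n) \<phi>'" "\<forall>x\<in>topspace X. \<forall>v \<in> {..<Suc n} \<rightarrow>\<^sub>E topspace X.
     has_gateaux_derivative euclideanreal (\<lambda>y. \<phi> y (restrict v {..<n})) x (v n) (\<phi>' x v)"
    using mult.IH(1) by (elim exE conjE)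
  obtain \<psi>' where \<psi>': "deriv_alg X (Suc n) \<psi>'" "\<forall>x\<in>topspace X. \<forall>v \<in> {..<Suc n} \<rightarrow>\<^sub>E topspace X.
     has_gateaux_derivative euclideanreal (\<lambda>y. \<psi> y (restrict v {..<n})) x (v n) (\<psi>' x v)"
    using mult.IH(2) by (elim exE conjE)
  have "has_gateaux_derivative euclideanreal (\<lambda>y. \<phi> y (restrict v {..<n}) * \<psi> y (restrict v {..<n})) x (v n)
      (\<phi>' x v * \<psi> x (restrict v {..<n}) + \<psi>' x v * \<phi> x (restrict v {..<n}))"
    if x: "x \<in> topspace X" and v: "v \<in> {..<Suc n} \<rightarrow>\<^sub>E topspace X" for x v
    using DERIV_mult[OF bspec[OF bspec[OF \<phi>'(2) x] v, unfolded has_gateaux_real_iff]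
        bspec[OF bspec[OF \<psi>'(2) x] v, unfolded has_gateaux_real_iff]]
    unfolding has_gateaux_real_iff by simp
  then show ?case
    by (intro exI[of _ "\<lambda>x v. \<phi>' x v * \<psi> x (restrict v {..<n}) + \<psi>' x v * \<phi> x (restrict v {..<n})"] conjI ballI
        deriv_alg.add[OF deriv_alg.mult[OF \<phi>'(1) deriv_alg_restrict[OF mult.hyps(2)]]
          deriv_alg.mult[OF \<psi>'(1) deriv_alg_restrict[OF mult.hyps(1)]]])
qed

lemma deriv_alg_smooth:
  assumes "deriv_alg X 0 \<phi>" "\<And>x. x \<in> topspace X \<Longrightarrow> \<phi> x (\<lambda>i. undefined) = f x"
  shows "gateaux_smooth X euclideanreal f"
proof (rule gateaux_smoothI[where S = "deriv_alg X" and \<phi> = \<phi>])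
  show "deriv_alg X 0 \<phi>" by (rule assms(1))
  show "\<phi> x (\<lambda>i. undefined) = f x" if "x \<in> topspace X" for x by (rule assms(2)[OF that])
qed (erule deriv_alg_continuous deriv_alg_derivative)+

lemma gateaux_smooth_deriv_alg:
  assumes "gateaux_smooth X euclideanreal f"
  shows "\<exists>\<phi>. deriv_alg X 0 \<phi> \<and> (\<forall>x\<in>topspace X. \<phi> x (\<lambda>i. undefined) = f x)"
proof -
  obtain D where "(\<forall>x\<in>topspace X. D 0 x (\<lambda>i. undefined) = f x) \<and> deriv_family X D"
    using assms unfolding gateaux_smooth_def deriv_family_def by (elim exE)
  note D = conjunct1[OF this] conjunct2[OF this]
  have "deriv_alg X 0 (\<lambda>x v. D 0 x (restrict (\<lambda>i. v (id i)) {..<0}))"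
    by (rule deriv_alg.base[where m = 0 and e = id, OF D(2)]) simp
  \<comment> \<open>An empty family of directions is constantly \<open>undefined\<close>; this is
    the argument at which \<open>gateaux_smooth\<close> reads off the function itself.\<close>
  moreover have "restrict g {..<0} = (\<lambda>i::nat. undefined :: 'a)" for g
    by (intro ext) (simp add: restrict_def)
  ultimately have "deriv_alg X 0 (\<lambda>x v. D 0 x (\<lambda>i. undefined))" by (simp only:)
  then show ?thesis using D(1) by (intro exI[of _ "\<lambda>x v. D 0 x (\<lambda>i. undefined)"] conjI)
qed

lemma gateaux_smooth_add:
  assumes "gateaux_smooth X euclideanreal f" "gateaux_smooth X euclideanreal g"
  shows "gateaux_smooth X euclideanreal (\<lambda>x. f x + g x)"
proof -
  obtain \<phi> where \<phi>: "deriv_alg X 0 \<phi>" "\<forall>x\<in>topspace X. \<phi> x (\<lambda>i. undefined) = f x"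
    using gateaux_smooth_deriv_alg[OF assms(1)] by (elim exE conjE)
  obtain \<psi> where \<psi>: "deriv_alg X 0 \<psi>" "\<forall>x\<in>topspace X. \<psi> x (\<lambda>i. undefined) = g x"
    using gateaux_smooth_deriv_alg[OF assms(2)] by (elim exE conjE)
  show ?thesis
  proof (rule deriv_alg_smooth[OF deriv_alg.add[OF \<phi>(1) \<psi>(1)]])
    show "\<phi> x (\<lambda>i. undefined) + \<psi> x (\<lambda>i. undefined) = f x + g x" if "x \<in> topspace X" for x
      by (simp only: bspec[OF \<phi>(2) that] bspec[OF \<psi>(2) that])
  qed
qed

lemma gateaux_smooth_mult:
  assumes "gateaux_smooth X euclideanreal f" "gateaux_smooth X euclideanreal g"
  shows "gateaux_smooth X euclideanreal (\<lambda>x. f x * g x)"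
proof -
  obtain \<phi> where \<phi>: "deriv_alg X 0 \<phi>" "\<forall>x\<in>topspace X. \<phi> x (\<lambda>i. undefined) = f x"
    using gateaux_smooth_deriv_alg[OF assms(1)] by (elim exE conjE)
  obtain \<psi> where \<psi>: "deriv_alg X 0 \<psi>" "\<forall>x\<in>topspace X. \<psi> x (\<lambda>i. undefined) = g x"
    using gateaux_smooth_deriv_alg[OF assms(2)] by (elim exE conjE)
  show ?thesis
  proof (rule deriv_alg_smooth[OF deriv_alg.mult[OF \<phi>(1) \<psi>(1)]])
    show "\<phi> x (\<lambda>i. undefined) * \<psi> x (\<lambda>i. undefined) = f x * g x" if "x \<in> topspace X" for x
      by (simp only: bspec[OF \<phi>(2) that] bspec[OF \<psi>(2) that])
  qed
qed

lemma gateaux_smooth_const: "gateaux_smooth X euclideanreal (\<lambda>x. c)"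
  unfolding gateaux_smooth_def
proof (intro exI[of _ "\<lambda>n x v. if n = 0 then c else 0"] conjI allI ballI)
  fix n x and v :: "nat \<Rightarrow> 'a"
  show "has_gateaux_derivative euclideanreal (\<lambda>y. if n = 0 then c else 0) x (v n) (if Suc n = 0 then c else 0)"
    unfolding has_gateaux_real_iff by simp
  show "continuous_map (prod_topology X (product_topology (\<lambda>i. X) {..<n})) euclideanreal (\<lambda>(x, v). if n = 0 then c else 0)"
    unfolding case_prod_unfold by simp
qed simp

lemma gateaux_smooth_sum:
  "(\<And>i. i \<in> A \<Longrightarrow> gateaux_smooth X euclideanreal (f i)) \<Longrightarrow> gateaux_smooth X euclideanreal (\<lambda>x. \<Sum>i\<in>A. f i x)"
proof (induction A rule: infinite_finite_induct)
  case (insert i A)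
  have "gateaux_smooth X euclideanreal (\<lambda>x. f i x + (\<Sum>i\<in>A. f i x))"
    by (rule gateaux_smooth_add) (use insert in simp_all)
  then show ?case by (simp only: sum.insert[OF insert.hyps])
qed (simp_all add: gateaux_smooth_const)

text \<open>The singleton of h is a bounded set, and its strong dual seminorm bounds the evaluation
  at h. The cut-off outside the space makes the evaluation an element of \<open>tvs_dual\<close>, to
  which \<open>dual.dualI\<close> applies.\<close>

lemma continuous_map_evaluation:
  fixes h :: "'d::finite obs"
  assumes h: "h \<in> sym_smooth k"
  shows "continuous_map (strong_dual (sym_smooth_top k)) euclideanreal (\<lambda>\<phi>. \<phi> h)"
proof -
  let ?V = "tvs_dual (sym_smooth_top k) :: ('d obs \<Rightarrow> real) set"
  let ?ev = "\<lambda>\<phi>. if \<phi> \<in> ?V then \<phi> h else 0"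
  have B: "tvs_bounded (sym_smooth_top k) {h}"
    unfolding sym_smooth_top_cn sym.bounded_iff
  proof (intro conjI ballI)
    show "{h} \<subseteq> sym_smooth k" using h by simp
    show "\<exists>M. \<forall>x\<in>{h}. p x \<le> M" for p :: "'d obs \<Rightarrow> real" by (rule exI[of _ "p h"]) simp
  qed
  have "?ev \<in> tvs_dual (seminorm_topology ?V (sup_norms k))"
  proof (rule dual.dualI[where p = "sup_norm {h}" and C = 1])
    show "?ev (x + y) = ?ev x + ?ev y" if "x \<in> ?V" "y \<in> ?V" for x y
      using that subspace_add[OF subspace_dual that] by (simp only: if_True plus_functional)
    show "?ev (c *\<^sub>R x) = c * ?ev x" if "x \<in> ?V" for c x
      using that subspace_scale[OF subspace_dual that, of c] by (simp only: if_True scaleR_functional)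
    show "sup_norm {h} \<in> sup_norms k"
      unfolding sup_norms_def using B by (intro CollectI exI[of _ "{h}"]) simp
    show "\<bar>?ev x\<bar> \<le> 1 * sup_norm {h} x" if "x \<in> ?V" for x
      using sup_norm_upper[OF that B, of h] that by simp
  qed simp
  then have "continuous_map (strong_dual (sym_smooth_top k)) euclideanreal ?ev"
    unfolding tvs_dual_def strong_dual_sup_norms by simp
  then show ?thesis by (rule continuous_map_eq) (simp only: topspace_dual if_True)
qed

lemma gateaux_derivative_evaluation:
  assumes "h \<in> sym_smooth k" "has_gateaux_derivative (strong_dual (sym_smooth_top k)) f x v l"
  shows "has_gateaux_derivative euclideanreal (\<lambda>x. f x h) x v (l h)"
proof -
  have "limitin euclideanreal ((\<lambda>\<phi>. \<phi> h) \<circ> (\<lambda>t. (1 / t) *\<^sub>R (f (x + t *\<^sub>R v) - f x))) (l h) (at 0)"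
    by (rule continuous_map_limit[OF continuous_map_evaluation[OF assms(1)] assms(2)[unfolded has_gateaux_derivative_def]])
  then show ?thesis
    unfolding has_gateaux_derivative_def by (simp only: o_def scaleR_functional minus_functional real_scaleR_def)
qed

lemma gateaux_smooth_evaluation:
  assumes h: "h \<in> sym_smooth k" and f: "gateaux_smooth X (strong_dual (sym_smooth_top k)) f"
  shows "gateaux_smooth X euclideanreal (\<lambda>x. f x h)"
proof -
  obtain D where D: "\<forall>x\<in>topspace X. D 0 x (\<lambda>i. undefined) = f x"
    "\<forall>n. \<forall>x\<in>topspace X. \<forall>v \<in> {..<Suc n} \<rightarrow>\<^sub>E topspace X.
        has_gateaux_derivative (strong_dual (sym_smooth_top k)) (\<lambda>y. D n y (restrict v {..<n})) x (v n) (D (Suc n) x v)"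
    "\<forall>n. continuous_map (prod_topology X (product_topology (\<lambda>i. X) {..<n})) (strong_dual (sym_smooth_top k)) (\<lambda>(x, v). D n x v)"
    using f unfolding gateaux_smooth_def by (elim exE conjE)
  show ?thesis
    unfolding gateaux_smooth_def
  proof (intro exI[of _ "\<lambda>n x v. D n x v h"] conjI allI ballI)
    show "D 0 x (\<lambda>i. undefined) h = f x h" if "x \<in> topspace X" for x
      by (simp only: bspec[OF D(1) that])
    show "has_gateaux_derivative euclideanreal (\<lambda>y. D n y (restrict v {..<n}) h) x (v n) (D (Suc n) x v h)"
      if "x \<in> topspace X" "v \<in> {..<Suc n} \<rightarrow>\<^sub>E topspace X" for n x v
      by (rule gateaux_derivative_evaluation[OF h bspec[OF bspec[OF spec[OF D(2)] that(1)] that(2)]])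
    show "continuous_map (prod_topology X (product_topology (\<lambda>i. X) {..<n})) euclideanreal (\<lambda>(x, v). D n x v h)" for n
      using continuous_map_compose[OF spec[OF D(3), of n] continuous_map_evaluation[OF h]]
      by (simp only: o_def case_prod_unfold)
  qed
qed

lemma G_infD:
  assumes "F \<in> G_inf"
  shows "F 0 = 0" "k \<ge> 1 \<Longrightarrow> F k \<in> sym_smooth k" "finite {k. F k \<noteq> 0}" "F k \<noteq> 0 \<Longrightarrow> k \<ge> 1"
proof -
  show F0: "F 0 = 0" and "k \<ge> 1 \<Longrightarrow> F k \<in> sym_smooth k" and "finite {k. F k \<noteq> 0}"
    using assms by (simp_all add: G_inf_def)
  show "k \<ge> 1" if "F k \<noteq> 0"
    using that F0 by (cases k) simp_all
qed

lemma gateaux_smooth_A_inf: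
  fixes \<F> :: "(nat \<Rightarrow> 'd::finite obs \<Rightarrow> real) \<Rightarrow> real"
  assumes "\<F> \<in> A_inf"
  shows "gateaux_smooth g1_dual euclideanreal (\<F> \<circ> iota)"
  using assms
proof (induction rule: A_inf.induct)
  case (const c)
  then show ?case by (simp only: o_def gateaux_smooth_const)
next
  case (linear F)
  have "gateaux_smooth g1_dual euclideanreal (\<lambda>\<gamma>. \<Sum>k | F k \<noteq> 0. iota \<gamma> k (F k))"
  proof (rule gateaux_smooth_sum)
    fix k assume "k \<in> {k. F k \<noteq> 0}"
    then have k: "k \<ge> 1" using G_infD(4)[OF linear] by simp
    show "gateaux_smooth g1_dual euclideanreal (\<lambda>\<gamma>. iota \<gamma> k (F k))"
      unfolding iota_pos[OF k] by (rule gateaux_smooth_evaluation[OF G_infD(2)[OF linear k] gateaux_smooth_tensor_power[OF k]])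
  qed
  then show ?case by (simp only: o_def pairing_def)
next
  case (add \<F> \<G>)
  show ?case using add.IH unfolding o_def by (rule gateaux_smooth_add)
next
  case (mult \<F> \<G>)
  show ?case using mult.IH unfolding o_def by (rule gateaux_smooth_mult)
qed

section \<open>Symmetry of tensor powers\<close>

text \<open>Fubini as the rule that any slot can be made the one applied last. Iterating it shows
  that only the set of slots counts.\<close>

lemma apply_slots_remove1:
  assumes w: "\<And>i. i \<in> set xs \<Longrightarrow> w i \<in> dual1" and h: "smooth_config h"
  shows "distinct xs \<Longrightarrow> i \<in> set xs \<Longrightarrow> apply_slots w xs h = apply_at (w i) i (apply_slots w (remove1 i xs) h)"
  using w
proof (induction xs)
  case (Cons j xs)
  show ?case
  proof (cases "i = j")
    case False
    have i: "i \<in> set xs" and d: "distinct xs" using Cons.prems(1,2) False by auto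
    have wxs: "\<And>i. i \<in> set xs \<Longrightarrow> w i \<in> dual1" using Cons.prems(3) by simp
    have wr: "\<And>k. k \<in> set (remove1 i xs) \<Longrightarrow> w k \<in> dual1"
      using wxs set_remove1_subset by fast
    have "apply_slots w xs h = apply_at (w i) i (apply_slots w (remove1 i xs) h)"
      by (rule Cons.IH[OF d i wxs])
    moreover have "apply_at (w j) j (apply_at (w i) i (apply_slots w (remove1 i xs) h))
        = apply_at (w i) i (apply_at (w j) j (apply_slots w (remove1 i xs) h))"
      by (rule apply_at_commute[OF _ _ _ smooth_config_apply_slots[OF wr h]]) (use Cons.prems(3) i False in auto)
    ultimately show ?thesis using False by simp
  qed simp
qed simp

lemma apply_slots_order:
  assumes h: "smooth_config h"
  shows "distinct xs \<Longrightarrow> distinct ys \<Longrightarrow> set xs = set ys \<Longrightarrow> (\<And>i. i \<in> set xs \<Longrightarrow> w i \<in> dual1) \<Longrightarrow>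
    apply_slots w xs h = apply_slots w ys h"
proof (induction xs arbitrary: ys)
  case (Cons i xs)
  have i: "i \<in> set ys" using Cons.prems(3) by auto
  have wy: "\<And>i. i \<in> set ys \<Longrightarrow> w i \<in> dual1" using Cons.prems(3,4) by simp
  have "apply_slots w xs h = apply_slots w (remove1 i ys) h"
  proof (rule Cons.IH)
    show "distinct xs" using Cons.prems(1) by simp
    show "distinct (remove1 i ys)" using Cons.prems(2) by simp
    show "set xs = set (remove1 i ys)" using Cons.prems(1,2,3) by (auto simp: set_remove1_eq)
    show "\<And>i. i \<in> set xs \<Longrightarrow> w i \<in> dual1" using Cons.prems(4) by simp
  qed
  then show ?case using apply_slots_remove1[OF wy h Cons.prems(2) i] by simp
qed simp

text \<open>Changing entry i of Z changes entry \<open>inv \<pi> i\<close> of the permuted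
  configuration, so the slots are relabelled by \<open>inv \<pi>\<close> and the distributions by
  \<pi>.\<close>

lemma apply_slots_permute:
  assumes "\<pi> permutes A"
  shows "apply_slots w xs (\<lambda>Z. h (\<lambda>m. Z (\<pi> m))) = (\<lambda>Z. apply_slots (w \<circ> \<pi>) (map (inv \<pi>) xs) h (\<lambda>m. Z (\<pi> m)))"
proof (induction xs)
  case (Cons i xs)
  have upd: "(\<lambda>m. (Z(i := y)) (\<pi> m)) = (\<lambda>m. Z (\<pi> m))(inv \<pi> i := y)" for Z :: "'a config" and y
    using permutes_inverses[OF assms] by (auto simp: fun_eq_iff)
  have "apply_at \<gamma> i (\<lambda>Z. g (\<lambda>m. Z (\<pi> m))) = (\<lambda>Z. apply_at \<gamma> (inv \<pi> i) g (\<lambda>m. Z (\<pi> m)))"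
    for \<gamma> and g :: "'a obs"
    unfolding apply_at_def upd ..
  then show ?case
    unfolding apply_slots_Cons list.map Cons.IH using permutes_inverses(1)[OF assms] by (simp only: o_def)
qed simp

lemma smooth_config_permute:
  assumes h: "smooth_config h" and \<pi>: "\<pi> permutes A"
  shows "smooth_config (\<lambda>Z. h (\<lambda>m. Z (\<pi> m)))"
  using smooth_config_subst[OF h, of \<pi> UNIV] permutes_inj[OF \<pi>] by simp

text \<open>The relabelled list of slots is a rearrangement of the same slots, so Fubini restores
  the order; the constant configuration 0 is unchanged by \<pi>.\<close>

lemma apply_slots_permute_all:
  assumes \<pi>: "\<pi> permutes {1..k}" and h: "smooth_config h" and w: "\<And>i. w i \<in> dual1"
  shows "apply_slots w [1..<Suc k] (\<lambda>Z. h (\<lambda>m. Z (\<pi> m))) (\<lambda>i. 0) = apply_slots (w \<circ> \<pi>) [1..<Suc k] h (\<lambda>i. 0)"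
proof -
  have inv: "inv \<pi> permutes {1..k}" by (rule permutes_inv[OF \<pi>])
  have st: "set [1..<Suc k] = {1..k}" by (simp only: set_upt atLeastLessThanSuc_atLeastAtMost)
  have "apply_slots (w \<circ> \<pi>) (map (inv \<pi>) [1..<Suc k]) h = apply_slots (w \<circ> \<pi>) [1..<Suc k] h"
  proof (rule apply_slots_order[OF h])
    show "distinct (map (inv \<pi>) [1..<Suc k])"
      unfolding distinct_map using inj_on_subset[OF permutes_inj[OF inv] subset_UNIV] by simp
    show "set (map (inv \<pi>) [1..<Suc k]) = set [1..<Suc k]"
      unfolding set_map st by (rule permutes_image[OF inv])
  qed (simp_all add: w del: upt_Suc)
  then show ?thesis unfolding apply_slots_permute[OF \<pi>] by (simp only:)
qed

definition rest_slots :: "('d::finite obs \<Rightarrow> real) \<Rightarrow> nat \<Rightarrow> 'd obs \<Rightarrow> 'd obs" where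
  "rest_slots \<gamma> k f = apply_slots (\<lambda>_. \<gamma>) [2..<Suc k] f"

lemma upt_1: "k \<ge> 1 \<Longrightarrow> [1..<Suc k] = 1 # [2..<Suc k]"
  by (simp add: upt_conv_Cons numeral_2_eq_2 One_nat_def del: upt_Suc)

lemma depends_on_rest_slots:
  assumes "depends_on {1..k} f"
  shows "depends_on {1} (rest_slots \<gamma> k f)"
proof -
  have "depends_on ({1..k} - set [2..<Suc k]) (rest_slots \<gamma> k f)"
    unfolding rest_slots_def by (rule depends_on_apply_slots[OF assms])
  then show ?thesis by (rule depends_on_mono) auto
qed

lemma rest_slots_sym_smooth:
  assumes \<gamma>: "\<gamma> \<in> dual1" and f: "f \<in> sym_smooth k"
  shows "rest_slots \<gamma> k f \<in> sym_smooth 1"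
  unfolding sym_smooth_1_iff
proof
  show "depends_on {1} (rest_slots \<gamma> k f)" by (rule depends_on_rest_slots[OF sym_smooth_depends[OF f]])
  show "smooth_config (rest_slots \<gamma> k f)"
    unfolding rest_slots_def by (rule smooth_config_apply_slots[OF \<gamma> sym_smooth_smooth[OF f]])
qed

lemma apply_at_1_depends:
  assumes "depends_on {1} u"
  shows "apply_at \<gamma> 1 u Z = \<gamma> u"
proof -
  have "slice 1 u Z = u" unfolding slice_def by (intro ext depends_onD[OF assms]) simp
  then show ?thesis by (simp only: apply_at_slice)
qed

text \<open>Symmetry of f and the transposition of 1 and j bring \<delta> to slot 1, which is
  applied last. The right side is free of j, so summing over the slots yields the factor k of the
  gradient.\<close>

lemma tens_single_slot:
  fixes \<gamma> \<delta> :: "'d::finite obs \<Rightarrow> real"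
  assumes \<gamma>: "\<gamma> \<in> dual1" and \<delta>: "\<delta> \<in> dual1" and f: "f \<in> sym_smooth k" and j: "j \<in> {1..k}"
  shows "tens ((\<lambda>_. \<gamma>)(j := \<delta>)) k f = \<delta> (rest_slots \<gamma> k f)"
proof -
  let ?w = "(\<lambda>_. \<gamma>)(j := \<delta>)" and ?w1 = "(\<lambda>_. \<gamma>)(1 := \<delta>)" and ?\<pi> = "Transposition.transpose 1 j"
  have k: "k \<ge> 1" using j by simp
  have \<pi>: "?\<pi> permutes {1..k}" by (rule permutes_swap_id) (use j in simp_all)
  have "f = (\<lambda>Z. f (\<lambda>m. Z (?\<pi> m)))" using f \<pi> by (intro ext) (simp add: sym_smooth_iff)
  then have "apply_slots ?w [1..<Suc k] f (\<lambda>i. 0) = apply_slots ?w [1..<Suc k] (\<lambda>Z. f (\<lambda>m. Z (?\<pi> m))) (\<lambda>i. 0)"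
    by (simp only:)
  also have "\<dots> = apply_slots (?w \<circ> ?\<pi>) [1..<Suc k] f (\<lambda>i. 0)"
    by (rule apply_slots_permute_all[OF \<pi> sym_smooth_smooth[OF f]]) (simp add: \<gamma> \<delta>)
  also have "?w \<circ> ?\<pi> = ?w1" by (auto simp: fun_eq_iff Transposition.transpose_def)
  also have "apply_slots ?w1 [1..<Suc k] f (\<lambda>i. 0) = apply_at \<delta> 1 (apply_slots ?w1 [2..<Suc k] f) (\<lambda>i. 0)"
    unfolding upt_1[OF k] by simp
  also have "apply_slots ?w1 [2..<Suc k] f = rest_slots \<gamma> k f"
    unfolding rest_slots_def by (rule apply_slots_cong) auto
  also have "apply_at \<delta> 1 (rest_slots \<gamma> k f) (\<lambda>i. 0) = \<delta> (rest_slots \<gamma> k f)"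
    by (rule apply_at_1_depends[OF depends_on_rest_slots[OF sym_smooth_depends[OF f]]])
  finally show ?thesis unfolding tens_def using f by (simp only: if_True)
qed

lemma apply_slots_zero:
  assumes w: "\<And>i. i \<in> set xs \<Longrightarrow> w i \<in> dual1"
  shows "apply_slots w xs (\<lambda>Z. 0) = (\<lambda>Z. 0)"
  using apply_slots_lincomb[of xs w "\<lambda>Z. 0" "\<lambda>Z. 0" 0 0, OF w smooth_config_const smooth_config_const] by simp

lemma apply_slots_sum:
  assumes w: "\<And>i. i \<in> set xs \<Longrightarrow> w i \<in> dual1"
  shows "(\<And>b. b \<in> B \<Longrightarrow> smooth_config (f b)) \<Longrightarrow>
    apply_slots w xs (\<lambda>Z. \<Sum>b\<in>B. f b Z) = (\<lambda>Z. \<Sum>b\<in>B. apply_slots w xs (f b) Z)"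
proof (induction B rule: infinite_finite_induct)
  case (insert b B)
  have fb: "smooth_config (f b)" and fB: "smooth_config (\<lambda>Z. \<Sum>b\<in>B. f b Z)"
    using insert.prems by (simp_all add: smooth_config_sum)
  have "apply_slots w xs (\<lambda>Z. 1 * f b Z + 1 * (\<Sum>b\<in>B. f b Z))
      = (\<lambda>Z. 1 * apply_slots w xs (f b) Z + 1 * apply_slots w xs (\<lambda>Z. \<Sum>b\<in>B. f b Z) Z)"
    by (rule apply_slots_lincomb[OF w fb fB])
  then show ?case using insert by (simp add: fun_eq_iff)
next
  case empty
  show ?case unfolding sum.empty by (rule apply_slots_zero[OF w])
next
  case (infinite B)
  show ?case unfolding sum.infinite[OF infinite(1)] by (rule apply_slots_zero[OF w])
qed

section \<open>Tensor powers applied to wedge products\<close>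

lemma apply_slots_mult:
  assumes \<gamma>: "\<gamma> \<in> dual1" and p: "depends_on I p" and q: "smooth_config q"
  shows "set xs \<inter> I = {} \<Longrightarrow> apply_slots (\<lambda>_. \<gamma>) xs (\<lambda>Z. p Z * q Z) = (\<lambda>Z. p Z * apply_slots (\<lambda>_. \<gamma>) xs q Z)"
proof (induction xs)
  case (Cons i xs)
  have "apply_at \<gamma> i (\<lambda>Z. p Z * apply_slots (\<lambda>_. \<gamma>) xs q Z) = (\<lambda>Z. p Z * apply_at \<gamma> i (apply_slots (\<lambda>_. \<gamma>) xs q) Z)"
    by (rule apply_at_mult[OF \<gamma> p _ smooth_config_apply_slots[OF \<gamma> q]]) (use Cons.prems in auto)
  then show ?case using Cons by simp
qed simp

lemma partial_deriv_apply_slots: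
  assumes \<gamma>: "\<gamma> \<in> dual1" and h: "smooth_config h" and a: "snd a \<in> Basis"
  shows "fst a \<notin> set xs \<Longrightarrow> partial_deriv a (apply_slots (\<lambda>_. \<gamma>) xs h) = apply_slots (\<lambda>_. \<gamma>) xs (partial_deriv a h)"
proof (induction xs)
  case (Cons i xs)
  have "partial_deriv a (apply_at \<gamma> i (apply_slots (\<lambda>_. \<gamma>) xs h)) = apply_at \<gamma> i (partial_deriv a (apply_slots (\<lambda>_. \<gamma>) xs h))"
    by (rule partial_deriv_apply_at[OF \<gamma> smooth_config_apply_slots[OF \<gamma> h] a]) (use Cons.prems in auto)
  then show ?case using Cons by simp
qed simp

text \<open>The points \<open>z\<^sub>1, z\<^sub>l\<^sub>+\<^sub>1, z\<^sub>l\<^sub>+\<^sub>2,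
  \<dots>\<close> at which the second factor of a wedge product is evaluated; it shares only slot 1
  with the first factor.\<close>

abbreviation wedge_shift :: "nat \<Rightarrow> 'd::finite config \<Rightarrow> 'd config" where
  "wedge_shift l Z \<equiv> (\<lambda>i. if i = 1 then Z 1 else Z (l + i - 1))"

lemma apply_slots_wedge_shift:
  assumes l: "l \<ge> 1"
  shows "\<forall>i\<in>set xs. i \<ge> 2 \<Longrightarrow> apply_slots (\<lambda>_. \<gamma>) (map (\<lambda>i. l + i - 1) xs) (\<lambda>Z. q (wedge_shift l Z))
    = (\<lambda>Z. apply_slots (\<lambda>_. \<gamma>) xs q (wedge_shift l Z))"
proof (induction xs)
  case (Cons i xs)
  have i: "i \<ge> 2" using Cons.prems by simp
  have upd: "wedge_shift l (Z(l + i - 1 := y)) = (wedge_shift l Z)(i := y)" for Z :: "'a config" and y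
    using i l by (auto simp: fun_eq_iff)
  have "apply_at \<gamma> (l + i - 1) (\<lambda>Z. g (wedge_shift l Z)) = (\<lambda>Z. apply_at \<gamma> i g (wedge_shift l Z))" for g :: "'a obs"
    unfolding apply_at_def upd ..
  then show ?case using Cons by simp
qed simp

text \<open>The relabelling is injective on the indices 1 to j, whereas index 0 may collide with
  index 1 (for l = 2). It is therefore cut down to the indices on which q depends.\<close>

lemma smooth_config_wedge_shift:
  assumes q: "smooth_config q" "depends_on {1..j} q" and l: "l \<ge> 1"
  shows "smooth_config (\<lambda>Z. q (wedge_shift l Z))"
proof -
  let ?\<sigma> = "\<lambda>i. if i = 1 then 1 else l + i - 1"
  have "inj_on ?\<sigma> {1..j}" using l by (auto simp: inj_on_def)
  then have "smooth_config (\<lambda>Z. q (\<lambda>i. if i \<in> {1..j} then Z (?\<sigma> i) else 0))" by (rule smooth_config_subst[OF q(1)])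
  moreover have "q (\<lambda>i. if i \<in> {1..j} then Z (?\<sigma> i) else 0) = q (wedge_shift l Z)" for Z :: "'a config"
    by (rule depends_onD[OF q(2)]) simp
  ultimately show ?thesis by (simp only:)
qed

text \<open>Apart from the shared slot 1, the two factors live on disjoint blocks of slots, 2 to l
  and l + 1 to l + j - 1. Each block acts on its own factor and treats the other as
  constant.\<close>

lemma tensor_wedge_product:
  fixes p q :: "'d::finite obs"
  assumes \<gamma>: "\<gamma> \<in> dual1" and p: "smooth_config p" "depends_on {1..l} p" and q: "smooth_config q" "depends_on {1..j} q"
    and l: "l \<ge> 1" and j: "j \<ge> 1"
  shows "rest_slots \<gamma> (l + j - 1) (\<lambda>Z. p Z * q (wedge_shift l Z)) = (\<lambda>Z. rest_slots \<gamma> l p Z * rest_slots \<gamma> j q Z)"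
proof -
  let ?a = "apply_slots (\<lambda>_. \<gamma>)" and ?k = "l + j - 1"
  have s: "smooth_config (\<lambda>Z. q (wedge_shift l Z))" by (rule smooth_config_wedge_shift[OF q l])
  \<comment> \<open>The later block stands last in the list and so acts first. It has j - 1 slots
    and is empty for j = 1.\<close>
  have split: "[2..<Suc ?k] = [2..<Suc l] @ [Suc l..<Suc ?k]"
  proof -
    have eq: "Suc ?k = Suc l + (j - 1)" using l j by simp
    show ?thesis unfolding eq by (rule upt_add_eq_append) (use l in simp)
  qed
  have "?a [Suc l..<Suc ?k] (\<lambda>Z. q (wedge_shift l Z)) = ?a (map (\<lambda>i. l + i - 1) [2..<Suc j]) (\<lambda>Z. q (wedge_shift l Z))"
  proof (rule apply_slots_order[OF s])
    show "distinct (map (\<lambda>i. l + i - 1) [2..<Suc j])" by (simp add: distinct_map inj_on_def del: upt_Suc) auto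
    show "set [Suc l..<Suc ?k] = set (map (\<lambda>i. l + i - 1) [2..<Suc j])"
    proof (intro set_eqI iffI)
      fix x assume "x \<in> set [Suc l..<Suc ?k]"
      then have "x = l + (x + 1 - l) - 1" "x + 1 - l \<in> set [2..<Suc j]" using l j by (auto simp del: upt_Suc)
      then show "x \<in> set (map (\<lambda>i. l + i - 1) [2..<Suc j])" unfolding set_map by (rule image_eqI)
    qed (use l j in \<open>auto simp del: upt_Suc\<close>)
  qed (simp_all add: \<gamma> del: upt_Suc)
  also have "\<dots> = (\<lambda>Z. ?a [2..<Suc j] q (wedge_shift l Z))"
    by (rule apply_slots_wedge_shift[OF l]) (simp del: upt_Suc)
  also have "\<dots> = rest_slots \<gamma> j q"
  proof
    fix Z :: "'d config"
    have "rest_slots \<gamma> j q (wedge_shift l Z) = rest_slots \<gamma> j q Z"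
      by (rule depends_onD[OF depends_on_rest_slots[OF q(2)]]) simp
    then show "?a [2..<Suc j] q (wedge_shift l Z) = rest_slots \<gamma> j q Z" by (simp only: rest_slots_def)
  qed
  finally have inner: "?a [Suc l..<Suc ?k] (\<lambda>Z. q (wedge_shift l Z)) = rest_slots \<gamma> j q" .
  have "?a [Suc l..<Suc ?k] (\<lambda>Z. p Z * q (wedge_shift l Z)) = (\<lambda>Z. p Z * rest_slots \<gamma> j q Z)"
    unfolding inner[symmetric] by (rule apply_slots_mult[OF \<gamma> p(2) s]) (auto simp del: upt_Suc)
  moreover have "?a [2..<Suc l] (\<lambda>Z. rest_slots \<gamma> j q Z * p Z) = (\<lambda>Z. rest_slots \<gamma> j q Z * ?a [2..<Suc l] p Z)"
    by (rule apply_slots_mult[OF \<gamma> depends_on_rest_slots[OF q(2)] p(1)]) (simp del: upt_Suc)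
  ultimately show ?thesis
    unfolding rest_slots_def[of \<gamma> ?k] split apply_slots_append by (simp only: rest_slots_def[of \<gamma> l] mult.commute)
qed

lemma Basis_x: "b \<in> Basis \<Longrightarrow> snd (i, (b, 0)) \<in> (Basis :: 'd::finite phase set)"
  by (simp add: Basis_prod_def)

lemma Basis_v: "b \<in> Basis \<Longrightarrow> snd (i, (0, b)) \<in> (Basis :: 'd::finite phase set)"
  by (simp add: Basis_prod_def)

lemma smooth_config_grad:
  fixes f g :: "'d::finite obs"
  assumes f: "smooth_config f" and g: "smooth_config g" "depends_on {1..j} g" and l: "l \<ge> 1"
  shows "smooth_config (\<lambda>Z. grad_x_dot_grad_v 1 f Z g (wedge_shift l Z))"
  unfolding grad_x_dot_grad_v_def
  by (intro smooth_config_sum smooth_config_mult smooth_config_partial_deriv[OF f Basis_x]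
      smooth_config_wedge_shift[OF smooth_config_partial_deriv[OF g(1) Basis_v] depends_on_partial_deriv[OF g(2)] l])

text \<open>Derivatives in slot 1 commute with \<gamma> acting in the other slots, so the
  integration of those slots reduces the expression to one for the two one-particle functions; slot
  1 is applied at the end.\<close>

lemma tensor_grad:
  fixes f g :: "'d::finite obs"
  assumes \<gamma>: "\<gamma> \<in> dual1" and f: "smooth_config f" "depends_on {1..l} f" and g: "smooth_config g" "depends_on {1..j} g"
    and l: "l \<ge> 1" and j: "j \<ge> 1"
  shows "apply_slots (\<lambda>_. \<gamma>) [1..<Suc (l + j - 1)] (\<lambda>Z. grad_x_dot_grad_v 1 f Z g (wedge_shift l Z)) Z0
    = \<gamma> (\<lambda>W. grad_x_dot_grad_v 1 (rest_slots \<gamma> l f) W (rest_slots \<gamma> j g) W)"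
proof -
  let ?k = "l + j - 1"
  have k: "?k \<ge> 1" using l j by simp
  let ?p = "\<lambda>b. partial_deriv (1, (b, 0)) f" and ?q = "\<lambda>b. partial_deriv (1, (0, b)) g"
  have s: "smooth_config (\<lambda>Z. ?p b Z * ?q b (wedge_shift l Z))" if "b \<in> Basis" for b
    by (intro smooth_config_mult smooth_config_partial_deriv[OF f(1) Basis_x[OF that]]
      smooth_config_wedge_shift[OF smooth_config_partial_deriv[OF g(1) Basis_v[OF that]] depends_on_partial_deriv[OF g(2)] l])
  have "rest_slots \<gamma> ?k (\<lambda>Z. \<Sum>b\<in>Basis. ?p b Z * ?q b (wedge_shift l Z))
      = (\<lambda>Z. \<Sum>b\<in>Basis. rest_slots \<gamma> ?k (\<lambda>Z. ?p b Z * ?q b (wedge_shift l Z)) Z)"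
    unfolding rest_slots_def by (rule apply_slots_sum[OF \<gamma> s])
  also have "\<dots> = (\<lambda>Z. \<Sum>b\<in>Basis. partial_deriv (1, (b, 0)) (rest_slots \<gamma> l f) Z * partial_deriv (1, (0, b)) (rest_slots \<gamma> j g) Z)"
  proof (intro ext sum.cong refl)
    fix Z and b :: "real ^ 'd" assume b: "b \<in> Basis"
    have "rest_slots \<gamma> ?k (\<lambda>Z. ?p b Z * ?q b (wedge_shift l Z)) = (\<lambda>Z. rest_slots \<gamma> l (?p b) Z * rest_slots \<gamma> j (?q b) Z)"
      by (rule tensor_wedge_product[OF \<gamma> smooth_config_partial_deriv[OF f(1) Basis_x[OF b]] depends_on_partial_deriv[OF f(2)]
            smooth_config_partial_deriv[OF g(1) Basis_v[OF b]] depends_on_partial_deriv[OF g(2)] l j])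
    moreover have "rest_slots \<gamma> l (?p b) = partial_deriv (1, (b, 0)) (rest_slots \<gamma> l f)"
      unfolding rest_slots_def by (rule partial_deriv_apply_slots[OF \<gamma> f(1) Basis_x[OF b], symmetric]) (simp del: upt_Suc)
    moreover have "rest_slots \<gamma> j (?q b) = partial_deriv (1, (0, b)) (rest_slots \<gamma> j g)"
      unfolding rest_slots_def by (rule partial_deriv_apply_slots[OF \<gamma> g(1) Basis_v[OF b], symmetric]) (simp del: upt_Suc)
    ultimately show "rest_slots \<gamma> ?k (\<lambda>Z. ?p b Z * ?q b (wedge_shift l Z)) Z
        = partial_deriv (1, (b, 0)) (rest_slots \<gamma> l f) Z * partial_deriv (1, (0, b)) (rest_slots \<gamma> j g) Z" by (simp only:)
  qed
  finally have eq: "rest_slots \<gamma> ?k (\<lambda>Z. grad_x_dot_grad_v 1 f Z g (wedge_shift l Z))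
      = (\<lambda>W. grad_x_dot_grad_v 1 (rest_slots \<gamma> l f) W (rest_slots \<gamma> j g) W)"
    unfolding grad_x_dot_grad_v_def .
  have "depends_on {1} (\<lambda>W. grad_x_dot_grad_v 1 (rest_slots \<gamma> l f) W (rest_slots \<gamma> j g) W)"
    unfolding depends_on_def
  proof (intro allI impI)
    fix Z W :: "'d config" assume ZW: "\<forall>i\<in>{1}. Z i = W i"
    have "partial_deriv a (rest_slots \<gamma> l f) Z = partial_deriv a (rest_slots \<gamma> l f) W" for a
      by (rule depends_onD[OF depends_on_partial_deriv[OF depends_on_rest_slots[OF f(2)]]]) (use ZW in simp)
    moreover have "partial_deriv a (rest_slots \<gamma> j g) Z = partial_deriv a (rest_slots \<gamma> j g) W" for a
      by (rule depends_onD[OF depends_on_partial_deriv[OF depends_on_rest_slots[OF g(2)]]]) (use ZW in simp)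
    ultimately show "grad_x_dot_grad_v 1 (rest_slots \<gamma> l f) Z (rest_slots \<gamma> j g) Z
        = grad_x_dot_grad_v 1 (rest_slots \<gamma> l f) W (rest_slots \<gamma> j g) W"
      by (simp only: grad_x_dot_grad_v_def)
  qed
  from apply_at_1_depends[OF this, of \<gamma> Z0] show ?thesis
    unfolding upt_1[OF k] apply_slots_Cons rest_slots_def[symmetric] eq .
qed

section \<open>Gradients\<close>

text \<open>Point evaluation, set to 0 off the space. These functionals separate functions, which is
  why at most one element can represent a derivative.\<close>

definition dirac :: "nat \<Rightarrow> 'd::finite config \<Rightarrow> 'd obs \<Rightarrow> real" where
  "dirac k Z f = (if f \<in> sym_smooth k then f Z else 0)"

lemma dirac_dual: "dirac k (Z :: 'd::finite config) \<in> tvs_dual (sym_smooth_top k)"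
proof (rule dual_cn_boundI[where C = 1 and N = "nat \<lceil>\<Sum>i\<in>{1..k}. norm (Z i)\<rceil>"])
  fix f g :: "'d obs" assume fg: "f \<in> sym_smooth k" "g \<in> sym_smooth k"
  then have "f + g \<in> sym_smooth k" by (rule subspace_add[OF subspace_sym_smooth])
  then show "dirac k Z (f + g) = dirac k Z f + dirac k Z g"
    using fg by (simp only: dirac_def if_True plus_functional)
next
  fix f :: "'d obs" and c :: real assume f: "f \<in> sym_smooth k"
  then have "c *\<^sub>R f \<in> sym_smooth k" by (rule subspace_scale[OF subspace_sym_smooth])
  then show "dirac k Z (c *\<^sub>R f) = c * dirac k Z f"
    using f by (simp only: dirac_def if_True scaleR_functional)
next
  fix f :: "'d obs" and M :: real
  assume f: "f \<in> sym_smooth k" and b: "cn_bound k (nat \<lceil>\<Sum>i\<in>{1..k}. norm (Z i)\<rceil>) f M"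
  have "\<bar>iter_partial [] f Z\<bar> \<le> M"
  proof (rule b[unfolded cn_bound_def, THEN bspec, THEN mp, THEN spec, THEN mp, OF Nil_multi_indices])
    show "\<forall>i\<in>{1..k}. norm (Z i) \<le> real (nat \<lceil>\<Sum>i\<in>{1..k}. norm (Z i)\<rceil>)"
    proof
      fix i assume "i \<in> {1..k}"
      then have "norm (Z i) \<le> (\<Sum>i\<in>{1..k}. norm (Z i))" by (intro member_le_sum) simp_all
      then show "norm (Z i) \<le> real (nat \<lceil>\<Sum>i\<in>{1..k}. norm (Z i)\<rceil>)" by linarith
    qed
  qed simp
  then show "\<bar>dirac k Z f\<bar> \<le> 1 * M" using f by (simp add: dirac_def)
qed (simp add: dirac_def)

lemma functional_gradient_eqI:
  assumes "f \<in> V" "\<And>v. v \<in> topspace X \<Longrightarrow> has_gateaux_derivative euclideanreal \<F> x v (pr f v)"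
    and sep: "\<And>g. g \<in> V \<Longrightarrow> (\<And>v. v \<in> topspace X \<Longrightarrow> pr g v = pr f v) \<Longrightarrow> g = f"
  shows "functional_gradient V X pr \<F> x = f"
  unfolding functional_gradient_def
proof (rule the_equality)
  show "f \<in> V \<and> (\<forall>v\<in>topspace X. has_gateaux_derivative euclideanreal \<F> x v (pr f v))"
    using assms(1,2) by simp
  fix g assume g: "g \<in> V \<and> (\<forall>v\<in>topspace X. has_gateaux_derivative euclideanreal \<F> x v (pr g v))"
  show "g = f"
  proof (rule sep)
    fix v assume v: "v \<in> topspace X"
    show "pr g v = pr f v"
      using bspec[OF conjunct2[OF g] v] assms(2)[OF v] unfolding has_gateaux_real_iff by (rule DERIV_unique)
  qed (rule conjunct1[OF g])
qed

lemma functional_gradient_g1: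
  fixes f :: "'d::finite obs"
  assumes f: "f \<in> sym_smooth 1" and "\<And>\<delta>. \<delta> \<in> dual1 \<Longrightarrow> has_gateaux_derivative euclideanreal \<F> \<gamma> \<delta> (\<delta> f)"
  shows "functional_gradient (sym_smooth 1) g1_dual (\<lambda>f \<nu>. \<nu> f) \<F> \<gamma> = f"
proof (rule functional_gradient_eqI[OF f])
  show "has_gateaux_derivative euclideanreal \<F> \<gamma> \<delta> (\<delta> f)" if "\<delta> \<in> topspace g1_dual" for \<delta>
    using that assms(2) unfolding topspace_dual by simp
  fix g :: "'d obs" assume g: "g \<in> sym_smooth 1" and eq: "\<And>\<nu>. \<nu> \<in> topspace g1_dual \<Longrightarrow> \<nu> g = \<nu> f"
  show "g = f"
  proof
    fix Z
    have "dirac 1 Z g = dirac 1 Z f" by (rule eq) (simp only: topspace_dual dirac_dual)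
    then show "g Z = f Z" using f g by (simp only: dirac_def if_True)
  qed
qed

lemma dual_zero_fun: "\<gamma> \<in> tvs_dual (sym_smooth_top k) \<Longrightarrow> \<gamma> 0 = 0"
  using dual_zero[of \<gamma> k] by (simp only: zero_fun_def)

lemma G_inf_dual_components: "\<Delta> \<in> topspace G_inf_dual \<Longrightarrow> \<Delta> k \<in> tvs_dual (sym_smooth_top k)"
  unfolding topspace_G_inf_dual by simp

text \<open>The index set of \<open>pairing\<close> varies with F. A common finite set of degrees
  makes sums for different sequences comparable.\<close>

lemma pairing_superset:
  assumes "\<Delta> \<in> topspace G_inf_dual" "finite S" "{k. F k \<noteq> 0} \<subseteq> S"
  shows "pairing F \<Delta> = (\<Sum>k\<in>S. \<Delta> k (F k))"
  unfolding pairing_def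
proof (rule sum.mono_neutral_left[OF assms(2,3)], rule ballI)
  fix k assume "k \<in> S - {k. F k \<noteq> 0}"
  then have "F k = 0" by simp
  then show "\<Delta> k (F k) = 0" by (simp only: dual_zero_fun[OF G_inf_dual_components[OF assms(1)]])
qed

lemma functional_gradient_G_inf:
  fixes F :: "nat \<Rightarrow> 'd::finite obs"
  assumes F: "F \<in> G_inf" and "\<And>\<Delta>. \<Delta> \<in> topspace G_inf_dual \<Longrightarrow> has_gateaux_derivative euclideanreal \<F> \<Gamma> \<Delta> (pairing F \<Delta>)"
  shows "functional_gradient G_inf G_inf_dual pairing \<F> \<Gamma> = F"
proof (rule functional_gradient_eqI[where pr = pairing, OF F])
  show "has_gateaux_derivative euclideanreal \<F> \<Gamma> \<Delta> (pairing F \<Delta>)" if "\<Delta> \<in> topspace G_inf_dual" for \<Delta>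
    by (rule assms(2)[OF that])
  fix G :: "nat \<Rightarrow> 'd obs"
  assume G: "G \<in> G_inf" and eq: "\<And>\<Delta>. \<Delta> \<in> topspace G_inf_dual \<Longrightarrow> pairing G \<Delta> = pairing F \<Delta>"
  show "G = F"
  proof
    fix k
    show "G k = F k"
    proof (cases "k = 0")
      case True
      then show ?thesis using G_infD(1)[OF F] G_infD(1)[OF G] by simp
    next
      case False
      then have k: "k \<ge> 1" by simp
      show ?thesis
      proof
        fix Z :: "'d config"
        \<comment> \<open>Concentrated in degree k, this functional reads off the single value of
          component k at Z.\<close>
        let ?\<Delta> = "\<lambda>m. if m = k then dirac k Z else 0"
        have \<Delta>: "?\<Delta> \<in> topspace G_inf_dual"
          unfolding topspace_G_inf_dual
        proof (intro CollectI conjI allI)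
          show "?\<Delta> m \<in> tvs_dual (sym_smooth_top m)" for m
            using dirac_dual[of k Z] subspace_0[OF subspace_dual] by (cases "m = k") (simp_all only: if_True if_False simp_thms)
        qed (use False in simp)
        have "pairing H ?\<Delta> = H k Z" if H: "H \<in> G_inf" for H :: "nat \<Rightarrow> 'd obs"
        proof -
          have "pairing H ?\<Delta> = (\<Sum>m\<in>insert k {m. H m \<noteq> 0}. ?\<Delta> m (H m))"
            by (rule pairing_superset[OF \<Delta>]) (use G_infD(3)[OF H] in auto)
          also have "\<dots> = ?\<Delta> k (H k) + (\<Sum>m\<in>{m. H m \<noteq> 0} - {k}. ?\<Delta> m (H m))"
            by (rule sum.insert_remove[OF G_infD(3)[OF H]])
          also have "(\<Sum>m\<in>{m. H m \<noteq> 0} - {k}. ?\<Delta> m (H m)) = 0" by (rule sum.neutral) simp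
          finally show ?thesis using G_infD(2)[OF H k] by (simp add: dirac_def)
        qed
        then show "G k Z = F k Z" using eq[OF \<Delta>] F G by simp
      qed
    qed
  qed
qed

lemma G_inf_lincomb:
  fixes F G :: "nat \<Rightarrow> 'd::finite obs"
  assumes F: "F \<in> G_inf" and G: "G \<in> G_inf"
  shows "(\<lambda>k. c *\<^sub>R F k + d *\<^sub>R G k) \<in> G_inf"
  unfolding G_inf_def
proof (intro CollectI conjI allI impI)
  show "c *\<^sub>R F 0 + d *\<^sub>R G 0 = 0" by (simp only: G_infD(1)[OF F] G_infD(1)[OF G] scaleR_zero_right add_0)
  show "c *\<^sub>R F k + d *\<^sub>R G k \<in> sym_smooth k" if "1 \<le> k" for k
    by (intro subspace_add[OF subspace_sym_smooth] subspace_scale[OF subspace_sym_smooth] G_infD(2)[OF F that] G_infD(2)[OF G that])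
  have "{k. c *\<^sub>R F k + d *\<^sub>R G k \<noteq> 0} \<subseteq> {k. F k \<noteq> 0} \<union> {k. G k \<noteq> 0}"
    by (rule subsetI, rule ccontr) (simp only: mem_Collect_eq Un_iff de_Morgan_disj not_not scaleR_zero_right add_0 not_True_eq_False)
  then show "finite {k. c *\<^sub>R F k + d *\<^sub>R G k \<noteq> 0}"
    by (rule finite_subset) (simp only: finite_Un G_infD(3)[OF F] G_infD(3)[OF G])
qed

lemma pairing_lincomb:
  fixes F G :: "nat \<Rightarrow> 'd::finite obs"
  assumes F: "F \<in> G_inf" and G: "G \<in> G_inf" and \<Delta>: "\<Delta> \<in> topspace G_inf_dual"
  shows "pairing (\<lambda>k. c *\<^sub>R F k + d *\<^sub>R G k) \<Delta> = c * pairing F \<Delta> + d * pairing G \<Delta>"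
proof -
  let ?S = "{k. F k \<noteq> 0} \<union> {k. G k \<noteq> 0}"
  have S: "finite ?S" by (simp only: finite_Un G_infD(3)[OF F] G_infD(3)[OF G])
  have "{k. c *\<^sub>R F k + d *\<^sub>R G k \<noteq> 0} \<subseteq> ?S"
    by (rule subsetI, rule ccontr) (simp only: mem_Collect_eq Un_iff de_Morgan_disj not_not scaleR_zero_right add_0 not_True_eq_False)
  then have "pairing (\<lambda>k. c *\<^sub>R F k + d *\<^sub>R G k) \<Delta> = (\<Sum>k\<in>?S. \<Delta> k (c *\<^sub>R F k + d *\<^sub>R G k))"
    by (rule pairing_superset[OF \<Delta> S])
  also have "\<dots> = (\<Sum>k\<in>?S. c * \<Delta> k (F k) + d * \<Delta> k (G k))"
  proof (rule sum.cong[OF refl])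
    fix k assume "k \<in> ?S"
    then have k: "k \<ge> 1" using G_infD(4)[OF F] G_infD(4)[OF G] by (elim UnE) simp_all
    have "c *\<^sub>R F k + d *\<^sub>R G k = (\<lambda>Z. c * F k Z + d * G k Z)" by (simp add: fun_eq_iff scaleR_fun_def)
    then show "\<Delta> k (c *\<^sub>R F k + d *\<^sub>R G k) = c * \<Delta> k (F k) + d * \<Delta> k (G k)"
      by (simp only: dual_lincomb[OF G_inf_dual_components[OF \<Delta>] G_infD(2)[OF F k] G_infD(2)[OF G k]])
  qed
  also have "\<dots> = c * (\<Sum>k\<in>?S. \<Delta> k (F k)) + d * (\<Sum>k\<in>?S. \<Delta> k (G k))"
    by (simp only: sum.distrib sum_distrib_left)
  also have "(\<Sum>k\<in>?S. \<Delta> k (F k)) = pairing F \<Delta>" by (rule pairing_superset[OF \<Delta> S, symmetric]) simp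
  also have "(\<Sum>k\<in>?S. \<Delta> k (G k)) = pairing G \<Delta>" by (rule pairing_superset[OF \<Delta> S, symmetric]) simp
  finally show ?thesis .
qed

text \<open>The derivative of \<open>iota\<close> at \<gamma> in direction \<delta>, degree by
  degree.\<close>

definition diota :: "('d::finite obs \<Rightarrow> real) \<Rightarrow> ('d obs \<Rightarrow> real) \<Rightarrow> nat \<Rightarrow> 'd obs \<Rightarrow> real" where
  "diota \<gamma> \<delta> k = (\<Sum>j\<in>{1..k}. tens ((\<lambda>_. \<gamma>)(j := \<delta>)) k)"

lemma diota_topspace:
  fixes \<gamma> \<delta> :: "'d::finite obs \<Rightarrow> real"
  assumes "\<gamma> \<in> dual1" "\<delta> \<in> dual1"
  shows "diota \<gamma> \<delta> \<in> topspace G_inf_dual"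
  unfolding topspace_G_inf_dual
proof (intro CollectI conjI allI)
  show "diota \<gamma> \<delta> k \<in> tvs_dual (sym_smooth_top k)" for k
    unfolding diota_def by (intro subspace_sum[OF subspace_dual] tens_dual) (simp add: assms)
qed (simp add: diota_def)

lemma iota_topspace:
  fixes \<gamma> :: "'d::finite obs \<Rightarrow> real"
  assumes "\<gamma> \<in> dual1"
  shows "iota \<gamma> \<in> topspace G_inf_dual"
  unfolding topspace_G_inf_dual
proof (intro CollectI conjI allI)
  show "iota \<gamma> k \<in> tvs_dual (sym_smooth_top k)" for k
  proof (cases "k \<ge> 1")
    case True
    show ?thesis unfolding iota_pos[OF True] tensor_power_tens by (rule tens_dual[OF assms])
  next
    case False
    then have "k = 0" by simp
    then show ?thesis using subspace_0[OF subspace_dual] by (simp only: iota_0)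
  qed
qed (rule iota_0)

text \<open>The transpose of the derivative of \<open>iota\<close> at \<gamma>, applied to F; the
  factor k counts the slots that a direction may enter.\<close>

definition pull_gradient :: "('d::finite obs \<Rightarrow> real) \<Rightarrow> (nat \<Rightarrow> 'd obs) \<Rightarrow> 'd obs" where
  "pull_gradient \<gamma> F = (\<lambda>Z. \<Sum>k | F k \<noteq> 0. real k * rest_slots \<gamma> k (F k) Z)"

lemma rest_slots_zero: "\<gamma> \<in> dual1 \<Longrightarrow> rest_slots \<gamma> k 0 = (\<lambda>Z. 0)"
  unfolding rest_slots_def zero_fun_def by (rule apply_slots_zero)

lemma pull_gradient_superset:
  assumes \<gamma>: "\<gamma> \<in> dual1" and S: "finite S" "{k. F k \<noteq> 0} \<subseteq> S"
  shows "pull_gradient \<gamma> F = (\<lambda>Z. \<Sum>k\<in>S. real k * rest_slots \<gamma> k (F k) Z)"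
  unfolding pull_gradient_def
proof (intro ext sum.mono_neutral_left[OF S] ballI)
  fix Z k assume "k \<in> S - {k. F k \<noteq> 0}"
  then have "F k = 0" by simp
  then show "real k * rest_slots \<gamma> k (F k) Z = 0" by (simp only: rest_slots_zero[OF \<gamma>] mult_zero_right)
qed

lemma dual_sum_lincomb:
  fixes f :: "'i \<Rightarrow> 'd::finite obs"
  assumes \<gamma>: "\<gamma> \<in> tvs_dual (sym_smooth_top k)"
  shows "(\<And>i. i \<in> A \<Longrightarrow> f i \<in> sym_smooth k) \<Longrightarrow>
    (\<lambda>Z. \<Sum>i\<in>A. c i * f i Z) \<in> sym_smooth k \<and> \<gamma> (\<lambda>Z. \<Sum>i\<in>A. c i * f i Z) = (\<Sum>i\<in>A. c i * \<gamma> (f i))"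
proof (induction A rule: infinite_finite_induct)
  case (insert i A)
  have fi: "f i \<in> sym_smooth k" by (rule insert.prems) simp
  have "(\<lambda>Z. \<Sum>i\<in>A. c i * f i Z) \<in> sym_smooth k \<and> \<gamma> (\<lambda>Z. \<Sum>i\<in>A. c i * f i Z) = (\<Sum>i\<in>A. c i * \<gamma> (f i))"
    by (rule insert.IH) (rule insert.prems, simp)
  note IH = conjunct1[OF this] conjunct2[OF this]
  show ?case
    using sym_smooth_lincomb[OF fi IH(1), of "c i" 1] dual_lincomb[OF \<gamma> fi IH(1), of "c i" 1]
    by (simp only: IH(2) mult_1 sum.insert[OF insert.hyps] simp_thms)
next
  case empty
  show ?case using subspace_0[OF subspace_sym_smooth[of k]] dual_zero[OF \<gamma>] by (simp only: sum.empty zero_fun_def)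
next
  case (infinite A)
  show ?case using subspace_0[OF subspace_sym_smooth[of k]] dual_zero[OF \<gamma>]
    by (simp only: sum.infinite[OF infinite(1)] zero_fun_def)
qed

text \<open>In degree k each of the k terms of \<open>diota\<close> contributes the same value, by
  \<open>tens_single_slot\<close>. This adjointness identifies the gradient of a pulled-back
  functional.\<close>

lemma pairing_diota:
  fixes \<gamma> \<delta> :: "'d::finite obs \<Rightarrow> real"
  assumes \<gamma>: "\<gamma> \<in> dual1" and \<delta>: "\<delta> \<in> dual1" and F: "F \<in> G_inf"
  shows "pull_gradient \<gamma> F \<in> sym_smooth 1" "\<delta> (pull_gradient \<gamma> F) = pairing F (diota \<gamma> \<delta>)"
proof -
  have u: "rest_slots \<gamma> k (F k) \<in> sym_smooth 1" if "k \<in> {k. F k \<noteq> 0}" for k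
    using that G_infD(4)[OF F] by (intro rest_slots_sym_smooth[OF \<gamma>] G_infD(2)[OF F]) simp
  note * = dual_sum_lincomb[OF \<delta> u, of "{k. F k \<noteq> 0}" "\<lambda>k. k" real]
  show "pull_gradient \<gamma> F \<in> sym_smooth 1" unfolding pull_gradient_def using * by simp
  have "(\<Sum>k | F k \<noteq> 0. real k * \<delta> (rest_slots \<gamma> k (F k))) = (\<Sum>k | F k \<noteq> 0. diota \<gamma> \<delta> k (F k))"
  proof (rule sum.cong[OF refl])
    fix k assume "k \<in> {k. F k \<noteq> 0}"
    then have k: "F k \<in> sym_smooth k" using G_infD(4)[OF F] G_infD(2)[OF F] by simp
    show "real k * \<delta> (rest_slots \<gamma> k (F k)) = diota \<gamma> \<delta> k (F k)"
      unfolding diota_def sum_functional using tens_single_slot[OF \<gamma> \<delta> k] by simp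
  qed
  then show "\<delta> (pull_gradient \<gamma> F) = pairing F (diota \<gamma> \<delta>)"
    unfolding pull_gradient_def pairing_def using * by simp
qed

text \<open>The same F must represent the derivative at \<open>iota \<gamma>\<close> and, paired
  with \<open>diota\<close>, the derivative along the image of \<gamma>. Carrying both claims
  through the induction replaces a chain rule; only the linear generators use the derivative of
  tensor powers.\<close>

lemma A_inf_gradient:
  fixes \<gamma> :: "'d::finite obs \<Rightarrow> real"
  assumes "\<F> \<in> A_inf" and \<gamma>: "\<gamma> \<in> dual1"
  shows "\<exists>F\<in>G_inf. (\<forall>\<Delta>\<in>topspace G_inf_dual. has_gateaux_derivative euclideanreal \<F> (iota \<gamma>) \<Delta> (pairing F \<Delta>)) \<and>
    (\<forall>\<delta>\<in>dual1. has_gateaux_derivative euclideanreal (\<F> \<circ> iota) \<gamma> \<delta> (pairing F (diota \<gamma> \<delta>)))"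
  using assms(1)
proof (induction rule: A_inf.induct)
  case (const c)
  have "(\<lambda>k. 0) \<in> (G_inf :: (nat \<Rightarrow> 'd obs) set)"
    unfolding G_inf_def by (intro CollectI conjI allI impI refl subspace_0[OF subspace_sym_smooth]) simp
  then show ?case
    by (intro bexI[of _ "\<lambda>k. 0"]) (simp_all add: has_gateaux_real_iff pairing_def)
next
  case (linear F)
  show ?case
  proof (intro bexI[OF _ linear] conjI ballI)
    fix \<Delta> :: "nat \<Rightarrow> 'd obs \<Rightarrow> real"
    have "pairing F (iota \<gamma> + t *\<^sub>R \<Delta>) = pairing F (iota \<gamma>) + t * pairing F \<Delta>" for t
      unfolding pairing_def by (simp add: scaleR_fun_def sum.distrib sum_distrib_left)
    then show "has_gateaux_derivative euclideanreal (pairing F) (iota \<gamma>) \<Delta> (pairing F \<Delta>)"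
      unfolding has_gateaux_real_iff by (auto intro!: derivative_eq_intros)
  next
    fix \<delta> :: "'d obs \<Rightarrow> real" assume \<delta>: "\<delta> \<in> dual1"
    have "((\<lambda>t. \<Sum>k | F k \<noteq> 0. iota (\<gamma> + t *\<^sub>R \<delta>) k (F k)) has_real_derivative (\<Sum>k | F k \<noteq> 0. diota \<gamma> \<delta> k (F k))) (at 0)"
    proof (rule DERIV_sum)
      fix k assume "k \<in> {k. F k \<noteq> 0}"
      then have k: "k \<ge> 1" using G_infD(4)[OF linear] by simp
      show "((\<lambda>t. iota (\<gamma> + t *\<^sub>R \<delta>) k (F k)) has_real_derivative diota \<gamma> \<delta> k (F k)) (at 0)"
        using gateaux_derivative_evaluation[OF G_infD(2)[OF linear k] tens_functional_derivative[OF k \<gamma> \<delta>]]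
        unfolding has_gateaux_real_iff iota_pos[OF k] diota_def .
    qed
    then show "has_gateaux_derivative euclideanreal (pairing F \<circ> iota) \<gamma> \<delta> (pairing F (diota \<gamma> \<delta>))"
      unfolding has_gateaux_real_iff by (simp only: pairing_def o_def)
  qed
next
  case (add \<F> \<G>)
  obtain F where F: "F \<in> G_inf" "\<forall>\<Delta>\<in>topspace G_inf_dual. has_gateaux_derivative euclideanreal \<F> (iota \<gamma>) \<Delta> (pairing F \<Delta>)"
    "\<forall>\<delta>\<in>dual1. has_gateaux_derivative euclideanreal (\<F> \<circ> iota) \<gamma> \<delta> (pairing F (diota \<gamma> \<delta>))"
    using add.IH(1) by (elim bexE conjE)
  obtain G where G: "G \<in> G_inf" "\<forall>\<Delta>\<in>topspace G_inf_dual. has_gateaux_derivative euclideanreal \<G> (iota \<gamma>) \<Delta> (pairing G \<Delta>)"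
    "\<forall>\<delta>\<in>dual1. has_gateaux_derivative euclideanreal (\<G> \<circ> iota) \<gamma> \<delta> (pairing G (diota \<gamma> \<delta>))"
    using add.IH(2) by (elim bexE conjE)
  let ?H = "\<lambda>k. 1 *\<^sub>R F k + 1 *\<^sub>R G k"
  show ?case
  proof (intro bexI[OF _ G_inf_lincomb[OF F(1) G(1), of 1 1]] conjI ballI)
    fix \<Delta> :: "nat \<Rightarrow> 'd obs \<Rightarrow> real" assume \<Delta>: "\<Delta> \<in> topspace G_inf_dual"
    show "has_gateaux_derivative euclideanreal (\<lambda>\<Gamma>. \<F> \<Gamma> + \<G> \<Gamma>) (iota \<gamma>) \<Delta> (pairing ?H \<Delta>)"
      unfolding pairing_lincomb[OF F(1) G(1) \<Delta>] mult_1
      using bspec[OF F(2) \<Delta>] bspec[OF G(2) \<Delta>] unfolding has_gateaux_real_iff by (rule DERIV_add)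
  next
    fix \<delta> :: "'d obs \<Rightarrow> real" assume \<delta>: "\<delta> \<in> dual1"
    show "has_gateaux_derivative euclideanreal ((\<lambda>\<Gamma>. \<F> \<Gamma> + \<G> \<Gamma>) \<circ> iota) \<gamma> \<delta> (pairing ?H (diota \<gamma> \<delta>))"
      unfolding pairing_lincomb[OF F(1) G(1) diota_topspace[OF \<gamma> \<delta>]] mult_1
      using bspec[OF F(3) \<delta>] bspec[OF G(3) \<delta>] unfolding has_gateaux_real_iff o_def by (rule DERIV_add)
  qed
next
  case (mult \<F> \<G>)
  obtain F where F: "F \<in> G_inf" "\<forall>\<Delta>\<in>topspace G_inf_dual. has_gateaux_derivative euclideanreal \<F> (iota \<gamma>) \<Delta> (pairing F \<Delta>)"
    "\<forall>\<delta>\<in>dual1. has_gateaux_derivative euclideanreal (\<F> \<circ> iota) \<gamma> \<delta> (pairing F (diota \<gamma> \<delta>))"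
    using mult.IH(1) by (elim bexE conjE)
  obtain G where G: "G \<in> G_inf" "\<forall>\<Delta>\<in>topspace G_inf_dual. has_gateaux_derivative euclideanreal \<G> (iota \<gamma>) \<Delta> (pairing G \<Delta>)"
    "\<forall>\<delta>\<in>dual1. has_gateaux_derivative euclideanreal (\<G> \<circ> iota) \<gamma> \<delta> (pairing G (diota \<gamma> \<delta>))"
    using mult.IH(2) by (elim bexE conjE)
  \<comment> \<open>Leibniz rule: each gradient is weighted by the value of the other factor at
    \<open>iota \<gamma>\<close>.\<close>
  let ?c = "\<G> (iota \<gamma>)" and ?d = "\<F> (iota \<gamma>)"
  let ?H = "\<lambda>k. ?c *\<^sub>R F k + ?d *\<^sub>R G k"
  show ?case
  proof (intro bexI[OF _ G_inf_lincomb[OF F(1) G(1), of ?c ?d]] conjI ballI)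
    fix \<Delta> :: "nat \<Rightarrow> 'd obs \<Rightarrow> real" assume \<Delta>: "\<Delta> \<in> topspace G_inf_dual"
    show "has_gateaux_derivative euclideanreal (\<lambda>\<Gamma>. \<F> \<Gamma> * \<G> \<Gamma>) (iota \<gamma>) \<Delta> (pairing ?H \<Delta>)"
      unfolding pairing_lincomb[OF F(1) G(1) \<Delta>]
      using DERIV_mult[OF bspec[OF F(2) \<Delta>, unfolded has_gateaux_real_iff] bspec[OF G(2) \<Delta>, unfolded has_gateaux_real_iff]]
      unfolding has_gateaux_real_iff by (simp add: mult.commute)
  next
    fix \<delta> :: "'d obs \<Rightarrow> real" assume \<delta>: "\<delta> \<in> dual1"
    show "has_gateaux_derivative euclideanreal ((\<lambda>\<Gamma>. \<F> \<Gamma> * \<G> \<Gamma>) \<circ> iota) \<gamma> \<delta> (pairing ?H (diota \<gamma> \<delta>))"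
      unfolding pairing_lincomb[OF F(1) G(1) diota_topspace[OF \<gamma> \<delta>]]
      using DERIV_mult[OF bspec[OF F(3) \<delta>, unfolded has_gateaux_real_iff o_def] bspec[OF G(3) \<delta>, unfolded has_gateaux_real_iff o_def]]
      unfolding has_gateaux_real_iff o_def by (simp add: mult.commute)
  qed
qed

section \<open>The brackets\<close>

lemma partial_deriv_sum:
  assumes "\<And>i. i \<in> A \<Longrightarrow> smooth_config (f i)" and a: "snd a \<in> Basis"
  shows "partial_deriv a (\<lambda>Z. \<Sum>i\<in>A. c i * f i Z) = (\<lambda>Z. \<Sum>i\<in>A. c i * partial_deriv a (f i) Z)"
proof (rule partial_deriv_eq)
  show "has_partial (\<lambda>Z. \<Sum>i\<in>A. c i * f i Z) a (\<lambda>Z. \<Sum>i\<in>A. c i * partial_deriv a (f i) Z)"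
    unfolding has_partial_def
  proof (intro allI DERIV_sum DERIV_cmult)
    fix Z i assume "i \<in> A"
    then show "((\<lambda>t. f i (shift a t Z)) has_real_derivative partial_deriv a (f i) Z) (at 0)"
      using smooth_config_has_partial[OF assms(1) a] unfolding has_partial_def by simp
  qed
qed

lemma grad_sum:
  fixes u :: "'i \<Rightarrow> 'd::finite obs" and v :: "'j \<Rightarrow> 'd obs"
  assumes u: "\<And>i. i \<in> A \<Longrightarrow> smooth_config (u i)" and v: "\<And>j. j \<in> B \<Longrightarrow> smooth_config (v j)"
  shows "grad_x_dot_grad_v 1 (\<lambda>Z. \<Sum>i\<in>A. c i * u i Z) W (\<lambda>Z. \<Sum>j\<in>B. d j * v j Z) W'
    = (\<Sum>i\<in>A. \<Sum>j\<in>B. (c i * d j) * grad_x_dot_grad_v 1 (u i) W (v j) W')"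
proof -
  have "grad_x_dot_grad_v 1 (\<lambda>Z. \<Sum>i\<in>A. c i * u i Z) W (\<lambda>Z. \<Sum>j\<in>B. d j * v j Z) W'
    = (\<Sum>b\<in>Basis. \<Sum>i\<in>A. \<Sum>j\<in>B. (c i * d j) * (partial_deriv (1, (b, 0)) (u i) W * partial_deriv (1, (0, b)) (v j) W'))"
    unfolding grad_x_dot_grad_v_def
  proof (rule sum.cong[OF refl])
    fix b :: "real ^ 'd" assume b: "b \<in> Basis"
    have "(\<Sum>i\<in>A. c i * partial_deriv (1, (b, 0)) (u i) W) * (\<Sum>j\<in>B. d j * partial_deriv (1, (0, b)) (v j) W')
      = (\<Sum>i\<in>A. \<Sum>j\<in>B. (c i * d j) * (partial_deriv (1, (b, 0)) (u i) W * partial_deriv (1, (0, b)) (v j) W'))"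
      unfolding sum_product by (intro sum.cong refl) (simp only: mult_ac)
    then show "partial_deriv (1, (b, 0)) (\<lambda>Z. \<Sum>i\<in>A. c i * u i Z) W * partial_deriv (1, (0, b)) (\<lambda>Z. \<Sum>j\<in>B. d j * v j Z) W'
      = (\<Sum>i\<in>A. \<Sum>j\<in>B. (c i * d j) * (partial_deriv (1, (b, 0)) (u i) W * partial_deriv (1, (0, b)) (v j) W'))"
      by (simp only: partial_deriv_sum[OF u Basis_x[OF b]] partial_deriv_sum[OF v Basis_v[OF b]])
  qed
  also have "\<dots> = (\<Sum>i\<in>A. \<Sum>b\<in>Basis. \<Sum>j\<in>B. (c i * d j) * (partial_deriv (1, (b, 0)) (u i) W * partial_deriv (1, (0, b)) (v j) W'))"
    by (rule sum.swap)
  also have "\<dots> = (\<Sum>i\<in>A. \<Sum>j\<in>B. \<Sum>b\<in>Basis. (c i * d j) * (partial_deriv (1, (b, 0)) (u i) W * partial_deriv (1, (0, b)) (v j) W'))"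
    by (intro sum.cong refl sum.swap)
  finally show ?thesis by (simp only: grad_x_dot_grad_v_def sum_distrib_left)
qed

lemma grad_sym_smooth:
  fixes u v :: "'d::finite obs"
  assumes u: "u \<in> sym_smooth 1" and v: "v \<in> sym_smooth 1"
  shows "(\<lambda>W. grad_x_dot_grad_v 1 u W v W) \<in> sym_smooth 1"
  unfolding sym_smooth_1_iff
proof
  have su: "smooth_config u" "depends_on {1} u" and sv: "smooth_config v" "depends_on {1} v"
    using u v by (simp_all only: sym_smooth_1_iff)
  show "smooth_config (\<lambda>W. grad_x_dot_grad_v 1 u W v W)"
    unfolding grad_x_dot_grad_v_def
    by (intro smooth_config_sum smooth_config_mult smooth_config_partial_deriv[OF su(1) Basis_x] smooth_config_partial_deriv[OF sv(1) Basis_v])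
  show "depends_on {1} (\<lambda>W. grad_x_dot_grad_v 1 u W v W)"
    unfolding depends_on_def
  proof (intro allI impI)
    fix Z W :: "'d config" assume ZW: "\<forall>i\<in>{1}. Z i = W i"
    have "partial_deriv a u Z = partial_deriv a u W" for a
      by (rule depends_onD[OF depends_on_partial_deriv[OF su(2)]]) (use ZW in simp)
    moreover have "partial_deriv a v Z = partial_deriv a v W" for a
      by (rule depends_onD[OF depends_on_partial_deriv[OF sv(2)]]) (use ZW in simp)
    ultimately show "grad_x_dot_grad_v 1 u Z v Z = grad_x_dot_grad_v 1 u W v W"
      by (simp only: grad_x_dot_grad_v_def)
  qed
qed

lemma depends_on_grad:
  fixes f g :: "'d::finite obs"
  assumes f: "depends_on {1..l} f" and g: "depends_on {1..j} g" and l: "l \<ge> 1" and j: "j \<ge> 1"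
  shows "depends_on {1..l + j - 1} (\<lambda>Z. grad_x_dot_grad_v 1 f Z g (wedge_shift l Z))"
  unfolding depends_on_def
proof (intro allI impI)
  fix Z W :: "'d config" assume ZW: "\<forall>i\<in>{1..l + j - 1}. Z i = W i"
  have "partial_deriv a f Z = partial_deriv a f W" for a
  proof (rule depends_onD[OF depends_on_partial_deriv[OF f]])
    fix i assume "i \<in> {1..l}"
    then have "i \<in> {1..l + j - 1}" using j by auto
    then show "Z i = W i" by (rule bspec[OF ZW])
  qed
  moreover have "partial_deriv a g (wedge_shift l Z) = partial_deriv a g (wedge_shift l W)" for a
  proof (rule depends_onD[OF depends_on_partial_deriv[OF g]])
    fix i assume i: "i \<in> {1..j}"
    have "1 \<in> {1..l + j - 1}" "l + i - 1 \<in> {1..l + j - 1}" using i l j by auto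
    then show "wedge_shift l Z i = wedge_shift l W i" using ZW by simp
  qed
  ultimately show "grad_x_dot_grad_v 1 f Z g (wedge_shift l Z) = grad_x_dot_grad_v 1 f W g (wedge_shift l W)"
    by (simp only: grad_x_dot_grad_v_def)
qed

lemma wedge1_smooth:
  fixes f g :: "'d::finite obs"
  assumes f: "f \<in> sym_smooth l" and g: "g \<in> sym_smooth j" and l: "l \<ge> 1" and j: "j \<ge> 1"
  shows "smooth_config (wedge1 l j f g)" "depends_on {1..l + j - 1} (wedge1 l j f g)"
proof -
  note fs = sym_smooth_smooth[OF f] sym_smooth_depends[OF f] and gs = sym_smooth_smooth[OF g] sym_smooth_depends[OF g]
  show "smooth_config (wedge1 l j f g)"
    unfolding wedge1_def
    by (intro smooth_config_cmult smooth_config_diff smooth_config_grad[OF fs(1) gs l] smooth_config_grad[OF gs(1) fs j])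
  have dA: "depends_on {1..l + j - 1} (\<lambda>Z. grad_x_dot_grad_v 1 f Z g (wedge_shift l Z))"
    by (rule depends_on_grad[OF fs(2) gs(2) l j])
  have dB: "depends_on {1..l + j - 1} (\<lambda>Z. grad_x_dot_grad_v 1 g Z f (wedge_shift j Z))"
    using depends_on_grad[OF gs(2) fs(2) j l] by (simp only: add.commute)
  show "depends_on {1..l + j - 1} (wedge1 l j f g)"
    unfolding depends_on_def
  proof (intro allI impI)
    fix Z W :: "'d config" assume ZW: "\<forall>i\<in>{1..l + j - 1}. Z i = W i"
    have "grad_x_dot_grad_v 1 f Z g (wedge_shift l Z) = grad_x_dot_grad_v 1 f W g (wedge_shift l W)"
      by (rule depends_onD[OF dA]) (rule bspec[OF ZW])
    moreover have "grad_x_dot_grad_v 1 g Z f (wedge_shift j Z) = grad_x_dot_grad_v 1 g W f (wedge_shift j W)"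
      by (rule depends_onD[OF dB]) (rule bspec[OF ZW])
    ultimately show "wedge1 l j f g Z = wedge1 l j f g W" by (simp only: wedge1_def)
  qed
qed

lemma Sym_sym_smooth:
  fixes h :: "'d::finite obs"
  assumes h: "smooth_config h" "depends_on {1..k} h"
  shows "Sym k h \<in> sym_smooth k"
  unfolding sym_smooth_iff
proof (intro conjI allI impI)
  let ?P = "{\<pi>. \<pi> permutes {1..k}}"
  show "smooth_config (Sym k h)"
    unfolding Sym_def
  proof (intro smooth_config_cmult smooth_config_sum)
    show "smooth_config (\<lambda>Z. h (\<lambda>i. Z (\<pi> i)))" if "\<pi> \<in> ?P" for \<pi>
      using that by (intro smooth_config_permute[OF h(1), of \<pi> "{1..k}"]) simp
  qed
  show "depends_on {1..k} (Sym k h)"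
    unfolding depends_on_def Sym_def
  proof (intro allI impI arg_cong[where f = "\<lambda>x. 1 / fact k * x"] sum.cong refl)
    fix Z W :: "'d config" and \<pi> assume ZW: "\<forall>i\<in>{1..k}. Z i = W i" and \<pi>: "\<pi> \<in> ?P"
    show "h (\<lambda>i. Z (\<pi> i)) = h (\<lambda>i. W (\<pi> i))"
    proof (rule depends_onD[OF h(2)])
      fix i assume "i \<in> {1..k}"
      then have "\<pi> i \<in> {1..k}" using \<pi> permutes_in_image[of \<pi> "{1..k}" i] by simp
      then show "Z (\<pi> i) = W (\<pi> i)" by (rule bspec[OF ZW])
    qed
  qed
  fix \<sigma> and Z :: "'d config" assume \<sigma>: "\<sigma> permutes {1..k}"
  have "(\<Sum>\<pi>\<in>?P. h (\<lambda>i. Z (\<sigma> (\<pi> i)))) = (\<Sum>\<pi>\<in>?P. h (\<lambda>i. Z (\<pi> i)))"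
  proof (rule sum.reindex_bij_witness[of _ "\<lambda>\<pi>. inv \<sigma> \<circ> \<pi>" "\<lambda>\<pi>. \<sigma> \<circ> \<pi>"])
    fix \<pi> assume "\<pi> \<in> ?P"
    then have \<pi>: "\<pi> permutes {1..k}" by simp
    show "inv \<sigma> \<circ> (\<sigma> \<circ> \<pi>) = \<pi>" "\<sigma> \<circ> (inv \<sigma> \<circ> \<pi>) = \<pi>"
      using permutes_inverses[OF \<sigma>] by (simp_all add: fun_eq_iff)
    show "\<sigma> \<circ> \<pi> \<in> ?P" using permutes_compose[OF \<pi> \<sigma>] by simp
    show "inv \<sigma> \<circ> \<pi> \<in> ?P" using permutes_compose[OF \<pi> permutes_inv[OF \<sigma>]] by simp
  qed (simp only: o_def)
  then show "Sym k h (\<lambda>i. Z (\<sigma> i)) = Sym k h Z" by (simp only: Sym_def)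
qed

text \<open>Every permutation of the variables of h yields the same number, and the k! equal terms
  cancel the prefactor of \<open>Sym\<close>.\<close>

lemma tensor_power_Sym:
  fixes h :: "'d::finite obs"
  assumes \<gamma>: "\<gamma> \<in> dual1" and h: "smooth_config h" "depends_on {1..k} h"
  shows "tensor_power \<gamma> k (Sym k h) = apply_slots (\<lambda>_. \<gamma>) [1..<Suc k] h (\<lambda>i. 0)"
proof -
  let ?P = "{\<pi>. \<pi> permutes {1..k}}" and ?a = "apply_slots (\<lambda>_. \<gamma>) [1..<Suc k]"
  have hp: "smooth_config (\<lambda>Z. h (\<lambda>i. Z (\<pi> i)))" if "\<pi> \<in> ?P" for \<pi>
    using that by (intro smooth_config_permute[OF h(1), of \<pi> "{1..k}"]) simp
  have "Sym k h = (\<lambda>Z. \<Sum>\<pi>\<in>?P. 1 / fact k * h (\<lambda>i. Z (\<pi> i)))"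
    unfolding Sym_def sum_distrib_left ..
  then have "?a (Sym k h) = (\<lambda>Z. \<Sum>\<pi>\<in>?P. ?a (\<lambda>Z. 1 / fact k * h (\<lambda>i. Z (\<pi> i))) Z)"
    using apply_slots_sum[of "[1..<Suc k]" "\<lambda>_. \<gamma>" ?P "\<lambda>\<pi> Z. 1 / fact k * h (\<lambda>i. Z (\<pi> i))", OF \<gamma> smooth_config_cmult[OF hp]]
    by (simp only:)
  then have "?a (Sym k h) (\<lambda>i. 0) = (\<Sum>\<pi>\<in>?P. ?a (\<lambda>Z. 1 / fact k * h (\<lambda>i. Z (\<pi> i))) (\<lambda>i. 0))"
    by (rule fun_cong)
  also have "\<dots> = (\<Sum>\<pi>\<in>?P. 1 / fact k * ?a h (\<lambda>i. 0))"
  proof (rule sum.cong[OF refl])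
    fix \<pi> assume \<pi>: "\<pi> \<in> ?P"
    then have p: "\<pi> permutes {1..k}" by simp
    have "?a (\<lambda>Z. 1 / fact k * h (\<lambda>i. Z (\<pi> i)) + 0 * h (\<lambda>i. Z (\<pi> i)))
        = (\<lambda>Z. 1 / fact k * ?a (\<lambda>Z. h (\<lambda>i. Z (\<pi> i))) Z + 0 * ?a (\<lambda>Z. h (\<lambda>i. Z (\<pi> i))) Z)"
      by (rule apply_slots_lincomb[OF \<gamma> hp[OF \<pi>] hp[OF \<pi>]])
    then have "?a (\<lambda>Z. 1 / fact k * h (\<lambda>i. Z (\<pi> i))) (\<lambda>i. 0) = 1 / fact k * ?a (\<lambda>Z. h (\<lambda>i. Z (\<pi> i))) (\<lambda>i. 0)"
      by (simp only: mult_zero_left add_0_right)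
    also have "?a (\<lambda>Z. h (\<lambda>i. Z (\<pi> i))) (\<lambda>i. 0) = ?a h (\<lambda>i. 0)"
      using apply_slots_permute_all[OF p h(1), of "\<lambda>_. \<gamma>", OF \<gamma>] by (simp only: o_def)
    finally show "?a (\<lambda>Z. 1 / fact k * h (\<lambda>i. Z (\<pi> i))) (\<lambda>i. 0) = 1 / fact k * ?a h (\<lambda>i. 0)" .
  qed
  also have "\<dots> = real (card ?P) * (1 / fact k * ?a h (\<lambda>i. 0))" by (rule sum_constant)
  also have "card ?P = fact k" by (rule card_permutations) simp_all
  also have "real (fact k) * (1 / fact k * ?a h (\<lambda>i. 0)) = ?a h (\<lambda>i. 0)" by simp
  finally show ?thesis
    unfolding tensor_power_tens tens_def using Sym_sym_smooth[OF h] by (simp only: if_True)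
qed

lemma tensor_power_wedge:
  fixes f g :: "'d::finite obs"
  assumes \<gamma>: "\<gamma> \<in> dual1" and f: "f \<in> sym_smooth l" and g: "g \<in> sym_smooth j" and l: "l \<ge> 1" and j: "j \<ge> 1"
  shows "tensor_power \<gamma> (l + j - 1) (Sym (l + j - 1) (wedge1 l j f g))
    = real l * real j * \<gamma> (bracket_g1 (rest_slots \<gamma> l f) (rest_slots \<gamma> j g))"
proof -
  let ?k = "l + j - 1"
  let ?a = "apply_slots (\<lambda>_. \<gamma>) [1..<Suc ?k]"
  note fs = sym_smooth_smooth[OF f] sym_smooth_depends[OF f] and gs = sym_smooth_smooth[OF g] sym_smooth_depends[OF g]
  let ?A = "\<lambda>Z. grad_x_dot_grad_v 1 f Z g (wedge_shift l Z)" and ?B = "\<lambda>Z. grad_x_dot_grad_v 1 g Z f (wedge_shift j Z)"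
  have A: "smooth_config ?A" by (rule smooth_config_grad[OF fs(1) gs l])
  have B: "smooth_config ?B" by (rule smooth_config_grad[OF gs(1) fs j])
  have "wedge1 l j f g = (\<lambda>Z. (real l * real j) * ?A Z + (- (real l * real j)) * ?B Z)"
    by (rule ext) (simp add: wedge1_def right_diff_distrib)
  then have "?a (wedge1 l j f g) = (\<lambda>Z. (real l * real j) * ?a ?A Z + (- (real l * real j)) * ?a ?B Z)"
    by (simp only: apply_slots_lincomb[OF \<gamma> A B])
  then have a1: "?a (wedge1 l j f g) (\<lambda>i. 0) = (real l * real j) * ?a ?A (\<lambda>i. 0) + (- (real l * real j)) * ?a ?B (\<lambda>i. 0)"
    by (rule fun_cong)
  have a2: "?a ?A (\<lambda>i. 0) = \<gamma> (\<lambda>W. grad_x_dot_grad_v 1 (rest_slots \<gamma> l f) W (rest_slots \<gamma> j g) W)"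
    by (rule tensor_grad[OF \<gamma> fs gs l j])
  \<comment> \<open>The second half of the wedge product is the first with f, l and g, j exchanged;
    the degree l + j - 1 is symmetric in l and j.\<close>
  have a3: "?a ?B (\<lambda>i. 0) = \<gamma> (\<lambda>W. grad_x_dot_grad_v 1 (rest_slots \<gamma> j g) W (rest_slots \<gamma> l f) W)"
    using tensor_grad[OF \<gamma> gs fs j l] by (simp only: add.commute)
  have a4: "\<gamma> (bracket_g1 (rest_slots \<gamma> l f) (rest_slots \<gamma> j g))
    = \<gamma> (\<lambda>W. grad_x_dot_grad_v 1 (rest_slots \<gamma> l f) W (rest_slots \<gamma> j g) W)
      - \<gamma> (\<lambda>W. grad_x_dot_grad_v 1 (rest_slots \<gamma> j g) W (rest_slots \<gamma> l f) W)"
    unfolding bracket_g1_def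
    using dual_lincomb[OF \<gamma> grad_sym_smooth[OF rest_slots_sym_smooth[OF \<gamma> f] rest_slots_sym_smooth[OF \<gamma> g]]
        grad_sym_smooth[OF rest_slots_sym_smooth[OF \<gamma> g] rest_slots_sym_smooth[OF \<gamma> f]], of 1 "- 1"]
    by simp
  show ?thesis
    unfolding tensor_power_Sym[OF \<gamma> wedge1_smooth[OF f g l j]] a1 a2 a3 a4
    by (simp only: right_diff_distrib mult_minus_left add_uminus_conv_diff)
qed

lemma grad_zero: "grad_x_dot_grad_v i 0 Z g W = 0" "grad_x_dot_grad_v i g Z 0 W = 0"
  by (simp_all add: grad_x_dot_grad_v_def zero_fun_def partial_deriv_const)

lemma wedge1_zero: "wedge1 l j 0 g = 0" "wedge1 l j f 0 = 0"
  by (simp_all add: wedge1_def grad_zero fun_eq_iff)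

lemma Sym_zero: "Sym k 0 = 0"
  by (simp add: Sym_def fun_eq_iff)

lemma dual_sum_functions:
  fixes f :: "'i \<Rightarrow> 'd::finite obs"
  assumes \<gamma>: "\<gamma> \<in> tvs_dual (sym_smooth_top k)"
  shows "(\<And>i. i \<in> A \<Longrightarrow> f i \<in> sym_smooth k) \<Longrightarrow> \<gamma> (\<Sum>i\<in>A. f i) = (\<Sum>i\<in>A. \<gamma> (f i))"
proof (induction A rule: infinite_finite_induct)
  case (insert i A)
  have "f i \<in> sym_smooth k" "(\<Sum>i\<in>A. f i) \<in> sym_smooth k"
    using insert.prems by (auto intro: subspace_sum[OF subspace_sym_smooth])
  then have "\<gamma> (f i + (\<Sum>i\<in>A. f i)) = \<gamma> (f i) + \<gamma> (\<Sum>i\<in>A. f i)"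
    using \<gamma> unfolding tvs_dual_def topspace_sym_smooth_top by blast
  moreover have "\<gamma> (\<Sum>i\<in>A. f i) = (\<Sum>i\<in>A. \<gamma> (f i))" by (rule insert.IH) (rule insert.prems, simp)
  ultimately show ?case by (simp only: sum.insert[OF insert.hyps])
next
  case empty
  show ?case unfolding sum.empty by (rule dual_zero_fun[OF \<gamma>])
next
  case (infinite A)
  show ?case unfolding sum.infinite[OF infinite(1)] by (rule dual_zero_fun[OF \<gamma>])
qed

text \<open>Bilinearity of the one-particle bracket and linearity of \<gamma>. Both gradients are
  expanded over the same S so that the two double sums can be combined term by term.\<close>

lemma pull_gradient_bracket:
  fixes F G :: "nat \<Rightarrow> 'd::finite obs"
  assumes \<gamma>: "\<gamma> \<in> dual1" and F: "F \<in> G_inf" and G: "G \<in> G_inf"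
    and S: "finite S" "{k. F k \<noteq> 0} \<subseteq> S" "{k. G k \<noteq> 0} \<subseteq> S" "\<And>k. k \<in> S \<Longrightarrow> k \<ge> 1"
  shows "\<gamma> (bracket_g1 (pull_gradient \<gamma> F) (pull_gradient \<gamma> G))
    = (\<Sum>l\<in>S. \<Sum>j\<in>S. real l * real j * \<gamma> (bracket_g1 (rest_slots \<gamma> l (F l)) (rest_slots \<gamma> j (G j))))"
proof -
  let ?u = "\<lambda>l. rest_slots \<gamma> l (F l)" and ?v = "\<lambda>j. rest_slots \<gamma> j (G j)"
  have u: "?u l \<in> sym_smooth 1" and v: "?v l \<in> sym_smooth 1" if "l \<in> S" for l
    using rest_slots_sym_smooth[OF \<gamma> G_infD(2)[OF F S(4)[OF that]]] rest_slots_sym_smooth[OF \<gamma> G_infD(2)[OF G S(4)[OF that]]]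
    by simp_all
  note us = sym_smooth_smooth[OF u] and vs = sym_smooth_smooth[OF v]
  have eq: "bracket_g1 (pull_gradient \<gamma> F) (pull_gradient \<gamma> G) = (\<lambda>Z. \<Sum>p\<in>S \<times> S. (real (fst p) * real (snd p)) * bracket_g1 (?u (fst p)) (?v (snd p)) Z)"
  proof
    fix Z
    have "bracket_g1 (pull_gradient \<gamma> F) (pull_gradient \<gamma> G) Z
      = (\<Sum>l\<in>S. \<Sum>j\<in>S. (real l * real j) * grad_x_dot_grad_v 1 (?u l) Z (?v j) Z)
        - (\<Sum>j\<in>S. \<Sum>l\<in>S. (real j * real l) * grad_x_dot_grad_v 1 (?v j) Z (?u l) Z)"
      unfolding bracket_g1_def pull_gradient_superset[OF \<gamma> S(1,2)] pull_gradient_superset[OF \<gamma> S(1,3)]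
      by (simp only: grad_sum[OF us vs] grad_sum[OF vs us])
    also have "(\<Sum>j\<in>S. \<Sum>l\<in>S. (real j * real l) * grad_x_dot_grad_v 1 (?v j) Z (?u l) Z)
      = (\<Sum>l\<in>S. \<Sum>j\<in>S. (real j * real l) * grad_x_dot_grad_v 1 (?v j) Z (?u l) Z)" by (rule sum.swap)
    also have "(\<Sum>l\<in>S. \<Sum>j\<in>S. (real l * real j) * grad_x_dot_grad_v 1 (?u l) Z (?v j) Z)
        - (\<Sum>l\<in>S. \<Sum>j\<in>S. (real j * real l) * grad_x_dot_grad_v 1 (?v j) Z (?u l) Z)
      = (\<Sum>l\<in>S. \<Sum>j\<in>S. (real l * real j) * bracket_g1 (?u l) (?v j) Z)"
      unfolding sum_subtractf[symmetric]
      by (intro sum.cong refl) (simp only: bracket_g1_def right_diff_distrib mult.commute[of "real j" "real l" for j l])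
    finally show "bracket_g1 (pull_gradient \<gamma> F) (pull_gradient \<gamma> G) Z
      = (\<Sum>p\<in>S \<times> S. (real (fst p) * real (snd p)) * bracket_g1 (?u (fst p)) (?v (snd p)) Z)"
      by (simp only: sum.cartesian_product case_prod_unfold)
  qed
  have mem: "bracket_g1 (?u (fst p)) (?v (snd p)) \<in> sym_smooth 1" if "p \<in> S \<times> S" for p
  proof -
    have p: "fst p \<in> S" "snd p \<in> S" using that by auto
    show ?thesis
      using sym_smooth_lincomb[OF grad_sym_smooth[OF u[OF p(1)] v[OF p(2)]] grad_sym_smooth[OF v[OF p(2)] u[OF p(1)]], of 1 "- 1"]
      by (simp add: bracket_g1_def)
  qed
  have "\<gamma> (bracket_g1 (pull_gradient \<gamma> F) (pull_gradient \<gamma> G))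
    = (\<Sum>p\<in>S \<times> S. (real (fst p) * real (snd p)) * \<gamma> (bracket_g1 (?u (fst p)) (?v (snd p))))"
    unfolding eq
    by (rule conjunct2[OF dual_sum_lincomb[OF \<gamma>, of "S \<times> S" "\<lambda>p. bracket_g1 (?u (fst p)) (?v (snd p))"
          "\<lambda>p. real (fst p) * real (snd p)", OF mem]])
  then show ?thesis by (simp only: sum.cartesian_product case_prod_unfold)
qed

text \<open>Each pair (l, j) contributes in exactly one degree, l + j - 1, so summing the components
  over the degrees is summing over all pairs. Pairs outside the box give zero functions because F or
  G vanishes there.\<close>

lemma pairing_bracket:
  fixes F G :: "nat \<Rightarrow> 'd::finite obs"
  assumes \<gamma>: "\<gamma> \<in> dual1" and F: "F \<in> G_inf" and G: "G \<in> G_inf"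
    and N: "{k. F k \<noteq> 0} \<subseteq> {1..N}" "{k. G k \<noteq> 0} \<subseteq> {1..N}"
  shows "pairing (bracket_G_inf F G) (iota \<gamma>)
    = (\<Sum>l\<in>{1..N}. \<Sum>j\<in>{1..N}. real l * real j * \<gamma> (bracket_g1 (rest_slots \<gamma> l (F l)) (rest_slots \<gamma> j (G j))))"
proof -
  let ?P = "\<lambda>m. {(l, j). l \<ge> 1 \<and> j \<ge> 1 \<and> l + j - 1 = (m::nat)}"
  let ?h = "\<lambda>m p. Sym m (wedge1 (fst p) (snd p) (F (fst p)) (G (snd p)))"
  define q where "q p = real (fst p) * real (snd p) * \<gamma> (bracket_g1 (rest_slots \<gamma> (fst p) (F (fst p))) (rest_slots \<gamma> (snd p) (G (snd p))))"
    for p :: "nat \<times> nat"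
  let ?box = "{1..N} \<times> {1..N}"
  have br: "bracket_G_inf F G m = (\<Sum>p\<in>?P m. ?h m p)" for m
    unfolding bracket_G_inf_def case_prod_unfold ..
  have finP: "finite (?P m)" for m
    by (rule finite_subset[of _ "{1..m} \<times> {1..m}"]) auto
  have F0: "F l = 0" if "l \<notin> {1..N}" for l using N(1) that by blast
  have G0: "G l = 0" if "l \<notin> {1..N}" for l using N(2) that by blast
  have h0: "?h m p = 0" if "p \<notin> ?box" for m p
  proof -
    have "F (fst p) = 0 \<or> G (snd p) = 0" using that F0[of "fst p"] G0[of "snd p"] by (cases p) auto
    then show ?thesis by (elim disjE) (simp_all only: wedge1_zero Sym_zero)
  qed
  \<comment> \<open>Degrees coming from the box lie between 1 and 2 N - 1.\<close>
  have "bracket_G_inf F G m = 0" if m: "m \<notin> {1..2 * N}" for m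
    unfolding br
  proof (rule sum.neutral, rule ballI)
    fix p assume "p \<in> ?P m"
    then have "p \<notin> ?box" using m by (cases p) auto
    then show "?h m p = 0" by (rule h0)
  qed
  then have "{m. bracket_G_inf F G m \<noteq> 0} \<subseteq> {1..2 * N}" by blast
  then have "pairing (bracket_G_inf F G) (iota \<gamma>) = (\<Sum>m\<in>{1..2 * N}. iota \<gamma> m (bracket_G_inf F G m))"
    by (rule pairing_superset[OF iota_topspace[OF \<gamma>] finite_atLeastAtMost])
  also have "\<dots> = (\<Sum>m\<in>{1..2 * N}. \<Sum>p\<in>{p \<in> ?box. fst p + snd p - 1 = m}. q p)"
  proof (rule sum.cong[OF refl])
    fix m assume "m \<in> {1..2 * N}"
    then have m: "m \<ge> 1" by simp
    have hs: "?h m p \<in> sym_smooth m \<and> tensor_power \<gamma> m (?h m p) = q p" if "p \<in> ?P m" for p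
    proof -
      have p: "fst p \<ge> 1" "snd p \<ge> 1" "m = fst p + snd p - 1" using that by (cases p, simp)+
      note FG = G_infD(2)[OF F p(1)] G_infD(2)[OF G p(2)]
      show ?thesis
        unfolding p(3) q_def by (intro conjI Sym_sym_smooth wedge1_smooth[OF FG p(1,2)] tensor_power_wedge[OF \<gamma> FG p(1,2)])
    qed
    have i: "iota \<gamma> m \<in> tvs_dual (sym_smooth_top m)" by (rule G_inf_dual_components[OF iota_topspace[OF \<gamma>]])
    have "iota \<gamma> m (bracket_G_inf F G m) = (\<Sum>p\<in>?P m. iota \<gamma> m (?h m p))"
      unfolding br by (rule dual_sum_functions[OF i]) (rule conjunct1[OF hs])
    also have "\<dots> = (\<Sum>p\<in>{p \<in> ?box. fst p + snd p - 1 = m}. iota \<gamma> m (?h m p))"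
    proof (rule sum.mono_neutral_right[OF finP])
      show "{p \<in> ?box. fst p + snd p - 1 = m} \<subseteq> ?P m" by auto
      show "\<forall>p\<in>?P m - {p \<in> ?box. fst p + snd p - 1 = m}. iota \<gamma> m (?h m p) = 0"
      proof
        fix p assume p: "p \<in> ?P m - {p \<in> ?box. fst p + snd p - 1 = m}"
        then have "p \<notin> ?box" by (cases p) auto
        then have "?h m p = 0" by (rule h0)
        then show "iota \<gamma> m (?h m p) = 0" by (simp only: dual_zero_fun[OF i])
      qed
    qed
    also have "\<dots> = (\<Sum>p\<in>{p \<in> ?box. fst p + snd p - 1 = m}. q p)"
    proof (rule sum.cong[OF refl])
      fix p assume "p \<in> {p \<in> ?box. fst p + snd p - 1 = m}"
      then have "p \<in> ?P m" by auto
      then show "iota \<gamma> m (?h m p) = q p" using conjunct2[OF hs] by (simp only: iota_pos[OF m])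
    qed
    finally show "iota \<gamma> m (bracket_G_inf F G m) = (\<Sum>p\<in>{p \<in> ?box. fst p + snd p - 1 = m}. q p)" .
  qed
  \<comment> \<open>The fibres of the map from pairs to degrees partition the box.\<close>
  also have "\<dots> = (\<Sum>p\<in>?box. q p)"
    by (rule sum.group) auto
  also have "\<dots> = (\<Sum>l\<in>{1..N}. \<Sum>j\<in>{1..N}. q (l, j))"
    by (simp only: sum.cartesian_product case_prod_unfold prod.collapse)
  finally show ?thesis by (simp only: q_def fst_conv snd_conv)
qed

lemma iota_poisson:
  fixes \<F> \<G> :: "(nat \<Rightarrow> 'd::finite obs \<Rightarrow> real) \<Rightarrow> real"
  assumes "\<F> \<in> A_inf" "\<G> \<in> A_inf" and \<gamma>: "\<gamma> \<in> dual1"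
  shows "poisson_g1 (\<F> \<circ> iota) (\<G> \<circ> iota) \<gamma> = poisson_G_inf \<F> \<G> (iota \<gamma>)"
proof -
  have grad: "\<exists>F\<in>G_inf. functional_gradient G_inf G_inf_dual pairing \<H> (iota \<gamma>) = F \<and>
      functional_gradient (sym_smooth 1) g1_dual (\<lambda>f \<nu>. \<nu> f) (\<H> \<circ> iota) \<gamma> = pull_gradient \<gamma> F"
    if H: "\<H> \<in> A_inf" for \<H>
  proof -
    obtain F where F: "F \<in> G_inf" "\<forall>\<Delta>\<in>topspace G_inf_dual. has_gateaux_derivative euclideanreal \<H> (iota \<gamma>) \<Delta> (pairing F \<Delta>)"
      "\<forall>\<delta>\<in>dual1. has_gateaux_derivative euclideanreal (\<H> \<circ> iota) \<gamma> \<delta> (pairing F (diota \<gamma> \<delta>))"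
      using A_inf_gradient[OF H \<gamma>] by (elim bexE conjE)
    have "functional_gradient G_inf G_inf_dual pairing \<H> (iota \<gamma>) = F"
      by (rule functional_gradient_G_inf[OF F(1)]) (rule bspec[OF F(2)])
    moreover have "functional_gradient (sym_smooth 1) g1_dual (\<lambda>f \<nu>. \<nu> f) (\<H> \<circ> iota) \<gamma> = pull_gradient \<gamma> F"
    proof (rule functional_gradient_g1[OF pairing_diota(1)[OF \<gamma> \<gamma> F(1)]])
      fix \<delta> :: "'d obs \<Rightarrow> real" assume \<delta>: "\<delta> \<in> dual1"
      show "has_gateaux_derivative euclideanreal (\<H> \<circ> iota) \<gamma> \<delta> (\<delta> (pull_gradient \<gamma> F))"
        unfolding pairing_diota(2)[OF \<gamma> \<delta> F(1)] by (rule bspec[OF F(3) \<delta>])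
    qed
    ultimately show ?thesis using F(1) by (intro bexI[of _ F] conjI)
  qed
  obtain F where F: "F \<in> G_inf" "functional_gradient G_inf G_inf_dual pairing \<F> (iota \<gamma>) = F"
    "functional_gradient (sym_smooth 1) g1_dual (\<lambda>f \<nu>. \<nu> f) (\<F> \<circ> iota) \<gamma> = pull_gradient \<gamma> F"
    using grad[OF assms(1)] by (elim bexE conjE)
  obtain G where G: "G \<in> G_inf" "functional_gradient G_inf G_inf_dual pairing \<G> (iota \<gamma>) = G"
    "functional_gradient (sym_smooth 1) g1_dual (\<lambda>f \<nu>. \<nu> f) (\<G> \<circ> iota) \<gamma> = pull_gradient \<gamma> G"
    using grad[OF assms(2)] by (elim bexE conjE)
  have "finite ({k. F k \<noteq> 0} \<union> {k. G k \<noteq> 0})" by (simp only: finite_Un G_infD(3)[OF F(1)] G_infD(3)[OF G(1)])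
  then obtain N where N: "\<forall>k\<in>{k. F k \<noteq> 0} \<union> {k. G k \<noteq> 0}. k \<le> N" unfolding finite_nat_set_iff_bounded_le by (elim exE)
  have NF: "{k. F k \<noteq> 0} \<subseteq> {1..N}"
  proof
    fix k assume "k \<in> {k. F k \<noteq> 0}"
    then show "k \<in> {1..N}" using N G_infD(4)[OF F(1)] by simp
  qed
  have NG: "{k. G k \<noteq> 0} \<subseteq> {1..N}"
  proof
    fix k assume "k \<in> {k. G k \<noteq> 0}"
    then show "k \<in> {1..N}" using N G_infD(4)[OF G(1)] by simp
  qed
  have "\<gamma> (bracket_g1 (pull_gradient \<gamma> F) (pull_gradient \<gamma> G)) = pairing (bracket_G_inf F G) (iota \<gamma>)"
    unfolding pairing_bracket[OF \<gamma> F(1) G(1) NF NG]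
    by (rule pull_gradient_bracket[OF \<gamma> F(1) G(1) finite_atLeastAtMost NF NG]) simp
  then show ?thesis
    unfolding poisson_g1_def poisson_G_inf_def Let_def F(2,3) G(2,3) .
qed

text \<open>The middle conjunct records that pulling back along \<open>iota\<close> takes
  \<open>A_inf\<close> into the smooth functionals on the one-particle dual, as the notion of a
  morphism into a weak Lie-Poisson space demands.\<close>

theorem theorem2p14:
  shows "gateaux_smooth g1_dual G_inf_dual (iota :: ('d::finite obs \<Rightarrow> real) \<Rightarrow> _)
    \<and> (\<forall>\<F> \<in> A_inf. gateaux_smooth g1_dual euclideanreal
          (\<F> \<circ> (iota :: ('d obs \<Rightarrow> real) \<Rightarrow> _)))
    \<and> (\<forall>\<F> \<in> A_inf. \<forall>\<G> \<in> A_inf. \<forall>\<gamma> \<in> topspace g1_dual.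
          poisson_g1 (\<F> \<circ> (iota :: ('d obs \<Rightarrow> real) \<Rightarrow> _)) (\<G> \<circ> iota) \<gamma>
          = (poisson_G_inf \<F> \<G> \<circ> iota) \<gamma>)"
proof (intro conjI ballI)
  show "gateaux_smooth g1_dual G_inf_dual (iota :: ('d obs \<Rightarrow> real) \<Rightarrow> _)" by (rule gateaux_smooth_iota)
next
  fix \<F> :: "(nat \<Rightarrow> 'd obs \<Rightarrow> real) \<Rightarrow> real" assume "\<F> \<in> A_inf"
  then show "gateaux_smooth g1_dual euclideanreal (\<F> \<circ> iota)" by (rule gateaux_smooth_A_inf)
next
  fix \<F> \<G> :: "(nat \<Rightarrow> 'd obs \<Rightarrow> real) \<Rightarrow> real" and \<gamma> :: "'d obs \<Rightarrow> real"
  assume FG: "\<F> \<in> A_inf" "\<G> \<in> A_inf" and "\<gamma> \<in> topspace g1_dual"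
  then have "\<gamma> \<in> dual1" by (simp only: topspace_dual)
  then show "poisson_g1 (\<F> \<circ> iota) (\<G> \<circ> iota) \<gamma> = (poisson_G_inf \<F> \<G> \<circ> iota) \<gamma>"
    unfolding o_apply[of "poisson_G_inf \<F> \<G>" iota \<gamma>] by (rule iota_poisson[OF FG])
qed

end
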